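(* Let $c\ge2$ be fixed. Then $\mathsf{ACA}_0$ proves the following statement: for every dynamical hierarchy $\mathcal B=(B_i)_{i\in\mathbb N}$ such that $S_{B_0}(b)\le\min(b^2,bc)$ for every $b\in B_0$, for every $n$ there is some $i$ such that $\mathbb G^{\mathcal B}_i(n)=0$. Moreover, $\mathsf{ACA}_0$ does not prove this statement universally quantified over $c$.
   Context: Let $\mathbb N=\{0,1,2,\dots\}$; $\infty$ is regarded as greater than, and divisible by, every positive integer. For $b\ge 2$ and $n>0$, the $b$-decomposition of $n$ is the unique $n=b^e a+r$ with $b^e\le n<b^{e+1}$, $0<a<b$, $r<b^e$. For nonempty $B\subseteq\mathbb N\setminus\{0,1\}$: $\mathrm{base}_B(n)=\max\{b\in B: b\le n\}$ if $n\ge\min B$, else $\min B$; $S_B(n)=\min\{b\in B:b>n\}$ if this exists, else $\infty$. A base hierarchy is a nonempty $B\subseteq\mathbb N\setminus\{0,1\}$ with $b\mid S_B(b)$ for all $b\in B$. Upgrade: for base hierarchies $B,C$ with $\min B\le\min C$, define ${\uparrow}n={\uparrow}_B^C n\in\mathbb N\cup\{\infty\}$ recursively. If $n<\min B$, ${\uparrow}n=n$. Otherwise $b=\mathrm{base}_B(n)$; for $d\in C$ define $\langle b\to d\rangle m={\uparrow}m$ if $m<b$, and $\langle b\to d\rangle m=d^{\langle b\to d\rangle e}\cdot{\uparrow}a+\langle b\to d\rangle r$ if $m\ge b$ has $b$-decomposition $m=b^ea+r$. Then ${\uparrow}n=\langle b\to d\rangle n$ where $d$ is the least element of $C$ with ${\uparrow}(n-1)<\langle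 b\to d\rangle n<S_C(d)$; ${\uparrow}n=\infty$ if none exists. $C$ is a good successor of $B$ if (1) $\min B\le\min C$; (2) ${\uparrow}_B^C n<\infty$ for all $n$; (3) for every $b\in B$ with $b>\min B$, writing $x={\uparrow}_B^C(b-1)$, no multiple of $\mathrm{base}_C(x)$ lies strictly between $x$ and $S_C(x)$. A dynamical hierarchy is a sequence $(B_i)_{i\in\mathbb N}$ of base hierarchies with each $B_{i+1}$ a good successor of $B_i$. Goodstein sequence: $\mathbb G^{\mathcal B}_0(n)=n$, $\mathbb G^{\mathcal B}_{i+1}(n)={\uparrow}_{B_i}^{B_{i+1}}\mathbb G^{\mathcal B}_i(n)-1$ if $\mathbb G^{\mathcal B}_i(n)>0$, else $0$. These notions are formalized in second-order arithmetic in the natural way. *)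

theory Defs
  imports Main
begin

section \<open>Second-order arithmetic and the system ACA0\<close>

text \<open>Number variables and set variables are two separate namespaces, each indexed by nat.\<close>

datatype trm = Var nat | Zero | One | Add trm trm | Mul trm trm

datatype fm =
    Falsum
  | Eq trm trm
  | Less trm trm
  | Mem trm nat
  | Imp fm fm
  | AllN nat fm
  | AllS nat fm

abbreviation (input) Neg :: "fm \<Rightarrow> fm" where "Neg \<phi> \<equiv> Imp \<phi> Falsum"
abbreviation (input) Con :: "fm \<Rightarrow> fm \<Rightarrow> fm" where "Con \<phi> \<psi> \<equiv> Neg (Imp \<phi> (Neg \<psi>))"
abbreviation (input) Dis :: "fm \<Rightarrow> fm \<Rightarrow> fm" where "Dis \<phi> \<psi> \<equiv> Imp (Neg \<phi>) \<psi>"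
abbreviation (input) Iff :: "fm \<Rightarrow> fm \<Rightarrow> fm" where "Iff \<phi> \<psi> \<equiv> Con (Imp \<phi> \<psi>) (Imp \<psi> \<phi>)"
abbreviation (input) ExN :: "nat \<Rightarrow> fm \<Rightarrow> fm" where "ExN x \<phi> \<equiv> Neg (AllN x (Neg \<phi>))"
abbreviation (input) ExS :: "nat \<Rightarrow> fm \<Rightarrow> fm" where "ExS X \<phi> \<equiv> Neg (AllS X (Neg \<phi>))"

primrec vars_trm :: "trm \<Rightarrow> nat set" where
  "vars_trm (Var x) = {x}"
| "vars_trm Zero = {}"
| "vars_trm One = {}"
| "vars_trm (Add s t) = vars_trm s \<union> vars_trm t"
| "vars_trm (Mul s t) = vars_trm s \<union> vars_trm t"

primrec fvN :: "fm \<Rightarrow> nat set" where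
  "fvN Falsum = {}"
| "fvN (Eq s t) = vars_trm s \<union> vars_trm t"
| "fvN (Less s t) = vars_trm s \<union> vars_trm t"
| "fvN (Mem t X) = vars_trm t"
| "fvN (Imp \<phi> \<psi>) = fvN \<phi> \<union> fvN \<psi>"
| "fvN (AllN x \<phi>) = fvN \<phi> - {x}"
| "fvN (AllS X \<phi>) = fvN \<phi>"

primrec fvS :: "fm \<Rightarrow> nat set" where
  "fvS Falsum = {}"
| "fvS (Eq s t) = {}"
| "fvS (Less s t) = {}"
| "fvS (Mem t X) = {X}"
| "fvS (Imp \<phi> \<psi>) = fvS \<phi> \<union> fvS \<psi>"
| "fvS (AllN x \<phi>) = fvS \<phi>"
| "fvS (AllS X \<phi>) = fvS \<phi> - {X}"

primrec subst_trm :: "nat \<Rightarrow> trm \<Rightarrow> trm \<Rightarrow> trm" where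
  "subst_trm x u (Var y) = (if y = x then u else Var y)"
| "subst_trm x u Zero = Zero"
| "subst_trm x u One = One"
| "subst_trm x u (Add s t) = Add (subst_trm x u s) (subst_trm x u t)"
| "subst_trm x u (Mul s t) = Mul (subst_trm x u s) (subst_trm x u t)"

text \<open>Substitution does not rename bound variables; its uses below are guarded by the
  conditions \<open>free_forN\<close> and \<open>free_forS\<close>, which exclude capture.\<close>

primrec substN :: "nat \<Rightarrow> trm \<Rightarrow> fm \<Rightarrow> fm" where
  "substN x u Falsum = Falsum"
| "substN x u (Eq s t) = Eq (subst_trm x u s) (subst_trm x u t)"
| "substN x u (Less s t) = Less (subst_trm x u s) (subst_trm x u t)"
| "substN x u (Mem t X) = Mem (subst_trm x u t) X"
| "substN x u (Imp \<phi> \<psi>) = Imp (substN x u \<phi>) (substN x u \<psi>)"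
| "substN x u (AllN y \<phi>) = AllN y (if y = x then \<phi> else substN x u \<phi>)"
| "substN x u (AllS X \<phi>) = AllS X (substN x u \<phi>)"

primrec substS :: "nat \<Rightarrow> nat \<Rightarrow> fm \<Rightarrow> fm" where
  "substS X U Falsum = Falsum"
| "substS X U (Eq s t) = Eq s t"
| "substS X U (Less s t) = Less s t"
| "substS X U (Mem t Y) = Mem t (if Y = X then U else Y)"
| "substS X U (Imp \<phi> \<psi>) = Imp (substS X U \<phi>) (substS X U \<psi>)"
| "substS X U (AllN y \<phi>) = AllN y (substS X U \<phi>)"
| "substS X U (AllS Y \<phi>) = AllS Y (if Y = X then \<phi> else substS X U \<phi>)"

primrec free_forN :: "trm \<Rightarrow> nat \<Rightarrow> fm \<Rightarrow> bool" where
  "free_forN u x Falsum \<longleftrightarrow> True"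
| "free_forN u x (Eq s t) \<longleftrightarrow> True"
| "free_forN u x (Less s t) \<longleftrightarrow> True"
| "free_forN u x (Mem t X) \<longleftrightarrow> True"
| "free_forN u x (Imp \<phi> \<psi>) \<longleftrightarrow> free_forN u x \<phi> \<and> free_forN u x \<psi>"
| "free_forN u x (AllN y \<phi>) \<longleftrightarrow> x \<notin> fvN (AllN y \<phi>) \<or> (y \<notin> vars_trm u \<and> free_forN u x \<phi>)"
| "free_forN u x (AllS X \<phi>) \<longleftrightarrow> free_forN u x \<phi>"

primrec free_forS :: "nat \<Rightarrow> nat \<Rightarrow> fm \<Rightarrow> bool" where
  "free_forS U X Falsum \<longleftrightarrow> True"
| "free_forS U X (Eq s t) \<longleftrightarrow> True"
| "free_forS U X (Less s t) \<longleftrightarrow> True"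
| "free_forS U X (Mem t Y) \<longleftrightarrow> True"
| "free_forS U X (Imp \<phi> \<psi>) \<longleftrightarrow> free_forS U X \<phi> \<and> free_forS U X \<psi>"
| "free_forS U X (AllN y \<phi>) \<longleftrightarrow> free_forS U X \<phi>"
| "free_forS U X (AllS Y \<phi>) \<longleftrightarrow> X \<notin> fvS (AllS Y \<phi>) \<or> (Y \<noteq> U \<and> free_forS U X \<phi>)"

text \<open>Classical two-sorted predicate logic with equality for numbers, as a Hilbert calculus.
  Generalization is unrestricted, so open formulas in \<open>T\<close> stand for their universal closures.\<close>

inductive proves :: "fm set \<Rightarrow> fm \<Rightarrow> bool" (infix "\<turnstile>" 50) for T :: "fm set" where
  Ax: "\<phi> \<in> T \<Longrightarrow> T \<turnstile> \<phi>"
| K: "T \<turnstile> Imp \<phi> (Imp \<psi> \<phi>)"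
| S: "T \<turnstile> Imp (Imp \<phi> (Imp \<psi> \<chi>)) (Imp (Imp \<phi> \<psi>) (Imp \<phi> \<chi>))"
| DN: "T \<turnstile> Imp (Neg (Neg \<phi>)) \<phi>"
| MP: "T \<turnstile> Imp \<phi> \<psi> \<Longrightarrow> T \<turnstile> \<phi> \<Longrightarrow> T \<turnstile> \<psi>"
| InstN: "free_forN t x \<phi> \<Longrightarrow> T \<turnstile> Imp (AllN x \<phi>) (substN x t \<phi>)"
| DistN: "x \<notin> fvN \<phi> \<Longrightarrow> T \<turnstile> Imp (AllN x (Imp \<phi> \<psi>)) (Imp \<phi> (AllN x \<psi>))"
| GenN: "T \<turnstile> \<phi> \<Longrightarrow> T \<turnstile> AllN x \<phi>"
| InstS: "free_forS Y X \<phi> \<Longrightarrow> T \<turnstile> Imp (AllS X \<phi>) (substS X Y \<phi>)"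
| DistS: "X \<notin> fvS \<phi> \<Longrightarrow> T \<turnstile> Imp (AllS X (Imp \<phi> \<psi>)) (Imp \<phi> (AllS X \<psi>))"
| GenS: "T \<turnstile> \<phi> \<Longrightarrow> T \<turnstile> AllS X \<phi>"
| EqRefl: "T \<turnstile> Eq t t"
| EqSubst: "free_forN s x \<phi> \<Longrightarrow> free_forN t x \<phi> \<Longrightarrow>
    T \<turnstile> Imp (Eq s t) (Imp (substN x s \<phi>) (substN x t \<phi>))"

primrec arithmetical :: "fm \<Rightarrow> bool" where
  "arithmetical Falsum \<longleftrightarrow> True"
| "arithmetical (Eq s t) \<longleftrightarrow> True"
| "arithmetical (Less s t) \<longleftrightarrow> True"
| "arithmetical (Mem t X) \<longleftrightarrow> True"
| "arithmetical (Imp \<phi> \<psi>) \<longleftrightarrow> arithmetical \<phi> \<and> arithmetical \<psi>"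
| "arithmetical (AllN x \<phi>) \<longleftrightarrow> arithmetical \<phi>"
| "arithmetical (AllS X \<phi>) \<longleftrightarrow> False"

definition basic_axioms :: "fm set" where
  "basic_axioms = (let m = Var 0; n = Var 1 in
    { Neg (Eq (Add n One) Zero),
      Imp (Eq (Add m One) (Add n One)) (Eq m n),
      Eq (Add m Zero) m,
      Eq (Add m (Add n One)) (Add (Add m n) One),
      Eq (Mul m Zero) Zero,
      Eq (Mul m (Add n One)) (Add (Mul m n) m),
      Neg (Less m Zero),
      Iff (Less m (Add n One)) (Dis (Less m n) (Eq m n)) })"

definition induction_axiom :: fm where
  "induction_axiom =
    Imp (Con (Mem Zero 0) (AllN 0 (Imp (Mem (Var 0) 0) (Mem (Add (Var 0) One) 0))))
        (AllN 0 (Mem (Var 0) 0))"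

text \<open>Parameters, both numbers and sets, are allowed in \<open>\<phi>\<close>.\<close>

definition arithmetical_comprehension :: "fm set" where
  "arithmetical_comprehension =
    { ExS X (AllN x (Iff (Mem (Var x) X) \<phi>)) | X x \<phi>. arithmetical \<phi> \<and> X \<notin> fvS \<phi> }"

definition ACA0 :: "fm set" where
  "ACA0 = basic_axioms \<union> {induction_axiom} \<union> arithmetical_comprehension"


section \<open>Writing formulas without naming bound variables\<close>

text \<open>A \<open>form\<close> is a formula that waits for an index from which on all variables are unused.
  A quantifier binds the variable with that index and hands the next index to its body, so
  that nested bound variables are distinct and no capture can occur. The closed formula denoted
  by a \<open>form\<close> without free variables is obtained by starting at \<open>0\<close>.\<close>

type_synonym form = "nat \<Rightarrow> fm"

definition sentence :: "form \<Rightarrow> fm" where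
  "sentence \<phi> = \<phi> 0"

definition all_num :: "(trm \<Rightarrow> form) \<Rightarrow> form" (binder "\<^bold>\<forall>" 10) where
  "all_num f = (\<lambda>k. AllN k (f (Var k) (Suc k)))"
definition ex_num :: "(trm \<Rightarrow> form) \<Rightarrow> form" (binder "\<^bold>\<exists>" 10) where
  "ex_num f = (\<lambda>k. ExN k (f (Var k) (Suc k)))"
definition all_set :: "(nat \<Rightarrow> form) \<Rightarrow> form" (binder "\<^bold>\<forall>\<^sub>s" 10) where
  "all_set f = (\<lambda>k. AllS k (f k (Suc k)))"
definition ex_set :: "(nat \<Rightarrow> form) \<Rightarrow> form" (binder "\<^bold>\<exists>\<^sub>s" 10) where
  "ex_set f = (\<lambda>k. ExS k (f k (Suc k)))"

definition f_not :: "form \<Rightarrow> form" ("\<^bold>\<not> _" [40] 40) where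
  "(\<^bold>\<not> \<phi>) = (\<lambda>k. Neg (\<phi> k))"
definition f_and :: "form \<Rightarrow> form \<Rightarrow> form" (infixr "\<^bold>\<and>" 35) where
  "(\<phi> \<^bold>\<and> \<psi>) = (\<lambda>k. Con (\<phi> k) (\<psi> k))"
definition f_or :: "form \<Rightarrow> form \<Rightarrow> form" (infixr "\<^bold>\<or>" 30) where
  "(\<phi> \<^bold>\<or> \<psi>) = (\<lambda>k. Dis (\<phi> k) (\<psi> k))"
definition f_imp :: "form \<Rightarrow> form \<Rightarrow> form" (infixr "\<^bold>\<longrightarrow>" 25) where
  "(\<phi> \<^bold>\<longrightarrow> \<psi>) = (\<lambda>k. Imp (\<phi> k) (\<psi> k))"
definition f_iff :: "form \<Rightarrow> form \<Rightarrow> form" (infixr "\<^bold>\<longleftrightarrow>" 25) where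
  "(\<phi> \<^bold>\<longleftrightarrow> \<psi>) = (\<lambda>k. Iff (\<phi> k) (\<psi> k))"
definition f_eq :: "trm \<Rightarrow> trm \<Rightarrow> form" (infix "\<^bold>=" 50) where
  "(s \<^bold>= t) = (\<lambda>k. Eq s t)"
definition f_less :: "trm \<Rightarrow> trm \<Rightarrow> form" (infix "\<^bold><" 50) where
  "(s \<^bold>< t) = (\<lambda>k. Less s t)"
definition f_le :: "trm \<Rightarrow> trm \<Rightarrow> form" (infix "\<^bold>\<le>" 50) where
  "(s \<^bold>\<le> t) = (s \<^bold>< t \<^bold>\<or> s \<^bold>= t)"
definition f_mem :: "trm \<Rightarrow> nat \<Rightarrow> form" (infix "\<^bold>\<in>" 50) where
  "(t \<^bold>\<in> X) = (\<lambda>k. Mem t X)"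

notation Zero ("\<^bold>0")
notation One ("\<^bold>1")
notation Add (infixl "\<^bold>+" 65)
notation Mul (infixl "\<^bold>*" 70)

primrec num :: "nat \<Rightarrow> trm" where
  "num 0 = \<^bold>0"
| "num (Suc n) = num n \<^bold>+ \<^bold>1"

text \<open>\<open>(s + t)\<^sup>2 + s\<close> is injective on pairs of natural numbers.\<close>

definition pair :: "trm \<Rightarrow> trm \<Rightarrow> trm" where
  "pair s t = (s \<^bold>+ t) \<^bold>* (s \<^bold>+ t) \<^bold>+ s"

text \<open>A class is a formula with a distinguished number argument; \<open>slice X i\<close> is the \<open>i\<close>-th member
  of the sequence of sets coded by \<open>X\<close>.\<close>

type_synonym cls = "trm \<Rightarrow> form"

definition slice :: "nat \<Rightarrow> trm \<Rightarrow> cls" where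
  "slice X i = (\<lambda>t. pair i t \<^bold>\<in> X)"

definition is_function :: "nat \<Rightarrow> form" where
  "is_function F =
    (\<^bold>\<forall>x. \<^bold>\<exists>y. pair x y \<^bold>\<in> F \<^bold>\<and> (\<^bold>\<forall>z. pair x z \<^bold>\<in> F \<^bold>\<longrightarrow> z \<^bold>= y))"


section \<open>Base hierarchies\<close>

text \<open>Functions, partial ones included, are expressed by their graphs. The value \<open>\<infinity>\<close> is the
  absence of a value.\<close>

text \<open>\<open>p = b ^ e\<close>\<close>

definition is_power :: "trm \<Rightarrow> trm \<Rightarrow> trm \<Rightarrow> form" where
  "is_power b e p =
    (\<^bold>\<exists>\<^sub>s E. is_function E \<^bold>\<and> pair \<^bold>0 \<^bold>1 \<^bold>\<in> E \<^bold>\<and>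
      (\<^bold>\<forall>x y. pair x y \<^bold>\<in> E \<^bold>\<longrightarrow> pair (x \<^bold>+ \<^bold>1) (y \<^bold>* b) \<^bold>\<in> E) \<^bold>\<and>
      pair e p \<^bold>\<in> E)"

definition divides :: "trm \<Rightarrow> trm \<Rightarrow> form" where
  "divides s t = (\<^bold>\<exists>k. t \<^bold>= s \<^bold>* k)"

text \<open>\<open>n = b ^ e * a + r\<close> is the \<open>b\<close>-decomposition of \<open>n\<close>.\<close>

definition is_decomposition :: "trm \<Rightarrow> trm \<Rightarrow> trm \<Rightarrow> trm \<Rightarrow> trm \<Rightarrow> form" where
  "is_decomposition b n e a r =
    (\<^bold>\<exists>p q. is_power b e p \<^bold>\<and> is_power b (e \<^bold>+ \<^bold>1) q \<^bold>\<and> p \<^bold>\<le> n \<^bold>\<and> n \<^bold>< q \<^bold>\<and>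
      \<^bold>0 \<^bold>< a \<^bold>\<and> a \<^bold>< b \<^bold>\<and> r \<^bold>< p \<^bold>\<and> n \<^bold>= p \<^bold>* a \<^bold>+ r)"

definition is_min :: "cls \<Rightarrow> trm \<Rightarrow> form" where
  "is_min B m = (B m \<^bold>\<and> (\<^bold>\<forall>b. B b \<^bold>\<longrightarrow> m \<^bold>\<le> b))"

text \<open>\<open>b = base\<^sub>B(n)\<close>\<close>

definition is_base :: "cls \<Rightarrow> trm \<Rightarrow> trm \<Rightarrow> form" where
  "is_base B n b =
    (\<^bold>\<exists>m. is_min B m \<^bold>\<and>
      ((m \<^bold>\<le> n \<^bold>\<and> B b \<^bold>\<and> b \<^bold>\<le> n \<^bold>\<and> (\<^bold>\<forall>x. B x \<^bold>\<and> x \<^bold>\<le> n \<^bold>\<longrightarrow> x \<^bold>\<le> b)) \<^bold>\<or> (n \<^bold>< m \<^bold>\<and> b \<^bold>= m)))"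

text \<open>\<open>s = S\<^sub>B(n)\<close> with \<open>s\<close> finite\<close>

definition is_succ :: "cls \<Rightarrow> trm \<Rightarrow> trm \<Rightarrow> form" where
  "is_succ B n s = (B s \<^bold>\<and> n \<^bold>< s \<^bold>\<and> (\<^bold>\<forall>b. B b \<^bold>\<and> n \<^bold>< b \<^bold>\<longrightarrow> s \<^bold>\<le> b))"

text \<open>\<open>t < S\<^sub>B(n)\<close>, which holds if \<open>S\<^sub>B(n) = \<infinity>\<close>\<close>

definition less_succ :: "cls \<Rightarrow> trm \<Rightarrow> trm \<Rightarrow> form" where
  "less_succ B n t = (\<^bold>\<forall>s. is_succ B n s \<^bold>\<longrightarrow> t \<^bold>< s)"

definition base_hierarchy :: "cls \<Rightarrow> form" where
  "base_hierarchy B =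
    ((\<^bold>\<exists>b. B b) \<^bold>\<and> \<^bold>\<not> B \<^bold>0 \<^bold>\<and> \<^bold>\<not> B \<^bold>1 \<^bold>\<and>
     (\<^bold>\<forall>b s. B b \<^bold>\<and> is_succ B b s \<^bold>\<longrightarrow> divides b s))"


section \<open>Upgrade and good successors\<close>

text \<open>\<open>U\<close> is the graph of the upgrade operator from \<open>B\<close> to \<open>C\<close>, and \<open>V\<close> holds the base changes:
  \<open>in_V V b d m v\<close> says \<open>\<langle>b \<rightarrow> d\<rangle>m = v\<close>. An infinite value of the upgrade operator at a number
  \<open>\<ge> min B\<close> makes all its later values infinite, so that a missing value in \<open>admissible\<close>
  is correctly read as \<open>\<infinity>\<close>.\<close>

definition in_V :: "nat \<Rightarrow> trm \<Rightarrow> trm \<Rightarrow> trm \<Rightarrow> trm \<Rightarrow> form" where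
  "in_V V b d m v = (pair (pair b d) (pair m v) \<^bold>\<in> V)"

text \<open>The condition on \<open>d\<close> in the definition of the upgrade of \<open>n\<close>:
  the upgrade of \<open>n - 1\<close> is below \<open>\<langle>b \<rightarrow> d\<rangle>n\<close>, which is below \<open>S\<^sub>C(d)\<close>.\<close>

definition admissible :: "cls \<Rightarrow> nat \<Rightarrow> nat \<Rightarrow> trm \<Rightarrow> trm \<Rightarrow> trm \<Rightarrow> form" where
  "admissible C U V b n d =
    (C d \<^bold>\<and> (\<^bold>\<exists>n' u v. n \<^bold>= n' \<^bold>+ \<^bold>1 \<^bold>\<and> pair n' u \<^bold>\<in> U \<^bold>\<and> in_V V b d n v \<^bold>\<and>
      u \<^bold>< v \<^bold>\<and> less_succ C d v))"

definition upgrade_rec :: "cls \<Rightarrow> cls \<Rightarrow> nat \<Rightarrow> nat \<Rightarrow> form" where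
  "upgrade_rec B C U V =
    ((\<^bold>\<forall>n v. pair n v \<^bold>\<in> U \<^bold>\<longleftrightarrow>
       (\<^bold>\<exists>m. is_min B m \<^bold>\<and>
         ((n \<^bold>< m \<^bold>\<and> v \<^bold>= n) \<^bold>\<or>
          (m \<^bold>\<le> n \<^bold>\<and> (\<^bold>\<exists>b d. is_base B n b \<^bold>\<and> admissible C U V b n d \<^bold>\<and>
             (\<^bold>\<forall>d'. admissible C U V b n d' \<^bold>\<longrightarrow> d \<^bold>\<le> d') \<^bold>\<and> in_V V b d n v))))) \<^bold>\<and>
     (\<^bold>\<forall>b d m v. B b \<^bold>\<and> C d \<^bold>\<longrightarrow>
       (in_V V b d m v \<^bold>\<longleftrightarrow>
         ((m \<^bold>< b \<^bold>\<and> pair m v \<^bold>\<in> U) \<^bold>\<or>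
          (b \<^bold>\<le> m \<^bold>\<and> (\<^bold>\<exists>e a r e' a' r' p. is_decomposition b m e a r \<^bold>\<and>
             in_V V b d e e' \<^bold>\<and> pair a a' \<^bold>\<in> U \<^bold>\<and> in_V V b d r r' \<^bold>\<and>
             is_power d e' p \<^bold>\<and> v \<^bold>= p \<^bold>* a' \<^bold>+ r'))))))"

text \<open>The upgrade of \<open>n\<close> from \<open>B\<close> to \<open>C\<close> is the finite number \<open>v\<close>.\<close>

definition is_upgrade :: "cls \<Rightarrow> cls \<Rightarrow> trm \<Rightarrow> trm \<Rightarrow> form" where
  "is_upgrade B C n v = (\<^bold>\<exists>\<^sub>s U V. upgrade_rec B C U V \<^bold>\<and> pair n v \<^bold>\<in> U)"

definition good_successor :: "cls \<Rightarrow> cls \<Rightarrow> form" where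
  "good_successor B C =
    ((\<^bold>\<exists>m m'. is_min B m \<^bold>\<and> is_min C m' \<^bold>\<and> m \<^bold>\<le> m') \<^bold>\<and>
     (\<^bold>\<forall>n. \<^bold>\<exists>v. is_upgrade B C n v) \<^bold>\<and>
     (\<^bold>\<forall>b' m x y. B (b' \<^bold>+ \<^bold>1) \<^bold>\<and> is_min B m \<^bold>\<and> m \<^bold>< b' \<^bold>+ \<^bold>1 \<^bold>\<and>
        is_upgrade B C b' x \<^bold>\<and> is_base C x y \<^bold>\<longrightarrow>
        \<^bold>\<not> (\<^bold>\<exists>z. divides y z \<^bold>\<and> x \<^bold>< z \<^bold>\<and> less_succ C x z)))"


section \<open>Dynamical hierarchies and Goodstein sequences\<close>

definition dynamical_hierarchy :: "nat \<Rightarrow> form" where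
  "dynamical_hierarchy X =
    ((\<^bold>\<forall>i. base_hierarchy (slice X i)) \<^bold>\<and>
     (\<^bold>\<forall>i. good_successor (slice X i) (slice X (i \<^bold>+ \<^bold>1))))"

definition goodstein_sequence :: "nat \<Rightarrow> trm \<Rightarrow> nat \<Rightarrow> form" where
  "goodstein_sequence X n G =
    (is_function G \<^bold>\<and> pair \<^bold>0 n \<^bold>\<in> G \<^bold>\<and>
     (\<^bold>\<forall>i x y. pair i x \<^bold>\<in> G \<^bold>\<and> pair (i \<^bold>+ \<^bold>1) y \<^bold>\<in> G \<^bold>\<longrightarrow>
       (\<^bold>0 \<^bold>< x \<^bold>\<and> is_upgrade (slice X i) (slice X (i \<^bold>+ \<^bold>1)) x (y \<^bold>+ \<^bold>1)) \<^bold>\<or>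
       (x \<^bold>= \<^bold>0 \<^bold>\<and> y \<^bold>= \<^bold>0)))"

definition goodstein_value :: "nat \<Rightarrow> trm \<Rightarrow> trm \<Rightarrow> trm \<Rightarrow> form" where
  "goodstein_value X n i v = (\<^bold>\<exists>\<^sub>s G. goodstein_sequence X n G \<^bold>\<and> pair i v \<^bold>\<in> G)"

text \<open>\<open>S(b) \<le> min (b\<^sup>2) (b c)\<close> for all \<open>b\<close> in the zeroth hierarchy; in particular \<open>S(b)\<close> is finite.\<close>

definition slow_start :: "nat \<Rightarrow> trm \<Rightarrow> form" where
  "slow_start X c =
    (\<^bold>\<forall>b. slice X \<^bold>0 b \<^bold>\<longrightarrow>
       (\<^bold>\<exists>s. is_succ (slice X \<^bold>0) b s \<^bold>\<and> s \<^bold>\<le> b \<^bold>* b \<^bold>\<and> s \<^bold>\<le> b \<^bold>* c))"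

definition goodstein_terminates :: "trm \<Rightarrow> form" where
  "goodstein_terminates c =
    (\<^bold>\<forall>\<^sub>s X. dynamical_hierarchy X \<^bold>\<and> slow_start X c \<^bold>\<longrightarrow>
       (\<^bold>\<forall>n. \<^bold>\<exists>i. goodstein_value X n i \<^bold>0))"

end

theory Submission imports Defs "HOL-Library.Multiset_Order" "HOL-Library.Countable"
begin

text \<open>Provability for fixed \<open>c\<close>: by completeness it suffices to argue in an arbitrary model of ACA0. There a
 number \<open>n\<close> of the first hierarchy with \<open>S(b) <= b c\<close> gets an ordinal notation, Goodstein steps decrease it,
 and since \<open>c\<close> is a standard number, finitely many Gentzen jumps prove the transfinite induction needed.

 Unprovability of the uniform statement: the data of a dynamical hierarchy, of its upgrade operators, and of
 a Goodstein sequence that stays positive are coded by one set \<open>Y\<close>. Each axiom about \<open>Y\<close> has the form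
 \<open>ALL i. \<Phi>(i)\<close>, where \<open>\<Phi>(i)\<close> concerns the stages \<open>i\<close> and \<open>i + 1\<close> only. These axioms are consistent with
 induction: by cut elimination for \<open>\<omega>\<close>-logic a contradiction would have a cut-free derivation of height
 \<open>\<alpha> < \<epsilon>\<^sub>0\<close>, but one can descend along it while building a Goodstein sequence whose current ordinal dominates
 the height that is left. The first hierarchy \<open>b \<mapsto> b min(b, c)\<close> reaches arbitrarily large ordinals below
 \<open>\<epsilon>\<^sub>0\<close> as \<open>c\<close> grows, and inserting \<open>e\<close> new bases for each new digit makes a step cost as little as desired
 for large \<open>e\<close>. In a model of the axioms the sets definable from \<open>Y\<close> yield a model of ACA0 in which
 the Goodstein sequence coded by \<open>Y\<close> does not reach \<open>0\<close>.\<close>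

text \<open>The bound S(b) <= b^2 shapes both halves. Clause (3) of good successors passes it on
  from each hierarchy to the next, so the numbers to be upgraded always have exponent 1 and a base
  change is just d * up(a) + up(r). In the first half the pairs of a stage and a number themselves
  serve as ordinal notations, compared along iterated upgrades. Transfinite induction for them is a
  statement about all sets, to which induction inside the model does not apply; it is carried from
  digit to digit outside the model, and so only through standard digits. In the second half the
  ordinal assignment need not be optimal. Four properties suffice: it is strictly monotone, it does
  not drop under upgrades, after one step it can stay above any prescribed smaller ordinal, and its
  starting values are unbounded. The upgrade relation quantifies over sets, so in both models it
  must first be matched with one arithmetical graph. That this graph is single valued in the second
  model is imported from a theorem of ACA0 obtained in the first half.\<close>

abbreviation (input) bool_iff (infixr "<->" 25) where "A <-> B \<equiv> A = (B :: bool)"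

section \<open>Semantics and soundness\<close>

text \<open>Henkin semantics: set quantifiers range over the family \<open>Ss\<close> alone. Its
  members may contain elements outside \<open>Dom\<close>; under assignments into \<open>Dom\<close>
  this is never noticed.\<close>

record 'a mdl =
 Dom :: "'a set"
 Ze :: 'a
 On :: 'a
 Ad :: "'a => 'a => 'a"
 Mu :: "'a => 'a => 'a"
 Ls :: "'a => 'a => bool"
 Ss :: "'a set set"

primrec tval :: "('a, 'b) mdl_scheme => (nat => 'a) => trm => 'a" where
 "tval M e (Var x) = e x"
| "tval M e \<^bold>0 = Ze M"
| "tval M e \<^bold>1 = On M"
| "tval M e (s \<^bold>+ t) = Ad M (tval M e s) (tval M e t)"
| "tval M e (s \<^bold>* t) = Mu M (tval M e s) (tval M e t)"

primrec sat :: "('a, 'b) mdl_scheme => (nat => 'a) => (nat => 'a set) => fm => bool" where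
 "sat M e E Falsum <-> False"
| "sat M e E (Eq s t) <-> tval M e s = tval M e t"
| "sat M e E (Less s t) <-> Ls M (tval M e s) (tval M e t)"
| "sat M e E (Mem t X) <-> tval M e t : E X"
| "sat M e E (Imp \<phi> \<psi>) <-> (sat M e E \<phi> --> sat M e E \<psi>)"
| "sat M e E (AllN x \<phi>) <-> (ALL a:Dom M. sat M (e(x := a)) E \<phi>)"
| "sat M e E (AllS X \<phi>) <-> (ALL A:Ss M. sat M e (E(X := A)) \<phi>)"

definition is_str :: "('a, 'b) mdl_scheme => bool" where
 "is_str M <-> Ze M : Dom M & On M : Dom M & Ss M ~= {} &
  (ALL a:Dom M. ALL b:Dom M. Ad M a b : Dom M & Mu M a b : Dom M)"

definition valid :: "('a, 'b) mdl_scheme => fm => bool" where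
 "valid M \<phi> <-> (ALL e E. (ALL x. e x : Dom M) --> (ALL X. E X : Ss M) --> sat M e E \<phi>)"

lemma tval_cong: "(!!x. x : vars_trm t ==> e x = e' x) ==> tval M e t = tval M e' t"
 by (induction t) auto

lemma sat_cong:
 "(!!x. x : fvN \<phi> ==> e x = e' x) ==> (!!X. X : fvS \<phi> ==> E X = E' X) ==>
  sat M e E \<phi> = sat M e' E' \<phi>"
proof (induction \<phi> arbitrary: e e' E E')
 case (Imp \<phi> \<psi>)
 have "sat M e E \<phi> = sat M e' E' \<phi>" "sat M e E \<psi> = sat M e' E' \<psi>"
  using Imp.prems by (auto intro!: Imp.IH)
 then show ?case by simp
next
 case (AllN x \<phi>)
 have "sat M (e(x := a)) E \<phi> = sat M (e'(x := a)) E' \<phi>" for a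
  using AllN.prems by (intro AllN.IH) auto
 then show ?case by simp
next
 case (AllS X \<phi>)
 have "sat M e (E(X := A)) \<phi> = sat M e' (E'(X := A)) \<phi>" for A
  using AllS.prems by (intro AllS.IH) auto
 then show ?case by simp
next
 case (Eq s t)
 then show ?case using tval_cong[of s e e' M] tval_cong[of t e e' M] by simp
next
 case (Less s t)
 then show ?case using tval_cong[of s e e' M] tval_cong[of t e e' M] by simp
next
 case (Mem t X)
 then show ?case using tval_cong[of t e e' M] by simp
qed simp

lemma tval_subst: "tval M e (subst_trm x u t) = tval M (e(x := tval M e u)) t"
 by (induction t) auto

lemma tval_upd: "x ~: vars_trm t ==> tval M (e(x := a)) t = tval M e t"
 by (rule tval_cong) auto

lemma sat_updN: "x ~: fvN \<phi> ==> sat M (e(x := a)) E \<phi> = sat M e E \<phi>"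
 by (rule sat_cong) auto

lemma sat_updS: "X ~: fvS \<phi> ==> sat M e (E(X := A)) \<phi> = sat M e E \<phi>"
 by (rule sat_cong) auto

lemma subst_trm_id: "x ~: vars_trm t ==> subst_trm x u t = t"
 by (induction t) auto

lemma substN_id: "x ~: fvN \<phi> ==> substN x u \<phi> = \<phi>"
 by (induction \<phi>) (auto simp: subst_trm_id)

lemma substS_id: "X ~: fvS \<phi> ==> substS X U \<phi> = \<phi>"
 by (induction \<phi>) auto

lemma sat_substN:
 "free_forN u x \<phi> ==> sat M e E (substN x u \<phi>) = sat M (e(x := tval M e u)) E \<phi>"
proof (induction \<phi> arbitrary: e E)
 case (AllN y \<phi>)
 show ?case
 proof (cases "x : fvN (AllN y \<phi>)")
  \<comment> \<open>Without a free occurrence of \<open>x\<close> the guard says nothing about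
    capture, but then the substitution is the identity.\<close>
  case False
  then have "substN x u (AllN y \<phi>) = AllN y \<phi>" by (rule substN_id)
  then show ?thesis using False by (metis sat_updN)
 next
  case True
  then have y: "y ~= x" "y ~: vars_trm u" "free_forN u x \<phi>" using AllN.prems by auto
  have "sat M (e(y := a)) E (substN x u \<phi>) = sat M ((e(x := tval M e u))(y := a)) E \<phi>" for a
   by (simp only: AllN.IH[OF y(3)] tval_upd[OF y(2)] fun_upd_twist[OF y(1)])
  then show ?thesis by (simp only: substN.simps sat.simps y(1) if_False)
 qed
qed (auto simp: tval_subst)

lemma sat_substS:
 "free_forS Y X \<phi> ==> sat M e E (substS X Y \<phi>) = sat M e (E(X := E Y)) \<phi>"
proof (induction \<phi> arbitrary: e E)
 case (AllS Z \<phi>)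
 show ?case
 proof (cases "X : fvS (AllS Z \<phi>)")
  case False
  then have "substS X Y (AllS Z \<phi>) = AllS Z \<phi>" by (rule substS_id)
  then show ?thesis using False by (metis sat_updS)
 next
  case True
  then have y: "Z ~= X" "Z ~= Y" "free_forS Y X \<phi>" using AllS.prems by auto
  have "sat M e (E(Z := A)) (substS X Y \<phi>) = sat M e ((E(X := E Y))(Z := A)) \<phi>" for A
   using y(2) by (simp only: AllS.IH[OF y(3)] fun_upd_twist[OF y(1)] fun_upd_other[OF y(2)[symmetric]])
  then show ?thesis by (simp only: substS.simps sat.simps y(1) if_False)
 qed
qed auto

lemma tval_Dom: "is_str M ==> (!!x. e x : Dom M) ==> tval M e t : Dom M"
 by (induction t) (auto simp: is_str_def)

theorem soundness:
 assumes "T \<turnstile> \<phi>" "is_str M" "!!\<psi>. \<psi> : T ==> valid M \<psi>"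
 shows "valid M \<phi>"
 using assms(1)
proof induction
 case (InstN t x \<phi>)
 then show ?case
  using tval_Dom[OF assms(2)] by (auto simp: valid_def sat_substN)
next
 case (DistN x \<phi> \<psi>)
 then show ?case by (auto simp: valid_def sat_updN)
next
 case (InstS Y X \<phi>)
 then show ?case by (auto simp: valid_def sat_substS)
next
 case (DistS X \<phi> \<psi>)
 then show ?case by (auto simp: valid_def sat_updS)
next
 case (EqSubst s x \<phi> t)
 then show ?case by (auto simp: valid_def sat_substN)
qed (auto simp: valid_def assms(3)[unfolded valid_def])

instance trm :: countable by countable_datatype
instance fm :: countable by countable_datatype

section \<open>Completeness\<close>

text \<open>Derivations from hypotheses \<open>\<Gamma>\<close> that generalize over theorems of \<open>T\<close> only.\<close>

inductive drv :: "fm set => fm set => fm => bool" for T \<Gamma> where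
 hyp: "\<phi> : \<Gamma> ==> drv T \<Gamma> \<phi>"
| thmI: "T \<turnstile> \<phi> ==> drv T \<Gamma> \<phi>"
| mp: "drv T \<Gamma> (Imp \<phi> \<psi>) ==> drv T \<Gamma> \<phi> ==> drv T \<Gamma> \<psi>"

lemma drv_mono: "drv T \<Gamma> \<phi> ==> \<Gamma> <= \<Gamma>' ==> drv T \<Gamma>' \<phi>"
 by (induction rule: drv.induct) (auto intro: drv.intros)

lemma proves_refl: "T \<turnstile> Imp \<phi> \<phi>"
 by (rule MP[OF MP[OF proves.S K[of _ _ "Imp \<phi> \<phi>"]] K])

text \<open>No condition on variables arises, because generalization is confined to theorems of
  \<open>T\<close>.\<close>

lemma drv_ded: "drv T (insert \<psi> \<Gamma>) \<phi> ==> drv T \<Gamma> (Imp \<psi> \<phi>)"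
proof (induction rule: drv.induct)
 case (hyp \<phi>)
 then show ?case
  by (cases "\<phi> = \<psi>") (auto intro: drv.thmI proves_refl drv.mp[OF drv.thmI[OF K]] drv.hyp)
next
 case (thmI \<phi>)
 then show ?case by (blast intro: drv.thmI drv.mp K)
next
 case (mp \<phi> \<chi>)
 then show ?case by (blast intro: drv.thmI drv.mp proves.S)
qed

lemma drv_ded_iff: "drv T \<Gamma> (Imp \<psi> \<phi>) <-> drv T (insert \<psi> \<Gamma>) \<phi>"
 using drv_ded drv_mono[of T \<Gamma> "Imp \<psi> \<phi>" "insert \<psi> \<Gamma>"] drv.mp drv.hyp
 by (metis insertI1 subset_insertI)

lemma drv_raa: "drv T (insert (Neg \<phi>) \<Gamma>) Falsum ==> drv T \<Gamma> \<phi>"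
 by (rule drv.mp[OF drv.thmI[OF DN] drv_ded])

lemma drv_exf: "drv T \<Gamma> Falsum ==> drv T \<Gamma> \<phi>"
 by (rule drv_raa, erule drv_mono) auto

lemma drv_compact: "drv T \<Gamma> \<phi> ==> \<exists>\<Gamma>0. finite \<Gamma>0 & \<Gamma>0 <= \<Gamma> & drv T \<Gamma>0 \<phi>"
proof (induction rule: drv.induct)
 case (hyp \<phi>)
 then show ?case by (intro exI[of _ "{\<phi>}"]) (auto intro: drv.hyp)
next
 case (thmI \<phi>)
 then show ?case by (intro exI[of _ "{}"]) (auto intro: drv.thmI)
next
 case (mp \<phi> \<psi>)
 then obtain A B where "finite A" "A <= \<Gamma>" "drv T A (Imp \<phi> \<psi>)" "finite B" "B <= \<Gamma>" "drv T B \<phi>" by auto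
 then show ?case
  by (intro exI[of _ "A \<union> B"])
   (auto intro: drv.mp[OF drv_mono[of _ A] drv_mono[of _ B]])
qed

section \<open>Fresh variables, renaming, and generalization over hypotheses\<close>

primrec allN :: "fm => nat set" where
 "allN Falsum = {}"
| "allN (Eq s t) = vars_trm s \<union> vars_trm t"
| "allN (Less s t) = vars_trm s \<union> vars_trm t"
| "allN (Mem t X) = vars_trm t"
| "allN (Imp \<phi> \<psi>) = allN \<phi> \<union> allN \<psi>"
| "allN (AllN x \<phi>) = insert x (allN \<phi>)"
| "allN (AllS X \<phi>) = allN \<phi>"

primrec allS :: "fm => nat set" where
 "allS Falsum = {}"
| "allS (Eq s t) = {}"
| "allS (Less s t) = {}"
| "allS (Mem t X) = {X}"
| "allS (Imp \<phi> \<psi>) = allS \<phi> \<union> allS \<psi>"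
| "allS (AllN x \<phi>) = allS \<phi>"
| "allS (AllS X \<phi>) = insert X (allS \<phi>)"

lemma finite_vars_trm [simp]: "finite (vars_trm t)" by (induction t) auto
lemma finite_allN [simp]: "finite (allN \<phi>)" by (induction \<phi>) auto
lemma finite_allS [simp]: "finite (allS \<phi>)" by (induction \<phi>) auto
lemma fvN_allN: "fvN \<phi> <= allN \<phi>" by (induction \<phi>) auto
lemma fvS_allS: "fvS \<phi> <= allS \<phi>" by (induction \<phi>) auto

lemma free_forN_fresh: "y ~: allN \<phi> ==> free_forN (Var y) x \<phi>" by (induction \<phi>) auto
lemma free_forS_fresh: "Y ~: allS \<phi> ==> free_forS Y X \<phi>" by (induction \<phi>) auto
lemma free_forN_triv: "x ~: fvN \<phi> ==> free_forN u x \<phi>" by (induction \<phi>) auto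
lemma free_forS_triv: "X ~: fvS \<phi> ==> free_forS U X \<phi>" by (induction \<phi>) auto

lemma subst_trm_back: "y ~: vars_trm t ==> subst_trm y (Var x) (subst_trm x (Var y) t) = t"
 by (induction t) auto
lemma substN_back: "y ~: allN \<phi> ==> substN y (Var x) (substN x (Var y) \<phi>) = \<phi>"
proof (induction \<phi>)
 case (AllN z \<phi>)
 then show ?case using fvN_allN[of \<phi>] substN_id[of y \<phi> "Var x"] by auto
qed (auto simp: subst_trm_back)
lemma substS_back: "Y ~: allS \<phi> ==> substS Y X (substS X Y \<phi>) = \<phi>"
proof (induction \<phi>)
 case (AllS z \<phi>)
 then show ?case using fvS_allS[of \<phi>] substS_id[of Y \<phi> X] by auto
qed auto
lemma free_forN_back: "y ~: allN \<phi> ==> free_forN (Var x) y (substN x (Var y) \<phi>)"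
proof (induction \<phi>)
 case (AllN z \<phi>)
 then show ?case using fvN_allN[of \<phi>] by auto
qed auto
lemma free_forS_back: "Y ~: allS \<phi> ==> free_forS X Y (substS X Y \<phi>)"
proof (induction \<phi>)
 case (AllS z \<phi>)
 then show ?case using fvS_allS[of \<phi>] by auto
qed auto
lemma vars_subst: "vars_trm (subst_trm x u t) <= (vars_trm t - {x}) \<union> vars_trm u"
 by (induction t) auto
lemma fvN_substN: "x ~: vars_trm u ==> x ~: fvN (substN x u \<phi>)"
 using vars_subst[of x u] by (induction \<phi>) (auto dest: subsetD)
lemma fvS_substS: "X ~= U ==> X ~: fvS (substS X U \<phi>)"
 by (induction \<phi>) auto

text \<open>The usual eigenvariable condition. In the modus ponens case the quantifier must be
  distributed over an implication, which the calculus offers only through a combination of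
  \<open>InstN\<close>, \<open>GenN\<close> and \<open>DistN\<close>.\<close>

lemma drv_genN: "drv T \<Gamma> \<phi> ==> (!!\<gamma>. \<gamma> : \<Gamma> ==> y ~: fvN \<gamma>) ==> drv T \<Gamma> (AllN y \<phi>)"
proof (induction rule: drv.induct)
 case (hyp \<phi>)
 have "T \<turnstile> Imp \<phi> (AllN y \<phi>)" using hyp by (intro MP[OF DistN GenN[OF proves_refl]]) auto
 then show ?case using hyp by (blast intro: drv.intros)
next
 case (thmI \<phi>)
 then show ?case by (blast intro: drv.intros GenN)
next
 case (mp \<phi> \<psi>)
 let ?A = "{AllN y (Imp \<phi> \<psi>), AllN y \<phi>}"
 have i: "T \<turnstile> Imp (AllN y \<chi>) \<chi>" for \<chi>
 proof -
  have id: "subst_trm y (Var y) t = t" for t by (induction t) auto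
  have "substN y (Var y) \<chi> = \<chi>" "free_forN (Var y) y \<chi>" by (induction \<chi>) (auto simp: id)
  then show ?thesis using InstN[of "Var y" y \<chi> T] by simp
 qed
 have *: "drv T ?A \<psi>" by (meson i drv.intros insertI1 insertI2)
 have "T \<turnstile> \<chi> ==> T \<turnstile> AllN y \<chi>" for \<chi> by (rule GenN)
 have "drv T {} (Imp (AllN y (Imp \<phi> \<psi>)) (Imp (AllN y \<phi>) \<psi>))"
  using * by (simp add: drv_ded_iff insert_commute)
 moreover have "drv T {} \<chi> ==> T \<turnstile> \<chi>" for \<chi>
  by (induction rule: drv.induct) (auto intro: MP)
 ultimately have t: "T \<turnstile> Imp (AllN y (Imp \<phi> \<psi>)) (Imp (AllN y \<phi>) \<psi>)" by blast
 have "T \<turnstile> Imp (AllN y (Imp \<phi> \<psi>)) (AllN y (Imp (AllN y \<phi>) \<psi>))"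
  by (rule MP[OF DistN GenN[OF t]]) simp
 moreover have "T \<turnstile> Imp (AllN y (Imp (AllN y \<phi>) \<psi>)) (Imp (AllN y \<phi>) (AllN y \<psi>))"
  by (rule DistN) simp
 ultimately show ?case using mp by (meson drv.intros)
qed

lemma drv_genS: "drv T \<Gamma> \<phi> ==> (!!\<gamma>. \<gamma> : \<Gamma> ==> y ~: fvS \<gamma>) ==> drv T \<Gamma> (AllS y \<phi>)"
proof (induction rule: drv.induct)
 case (hyp \<phi>)
 have "T \<turnstile> Imp \<phi> (AllS y \<phi>)" using hyp by (intro MP[OF DistS GenS[OF proves_refl]]) auto
 then show ?case using hyp by (blast intro: drv.intros)
next
 case (thmI \<phi>)
 then show ?case by (blast intro: drv.intros GenS)
next
 case (mp \<phi> \<psi>)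
 let ?A = "{AllS y (Imp \<phi> \<psi>), AllS y \<phi>}"
 have i: "T \<turnstile> Imp (AllS y \<chi>) \<chi>" for \<chi>
 proof -
  have "substS y y \<chi> = \<chi>" "free_forS y y \<chi>" by (induction \<chi>) auto
  then show ?thesis using InstS[of y y \<chi> T] by simp
 qed
 have *: "drv T ?A \<psi>" by (meson i drv.intros insertI1 insertI2)
 have "drv T {} (Imp (AllS y (Imp \<phi> \<psi>)) (Imp (AllS y \<phi>) \<psi>))"
  using * by (simp add: drv_ded_iff insert_commute)
 moreover have "drv T {} \<chi> ==> T \<turnstile> \<chi>" for \<chi>
  by (induction rule: drv.induct) (auto intro: MP)
 ultimately have t: "T \<turnstile> Imp (AllS y (Imp \<phi> \<psi>)) (Imp (AllS y \<phi>) \<psi>)" by blast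
 have "T \<turnstile> Imp (AllS y (Imp \<phi> \<psi>)) (AllS y (Imp (AllS y \<phi>) \<psi>))"
  by (rule MP[OF DistS GenS[OF t]]) simp
 moreover have "T \<turnstile> Imp (AllS y (Imp (AllS y \<phi>) \<psi>)) (Imp (AllS y \<phi>) (AllS y \<psi>))"
  by (rule DistS) simp
 ultimately show ?case using mp by (meson drv.intros)
qed

text \<open>A witness is a fresh variable \<open>y\<close>. If it leads to a contradiction,
  generalization over \<open>y\<close> has to give back the original formula, whose bound variable
  is \<open>x\<close>.\<close>

lemma proves_renameN:
 assumes "y ~: allN (AllN x \<chi>)"
 shows "T \<turnstile> Imp (AllN y (substN x (Var y) \<chi>)) (AllN x \<chi>)"
proof -
 have "T \<turnstile> Imp (AllN y (substN x (Var y) \<chi>)) \<chi>"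
  using InstN[OF free_forN_back[of y \<chi> x], of T] assms by (simp add: substN_back)
 then show ?thesis using assms by (intro MP[OF DistN GenN]) (auto dest: fvN_substN[THEN notE, rotated])
qed

lemma proves_renameS:
 assumes "y ~: allS (AllS x \<chi>)"
 shows "T \<turnstile> Imp (AllS y (substS x y \<chi>)) (AllS x \<chi>)"
proof -
 have "T \<turnstile> Imp (AllS y (substS x y \<chi>)) \<chi>"
  using InstS[OF free_forS_back[of y \<chi> x], of T] assms by (simp add: substS_back)
 then show ?thesis using assms by (intro MP[OF DistS GenS]) (auto dest: fvS_substS[THEN notE, rotated])
qed

definition freshN :: "fm set => nat" where "freshN \<Gamma> = (SOME y. y ~: \<Union>(allN ` \<Gamma>))"
definition freshS :: "fm set => nat" where "freshS \<Gamma> = (SOME y. y ~: \<Union>(allS ` \<Gamma>))"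

lemma freshN: "finite \<Gamma> ==> \<gamma> : \<Gamma> ==> freshN \<Gamma> ~: allN \<gamma>"
 using someI_ex[OF ex_new_if_finite[of "\<Union>(allN ` \<Gamma>)"]] unfolding freshN_def
 by (metis (no_types, lifting) UN_I finite_UN finite_allN infinite_UNIV_char_0)
lemma freshS: "finite \<Gamma> ==> \<gamma> : \<Gamma> ==> freshS \<Gamma> ~: allS \<gamma>"
 using someI_ex[OF ex_new_if_finite[of "\<Union>(allS ` \<Gamma>)"]] unfolding freshS_def
 by (metis (no_types, lifting) UN_I finite_UN finite_allS infinite_UNIV_char_0)

definition wit :: "fm set => fm => fm set" where
 "wit \<Gamma> \<psi> = {Neg (substN x (Var (freshN \<Gamma>)) \<chi>) | x \<chi>. \<psi> = Neg (AllN x \<chi>)} \<union>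
  {Neg (substS x (freshS \<Gamma>) \<chi>) | x \<chi>. \<psi> = Neg (AllS x \<chi>)}"

lemma wit_cases:
 obtains "wit \<Gamma> \<psi> = {}"
 | x \<chi> where "\<psi> = Neg (AllN x \<chi>)" "wit \<Gamma> \<psi> = {Neg (substN x (Var (freshN \<Gamma>)) \<chi>)}"
 | x \<chi> where "\<psi> = Neg (AllS x \<chi>)" "wit \<Gamma> \<psi> = {Neg (substS x (freshS \<Gamma>) \<chi>)}"
 unfolding wit_def by fastforce

lemma wit_consistent:
 assumes fin: "finite \<Gamma>" and con: "\<not> drv T \<Gamma> Falsum" and \<psi>: "\<psi> : \<Gamma>"
 shows "finite (wit \<Gamma> \<psi>)" "\<not> drv T (\<Gamma> \<union> wit \<Gamma> \<psi>) Falsum"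
proof -
 have "finite (wit \<Gamma> \<psi>) & \<not> drv T (\<Gamma> \<union> wit \<Gamma> \<psi>) Falsum"
 proof (cases \<Gamma> \<psi> rule: wit_cases)
  case 1
  then show ?thesis using con by simp
 next
  case (2 x \<chi>)
  let ?y = "freshN \<Gamma>"
  have "False" if "drv T (insert (Neg (substN x (Var ?y) \<chi>)) \<Gamma>) Falsum"
  proof -
   have "drv T \<Gamma> (AllN ?y (substN x (Var ?y) \<chi>))"
    using drv_raa[OF that] freshN[OF fin] fvN_allN by (intro drv_genN) blast+
   moreover have "T \<turnstile> Imp (AllN ?y (substN x (Var ?y) \<chi>)) (AllN x \<chi>)"
    using freshN[OF fin \<psi>] 2 by (intro proves_renameN) auto
   ultimately have "drv T \<Gamma> (AllN x \<chi>)" by (blast intro: drv.intros)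
   then show False using con \<psi> 2 by (blast intro: drv.intros)
  qed
  then show ?thesis using 2 by auto
 next
  case (3 x \<chi>)
  let ?y = "freshS \<Gamma>"
  have "False" if "drv T (insert (Neg (substS x ?y \<chi>)) \<Gamma>) Falsum"
  proof -
   have "drv T \<Gamma> (AllS ?y (substS x ?y \<chi>))"
    using drv_raa[OF that] freshS[OF fin] fvS_allS by (intro drv_genS) blast+
   moreover have "T \<turnstile> Imp (AllS ?y (substS x ?y \<chi>)) (AllS x \<chi>)"
    using freshS[OF fin \<psi>] 3 by (intro proves_renameS) auto
   ultimately have "drv T \<Gamma> (AllS x \<chi>)" by (blast intro: drv.intros)
   then show False using con \<psi> 3 by (blast intro: drv.intros)
  qed
  then show ?thesis using 3 by auto
 qed
 then show "finite (wit \<Gamma> \<psi>)" "\<not> drv T (\<Gamma> \<union> wit \<Gamma> \<psi>) Falsum" by auto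
qed

text \<open>Lindenbaum enumeration interleaved with witnesses. Since it starts from a finite set,
  all stages are finite and fresh variables never run out.\<close>

primrec chain :: "fm set => fm set => nat => fm set" where
 "chain T \<Gamma> 0 = \<Gamma>"
| "chain T \<Gamma> (Suc n) = (let \<Delta> = insert (from_nat n) (chain T \<Gamma> n) in
  if drv T \<Delta> Falsum then chain T \<Gamma> n else \<Delta> \<union> wit \<Delta> (from_nat n))"

locale henkin =
 fixes T \<Delta> :: "fm set"
 assumes con: "\<not> drv T \<Delta> Falsum"
  and max: "\<phi> : \<Delta> \<or> Neg \<phi> : \<Delta>"
  and witN: "Neg (AllN x \<chi>) : \<Delta> ==> EX y. y ~: allN \<chi> & Neg (substN x (Var y) \<chi>) : \<Delta>"
  and witS: "Neg (AllS x \<chi>) : \<Delta> ==> EX y. y ~: allS \<chi> & Neg (substS x y \<chi>) : \<Delta>"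

lemma henkin_extend:
 assumes "finite \<Gamma>" "\<not> drv T \<Gamma> Falsum"
 obtains \<Delta> where "\<Gamma> <= \<Delta>" "henkin T \<Delta>"
proof -
 let ?c = "chain T \<Gamma>"
 have c: "finite (?c n) & \<not> drv T (?c n) Falsum" for n
 proof (induction n)
  case (Suc n)
  then show ?case
   using wit_consistent[of "insert (from_nat n) (?c n)" T "from_nat n"] by (auto simp: Let_def)
 qed (use assms in auto)
 have "mono ?c" by (rule mono_iff_le_Suc[THEN iffD2]) (auto simp: Let_def)
 then have m: "i <= j ==> ?c i <= ?c j" for i j by (simp add: monoD)
 let ?D = "\<Union>n. ?c n"
 have D: "EX n. A <= ?c n" if "finite A" "A <= ?D" for A
  using that
 proof (induction A rule: finite_induct)
  case (insert a A)
  then obtain n k where "A <= ?c n" "a : ?c k" by auto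
  then show ?case using m[of n "max n k"] m[of k "max n k"] by (intro exI[of _ "max n k"]) auto
 qed auto
 have con: "\<not> drv T ?D Falsum"
  using drv_compact[of T ?D Falsum] D c drv_mono by meson
 have mem: "\<phi> : ?D" if "drv T ?D \<phi>" for \<phi>
 proof (rule ccontr)
  assume n: "\<phi> ~: ?D"
  then have "\<phi> ~: ?c (Suc (to_nat \<phi>))" by blast
  then have "drv T (insert \<phi> (?c (to_nat \<phi>))) Falsum" by (auto simp: Let_def split: if_splits)
  then have "drv T ?D (Neg \<phi>)" by (intro drv_mono[OF drv_ded]) auto
  then show False using that con drv.mp by blast
 qed
 have "henkin T ?D"
 proof
  show "\<not> drv T ?D Falsum" by (rule con)
  show "\<phi> : ?D \<or> Neg \<phi> : ?D" for \<phi>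
  proof (rule disjCI)
   assume n: "Neg \<phi> ~: ?D"
   have "\<phi> : ?c (Suc (to_nat \<phi>)) \<or> drv T (insert \<phi> (?c (to_nat \<phi>))) Falsum"
    by (auto simp: Let_def)
   then show "\<phi> : ?D"
    using n mem[of "Neg \<phi>"] drv_mono[OF drv_ded, of T \<phi> "?c (to_nat \<phi>)" Falsum ?D] by blast
  qed
 next
  fix x \<chi> assume a: "Neg (AllN x \<chi>) : ?D"
  let ?p = "Neg (AllN x \<chi>)" let ?n = "to_nat ?p" let ?G = "insert ?p (?c ?n)"
  have nd: "\<not> drv T ?G Falsum"
   using a con drv_mono[of T ?G Falsum ?D] by blast
  then have "wit ?G ?p <= ?c (Suc ?n)" by (simp add: Let_def) blast
  moreover have "Neg (substN x (Var (freshN ?G)) \<chi>) : wit ?G ?p" unfolding wit_def by auto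
  moreover have "freshN ?G ~: allN \<chi>" using freshN[of ?G ?p] c by auto
  ultimately show "EX y. y ~: allN \<chi> & Neg (substN x (Var y) \<chi>) : ?D" by blast
 next
  fix x \<chi> assume a: "Neg (AllS x \<chi>) : ?D"
  let ?p = "Neg (AllS x \<chi>)" let ?n = "to_nat ?p" let ?G = "insert ?p (?c ?n)"
  have nd: "\<not> drv T ?G Falsum"
   using a con drv_mono[of T ?G Falsum ?D] by blast
  then have "wit ?G ?p <= ?c (Suc ?n)" by (simp add: Let_def) blast
  moreover have "Neg (substS x (freshS ?G) \<chi>) : wit ?G ?p" unfolding wit_def by auto
  moreover have "freshS ?G ~: allS \<chi>" using freshS[of ?G ?p] c by auto
  ultimately show "EX y. y ~: allS \<chi> & Neg (substS x y \<chi>) : ?D" by blast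
 qed
 moreover have "\<Gamma> <= ?D" using chain.simps(1) by blast
 ultimately show ?thesis using that by blast
qed

text \<open>The truth lemma is proved by induction on this size: instances of a quantified formula
  are not subformulas, but substitution leaves the size unchanged.\<close>

primrec fsize :: "fm => nat" where
 "fsize Falsum = 0"
| "fsize (Eq s t) = 0"
| "fsize (Less s t) = 0"
| "fsize (Mem t X) = 0"
| "fsize (Imp \<phi> \<psi>) = Suc (fsize \<phi> + fsize \<psi>)"
| "fsize (AllN x \<phi>) = Suc (fsize \<phi>)"
| "fsize (AllS X \<phi>) = Suc (fsize \<phi>)"

lemma fsize_subst [simp]: "fsize (substN x u \<phi>) = fsize \<phi>" "fsize (substS X Y \<phi>) = fsize \<phi>"
 by (induction \<phi>) auto

context henkin
begin

lemma closed: "drv T \<Delta> \<phi> <-> \<phi> : \<Delta>"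
 using max[of \<phi>] con drv.mp drv.hyp by blast

lemma thm_in: "T \<turnstile> \<phi> ==> \<phi> : \<Delta>" using closed drv.thmI by blast
lemma mp_in: "Imp \<phi> \<psi> : \<Delta> ==> \<phi> : \<Delta> ==> \<psi> : \<Delta>" using closed drv.mp by blast
lemma Falsum_in: "Falsum ~: \<Delta>" using closed con by blast
lemma Imp_in: "Imp \<phi> \<psi> : \<Delta> <-> (\<phi> : \<Delta> --> \<psi> : \<Delta>)"
proof
 assume r: "\<phi> : \<Delta> --> \<psi> : \<Delta>"
 have "drv T (insert \<phi> \<Delta>) \<psi>"
 proof (cases "\<phi> : \<Delta>")
  case True
  then show ?thesis using r drv.hyp by blast
 next
  case False
  then have "Neg \<phi> : \<Delta>" using max by blast
  then have "drv T (insert \<phi> \<Delta>) Falsum" by (meson drv.intros insertI1 insertI2)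
  then show ?thesis by (rule drv_exf)
 qed
 then show "Imp \<phi> \<psi> : \<Delta>" using drv_ded closed by blast
qed (use mp_in in blast)

lemma inst_in: "AllN x \<phi> : \<Delta> ==> free_forN t x \<phi> ==> substN x t \<phi> : \<Delta>"
 using thm_in[OF InstN] mp_in by blast
lemma instS_in: "AllS x \<phi> : \<Delta> ==> free_forS t x \<phi> ==> substS x t \<phi> : \<Delta>"
 using thm_in[OF InstS] mp_in by blast

definition eqv :: "trm => trm => bool" where "eqv s t <-> Eq s t : \<Delta>"

lemma eqv_sub: "eqv s t ==> free_forN s x \<phi> ==> free_forN t x \<phi> ==>
  substN x s \<phi> : \<Delta> ==> substN x t \<phi> : \<Delta>"
 unfolding eqv_def using thm_in[OF EqSubst] mp_in by blast

lemma eqv_refl: "eqv t t" unfolding eqv_def by (rule thm_in[OF EqRefl])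

lemma fresh_ex: "EX x. x ~: vars_trm s & x ~: vars_trm t & x ~: F" if "finite F"
 using ex_new_if_finite[of "vars_trm s \<union> vars_trm t \<union> F"] that by auto

lemma eqv_sym: assumes "eqv s t" shows "eqv t s"
proof -
 obtain x where "x ~: vars_trm s" using fresh_ex[of "{}" s s] by auto
 then show ?thesis
  using eqv_sub[OF assms, of x "Eq (Var x) s"] eqv_refl[of s] by (simp add: eqv_def subst_trm_id)
qed

lemma eqv_trans: assumes "eqv r s" "eqv s t" shows "eqv r t"
proof -
 obtain x where "x ~: vars_trm r" using fresh_ex[of "{}" r r] by auto
 then show ?thesis
  using eqv_sub[OF assms(2), of x "Eq r (Var x)"] assms(1) by (simp add: eqv_def subst_trm_id)
qed

lemma eqv_bin:
 assumes "f = Add \<or> f = Mul" "eqv s s'" "eqv t t'" shows "eqv (f s t) (f s' t')"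
proof -
 have 1: "eqv (f s t) (f s' t)"
 proof -
  obtain x where "x ~: vars_trm s" "x ~: vars_trm t" using fresh_ex[of "{}" s t] by auto
  then show ?thesis
   using eqv_sub[OF assms(2), of x "Eq (f s t) (f (Var x) t)"] eqv_refl[of "f s t"] assms(1)
   by (auto simp: eqv_def subst_trm_id)
 qed
 have 2: "eqv (f s' t) (f s' t')"
 proof -
  obtain x where "x ~: vars_trm s'" "x ~: vars_trm t" using fresh_ex[of "{}" s' t] by auto
  then show ?thesis
   using eqv_sub[OF assms(3), of x "Eq (f s' t) (f s' (Var x))"] eqv_refl[of "f s' t"] assms(1)
   by (auto simp: eqv_def subst_trm_id)
 qed
 show ?thesis using 1 2 by (rule eqv_trans)
qed

lemma eqv_Less: assumes "eqv s s'" "eqv t t'" "Less s t : \<Delta>" shows "Less s' t' : \<Delta>"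
proof -
 have 1: "Less s' t : \<Delta>"
 proof -
  obtain x where "x ~: vars_trm t" using fresh_ex[of "{}" t t] by auto
  then show ?thesis using eqv_sub[OF assms(1), of x "Less (Var x) t"] assms(3) by (simp add: subst_trm_id)
 qed
 obtain x where "x ~: vars_trm s'" using fresh_ex[of "{}" s' s'] by auto
 then show ?thesis using eqv_sub[OF assms(2), of x "Less s' (Var x)"] 1 by (simp add: subst_trm_id)
qed

lemma eqv_Mem: assumes "eqv s s'" "Mem s X : \<Delta>" shows "Mem s' X : \<Delta>"
 using eqv_sub[OF assms(1), of 0 "Mem (Var 0) X"] assms(2) by simp

definition rep :: "trm => trm" where "rep t = (SOME s. eqv t s)"

lemma eqv_rep: "eqv t (rep t)" unfolding rep_def using eqv_refl by (rule someI)
lemma rep_eq: "rep s = rep t <-> eqv s t"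
proof
 assume "eqv s t"
 then have "eqv s = eqv t" using eqv_sym eqv_trans by blast
 then show "rep s = rep t" by (simp add: rep_def)
qed (metis eqv_rep eqv_sym eqv_trans)
lemma rep_rep [simp]: "rep (rep t) = rep t" using rep_eq eqv_rep eqv_sym by blast

definition setof :: "nat => trm set" where "setof X = {rep t | t. Mem t X : \<Delta>}"

lemma rep_setof: "rep t : setof X <-> Mem t X : \<Delta>"
 unfolding setof_def using rep_eq eqv_Mem eqv_sym by fastforce

definition MM :: "trm mdl" where
 "MM = \<lparr>Dom = range rep, Ze = rep \<^bold>0, On = rep \<^bold>1, Ad = (%s t. rep (s \<^bold>+ t)), Mu = (%s t. rep (s \<^bold>* t)),
  Ls = (%s t. Less s t : \<Delta>), Ss = range setof\<rparr>"

abbreviation "e0 \<equiv> %x. rep (Var x)"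

lemma is_str_MM: "is_str MM" by (auto simp: is_str_def MM_def)

lemma tval_MM: "tval MM e0 t = rep t"
proof (induction t)
 case (Add s t)
 then show ?case using eqv_bin[of Add s "rep s" t "rep t"] eqv_rep by (simp add: MM_def rep_eq eqv_sym)
next
 case (Mul s t)
 then show ?case using eqv_bin[of Mul s "rep s" t "rep t"] eqv_rep by (simp add: MM_def rep_eq eqv_sym)
qed (auto simp: MM_def)

text \<open>The witness property is applied to the negation of \<open>AllN z ?\<theta>\<close>. The
  refutable conclusion of \<open>?\<theta>\<close> mentions \<chi> only in order to force the
  witness to avoid all variables of \<chi>.\<close>

lemma name_ex: "EX y. y ~: allN \<chi> & rep t = rep (Var y)"
proof -
 obtain z where z: "z ~: vars_trm t" "z ~: allN \<chi>" using fresh_ex[of "allN \<chi>" t t] by auto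
 let ?\<theta> = "Imp (Eq t (Var z)) (Neg (Imp \<chi> \<chi>))"
 have zc: "z ~: fvN \<chi>" using z fvN_allN by blast
 have "AllN z ?\<theta> ~: \<Delta>"
 proof
  assume "AllN z ?\<theta> : \<Delta>"
  then have "substN z t ?\<theta> : \<Delta>" by (rule inst_in) (simp add: free_forN_triv zc)
  then have "Imp (Eq t t) (Neg (Imp \<chi> \<chi>)) : \<Delta>" using z zc by (simp add: subst_trm_id substN_id)
  then show False using thm_in[OF EqRefl, of t] Falsum_in by (simp add: Imp_in)
 qed
 then have "Neg (AllN z ?\<theta>) : \<Delta>" using max by blast
 then obtain y where y: "y ~: allN ?\<theta>" "Neg (substN z (Var y) ?\<theta>) : \<Delta>" using witN by blast
 then have "eqv t (Var y)" using Falsum_in z by (simp add: Imp_in eqv_def subst_trm_id)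
 then show ?thesis using y rep_eq by auto
qed

text \<open>The language has no equality of sets, so the witness is only coextensional with
  \<open>X\<close>; in the model this amounts to equality.\<close>

lemma nameS_ex: "EX Y. Y ~: allS \<chi> & setof X = setof Y"
proof -
 obtain Z where z: "Z ~= X" "Z ~: allS \<chi>" using ex_new_if_finite[of "insert X (allS \<chi>)"] by auto
 let ?i = "%Z. AllN 0 (Iff (Mem (Var 0) X) (Mem (Var 0) Z))"
 let ?\<theta> = "Imp (?i Z) (Neg (Imp \<chi> \<chi>))"
 have zc: "Z ~: fvS \<chi>" using z fvS_allS by blast
 have "T \<turnstile> ?i X"
 proof (rule GenN)
  let ?m = "Mem (Var 0) X"
  have "drv T {} (Iff ?m ?m)"
  proof (rule drv_ded)
   have "drv T {Imp (Imp ?m ?m) (Neg (Imp ?m ?m))} (Neg (Imp ?m ?m))"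
    by (rule drv.mp[OF drv.hyp drv.thmI[OF proves_refl]]) simp
   then show "drv T {Imp (Imp ?m ?m) (Neg (Imp ?m ?m))} Falsum"
    by (rule drv.mp[OF _ drv.thmI[OF proves_refl]])
  qed
  moreover have "drv T {} \<chi> ==> T \<turnstile> \<chi>" for \<chi>
   by (induction rule: drv.induct) (auto intro: MP)
  ultimately show "T \<turnstile> Iff ?m ?m" by blast
 qed
 then have iX: "?i X : \<Delta>" by (rule thm_in)
 have "AllS Z ?\<theta> ~: \<Delta>"
 proof
  assume "AllS Z ?\<theta> : \<Delta>"
  then have "substS Z X ?\<theta> : \<Delta>" by (rule instS_in) (simp add: free_forS_triv zc)
  then have "Imp (?i X) (Neg (Imp \<chi> \<chi>)) : \<Delta>" using z zc by (simp add: substS_id)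
  then show False using iX Falsum_in by (simp add: Imp_in)
 qed
 then have "Neg (AllS Z ?\<theta>) : \<Delta>" using max by blast
 then obtain Y where y: "Y ~: allS ?\<theta>" "Neg (substS Z Y ?\<theta>) : \<Delta>" using witS by blast
 then have iY: "?i Y : \<Delta>" using Falsum_in z by (auto simp: Imp_in)
 have "Mem t X : \<Delta> <-> Mem t Y : \<Delta>" for t
  using inst_in[OF iY, of t] Falsum_in by (auto simp: Imp_in)
 then show ?thesis using y by (auto simp: setof_def)
qed

theorem truth: "sat MM e0 setof \<phi> <-> \<phi> : \<Delta>"
proof (induction "fsize \<phi>" arbitrary: \<phi> rule: less_induct)
 case less
 show ?case
 proof (cases \<phi>)
  case Falsum
  then show ?thesis by (simp add: Falsum_in)
 next
  case (Eq s t)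
  then show ?thesis by (simp add: tval_MM rep_eq eqv_def)
 next
  case (Less s t)
  then show ?thesis
   using eqv_Less[of s "rep s" t "rep t"] eqv_Less[of "rep s" s "rep t" t] eqv_rep eqv_sym[OF eqv_rep]
   by (auto simp: tval_MM) (auto simp: MM_def)
 next
  case (Mem t X)
  then show ?thesis by (simp add: tval_MM rep_setof)
 next
  case (Imp \<psi> \<chi>)
  then show ?thesis using less[of \<psi>] less[of \<chi>] by (simp add: Imp_in)
 next
  case (AllN x \<chi>)
  have IH: "sat MM (e0(x := rep (Var y))) setof \<chi> <-> substN x (Var y) \<chi> : \<Delta>" if "y ~: allN \<chi>" for y
   using less[of "substN x (Var y) \<chi>"] sat_substN[OF free_forN_fresh[OF that], of MM e0 setof x] AllN
   by simp
  have "sat MM e0 setof \<phi> <-> (ALL t. sat MM (e0(x := rep t)) setof \<chi>)"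
   unfolding AllN sat.simps by (simp add: MM_def)
  \<comment> \<open>Every element is named by a variable that is fresh for \<chi>, and for such
    variables substitution is capture free, so that the induction hypothesis applies.\<close>
  also have "\<dots> <-> (ALL y. y ~: allN \<chi> --> substN x (Var y) \<chi> : \<Delta>)"
   using IH name_ex[of \<chi>] by metis
  also have "\<dots> <-> AllN x \<chi> : \<Delta>"
   using inst_in[of x \<chi>] free_forN_fresh[of _ \<chi> x] witN[of x \<chi>] max[of "AllN x \<chi>"] Falsum_in mp_in by blast
  finally show ?thesis using AllN by simp
 next
  case (AllS x \<chi>)
  have IH: "sat MM e0 (setof(x := setof y)) \<chi> <-> substS x y \<chi> : \<Delta>" if "y ~: allS \<chi>" for y
   using less[of "substS x y \<chi>"] sat_substS[OF free_forS_fresh[OF that], of MM e0 setof x] AllS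
   by simp
  have "sat MM e0 setof \<phi> <-> (ALL t. sat MM e0 (setof(x := setof t)) \<chi>)"
   unfolding AllS sat.simps by (simp add: MM_def)
  also have "\<dots> <-> (ALL y. y ~: allS \<chi> --> substS x y \<chi> : \<Delta>)"
   using IH nameS_ex[of \<chi>] by metis
  also have "\<dots> <-> AllS x \<chi> : \<Delta>"
   using instS_in[of x \<chi>] free_forS_fresh[of _ \<chi> x] witS[of x \<chi>] max[of "AllS x \<chi>"] Falsum_in mp_in by blast
  finally show ?thesis using AllS by simp
 qed
qed

lemma sat_foldr_AllN:
 "sat M e E (foldr AllN xs \<phi>) ==> (!!x. x ~: set xs ==> e' x = e x) ==> (!!x. e' x : Dom M) ==> sat M e' E \<phi>"
proof (induction xs arbitrary: e)
 case Nil
 then have "e' = e" by auto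
 then show ?case using Nil by simp
next
 case (Cons x xs)
 have "sat M (e(x := e' x)) E (foldr AllN xs \<phi>)"
  using Cons.prems(1,3) by (simp only: foldr.simps sat.simps comp_apply)
 from Cons.IH[OF this] show ?case using Cons.prems(2,3) by auto
qed

lemma sat_foldr_AllS:
 "sat M e E (foldr AllS xs \<phi>) ==> (!!x. x ~: set xs ==> E' x = E x) ==> (!!x. E' x : Ss M) ==> sat M e E' \<phi>"
proof (induction xs arbitrary: E)
 case Nil
 then have "E' = E" by auto
 then show ?case using Nil by simp
next
 case (Cons x xs)
 have "sat M e (E(x := E' x)) (foldr AllS xs \<phi>)"
  using Cons.prems(1,3) by (simp only: foldr.simps sat.simps comp_apply)
 from Cons.IH[OF this] show ?case using Cons.prems(2,3) by auto
qed

lemma valid_MM: assumes "T \<turnstile> \<phi>" shows "valid MM \<phi>"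
 unfolding valid_def
proof (intro allI impI)
 fix e :: "nat => trm" and E :: "nat => trm set" assume e: "ALL x. e x : Dom MM" and E: "ALL X. E X : Ss MM"
 obtain xs Xs where xs: "set xs = fvN \<phi>" "set Xs = fvS \<phi>"
  using finite_list[of "fvN \<phi>"] finite_list[of "fvS \<phi>"] finite_subset[OF fvN_allN finite_allN]
   finite_subset[OF fvS_allS finite_allS] by metis
 have a: "T \<turnstile> foldr AllN ys (foldr AllS Ys \<phi>)" for ys Ys
 proof (induction ys)
  case Nil
  show ?case by (induction Ys) (auto intro: GenS assms)
 qed (auto intro: GenN)
 \<comment> \<open>Outside the free variables of the formula the canonical assignment is kept,
   because the closure quantifies only over those.\<close>
 define e' where "e' = (%x. if x : fvN \<phi> then e x else e0 x)"
 define E' where "E' = (%x. if x : fvS \<phi> then E x else setof x)"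
 have "sat MM e0 setof (foldr AllN xs (foldr AllS Xs \<phi>))" using a truth thm_in by blast
 then have "sat MM e' setof (foldr AllS Xs \<phi>)"
  by (rule sat_foldr_AllN) (use e xs in \<open>auto simp: e'_def MM_def\<close>)
 then have "sat MM e' E' \<phi>"
  by (rule sat_foldr_AllS) (use E xs in \<open>auto simp: E'_def MM_def\<close>)
 then show "sat MM e E \<phi>" by (subst sat_cong[of _ e e' E E']) (auto simp: e'_def E'_def)
qed

end

theorem completeness:
 assumes "\<not> T \<turnstile> \<phi>"
 obtains M :: "trm mdl" and e E where "is_str M" "!!\<psi>. T \<turnstile> \<psi> ==> valid M \<psi>"
  "!!x. e x : Dom M" "!!X. E X : Ss M" "\<not> sat M e E \<phi>"
proof -
 have "drv T {} \<chi> ==> T \<turnstile> \<chi>" for \<chi>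
  by (induction rule: drv.induct) (auto intro: MP)
 then have "\<not> drv T {Neg \<phi>} Falsum" using drv_raa assms by blast
 then obtain \<Delta> where D: "{Neg \<phi>} <= \<Delta>" "henkin T \<Delta>" using henkin_extend[of "{Neg \<phi>}" T] by auto
 interpret henkin T \<Delta> by (rule D)
 have "\<not> sat MM e0 setof \<phi>" using truth D(1) Falsum_in mp_in by blast
 then show thesis using that[of MM e0 setof] is_str_MM valid_MM by (auto simp: MM_def)
qed

section \<open>Arithmetically definable predicates\<close>

text \<open>Arithmetical formulas with de Bruijn indices, so that no renaming of bound variables occurs.\<close>

datatype af = AFal | AEq trm trm | ALs trm trm | AMem trm nat | AImp af af | AAll af

primrec asat :: "('a, 'b) mdl_scheme => (nat => 'a set) => (nat => 'a) => af => bool" where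
 "asat M E e AFal <-> False"
| "asat M E e (AEq s t) <-> tval M e s = tval M e t"
| "asat M E e (ALs s t) <-> Ls M (tval M e s) (tval M e t)"
| "asat M E e (AMem t X) <-> tval M e t : E X"
| "asat M E e (AImp \<phi> \<psi>) <-> (asat M E e \<phi> --> asat M E e \<psi>)"
| "asat M E e (AAll \<phi>) <-> (ALL a:Dom M. asat M E (case_nat a e) \<phi>)"

primrec rent :: "(nat => nat) => trm => trm" where
 "rent f (Var x) = Var (f x)"
| "rent f \<^bold>0 = \<^bold>0"
| "rent f \<^bold>1 = \<^bold>1"
| "rent f (s \<^bold>+ t) = rent f s \<^bold>+ rent f t"
| "rent f (s \<^bold>* t) = rent f s \<^bold>* rent f t"

primrec renf :: "(nat => nat) => (nat => nat) => af => af" where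
 "renf f g AFal = AFal"
| "renf f g (AEq s t) = AEq (rent f s) (rent f t)"
| "renf f g (ALs s t) = ALs (rent f s) (rent f t)"
| "renf f g (AMem t X) = AMem (rent f t) (g X)"
| "renf f g (AImp \<phi> \<psi>) = AImp (renf f g \<phi>) (renf f g \<psi>)"
| "renf f g (AAll \<phi>) = AAll (renf (case_nat 0 (%n. Suc (f n))) g \<phi>)"

lemma tval_rent: "tval M e (rent f t) = tval M (%n. e (f n)) t"
 by (induction t) auto

lemma asat_renf: "asat M E e (renf f g \<phi>) = asat M (%n. E (g n)) (%n. e (f n)) \<phi>"
proof (induction \<phi> arbitrary: e f)
 case (AAll \<phi>)
 have "(%n. case_nat a e (case_nat 0 (%n. Suc (f n)) n)) = case_nat a (%n. e (f n))" for a
  by (rule ext) (simp split: nat.split)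
 then show ?case by (simp add: AAll)
qed (auto simp: tval_rent)

primrec afv :: "af => nat set" where
 "afv AFal = {}"
| "afv (AEq s t) = vars_trm s \<union> vars_trm t"
| "afv (ALs s t) = vars_trm s \<union> vars_trm t"
| "afv (AMem t X) = vars_trm t"
| "afv (AImp \<phi> \<psi>) = afv \<phi> \<union> afv \<psi>"
| "afv (AAll \<phi>) = {n. Suc n : afv \<phi>}"

primrec afs :: "af => nat set" where
 "afs AFal = {}"
| "afs (AEq s t) = {}"
| "afs (ALs s t) = {}"
| "afs (AMem t X) = {X}"
| "afs (AImp \<phi> \<psi>) = afs \<phi> \<union> afs \<psi>"
| "afs (AAll \<phi>) = afs \<phi>"

lemma finite_afv [simp]: "finite (afv \<phi>)"
proof (induction \<phi>)
 case (AAll \<phi>)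
 have "{n. Suc n : afv \<phi>} = Suc -` afv \<phi>" by auto
 then show ?case using AAll by (simp add: finite_vimageI)
qed auto
lemma finite_afs [simp]: "finite (afs \<phi>)" by (induction \<phi>) auto

lemma asat_cong: "(!!n. n : afv \<phi> ==> e n = e' n) ==> asat M E e \<phi> = asat M E e' \<phi>"
proof (induction \<phi> arbitrary: e e')
 case (AEq s t)
 then show ?case using tval_cong[of s e e' M] tval_cong[of t e e' M] by simp
next
 case (ALs s t)
 then show ?case using tval_cong[of s e e' M] tval_cong[of t e e' M] by simp
next
 case (AMem t X)
 then show ?case using tval_cong[of t e e' M] by simp
next
 case (AImp \<phi> \<psi>)
 have "asat M E e \<phi> = asat M E e' \<phi>" by (rule AImp.IH) (use AImp.prems in auto)
 moreover have "asat M E e \<psi> = asat M E e' \<psi>" by (rule AImp.IH) (use AImp.prems in auto)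
 ultimately show ?case by simp
next
 case (AAll \<phi>)
 have "asat M E (case_nat a e) \<phi> = asat M E (case_nat a e') \<phi>" for a
  by (rule AAll.IH) (use AAll.prems in \<open>auto split: nat.split\<close>)
 then show ?case by simp
qed simp

text \<open>Back to named variables: the next quantifier binds the name \<open>k\<close>, and
  \<open>v\<close> sends the free indices to names below \<open>k\<close>.\<close>

primrec tr :: "(nat => nat) => nat => af => fm" where
 "tr v k AFal = Falsum"
| "tr v k (AEq s t) = Eq (rent v s) (rent v t)"
| "tr v k (ALs s t) = Less (rent v s) (rent v t)"
| "tr v k (AMem t X) = Mem (rent v t) X"
| "tr v k (AImp \<phi> \<psi>) = Imp (tr v k \<phi>) (tr v k \<psi>)"
| "tr v k (AAll \<phi>) = AllN k (tr (case_nat k v) (Suc k) \<phi>)"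

lemma arithmetical_tr: "arithmetical (tr v k \<phi>)" by (induction \<phi> arbitrary: v k) auto
lemma fvS_tr: "fvS (tr v k \<phi>) = afs \<phi>" by (induction \<phi> arbitrary: v k) auto

lemma sat_tr: "(!!n. n : afv \<phi> ==> v n < k) ==> sat M e E (tr v k \<phi>) = asat M E (%n. e (v n)) \<phi>"
proof (induction \<phi> arbitrary: e v k)
 case (AAll \<phi>)
 have "sat M (e(k := a)) E (tr (case_nat k v) (Suc k) \<phi>) = asat M E (case_nat a (%n. e (v n))) \<phi>" for a
 proof -
  have lt: "v n < k" if "Suc n : afv \<phi>" for n using AAll.prems that by auto
  have "sat M (e(k := a)) E (tr (case_nat k v) (Suc k) \<phi>) =
    asat M E (%n. (e(k := a)) (case_nat k v n)) \<phi>"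
   by (rule AAll.IH) (auto split: nat.split intro: less_SucI lt)
  also have "\<dots> = asat M E (case_nat a (%n. e (v n))) \<phi>"
   by (rule asat_cong) (use lt in \<open>auto split: nat.split dest: less_imp_neq\<close>)
  finally show ?thesis .
 qed
 then show ?case by simp
qed (auto simp: tval_rent)

text \<open>Arguments sit at even positions and parameters at odd ones. Thus one environment has
  room for any number of both, and parameter lists can be merged without moving the
  arguments.\<close>

definition mix :: "(nat => 'a) => (nat => 'a) => nat => 'a" where
 "mix e p n = (if even n then e (n div 2) else p (n div 2))"

text \<open>Definability as a property of predicates on environments rather than of formulas. Its
  closure properties then establish definability by following the shape of a HOL expression.\<close>

definition ar :: "('a, 'b) mdl_scheme => 'a set set => ((nat => 'a) => bool) => bool" where
 "ar M \<A> P <-> (\<exists>\<phi> E p. (ALL i. E i : \<A>) & (ALL i. p i : Dom M) &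
  (ALL e. (ALL i. e i : Dom M) --> P e = asat M E (mix e p) \<phi>))"

lemma arI: "(!!i. E i : \<A>) ==> (!!i. p i : Dom M) ==>
  (!!e. (!!i. e i : Dom M) ==> P e = asat M E (mix e p) \<phi>) ==> ar M \<A> P"
 unfolding ar_def by blast

lemma ar_cong: "(!!e. (!!i. e i : Dom M) ==> P e = Q e) ==> ar M \<A> Q ==> ar M \<A> P"
 unfolding ar_def by simp

lemma ar_imp: assumes "ar M \<A> P" "ar M \<A> Q" shows "ar M \<A> (%e. P e --> Q e)"
proof -
 obtain \<phi> E p where 1: "!!i. E i : \<A>" "!!i. p i : Dom M"
  "!!e. (!!i. e i : Dom M) ==> P e = asat M E (mix e p) \<phi>" using assms(1) unfolding ar_def by blast
 obtain \<psi> F q where 2: "!!i. F i : \<A>" "!!i. q i : Dom M"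
  "!!e. (!!i. e i : Dom M) ==> Q e = asat M F (mix e q) \<psi>" using assms(2) unfolding ar_def by blast
 \<comment> \<open>The merged parameter list is \<open>mix p q\<close>: entry \<open>m\<close> of
   \<open>p\<close> lands at position \<open>4 * m + 1\<close> and entry \<open>m\<close> of
   \<open>q\<close> at \<open>4 * m + 3\<close>.\<close>
 let ?f = "%n. if even n then n else 4 * (n div 2) + 1"
 let ?g = "%n. if even n then n else 4 * (n div 2) + 3"
 have d: "(4 * m + 3) div 2 = 2 * m + 1" "(4 * m + 1) div 2 = 2 * m" for m :: nat by presburger+
 have o: "(n - Suc 0) div 2 = n div 2" if "odd n" for n :: nat using that by presburger
 have f: "(%n. mix e (mix p q) (?f n)) = mix e p" for e by (rule ext) (auto simp: mix_def d o)
 have g: "(%n. mix e (mix p q) (?g n)) = mix e q" for e by (rule ext) (auto simp: mix_def d o)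
 have ef: "(%n. mix E F (2 * n)) = E" "(%n. mix E F (2 * n + 1)) = F" by (auto simp: mix_def)
 show ?thesis
  by (rule arI[of "mix E F" _ "mix p q" M _ "AImp (renf ?f (%n. 2 * n) \<phi>) (renf ?g (%n. 2 * n + 1) \<psi>)"])
   (use 1 2 in \<open>simp_all add: asat_renf f g ef ef[unfolded One_nat_def Suc_eq_plus1[symmetric]] mix_def[of E F i for i] mix_def[of p q i for i] del: One_nat_def\<close>)
qed

lemma ar_False: assumes "A : \<A>" "a : Dom M" shows "ar M \<A> (%e. False)"
 by (rule arI[of "%_. A" _ "%_. a" _ _ AFal]) (use assms in auto)

lemma ar_all: assumes "ar M \<A> (%e. Q (e 0) (%n. e (Suc n)))" shows "ar M \<A> (%e. ALL a:Dom M. Q a e)"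
proof -
 obtain \<phi> E p where 1: "!!i. E i : \<A>" "!!i. p i : Dom M"
  "!!e. (!!i. e i : Dom M) ==> Q (e 0) (%n. e (Suc n)) = asat M E (mix e p) \<phi>"
  using assms unfolding ar_def by blast
 \<comment> \<open>The bound variable is put in front of the interleaved list, whereas the
   hypothesis expects it in front of the arguments only. The renaming moves the other arguments down
   by one position and the parameters up by one.\<close>
 let ?f = "%n. if n = 0 then 0 else if even n then n - 1 else Suc n"
 have f: "(%n. case_nat a (mix e p) (?f n)) = mix (case_nat a e) p" for e a
 proof
  fix n
  show "case_nat a (mix e p) (?f n) = mix (case_nat a e) p n"
  proof (cases "even n")
   case True
   then obtain m where m: "n = 2 * m" by blast
   show ?thesis unfolding m by (cases m) (simp_all add: mix_def)
  next
   case False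
   then obtain m where m: "n = 2 * m + 1" by (blast elim: oddE)
   show ?thesis unfolding m by (simp add: mix_def)
  qed
 qed
 have "Q a e = asat M E (mix (case_nat a e) p) \<phi>" if "!!i. e i : Dom M" "a : Dom M" for a e
 proof -
  have "!!i. case_nat a e i : Dom M" using that by (simp split: nat.split)
  then show ?thesis using 1(3)[of "case_nat a e"] by simp
 qed
 then show ?thesis
  by (intro arI[of E _ p M _ "AAll (renf ?f id \<phi>)"]) (use 1 in \<open>auto simp: asat_renf f\<close>)
qed

locale defn =
 fixes M :: "'a mdl" and \<A> :: "'a set set"
 assumes str: "is_str M" and ne: "\<A> ~= {}"
begin

abbreviation "D \<equiv> Dom M"

lemma ops [simp]: "Ze M : D" "On M : D" "a : D ==> b : D ==> Ad M a b : D"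
 "a : D ==> b : D ==> Mu M a b : D"
 using str by (auto simp: is_str_def)

lemma ar_fal: "ar M \<A> (%e. False)" proof -
 obtain A where "A : \<A>" using ne by auto
 then show ?thesis using ops(1) by (rule ar_False)
qed
lemma ar_not: assumes "ar M \<A> P" shows "ar M \<A> (%e. \<not> P e)"
 by (rule ar_cong[OF _ ar_imp[OF assms ar_fal]]) simp
lemma ar_tru: "ar M \<A> (%e. True)" using ar_not[OF ar_fal] by simp
lemma ar_or: assumes "ar M \<A> P" "ar M \<A> Q" shows "ar M \<A> (%e. P e \<or> Q e)"
 by (rule ar_cong[OF _ ar_imp[OF ar_not[OF assms(1)] assms(2)]]) (simp add: disj_imp)
lemma ar_and: assumes "ar M \<A> P" "ar M \<A> Q" shows "ar M \<A> (%e. P e & Q e)"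
 by (rule ar_cong[OF _ ar_not[OF ar_imp[OF assms(1) ar_not[OF assms(2)]]]]) simp
lemma ar_iff: assumes "ar M \<A> P" "ar M \<A> Q" shows "ar M \<A> (%e. P e = Q e)"
 by (rule ar_cong[OF _ ar_and[OF ar_imp[OF assms] ar_imp[OF assms(2,1)]]]) (simp add: iff_conv_conj_imp)
lemma ar_ex: assumes "ar M \<A> (%e. Q (e 0) (%n. e (Suc n)))" shows "ar M \<A> (%e. EX a:D. Q a e)"
 by (rule ar_cong[OF _ ar_not[OF ar_all[of _ _ "%a e. \<not> Q a e", OF ar_not[OF assms]]]]) simp
lemma ar_const: "ar M \<A> (%e. c)"
 using ar_fal ar_tru by (cases c) simp_all

text \<open>A function counts as definable if its graph is: position 0 holds the value and the
  arguments are shifted by one. It need not be given by a term of the language.\<close>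

definition tm :: "((nat => 'a) => 'a) => bool" where
 "tm f <-> (ALL e. (ALL i. e i : D) --> f e : D) & ar M \<A> (%e. e 0 = f (%n. e (Suc n)))"

text \<open>The function is eliminated by an existential quantifier over its value.\<close>

lemma ar_sub:
 assumes "tm f" "ar M \<A> (%e. Q (e 0) (%n. e (Suc n)))" shows "ar M \<A> (%e. Q (f e) e)"
proof (rule ar_cong)
 show "ar M \<A> (%e. EX a:D. a = f e & Q a e)"
  by (rule ar_ex, rule ar_and) (use assms in \<open>auto simp: tm_def\<close>)
qed (use assms in \<open>auto simp: tm_def\<close>)

lemma ar_atom0: "ar M \<A> (%e. tval M e s = tval M e t)" "ar M \<A> (%e. Ls M (tval M e s) (tval M e t))"
proof -
 obtain A where "A : \<A>" using ne by auto
 moreover have "(%n. mix e p (2 * n)) = e" for e p :: "nat => 'a" by (auto simp: mix_def)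
 ultimately show "ar M \<A> (%e. tval M e s = tval M e t)" "ar M \<A> (%e. Ls M (tval M e s) (tval M e t))"
  by (intro arI[of "%_. A" _ "%_. Ze M" _ _ "renf (%n. 2 * n) id (AEq s t)"]
   arI[of "%_. A" _ "%_. Ze M" _ _ "renf (%n. 2 * n) id (ALs s t)"]; simp add: tval_rent)+
qed

lemma tm_var: "tm (%e. e k)"
 using ar_atom0(1)[of "Var 0" "Var (Suc k)"] by (simp add: tm_def)

lemma tm_const: assumes "a : D" shows "tm (%e. a)"
proof -
 obtain A where "A : \<A>" using ne by auto
 then have "ar M \<A> (%e. e 0 = a)"
  by (intro arI[of "%_. A" _ "%_. a" _ _ "AEq (Var 0) (Var 1)"]) (auto simp: mix_def assms)
 then show ?thesis using assms by (simp add: tm_def)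
qed

lemma ar_mem: assumes "tm f" "A : \<A>" shows "ar M \<A> (%e. f e : A)"
proof (rule ar_sub[OF assms(1)])
 show "ar M \<A> (%e. e 0 : A)"
  by (intro arI[of "%_. A" _ "%_. Ze M" _ _ "AMem (Var 0) 0"]) (auto simp: mix_def assms)
qed

lemma tm_shift: assumes "tm f" shows "tm (%e. f (%n. e (g n)))"
proof -
 obtain \<phi> E p where 1: "!!i. E i : \<A>" "!!i. p i : D"
  "!!e. (!!i. e i : D) ==> (e 0 = f (%n. e (Suc n))) = asat M E (mix e p) \<phi>"
  using assms unfolding tm_def ar_def by blast
 let ?g = "case_nat 0 (%n. Suc (g n))"
 let ?h = "%n. if even n then 2 * ?g (n div 2) else n"
 have h: "(%n. mix e p (?h n)) = mix (%n. e (?g n)) p" for e by (rule ext) (auto simp: mix_def)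
 have "ar M \<A> (%e. e 0 = f (%n. e (Suc (g n))))"
 proof (rule arI[of E \<A> p M _ "renf ?h id \<phi>"])
  fix e assume "!!i::nat. e i : D"
  then show "(e 0 = f (%n. e (Suc (g n)))) = asat M E (mix e p) (renf ?h id \<phi>)"
   using 1(3)[of "%n. e (?g n)"] by (simp add: asat_renf h)
 qed (use 1 in auto)
 then show ?thesis using assms by (simp add: tm_def)
qed

lemma ar_eq: "tm f ==> tm g ==> ar M \<A> (%e. f e = g e)"
 by (rule ar_sub[of f "%a e. a = g e"], assumption, rule ar_sub[OF tm_shift[of g Suc]], assumption)
  (use ar_atom0(1)[of "Var 1" "Var 0"] in simp)

lemma ar_ls: "tm f ==> tm g ==> ar M \<A> (%e. Ls M (f e) (g e))"
 by (rule ar_sub[of f "%a e. Ls M a (g e)"], assumption, rule ar_sub[OF tm_shift[of g Suc]], assumption)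
  (use ar_atom0(2)[of "Var 1" "Var 0"] in simp)

lemma tm_op2:
 assumes "ar M \<A> (%e. e 0 = h (e 1) (e 2))" "!!a b. a : D ==> b : D ==> h a b : D" "tm f" "tm g"
 shows "tm (%e. h (f e) (g e))"
proof -
 have "ar M \<A> (%e. e 0 = h (f (%n. e (Suc n))) (g (%n. e (Suc n))))"
 proof (rule ar_sub[OF tm_shift[OF assms(3), of Suc], of "%a e. e 0 = h a (g (%n. e (Suc n)))"],
   rule ar_sub[OF tm_shift[OF assms(4), of "%n. Suc (Suc n)"], of "%b e. e 1 = h (e 0) b", simplified])
  obtain \<phi> E p where 1: "!!i. E i : \<A>" "!!i. p i : D"
   "!!e. (!!i. e i : D) ==> (e 0 = h (e 1) (e 2)) = asat M E (mix e p) \<phi>"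
   using assms(1) unfolding ar_def by blast
  let ?g = "%n. if n = 0 then 2 else if n = 1 then 1 else (0::nat)"
  let ?h = "%n. if even n then 2 * ?g (n div 2) else n"
  have h: "(%n. mix e p (?h n)) = mix (%n. e (?g n)) p" for e by (rule ext) (auto simp: mix_def)
  show "ar M \<A> (%e. e (Suc (Suc 0)) = h (e (Suc 0)) (e 0))"
  proof (rule arI[of E \<A> p M _ "renf ?h id \<phi>"])
   fix e assume "!!i::nat. e i : D"
   then show "(e (Suc (Suc 0)) = h (e (Suc 0)) (e 0)) = asat M E (mix e p) (renf ?h id \<phi>)"
    unfolding asat_renf id_apply h using 1(3)[of "%n. e (?g n)"] by (simp add: numeral_2_eq_2)
  qed (use 1 in auto)
 qed
 then show ?thesis using assms by (auto simp: tm_def)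
qed

lemma tm_add: "tm f ==> tm g ==> tm (%e. Ad M (f e) (g e))"
 by (rule tm_op2[of "Ad M"]) (use ar_atom0(1)[of "Var 0" "Add (Var 1) (Var 2)"] in auto)
lemma tm_mul: "tm f ==> tm g ==> tm (%e. Mu M (f e) (g e))"
 by (rule tm_op2[of "Mu M"]) (use ar_atom0(1)[of "Var 0" "Mul (Var 1) (Var 2)"] in auto)

end

section \<open>A generic model of ACA0\<close>

definition std :: "'a set set => ('a::{zero, one, plus, times, ord}) mdl" where
 "std \<S> = \<lparr>Dom = UNIV, Ze = 0, On = 1, Ad = (+), Mu = (*), Ls = (<), Ss = \<S>\<rparr>"

lemma std_simps [simp]: "Dom (std \<S>) = UNIV" "Ze (std \<S>) = 0" "On (std \<S>) = 1" "Ad (std \<S>) = (+)"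
 "Mu (std \<S>) = (*)" "Ls (std \<S>) = (<)" "Ss (std \<S>) = \<S>"
 by (simp_all add: std_def)

lemma ACA0_cases:
 assumes "\<phi> : ACA0"
 obtains "\<phi> : basic_axioms" | "\<phi> = induction_axiom" | "\<phi> : arithmetical_comprehension"
 using assms by (auto simp: ACA0_def)

lemma valid_comprehension:
 assumes "!!\<phi> x e E. arithmetical \<phi> ==> (!!y. e y : Dom M) ==> (!!X. E X : Ss M) ==>
  EX A:Ss M. ALL a:Dom M. a : A <-> sat M (e(x := a)) E \<phi>"
  and "\<psi> : arithmetical_comprehension"
 shows "valid (M :: 'a mdl) \<psi>"
proof -
 obtain X x \<phi> where \<psi>: "\<psi> = ExS X (AllN x (Iff (Mem (Var x) X) \<phi>))" "arithmetical \<phi>" "X ~: fvS \<phi>"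
  using assms(2) unfolding arithmetical_comprehension_def by blast
 show ?thesis
  unfolding valid_def
 proof (intro allI impI)
  fix e :: "nat => 'a" and E :: "nat => 'a set" assume e: "ALL y. e y : Dom M" "ALL X. E X : Ss M"
  then obtain A where A: "A : Ss M" "ALL a:Dom M. a : A <-> sat M (e(x := a)) E \<phi>"
   using assms(1)[OF \<psi>(2), of e E x] by blast
  then have "sat M e (E(X := A)) (AllN x (Iff (Mem (Var x) X) \<phi>))"
   by (simp add: sat_updS[OF \<psi>(3)])
  then show "sat M e E \<psi>" unfolding \<psi>(1) using A(1) by (simp only: sat.simps) blast
 qed
qed

text \<open>The standard model shows that ACA0 is consistent; hence a model exists from which
  \<open>M0\<close> can be chosen.\<close>

lemma valid_ACA0_nat: assumes "\<phi> : ACA0" shows "valid (std (UNIV :: nat set set)) \<phi>"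
 using assms
proof (cases rule: ACA0_cases)
 case 2
 show ?thesis
  unfolding 2 valid_def
 proof (intro allI impI)
  fix e :: "nat => nat" and E :: "nat => nat set"
  have A: "0 : E 0 & (ALL a. a : E 0 --> a + 1 : E 0) --> (ALL n. n : E 0)"
   unfolding Suc_eq_plus1[symmetric] using nat_induct[of "%n. n : E 0"] by blast
  have *: "(((P --> Q --> False) --> False) --> R) = (P & Q --> R)" for P Q R by blast
  have B: "sat (std (UNIV :: nat set set)) e E induction_axiom <->
    (0 : E 0 & (ALL a. a : E 0 --> a + 1 : E 0) --> (ALL n. n : E 0))"
   by (simp only: induction_axiom_def sat.simps tval.simps std_simps fun_upd_same ball_UNIV *)
  from B A show "sat (std (UNIV :: nat set set)) e E induction_axiom" by (rule iffD2)
 qed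
next
 case 3
 show ?thesis
 proof (rule valid_comprehension[OF _ 3])
  fix \<phi> x e E
  show "EX A:Ss (std UNIV). ALL a:Dom (std (UNIV :: nat set set)). a : A <-> sat (std UNIV) (e(x := a)) E \<phi>"
   by (rule bexI[of _ "{a. sat (std UNIV) (e(x := a)) E \<phi>}"]) simp_all
 qed
qed (auto simp: basic_axioms_def valid_def Let_def)

text \<open>Included among the targets so that it becomes a theorem of ACA0. Soundness then makes it
  available in the model of the unprovability half.\<close>

definition upgrade_unique :: fm where
 "upgrade_unique = sentence (\<^bold>\<forall>\<^sub>s X. \<^bold>\<forall>c i n v w. dynamical_hierarchy X \<^bold>\<and> slow_start X c \<^bold>\<and>
  is_upgrade (slice X i) (slice X (i \<^bold>+ \<^bold>1)) n v \<^bold>\<and> is_upgrade (slice X i) (slice X (i \<^bold>+ \<^bold>1)) n w \<^bold>\<longrightarrow> v \<^bold>= w)"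

definition targets :: "fm set" where
 "targets = insert upgrade_unique {sentence (goodstein_terminates (num c)) | c. 2 <= c}"

definition aca_mdl :: "'a mdl => bool" where
 "aca_mdl M <-> is_str M & (\<forall>\<phi>\<in>ACA0. valid M \<phi>)"

text \<open>A countermodel to one of the targets if there is one. Fixing it once and for all makes its
 domain available as a type.\<close>

definition M0 :: "trm mdl" where
 "M0 = (SOME M. aca_mdl M & ((\<exists>M :: trm mdl. aca_mdl M & \<not> (\<forall>\<phi>\<in>targets. valid M \<phi>)) --> \<not> (\<forall>\<phi>\<in>targets. valid M \<phi>)))"

lemma aca_mdl_ex: "\<exists>M :: trm mdl. aca_mdl M"
proof -
 have "\<not> ACA0 \<turnstile> Falsum"
 proof
  assume "ACA0 \<turnstile> Falsum"
  then have "valid (std (UNIV :: nat set set)) Falsum"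
   by (rule soundness) (auto simp: is_str_def valid_ACA0_nat)
  then show False by (auto simp: valid_def)
 qed
 then show ?thesis by (rule completeness) (auto simp: aca_mdl_def intro: Ax)
qed

lemma M0: "aca_mdl M0"
 and M0_targets: "valid M0 ` targets <= {True} ==> aca_mdl (M :: trm mdl) ==> \<phi> : targets ==> valid M \<phi>"
proof -
 let ?bad = "%M :: trm mdl. \<not> (\<forall>\<phi>\<in>targets. valid M \<phi>)"
 have "\<exists>M :: trm mdl. aca_mdl M & ((\<exists>M :: trm mdl. aca_mdl M & ?bad M) --> ?bad M)"
  using aca_mdl_ex by (cases "\<exists>M :: trm mdl. aca_mdl M & ?bad M") auto
 from someI_ex[OF this] have *: "aca_mdl M0 & ((\<exists>M :: trm mdl. aca_mdl M & ?bad M) --> ?bad M0)"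
  unfolding M0_def .
 then show "aca_mdl M0" by simp
 show "valid M0 ` targets <= {True} ==> aca_mdl (M :: trm mdl) ==> \<phi> : targets ==> valid M \<phi>"
  using * by auto
qed

lemma targets_provable:
 assumes "!!\<phi>. \<phi> : targets ==> valid M0 \<phi>" "\<phi> : targets" shows "ACA0 \<turnstile> \<phi>"
proof (rule ccontr)
 assume "\<not> ACA0 \<turnstile> \<phi>"
 then obtain M :: "trm mdl" and e E where M: "is_str M" "!!\<psi>. ACA0 \<turnstile> \<psi> ==> valid M \<psi>"
  "!!x. e x : Dom M" "!!X. E X : Ss M" "\<not> sat M e E \<phi>" by (rule completeness) blast
 then have "valid M \<phi>" using M0_targets[of M \<phi>] assms by (auto simp: aca_mdl_def intro: Ax)
 then show False using M by (auto simp: valid_def)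
qed

typedef mnum = "Dom M0"
 using M0 by (auto simp: aca_mdl_def is_str_def)

definition SS :: "mnum set set" where "SS = (%A. {x. Rep_mnum x : A}) ` Ss M0"

lemma M0_ops: "Ze M0 : Dom M0" "On M0 : Dom M0" "a : Dom M0 ==> b : Dom M0 ==> Ad M0 a b : Dom M0"
 "a : Dom M0 ==> b : Dom M0 ==> Mu M0 a b : Dom M0"
 using M0 by (auto simp: aca_mdl_def is_str_def)

instantiation mnum :: "{zero, one, plus, times, ord}"
begin
definition "0 = Abs_mnum (Ze M0)"
definition "1 = Abs_mnum (On M0)"
definition "a + b = Abs_mnum (Ad M0 (Rep_mnum a) (Rep_mnum b))"
definition "a * b = Abs_mnum (Mu M0 (Rep_mnum a) (Rep_mnum b))"
definition "a < b <-> Ls M0 (Rep_mnum a) (Rep_mnum b)"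
definition "(a :: mnum) <= b <-> a < b \<or> a = b"
instance ..
end

abbreviation "MS \<equiv> std SS"

lemma tval_mnum: "Rep_mnum (tval MS e t) = tval M0 (%x. Rep_mnum (e x)) t"
proof (induction t)
 case (Add s t)
 then show ?case by (simp add: plus_mnum_def Abs_mnum_inverse M0_ops(3) Rep_mnum flip: Add)
next
 case (Mul s t)
 then show ?case by (simp add: times_mnum_def Abs_mnum_inverse M0_ops(4) Rep_mnum flip: Mul)
qed (simp_all add: zero_mnum_def one_mnum_def Abs_mnum_inverse M0_ops)

lemma sat_mnum:
 "sat MS e (%X. {x. Rep_mnum x : E X}) \<phi> = sat M0 (%x. Rep_mnum (e x)) E \<phi>"
proof (induction \<phi> arbitrary: e E)
 case (AllN x \<phi>)
 have "(%y. Rep_mnum ((e(x := a)) y)) = (%y. Rep_mnum (e y))(x := Rep_mnum a)" for a by auto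
 then have "sat MS (e(x := a)) (%X. {x. Rep_mnum x : E X}) \<phi> =
   sat M0 ((%y. Rep_mnum (e y))(x := Rep_mnum a)) E \<phi>" for a
  using AllN[of "e(x := a)" E] by (simp only:)
 then show ?case unfolding sat.simps std_simps
  by (metis Abs_mnum_inverse Rep_mnum UNIV_I)
next
 case (AllS Y \<phi>)
 have "(%X. {x. Rep_mnum x : E X})(Y := {x. Rep_mnum x : A}) = (%X. {x. Rep_mnum x : (E(Y := A)) X})" for A
  by (rule ext) simp
 moreover have "(ALL A:SS. Q A) = (ALL A:Ss M0. Q {x. Rep_mnum x : A})" for Q by (auto simp: SS_def)
 ultimately show ?case unfolding sat.simps std_simps by (simp only: AllS)
qed (auto simp: tval_mnum[symmetric] Rep_mnum_inject less_mnum_def)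

lemma valid_mnum: "valid MS \<phi> <-> valid M0 \<phi>"
proof
 assume v: "valid MS \<phi>"
 show "valid M0 \<phi>"
  unfolding valid_def
 proof (intro allI impI)
  fix e :: "nat => trm" and E :: "nat => trm set" assume e: "ALL x. e x : Dom M0" and E: "ALL X. E X : Ss M0"
  have "sat MS (%x. Abs_mnum (e x)) (%X. {x. Rep_mnum x : E X}) \<phi>"
   using v E by (auto simp: valid_def SS_def)
  then show "sat M0 e E \<phi>" using e by (simp add: sat_mnum Abs_mnum_inverse)
 qed
next
 assume v: "valid M0 \<phi>"
 show "valid MS \<phi>"
  unfolding valid_def
 proof (intro allI impI)
  fix e :: "nat => mnum" and E :: "nat => mnum set" assume "ALL X. E X : Ss MS"
  then have "ALL X. EX A:Ss M0. E X = {x. Rep_mnum x : A}" by (auto simp: SS_def)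
  then obtain F where F: "!!X. F X : Ss M0" "!!X. E X = {x. Rep_mnum x : F X}" by metis
  then have "E = (%X. {x. Rep_mnum x : F X})" by auto
  then show "sat MS e E \<phi>" using v F(1) by (simp add: sat_mnum valid_def Rep_mnum)
 qed
qed

lemma SS_ne: "SS ~= {}" using M0 by (auto simp: SS_def aca_mdl_def is_str_def)

lemma valid_MS: "\<phi> : ACA0 ==> valid MS \<phi>" using M0 by (simp add: valid_mnum aca_mdl_def)

interpretation defn MS SS
 by standard (auto simp: is_str_def SS_ne)

abbreviation df :: "((nat => mnum) => bool) => bool" where "df \<equiv> ar MS SS"

lemma tm_zero: "tm (%e. 0)" and tm_one: "tm (%e. 1)" by (auto intro: tm_const)

lemma df_all: "df (%e. Q (e 0) (%n. e (Suc n))) ==> df (%e. ALL a. Q a e)"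
 using ar_all[of MS SS Q] by simp
lemma df_ex: "df (%e. Q (e 0) (%n. e (Suc n))) ==> df (%e. EX a. Q a e)"
 using ar_ex[of Q] by simp
lemma df_less: "tm f ==> tm g ==> df (%e. f e < g e)"
 using ar_ls by simp
lemma df_le: "tm f ==> tm g ==> df (%e. f e <= g e)"
 unfolding less_eq_mnum_def by (intro ar_or df_less ar_eq)
lemma tm_plus: "tm f ==> tm g ==> tm (%e. f e + g e)"
 using tm_add by simp
lemma tm_times: "tm f ==> tm g ==> tm (%e. f e * g e)"
 using tm_mul by simp
lemma tm_par: "tm (%e. a)" by (rule tm_const) simp

lemmas df_intros = ar_not ar_or ar_and ar_iff ar_imp df_ex df_all ar_eq df_less df_le ar_mem
 tm_plus tm_times tm_var tm_zero tm_one tm_par ar_const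

text \<open>The predicate is evaluated at the constant environment, so all its argument positions
  stand for the same element.\<close>

lemma comprehension: assumes "df P" shows "{a. P (%_. a)} : SS"
proof -
 obtain \<phi> E p where 1: "!!i. E i : SS" "!!e. P e = asat MS E (mix e p) \<phi>"
  using assms unfolding ar_def by auto
 \<comment> \<open>All even positions are collapsed to the variable 0, the element to be tested; odd
   positions keep their names and hold the parameters.\<close>
 define v where "v = (%n::nat. if even n then 0 else n)"
 define k where "k = Suc (Max (insert 0 (afv \<phi>)))"
 obtain X where X: "X ~: afs \<phi>" using ex_new_if_finite[OF infinite_UNIV_nat finite_afs] by blast
 let ?\<phi> = "tr v k \<phi>" and ?e = "%n. p (n div 2)"
 have v: "v n < k" if "n : afv \<phi>" for n
  using that Max_ge[of "insert 0 (afv \<phi>)" n] by (auto simp: v_def k_def less_Suc_eq_le)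
 have "ExS X (AllN 0 (Iff (Mem (Var 0) X) ?\<phi>)) : ACA0"
  using arithmetical_tr X fvS_tr unfolding ACA0_def arithmetical_comprehension_def by blast
 from valid_MS[OF this] have "sat MS ?e E (ExS X (AllN 0 (Iff (Mem (Var 0) X) ?\<phi>)))"
  using 1(1) by (simp add: valid_def)
 then obtain A where A: "A : SS" "sat MS ?e (E(X := A)) (AllN 0 (Iff (Mem (Var 0) X) ?\<phi>))"
  by (auto simp del: sat.simps(6))
 have "a : A <-> P (%_. a)" for a
 proof -
  have m: "(%n. (?e(0 := a)) (v n)) = mix (%_. a) p" by (auto simp: mix_def v_def)
  have "sat MS (?e(0 := a)) (E(X := A)) (Iff (Mem (Var 0) X) ?\<phi>)"
   using A(2) unfolding sat.simps(6) by (simp only: std_simps UNIV_I ball_simps)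
  then have "a : A <-> sat MS (?e(0 := a)) (E(X := A)) ?\<phi>"
   by (simp only: sat.simps tval.simps fun_upd_same) blast
  also have "\<dots> <-> sat MS (?e(0 := a)) E ?\<phi>" by (rule sat_updS) (simp add: fvS_tr X)
  also have "\<dots> <-> asat MS E (%n. (?e(0 := a)) (v n)) \<phi>" by (rule sat_tr) (rule v)
  also have "\<dots> <-> P (%_. a)" unfolding m by (simp add: 1(2))
  finally show ?thesis .
 qed
 then show ?thesis using A(1) by (metis (mono_tags, lifting) Collect_cong Collect_mem_eq)
qed

lemma set_induct: assumes "A : SS" "0 : A" "!!a. a : A ==> a + 1 : A" shows "a : A"
proof -
 have "valid MS induction_axiom" by (rule valid_MS) (simp add: ACA0_def)
 then have "sat MS (%_. 0) (%_. A) induction_axiom" using assms(1) by (simp add: valid_def)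
 then show ?thesis using assms by (simp add: induction_axiom_def)
qed

lemma ind0:
 assumes "df (%e. P (e 0))" "P 0" "!!a. P a ==> P (a + 1)" shows "P a"
 using set_induct[OF comprehension[OF assms(1)], of a] assms by simp

lemma basic: "(n::mnum) + 1 ~= 0" "m + 1 = n + 1 <-> m = (n::mnum)" "(m::mnum) + 0 = m"
 "(m::mnum) + (n + 1) = m + n + 1" "(m::mnum) * 0 = 0" "(m::mnum) * (n + 1) = m * n + m"
 "\<not> (m::mnum) < 0" "(m::mnum) < n + 1 <-> m < n \<or> m = n"
proof -
 let ?e = "%i::nat. if i = 0 then m else n"
 obtain A where A: "A : SS" using SS_ne by auto
 have "sat MS ?e (%_. A) \<phi>" if "\<phi> : basic_axioms" for \<phi>
  using valid_MS[of \<phi>] that A by (simp add: ACA0_def valid_def)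
 then have "\<forall>\<phi>\<in>basic_axioms. sat MS ?e (%_. A) \<phi>" by blast
 then have *: "n + 1 ~= 0" "m + 1 = n + 1 --> m = n" "m + 0 = m" "m + (n + 1) = m + n + 1" "m * 0 = 0"
  "m * (n + 1) = m * n + m" "\<not> m < 0" "\<not> ((m < n + 1 --> \<not> m < n --> m = n) --> \<not> ((\<not> m < n --> m = n) --> m < n + 1))"
  by (simp_all add: basic_axioms_def Let_def)
 show "n + 1 ~= 0" "m + 1 = n + 1 <-> m = n" "m + 0 = m" "m + (n + 1) = m + n + 1" "m * 0 = 0"
  "m * (n + 1) = m * n + m" "\<not> m < 0" "m < n + 1 <-> m < n \<or> m = n"
  using * by blast+
qed


section \<open>The ordered semiring structure of the generic model\<close>

lemma A_assoc: "(a::mnum) + b + c = a + (b + c)"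
proof (rule ind0[of "%c. a + b + c = a + (b + c)"])
 show "df (%e. a + b + e 0 = a + (b + e 0))" by (intro df_intros)
qed (simp_all only: basic)

lemma A_0: "0 + (a::mnum) = a"
proof (rule ind0[of "%a. 0 + a = a"])
 show "df (%e. 0 + e 0 = e 0)" by (intro df_intros)
qed (simp_all only: basic)

lemma A_1: "1 + (a::mnum) = a + 1"
proof (rule ind0[of "%a. 1 + a = a + 1"])
 show "df (%e. 1 + e 0 = e 0 + 1)" by (intro df_intros)
qed (simp_all only: basic A_0)

lemma A_comm: "(a::mnum) + b = b + a"
proof (rule ind0[of "%b. a + b = b + a"])
 show "df (%e. a + e 0 = e 0 + a)" by (intro df_intros)
 show "a + (b + 1) = b + 1 + a" if "a + b = b + a" for b using that by (metis basic(4) A_1 A_assoc)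
qed (simp only: basic A_0)

lemma M_0: "0 * (a::mnum) = 0"
proof (rule ind0[of "%a. 0 * a = 0"])
 show "df (%e. 0 * e 0 = 0)" by (intro df_intros)
qed (simp_all only: basic)

lemma M_1: "1 * (a::mnum) = a"
proof (rule ind0[of "%a. 1 * a = a"])
 show "df (%e. 1 * e 0 = e 0)" by (intro df_intros)
qed (simp_all only: basic)

lemma M_dist: "(a + b) * (c::mnum) = a * c + b * c"
proof (rule ind0[of "%c. (a + b) * c = a * c + b * c"])
 show "df (%e. (a + b) * e 0 = a * e 0 + b * e 0)" by (intro df_intros)
 show "(a + b) * (c + 1) = a * (c + 1) + b * (c + 1)" if "(a + b) * c = a * c + b * c" for c
  using that by (simp only: basic(6)) (metis A_assoc A_comm)
qed (simp only: basic)

lemma M_comm: "(a::mnum) * b = b * a"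
proof (rule ind0[of "%b. a * b = b * a"])
 show "df (%e. a * e 0 = e 0 * a)" by (intro df_intros)
qed (simp_all only: basic M_0 M_1 M_dist)

lemma M_distl: "(c::mnum) * (a + b) = c * a + c * b" by (metis M_comm M_dist)

lemma M_assoc: "(a::mnum) * b * c = a * (b * c)"
proof (rule ind0[of "%c. a * b * c = a * (b * c)"])
 show "df (%e. a * b * e 0 = a * (b * e 0))" by (intro df_intros)
 show "a * b * (c + 1) = a * (b * (c + 1))" if "a * b * c = a * (b * c)" for c
  using that by (simp only: basic(6) M_distl[of a "b * c" b])
qed (simp_all only: basic)

lemma A_cancel: "(a::mnum) + c = b + c ==> a = b"
proof -
 have "a + c = b + c --> a = b"
 proof (rule ind0[of "%c. a + c = b + c --> a = b"])
  show "df (%e. a + e 0 = b + e 0 --> a = b)" by (intro df_intros)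
  show "a + (c + 1) = b + (c + 1) --> a = b" if "a + c = b + c --> a = b" for c
   using that basic(2) by (simp only: basic(4))
 qed (simp only: basic simp_thms)
 then show "a + c = b + c ==> a = b" by blast
qed

lemma mnum_cases: "(a::mnum) = 0 \<or> (EX b. a = b + 1)"
proof (rule ind0[of "%a. a = 0 \<or> (EX b. a = b + 1)"])
 show "df (%e. e 0 = 0 \<or> (EX b. e 0 = b + 1))" by (intro df_intros)
qed blast+

lemma less_iff: "(a::mnum) < b <-> (EX c. b = a + c + 1)"
proof (rule ind0[of "%b. a < b <-> (EX c. b = a + c + 1)"])
 show "df (%e. a < e 0 <-> (EX c. e 0 = a + c + 1))" by (intro df_intros)
 show "a < 0 <-> (EX c. 0 = a + c + 1)" using basic(1,7) by metis
 fix b assume b: "a < b <-> (EX c. b = a + c + 1)"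
 have "a < b + 1 <-> (EX c. b = a + c)"
  unfolding basic(8) b using mnum_cases basic(3,4) by metis
 also have "\<dots> <-> (EX c. b + 1 = a + c + 1)" using basic(2) by blast
 finally show "a < b + 1 <-> (EX c. b + 1 = a + c + 1)" .
qed

lemma less_irr: "\<not> (a::mnum) < a"
 unfolding less_iff by (metis A_0 A_assoc A_cancel A_comm basic(1))
lemma less_tr: "(a::mnum) < b ==> b < c ==> a < c"
 unfolding less_iff by (metis A_assoc)
lemma less_lin: "(a::mnum) < b \<or> a = b \<or> b < a"
proof (rule ind0[of "%a. a < b \<or> a = b \<or> b < a"])
 show "df (%e. e 0 < b \<or> e 0 = b \<or> b < e 0)" by (intro df_intros)
 show "0 < b \<or> 0 = b \<or> b < 0" using mnum_cases[of b] by (metis less_iff A_0)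
 fix a assume "a < b \<or> a = b \<or> b < a"
 then show "a + 1 < b \<or> a + 1 = b \<or> b < a + 1"
 proof (elim disjE)
  assume "a < b"
  then obtain c where c: "b = a + c + 1" unfolding less_iff by blast
  from mnum_cases[of c] show ?thesis
  proof
   assume "c = 0" then have "b = a + 1" using c by (simp only: basic(3))
   then show ?thesis by blast
  next
   assume "EX d. c = d + 1"
   then obtain d where "c = d + 1" by blast
   then have "b = a + 1 + d + 1" using c by (simp only: A_assoc A_comm[of 1 d])
   then show ?thesis unfolding less_iff by blast
  qed
 qed (simp_all only: basic(8) simp_thms)
qed

lemma le_iff: "(a::mnum) <= b <-> (EX c. b = a + c)"
 unfolding less_eq_mnum_def less_iff by (metis mnum_cases basic(3,4))

instantiation mnum :: minus
begin
definition "a - b = (if b <= a then (THE c. a = b + c) else (0 :: mnum))"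
instance ..
end

lemma minus_mnum: "a = b + c ==> a - b = (c :: mnum)" "\<not> b <= a ==> a - b = (0 :: mnum)"
proof -
 assume a: "a = b + c"
 have "(THE d. a = b + d) = c" by (rule the_equality) (use a A_cancel A_comm in metis)+
 then show "a - b = c" using a by (auto simp: minus_mnum_def le_iff)
qed (simp add: minus_mnum_def)

lemma mult_mono_strict: "(a::mnum) < b ==> 0 < c ==> c * a < c * b"
proof -
 assume "a < b" "0 < c"
 then obtain d k where d: "b = a + d + 1" "c = 0 + k + 1" unfolding less_iff by blast
 have "c * b = c * a + c * d + c" by (simp only: d(1) basic(6) M_distl[of c a d])
 also have "\<dots> = c * a + (c * d + k) + 1" by (metis A_assoc A_0 d(2))
 finally have "c * b = c * a + (c * d + k) + 1" .
 then show "c * a < c * b" unfolding less_iff by blast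
qed

instance mnum :: linordered_semidom
proof
 fix a b c :: mnum
 show "a + b + c = a + (b + c)" by (rule A_assoc)
 show "a + b = b + a" by (rule A_comm)
 show "0 + a = a" by (rule A_0)
 show "a * b * c = a * (b * c)" by (rule M_assoc)
 show "a * b = b * a" by (rule M_comm)
 show "1 * a = a" by (rule M_1)
 show "(a + b) * c = a * c + b * c" by (rule M_dist)
 show "(0::mnum) ~= 1" using basic(1)[of 0] by (simp only: A_0) metis
 show "0 * a = 0" by (rule M_0)
 show "a * 0 = 0" by (rule basic)
 show "a + b - a = b" by (rule minus_mnum) simp
 show d: "a - b - c = a - (b + c)"
 proof (cases "b + c <= a")
  case True
  then obtain d where d: "a = b + (c + d)" by (auto simp: le_iff A_assoc)
  then show ?thesis using minus_mnum(1)[of a b "c + d"] minus_mnum(1)[of "c + d" c d] minus_mnum(1)[of a "b + c" d]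
   by (simp add: A_assoc)
 next
  case False
  show ?thesis
  proof (cases "b <= a")
   case True
   then obtain d where d: "a = b + d" by (auto simp: le_iff)
   then have "\<not> c <= d" using False by (auto simp: le_iff A_assoc)
   then show ?thesis using False d minus_mnum by simp
  next
   case F: False
   have "0 - c = 0"
   proof (cases "c <= 0")
    case True
    then have "c = 0" using basic(7) by (auto simp: less_eq_mnum_def)
    then show ?thesis using minus_mnum(1)[of 0 0 0] by (simp add: A_0)
   qed (rule minus_mnum)
   then show ?thesis using F False minus_mnum by simp
  qed
 qed
 show "a < b <-> a <= b & \<not> b <= a" using less_irr less_tr less_eq_mnum_def by metis
 show "a <= a" by (simp add: less_eq_mnum_def)
 show "a <= b ==> b <= c ==> a <= c" using less_tr by (auto simp: less_eq_mnum_def)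
 show "a <= b ==> b <= a ==> a = b" using less_tr less_irr unfolding less_eq_mnum_def by metis
 show "a <= b \<or> b <= a" using less_lin by (auto simp: less_eq_mnum_def)
 show "a <= b ==> c + a <= c + b" by (auto simp: le_iff A_assoc)
 show "a < b ==> 0 < c ==> c * a < c * b" by (rule mult_mono_strict)
 show "0 < (1::mnum)" using basic(8)[of 0 0] by (simp add: A_0)
 show "b <= a ==> a - b + b = a"
  using minus_mnum(1)[of a b] by (auto simp: le_iff A_comm)
 show "c * (a + b) = c * a + c * b" by (rule M_distl)
 show "a * (b - c) = a * b - a * c"
 proof (cases "c <= b")
  case True
  then obtain d where "b = c + d" by (auto simp: le_iff)
  then show ?thesis using minus_mnum(1)[of b c d] minus_mnum(1)[of "a * b" "a * c" "a * d"] by (simp add: M_distl)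
 next
  case False
  then have l: "b < c" using less_lin less_eq_mnum_def by blast
  show ?thesis
  proof (cases "a = 0")
   case True
   then show ?thesis using minus_mnum(1)[of 0 0 0] by (simp add: M_0 A_0)
  next
   case a: False
   then have "0 < a" using less_lin basic(7) by blast
   then have "\<not> a * c <= a * b" using mult_mono_strict[OF l, of a] less_tr less_irr unfolding less_eq_mnum_def by metis
   then have "a * b - a * c = 0" by (rule minus_mnum)
   then show ?thesis using minus_mnum(2)[OF False] by (simp add: basic)
  qed
 qed
 show "a ~= 0 ==> b ~= 0 ==> a * b ~= 0"
  using mnum_cases[of a] mnum_cases[of b] basic(1,4,6) by metis
qed

lemma mnum_nonneg [simp]: "0 <= (a::mnum)" using basic(7)[of a] by (simp add: not_less)
lemma less_add1 [simp]: "(a::mnum) < b + 1 <-> a <= b" using basic(8) by (simp add: less_eq_mnum_def)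
lemma add1_le [simp]: "(a::mnum) + 1 <= b <-> a < b" by (metis less_add1 not_le)

lemma ind:
 assumes "df (%e. P (e 0))" "P 0" "!!a. P a ==> P (a + 1)" shows "P (a::mnum)"
 by (rule ind0) (use assms in auto)

lemma less_ind:
 assumes "df (%e. P (e 0))" "!!a. (!!b. b < a ==> P b) ==> P a" shows "P (a::mnum)"
proof -
 have "ALL b. b <= a --> P b"
 proof (rule ind[of "%a. ALL b. b <= a --> P b"])
  have "df (%e. ALL b. \<not> b <= e 0 \<or> P b)"
  proof (rule df_all, rule ar_or)
   show "df (%e. P (e 0))" by (rule assms)
  qed (intro df_intros)
  then show "df (%e. ALL b. b <= e 0 --> P b)" by (simp only: imp_conv_disj)
  show "ALL b. b <= 0 --> P b" using assms(2) by (metis mnum_nonneg not_less order_antisym)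
  show "ALL b. b <= a + 1 --> P b" if "ALL b. b <= a --> P b" for a
   using that assms(2) by (metis less_add1 less_le_trans)
 qed
 then show ?thesis by simp
qed

lemma least: assumes "df (%e. P (e 0))" "P (a::mnum)" shows "EX b. P b & (ALL c. P c --> b <= c)"
proof (rule ccontr)
 assume n: "\<not> ?thesis"
 have "\<not> P a"
 proof (rule less_ind[of "%a. \<not> P a"])
  show "df (%e. \<not> P (e 0))" using assms by (intro df_intros)
 qed (use n not_less in blast)
 then show False using assms by blast
qed

section \<open>The meaning of the formulas\<close>

abbreviation le :: "'a mdl => 'a => 'a => bool" where "le M a b \<equiv> Ls M a b \<or> a = b"
definition pr :: "'a mdl => 'a => 'a => 'a" where
 "pr M a b = Ad M (Mu M (Ad M a b) (Ad M a b)) a"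
definition sl :: "'a mdl => 'a set => 'a => 'a => bool" where "sl M A i t <-> pr M i t : A"

text \<open>The predicates with prefix \<open>s_\<close> follow the official formulas word for word,
  over an arbitrary model. One translation thus serves the generic model and the model of the
  unprovability half.\<close>

definition s_fun :: "'a mdl => 'a set => bool" where
 "s_fun M F <-> (ALL x:Dom M. EX y:Dom M. pr M x y : F & (ALL z:Dom M. pr M x z : F --> z = y))"
definition s_pow :: "'a mdl => 'a => 'a => 'a => bool" where
 "s_pow M b e p <-> (EX E:Ss M. s_fun M E & pr M (Ze M) (On M) : E &
  (ALL x:Dom M. ALL y:Dom M. pr M x y : E --> pr M (Ad M x (On M)) (Mu M y b) : E) & pr M e p : E)"
definition s_dvd :: "'a mdl => 'a => 'a => bool" where
 "s_dvd M s t <-> (EX k:Dom M. t = Mu M s k)"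
definition s_dec :: "'a mdl => 'a => 'a => 'a => 'a => 'a => bool" where
 "s_dec M b n e a r <-> (EX p:Dom M. EX q:Dom M. s_pow M b e p & s_pow M b (Ad M e (On M)) q & le M p n &
  Ls M n q & Ls M (Ze M) a & Ls M a b & Ls M r p & n = Ad M (Mu M p a) r)"
definition s_min :: "'a mdl => ('a => bool) => 'a => bool" where
 "s_min M B m <-> B m & (ALL b:Dom M. B b --> le M m b)"
definition s_base :: "'a mdl => ('a => bool) => 'a => 'a => bool" where
 "s_base M B n b <-> (EX m:Dom M. s_min M B m &
  ((le M m n & B b & le M b n & (ALL x:Dom M. B x & le M x n --> le M x b)) \<or> (Ls M n m & b = m)))"
definition s_succ :: "'a mdl => ('a => bool) => 'a => 'a => bool" where
 "s_succ M B n s <-> B s & Ls M n s & (ALL b:Dom M. B b & Ls M n b --> le M s b)"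
definition s_lsucc :: "'a mdl => ('a => bool) => 'a => 'a => bool" where
 "s_lsucc M B n t <-> (ALL s:Dom M. s_succ M B n s --> Ls M t s)"
definition s_bh :: "'a mdl => ('a => bool) => bool" where
 "s_bh M B <-> (EX b:Dom M. B b) & \<not> B (Ze M) & \<not> B (On M) &
  (ALL b:Dom M. ALL s:Dom M. B b & s_succ M B b s --> s_dvd M b s)"
definition s_inV :: "'a mdl => 'a set => 'a => 'a => 'a => 'a => bool" where
 "s_inV M V b d m v <-> pr M (pr M b d) (pr M m v) : V"
definition s_adm :: "'a mdl => ('a => bool) => 'a set => 'a set => 'a => 'a => 'a => bool" where
 "s_adm M C U V b n d <-> C d & (EX n':Dom M. EX u:Dom M. EX v:Dom M. n = Ad M n' (On M) & pr M n' u : U &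
  s_inV M V b d n v & Ls M u v & s_lsucc M C d v)"
definition s_ur :: "'a mdl => ('a => bool) => ('a => bool) => 'a set => 'a set => bool" where
 "s_ur M B C U V <->
  (ALL n:Dom M. ALL v:Dom M. pr M n v : U <-> (EX m:Dom M. s_min M B m &
   ((Ls M n m & v = n) \<or> (le M m n & (EX b:Dom M. EX d:Dom M. s_base M B n b & s_adm M C U V b n d &
    (ALL d':Dom M. s_adm M C U V b n d' --> le M d d') & s_inV M V b d n v))))) &
  (ALL b:Dom M. ALL d:Dom M. ALL m:Dom M. ALL v:Dom M. B b & C d --> (s_inV M V b d m v <->
   (Ls M m b & pr M m v : U) \<or> (le M b m & (EX e:Dom M. EX a:Dom M. EX r:Dom M. EX e':Dom M. EX a':Dom M.
    EX r':Dom M. EX p:Dom M. s_dec M b m e a r & s_inV M V b d e e' & pr M a a' : U & s_inV M V b d r r' &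
    s_pow M d e' p & v = Ad M (Mu M p a') r'))))"
definition s_up :: "'a mdl => ('a => bool) => ('a => bool) => 'a => 'a => bool" where
 "s_up M B C n v <-> (EX U:Ss M. EX V:Ss M. s_ur M B C U V & pr M n v : U)"
definition s_good :: "'a mdl => ('a => bool) => ('a => bool) => bool" where
 "s_good M B C <-> (EX m:Dom M. EX m':Dom M. s_min M B m & s_min M C m' & le M m m') &
  (ALL n:Dom M. EX v:Dom M. s_up M B C n v) &
  (ALL b':Dom M. ALL m:Dom M. ALL x:Dom M. ALL y:Dom M. B (Ad M b' (On M)) & s_min M B m & Ls M m (Ad M b' (On M)) &
   s_up M B C b' x & s_base M C x y --> \<not> (EX z:Dom M. s_dvd M y z & Ls M x z & s_lsucc M C x z))"
definition s_dyn :: "'a mdl => 'a set => bool" where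
 "s_dyn M X <-> (ALL i:Dom M. s_bh M (sl M X i)) & (ALL i:Dom M. s_good M (sl M X i) (sl M X (Ad M i (On M))))"
definition s_gseq :: "'a mdl => 'a set => 'a => 'a set => bool" where
 "s_gseq M X n G <-> s_fun M G & pr M (Ze M) n : G &
  (ALL i:Dom M. ALL x:Dom M. ALL y:Dom M. pr M i x : G & pr M (Ad M i (On M)) y : G -->
   (Ls M (Ze M) x & s_up M (sl M X i) (sl M X (Ad M i (On M))) x (Ad M y (On M))) \<or> (x = Ze M & y = Ze M))"
definition s_gval :: "'a mdl => 'a set => 'a => 'a => 'a => bool" where
 "s_gval M X n i v <-> (EX G:Ss M. s_gseq M X n G & pr M i v : G)"
definition s_slow :: "'a mdl => 'a set => 'a => bool" where
 "s_slow M X c <-> (ALL b:Dom M. sl M X (Ze M) b -->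
  (EX s:Dom M. s_succ M (sl M X (Ze M)) b s & le M s (Mu M b b) & le M s (Mu M b c)))"
definition s_term :: "'a mdl => 'a => bool" where
 "s_term M c <-> (ALL X:Ss M. s_dyn M X & s_slow M X c --> (ALL n:Dom M. EX i:Dom M. s_gval M X n i (Ze M)))"

text \<open>Terms that use only variables below the next index are not affected when a quantifier
  binds that index. This condition takes the place of all capture arguments in the translation of
  the official formulas.\<close>

definition bt :: "nat => trm => bool" where "bt k t <-> vars_trm t <= {..<k}"

lemma bt_simps [simp]: "bt k (Var x) <-> x < k" "bt k \<^bold>0" "bt k \<^bold>1" "bt k (s \<^bold>+ t) <-> bt k s & bt k t"
 "bt k (s \<^bold>* t) <-> bt k s & bt k t" "bt k t ==> bt (Suc k) t" "bt k (num n)" "bt k (pair s t) <-> bt k s & bt k t"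
 by (auto simp: bt_def pair_def less_Suc_eq) (induction n; auto)
lemma tval_bt [simp]: "bt k t ==> tval M (e(k := a)) t = tval M e t"
 by (rule tval_upd) (auto simp: bt_def)
lemma tval_pair [simp]: "tval M e (pair s t) = pr M (tval M e s) (tval M e t)"
 by (simp add: pair_def pr_def)

lemma sat_con:
 "sat M e E ((\<^bold>\<forall>x. f x) k) <-> (ALL a:Dom M. sat M (e(k := a)) E (f (Var k) (Suc k)))"
 "sat M e E ((\<^bold>\<exists>x. f x) k) <-> (EX a:Dom M. sat M (e(k := a)) E (f (Var k) (Suc k)))"
 "sat M e E ((\<^bold>\<forall>\<^sub>s X. g X) k) <-> (ALL A:Ss M. sat M e (E(k := A)) (g k (Suc k)))"
 "sat M e E ((\<^bold>\<exists>\<^sub>s X. g X) k) <-> (EX A:Ss M. sat M e (E(k := A)) (g k (Suc k)))"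
 "sat M e E ((\<^bold>\<not> \<phi>) k) <-> \<not> sat M e E (\<phi> k)"
 "sat M e E ((\<phi> \<^bold>\<and> \<psi>) k) <-> sat M e E (\<phi> k) & sat M e E (\<psi> k)"
 "sat M e E ((\<phi> \<^bold>\<or> \<psi>) k) <-> sat M e E (\<phi> k) \<or> sat M e E (\<psi> k)"
 "sat M e E ((\<phi> \<^bold>\<longrightarrow> \<psi>) k) <-> (sat M e E (\<phi> k) --> sat M e E (\<psi> k))"
 "sat M e E ((\<phi> \<^bold>\<longleftrightarrow> \<psi>) k) <-> (sat M e E (\<phi> k) <-> sat M e E (\<psi> k))"
 "sat M e E ((s \<^bold>= t) k) <-> tval M e s = tval M e t"
 "sat M e E ((s \<^bold>< t) k) <-> Ls M (tval M e s) (tval M e t)"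
 "sat M e E ((s \<^bold>\<le> t) k) <-> le M (tval M e s) (tval M e t)"
 "sat M e E ((t \<^bold>\<in> X) k) <-> tval M e t : E X"
 unfolding all_num_def ex_num_def all_set_def ex_set_def f_not_def f_and_def f_or_def f_imp_def f_iff_def
  f_eq_def f_less_def f_le_def f_mem_def sat.simps by blast+

lemma sat_slice [simp]: "sat M e E (slice X i t k) <-> sl M (E X) (tval M e i) (tval M e t)"
 by (simp add: slice_def sl_def sat_con)

lemma sat_is_function [simp]: "sat M e E (is_function F k) <-> s_fun M (E F)"
 by (simp add: is_function_def s_fun_def sat_con)

lemma sat_is_power [simp]: "bt k b ==> bt k x ==> bt k p ==>
  sat M e E (is_power b x p k) <-> s_pow M (tval M e b) (tval M e x) (tval M e p)"
 by (simp add: is_power_def s_pow_def sat_con)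

lemma sat_divides [simp]: "bt k s ==> bt k t ==> sat M e E (divides s t k) <-> s_dvd M (tval M e s) (tval M e t)"
 by (simp add: divides_def s_dvd_def sat_con)

lemma sat_is_decomposition [simp]: "bt k b ==> bt k n ==> bt k x ==> bt k a ==> bt k r ==>
  sat M e E (is_decomposition b n x a r k) <->
  s_dec M (tval M e b) (tval M e n) (tval M e x) (tval M e a) (tval M e r)"
 by (simp add: is_decomposition_def s_dec_def sat_con)

lemma sat_is_min [simp]: "bt k i ==> bt k m ==>
  sat M e E (is_min (slice X i) m k) <-> s_min M (sl M (E X) (tval M e i)) (tval M e m)"
 by (simp add: is_min_def s_min_def sat_con)

lemma sat_is_base [simp]: "bt k i ==> bt k n ==> bt k b ==>
  sat M e E (is_base (slice X i) n b k) <-> s_base M (sl M (E X) (tval M e i)) (tval M e n) (tval M e b)"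
 by (simp add: is_base_def s_base_def sat_con)

lemma sat_is_succ [simp]: "bt k i ==> bt k n ==> bt k b ==>
  sat M e E (is_succ (slice X i) n b k) <-> s_succ M (sl M (E X) (tval M e i)) (tval M e n) (tval M e b)"
 by (simp add: is_succ_def s_succ_def sat_con)

lemma sat_less_succ [simp]: "bt k i ==> bt k n ==> bt k b ==>
  sat M e E (less_succ (slice X i) n b k) <-> s_lsucc M (sl M (E X) (tval M e i)) (tval M e n) (tval M e b)"
 by (simp add: less_succ_def s_lsucc_def sat_con)

lemma sat_base_hierarchy [simp]: "bt k i ==>
  sat M e E (base_hierarchy (slice X i) k) <-> s_bh M (sl M (E X) (tval M e i))"
 by (simp add: base_hierarchy_def s_bh_def sat_con)

lemma sat_in_V [simp]:
  "sat M e E (in_V V b d m v k) <-> s_inV M (E V) (tval M e b) (tval M e d) (tval M e m) (tval M e v)"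
 by (simp add: in_V_def s_inV_def sat_con)

lemma sat_admissible [simp]: "bt k i ==> bt k b ==> bt k n ==> bt k d ==>
  sat M e E (admissible (slice X i) U V b n d k) <->
  s_adm M (sl M (E X) (tval M e i)) (E U) (E V) (tval M e b) (tval M e n) (tval M e d)"
 by (simp add: admissible_def s_adm_def sat_con)

lemma sat_upgrade_rec [simp]: "bt k i ==> bt k j ==>
  sat M e E (upgrade_rec (slice X i) (slice X j) U V k) <->
  s_ur M (sl M (E X) (tval M e i)) (sl M (E X) (tval M e j)) (E U) (E V)"
 unfolding s_ur_def
 by (simp add: upgrade_rec_def sat_con)

lemma sat_is_upgrade [simp]: "bt k i ==> bt k j ==> bt k n ==> bt k v ==> X < k ==>
  sat M e E (is_upgrade (slice X i) (slice X j) n v k) <->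
  s_up M (sl M (E X) (tval M e i)) (sl M (E X) (tval M e j)) (tval M e n) (tval M e v)"
 by (simp add: is_upgrade_def s_up_def sat_con)

lemma sat_good_successor [simp]: "bt k i ==> bt k j ==> X < k ==>
  sat M e E (good_successor (slice X i) (slice X j) k) <->
  s_good M (sl M (E X) (tval M e i)) (sl M (E X) (tval M e j))"
 by (simp add: good_successor_def s_good_def sat_con)

lemma sat_dynamical_hierarchy [simp]: "X < k ==> sat M e E (dynamical_hierarchy X k) <-> s_dyn M (E X)"
 by (simp add: dynamical_hierarchy_def s_dyn_def sat_con)

lemma sat_goodstein_sequence [simp]: "bt k n ==> X < k ==>
  sat M e E (goodstein_sequence X n G k) <-> s_gseq M (E X) (tval M e n) (E G)"
 by (simp add: goodstein_sequence_def s_gseq_def sat_con)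

lemma sat_goodstein_value [simp]: "bt k n ==> bt k i ==> bt k v ==> X < k ==>
  sat M e E (goodstein_value X n i v k) <-> s_gval M (E X) (tval M e n) (tval M e i) (tval M e v)"
 by (simp add: goodstein_value_def s_gval_def sat_con)

lemma sat_slow_start [simp]: "bt k c ==> sat M e E (slow_start X c k) <-> s_slow M (E X) (tval M e c)"
 by (simp add: slow_start_def s_slow_def sat_con)

lemma sat_goodstein_terminates [simp]: "bt k c ==>
  sat M e E (goodstein_terminates c k) <-> s_term M (tval M e c)"
 by (simp add: goodstein_terminates_def s_term_def sat_con)

lemma valid_sentence:
 assumes "is_str M" "!!e E. sat M e E \<phi> <-> Q" shows "valid M \<phi> <-> Q"
proof -
 obtain A where "A : Ss M" "Ze M : Dom M" using assms(1) by (auto simp: is_str_def)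
 then have "EX e E. (ALL x. e x : Dom M) & (ALL X. E X : Ss M)"
  by (intro exI[of _ "%_. Ze M"] exI[of _ "%_. A"]) simp
 then show ?thesis unfolding valid_def assms(2) by blast
qed

lemma valid_terminates:
 "is_str M ==> valid M (sentence (goodstein_terminates (num c))) <-> s_term M (tval M (%_. Ze M) (num c))"
proof (rule valid_sentence, assumption)
 have *: "tval M e (num c) = tval M (%_. Ze M) (num c)" for e by (induction c) auto
 then show "sat M e E (sentence (goodstein_terminates (num c))) <-> s_term M (tval M (%_. Ze M) (num c))" for e E
  by (simp add: sentence_def *[of e])
qed

lemma valid_unique: "is_str M ==> valid M upgrade_unique <->
 (ALL X:Ss M. ALL c:Dom M. ALL i:Dom M. ALL n:Dom M. ALL v:Dom M. ALL w:Dom M. s_dyn M X & s_slow M X c &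
  s_up M (sl M X i) (sl M X (Ad M i (On M))) n v & s_up M (sl M X i) (sl M X (Ad M i (On M))) n w --> v = w)"
 by (rule valid_sentence, assumption)
  (simp add: upgrade_unique_def sentence_def sat_con)

lemma valid_all_terminate: "is_str M ==>
 valid M (sentence (\<^bold>\<forall>c. num 2 \<^bold>\<le> c \<^bold>\<longrightarrow> goodstein_terminates c)) <->
 (ALL c:Dom M. le M (Ad M (Ad M (Ze M) (On M)) (On M)) c --> s_term M c)"
 by (rule valid_sentence, assumption)
  (simp add: sentence_def sat_con numeral_2_eq_2)

section \<open>Arithmetic in the generic model\<close>

text \<open>The ring of integers of the model, which makes linear arithmetic available.\<close>

quotient_type mint = "mnum \<times> mnum" / "%(a, b) (c, d). a + d = c + b"
proof (rule equivpI)
 show "reflp (%(a::mnum, b) (c, d). a + d = c + b)" by (auto simp: reflp_def)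
 show "symp (%(a::mnum, b) (c, d). a + d = c + b)" by (auto simp: symp_def)
 show "transp (%(a::mnum, b) (c, d). a + d = c + b)"
 proof (rule transpI, clarify)
  fix a b c d e f :: mnum
  assume h: "a + d = c + b" "c + f = e + d"
  have "(a + f) + (c + d) = (a + d) + (c + f)" by (simp add: ac_simps)
  also have "\<dots> = (e + b) + (c + d)" unfolding h by (simp add: ac_simps)
  finally show "a + f = e + b" by (rule add_right_imp_eq)
 qed
qed

instantiation mint :: linordered_idom
begin
lift_definition zero_mint :: mint is "(0, 0)" .
lift_definition one_mint :: mint is "(1, 0)" .
lift_definition plus_mint :: "mint => mint => mint" is "%(a, b) (c, d). (a + c, b + d)"
 by clarify (metis add.assoc add.left_commute)
lift_definition uminus_mint :: "mint => mint" is "%(a, b). (b, a)"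
 by (auto simp: add.commute)
lift_definition minus_mint :: "mint => mint => mint" is "%(a, b) (c, d). (a + d, b + c)"
 by clarify (metis add.assoc add.left_commute add.commute)
lift_definition times_mint :: "mint => mint => mint" is "%(a, b) (c, d). (a * c + b * d, a * d + b * c)"
proof clarify
 fix a b c d e f g h :: mnum
 assume h: "a + d = c + b" "e + h = g + f"
 have "(a * e + b * f + (c * h + d * g)) + (d * e + c * f) = (a + d) * e + (b + c) * f + (c * h + d * g)"
  by (simp add: algebra_simps)
 also have "\<dots> = (c + b) * e + (a + d) * f + (c * h + d * g)" unfolding h by (simp add: ac_simps h)
 also have "\<dots> = c * (e + h) + d * (g + f) + b * e + a * f" by (simp add: algebra_simps)
 also have "\<dots> = c * (g + f) + d * (e + h) + b * e + a * f" unfolding h ..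
 also have "\<dots> = (c * g + d * h + (a * f + b * e)) + (d * e + c * f)" by (simp add: algebra_simps)
 finally show "a * e + b * f + (c * h + d * g) = c * g + d * h + (a * f + b * e)" by (rule add_right_imp_eq)
qed
lift_definition less_eq_mint :: "mint => mint => bool" is "%(a, b) (c, d). a + d <= c + b"
proof clarify
 fix a b c d e f g h :: mnum
 assume h: "a + d = c + b" "e + h = g + f"
 have "a + f <= e + b <-> (a + f) + (d + h) <= (e + b) + (d + h)" by simp
 also have "\<dots> <-> (a + d) + (f + h) <= (e + h) + (b + d)" by (simp add: ac_simps)
 also have "\<dots> <-> (c + h) + (b + f) <= (g + d) + (b + f)" unfolding h by (simp add: ac_simps)
 also have "\<dots> <-> c + h <= g + d" by simp
 finally show "(a + f <= e + b) = (c + h <= g + d)" .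
qed
definition "(x::mint) < y <-> x <= y & \<not> y <= x"
definition mint_abs: "\<bar>x::mint\<bar> = (if x < 0 then - x else x)"
definition "sgn (x::mint) = (if x = 0 then 0 else if 0 < x then 1 else - 1)"
instance
proof
 fix x y z :: mint
 show "x + y + z = x + (y + z)" by transfer (auto simp: ac_simps)
 show "x + y = y + x" by transfer (auto simp: ac_simps)
 show "0 + x = x" by transfer auto
 show "- x + x = 0" by transfer (auto simp: ac_simps)
 show "x - y = x + - y" by transfer (auto simp: ac_simps)
 show "x * y * z = x * (y * z)" by transfer (auto simp: algebra_simps)
 show "x * y = y * x" by transfer (auto simp: algebra_simps)
 show "1 * x = x" by transfer auto
 show "(x + y) * z = x * z + y * z" by transfer (auto simp: algebra_simps)
 show "(0::mint) ~= 1" by transfer auto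
 show "x + y - x = y" by transfer (auto simp: ac_simps)
 show "x - y - z = x - (y + z)" by transfer (auto simp: ac_simps)
 show "0 * x = 0" by transfer auto
 show "x * 0 = 0" by transfer auto
 show "x <= x" by transfer auto
 show "x < y <-> x <= y & \<not> y <= x" by (rule less_mint_def)
 show "x <= y ==> y <= z ==> x <= z"
 proof (transfer, clarify)
  fix a b c d e f :: mnum assume h: "a + d <= c + b" "c + f <= e + d"
  have "(a + f) + (c + d) <= (e + b) + (c + d)" using add_mono[OF h] by (simp add: ac_simps)
  then show "a + f <= e + b" by simp
 qed
 show "x <= y ==> y <= x ==> x = y" by transfer auto
 show "x <= y \<or> y <= x" by transfer auto
 show "x <= y ==> z + x <= z + y"
 proof (transfer, clarify)
  fix a b c d e f :: mnum assume h: "a + d <= c + b"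
  show "e + a + (f + d) <= e + c + (f + b)" using add_right_mono[OF h, of "e + f"] by (simp add: ac_simps)
 qed
 show "x < y ==> 0 < z ==> z * x < z * y"
  unfolding less_mint_def
 proof (transfer, goal_cases)
  case (1 x y z)
  obtain a b c d e f where x: "x = (a, b)" "y = (c, d)" "z = (e, f)" by (cases x, cases y, cases z) blast
  have h: "\<not> c + b <= a + d" "\<not> e <= f" using 1 by (simp_all add: x)
  then obtain k l where k: "c + b = a + d + k + 1" "e = f + l + 1" by (metis less_iff not_le)
  have "e * c + f * d + (e * b + f * a) = e * (c + b) + f * (a + d)" by (simp add: algebra_simps)
  also have "\<dots> = (e * a + f * b + (e * d + f * c)) + (k + 1) * (l + 1) "
  proof -
   have 3: "e * (k + 1) = f * (k + 1) + (k + 1) * (l + 1)" unfolding k(2) by (simp add: algebra_simps)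
   have "e * (c + b) + f * (a + d) = e * (a + d) + e * (k + 1) + f * (a + d)" unfolding k(1) by (simp add: algebra_simps)
   also have "\<dots> = e * (a + d) + f * (a + d + k + 1) + (k + 1) * (l + 1)" unfolding 3 by (simp add: algebra_simps)
   also have "\<dots> = e * (a + d) + f * (c + b) + (k + 1) * (l + 1)" unfolding k(1) ..
   also have "\<dots> = (e * a + f * b + (e * d + f * c)) + (k + 1) * (l + 1)" by (simp add: algebra_simps)
   finally show ?thesis .
  qed
  finally have 3: "e * c + f * d + (e * b + f * a) = (e * a + f * b + (e * d + f * c)) + (k + 1) * (l + 1)" .
  have 2: "0 < (k + 1) * (l + 1)" by (intro mult_pos_pos) simp_all
  have "e * a + f * b + (e * d + f * c) <= e * c + f * d + (e * b + f * a) &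
   \<not> e * c + f * d + (e * b + f * a) <= e * a + f * b + (e * d + f * c)"
   unfolding 3 using 2 by (simp add: not_le)
  then show ?case by (simp add: x)
 qed
 show "\<bar>x\<bar> = (if x < 0 then - x else x)" by (rule mint_abs)
 show "sgn x = (if x = 0 then 0 else if 0 < x then 1 else - 1)" by (rule sgn_mint_def)
qed
end

lift_definition zz :: "mnum => mint" is "%a. (a, 0)" .

lemma zz_add: "zz (a + b) = zz a + zz b" by transfer simp
lemma zz_mult: "zz (a * b) = zz a * zz b" by transfer simp
lemma zz_0: "zz 0 = 0" by transfer simp
lemma zz_1: "zz 1 = 1" by transfer simp
lemma zz_le: "a <= b <-> zz a <= zz b" by transfer simp
lemma zz_eq: "a = b <-> zz a = zz b" by transfer simp
lemma zz_less: "a < b <-> zz a + 1 <= zz b"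
 by (simp add: zz_le[symmetric] zz_1[symmetric] zz_add[symmetric])
lemma zz_nonneg [simp]: "0 <= zz a" by (simp add: zz_le[symmetric] zz_0[symmetric])
lemmas zz = zz_less zz_le zz_eq zz_add zz_mult zz_0 zz_1

lemma two_le: "2 <= (a::mnum) <-> 1 < a" by (metis add1_le one_add_one)

lemma tm_op3:
 assumes "tm (%e. h (e 0) (e 1) (e 2))" "tm f" "tm g" "tm k"
 shows "tm (%e. h (f e) (g e) (k e))"
proof -
 have 1: "tm (%e. h (e 2) (e 1) (e 0))"
  using tm_shift[OF assms(1), of "%n. if n = 0 then 2 else if n = 1 then 1 else 0"] by simp
 have "df (%e. EX a b c. a = f (%n. e (Suc n)) & b = g (%n. e (Suc n)) & c = k (%n. e (Suc n)) & e 0 = h a b c)"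
  using 1 by (intro df_ex ar_and ar_eq tm_var tm_shift[OF assms(2)] tm_shift[OF assms(3)] tm_shift[OF assms(4)])
   (simp_all add: numeral_2_eq_2)
 then show ?thesis by (simp add: tm_def)
qed

lemma tm_comp2: assumes "tm (%e. h (e 0) (e 1))" "tm f" "tm g" shows "tm (%e. h (f e) (g e))"
 by (rule tm_op3[of "%a b c. h a b" f g f]) (use assms in auto)
lemma tm_comp1: assumes "tm (%e. h (e 0))" "tm f" shows "tm (%e. h (f e))"
 by (rule tm_op3[of "%a b c. h a" f f f]) (use assms in auto)

lemma tm_graph:
 assumes "df (%e. Q (e 0) (e 1) (e 2))" "!!a b c. Q a b c <-> a = h b c" shows "tm (%e. h (e 0) (e 1))"
 using assms by (simp add: tm_def numeral_2_eq_2)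

lemma division: "0 < b ==> EX q r. n = b * q + r & r < (b::mnum)"
proof (rule ind[of "%n. EX q r. n = b * q + r & r < b"])
 show "df (%e. EX q r. e 0 = b * q + r & r < b)" by (intro df_intros)
 show "EX q r. 0 = b * q + r & r < b" if "0 < b" using that by (intro exI[of _ 0]) simp
 show "EX q r. n + 1 = b * q + r & r < b" if "0 < b" and IH: "EX q r. n = b * q + r & r < b" for n
 proof -
  obtain q r where q: "n = b * q + r" "r < b" using IH by blast
  show ?thesis
  proof (cases "r + 1 = b")
   case True
   then have "n + 1 = b * (q + 1) + 0" unfolding q(1) by (simp only: add.assoc) (simp add: algebra_simps)
   then show ?thesis using that by blast
  next
   case False
   then have "r + 1 < b" using q by (simp add: order.not_eq_order_implies_strict)
   moreover have "n + 1 = b * q + (r + 1)" using q by (simp add: ac_simps)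
   ultimately show ?thesis by blast
  qed
 qed
qed

lemma greatest:
 assumes "df (%e. P (e 0))" "P (a::mnum)" "!!x. P x ==> x <= n"
 shows "EX b. P b & (ALL c. P c --> c <= b)"
proof -
 have "EX b. (ALL x. P x --> x <= b) & (ALL c. (ALL x. P x --> x <= c) --> b <= c)"
 proof (rule least[of "%b. ALL x. P x --> x <= b" n])
  show "df (%e. ALL x. P x --> x <= e 0)" by (rule df_all, rule ar_imp, rule assms(1)) (intro df_intros)
 qed (use assms in blast)
 then obtain b where b: "!!x. P x ==> x <= b" "!!c. (!!x. P x ==> x <= c) ==> b <= c" by metis
 have "P b"
 proof (rule ccontr)
  assume n: "\<not> P b"
  then have "a < b" using b(1)[OF assms(2)] assms(2) by (auto simp: less_le)
  then obtain c where c: "b = c + 1" using mnum_cases[of b] basic(7) by blast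
  have "b <= c"
  proof (rule b(2))
   fix x assume "P x"
   then have "x < c + 1" using b(1)[of x] n c by (auto simp: less_le)
   then show "x <= c" by simp
  qed
  then have "c + 1 <= c" using c by simp
  then show False by (simp only: add1_le less_irr)
 qed
 then show ?thesis using b by blast
qed

lemma mnum_minus1: "0 < (n::mnum) ==> n - 1 + 1 = n" by (metis add1_le add_0 le_add_diff_inverse2)

definition pp :: "mnum => mnum => mnum" where "pp a b = (a + b) * (a + b) + a"

lemma pr_MS [simp]: "pr MS = pp" by (intro ext) (simp add: pr_def pp_def)

lemma tm_pp: "tm f ==> tm g ==> tm (%e. pp (f e) (g e))"
 unfolding pp_def by (intro tm_plus tm_times)

lemma pp_inj [simp]: "pp a b = pp c d <-> a = c & b = d"
proof -
 have *: False if "a + b < c + d" "pp a b = pp c d" for a b c d :: mnum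
 proof -
  have "(zz a + zz b + 1) * (zz a + zz b + 1) <= (zz c + zz d) * (zz c + zz d)"
   using that(1) by (intro mult_mono) (auto simp: zz intro: add_nonneg_nonneg)
  moreover have "(zz a + zz b) * (zz a + zz b) + zz a = (zz c + zz d) * (zz c + zz d) + zz c"
   using that(2) unfolding pp_def zz .
  ultimately show False using zz_nonneg[of a] zz_nonneg[of b] zz_nonneg[of c] by (simp add: algebra_simps)
 qed
 have "a + b = c + d" if "pp a b = pp c d" using *[of a b c d] *[of c d a b] that by (metis less_lin)
 then show ?thesis by (auto simp: pp_def)
qed

section \<open>Coding and recursion\<close>

text \<open>Coding finite sets by numbers requires exponentiation. No beta function is built for it:
  a power in the decomposition of a number is itself witnessed by a set of the model, and
  \<open>expo_ex\<close> extracts an exponential function from the hierarchy.\<close>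

locale expo =
 fixes pw :: "mnum => mnum" and \<beta> :: mnum
 assumes pw: "pw 0 = 1" "!!x. pw (x + 1) = pw x * \<beta>" and tm_pw0: "tm (%e. pw (e 0))" and beta: "1 < \<beta>"
begin

lemma tm_pw: "tm f ==> tm (%e. pw (f e))" by (rule tm_comp1[OF tm_pw0])

lemma pw_pos: "0 < pw x"
proof (rule ind[of "%x. 0 < pw x"])
 show "df (%e. 0 < pw (e 0))" by (intro df_intros tm_pw)
 have "0 < \<beta>" using beta by (rule order.strict_trans[rotated]) simp
 then show "0 < pw (a + 1)" if "0 < pw a" for a using that by (simp add: pw)
qed (simp add: pw)

lemma pw_step: "pw x + pw x <= pw (x + 1)"
proof -
 have "pw x * 2 <= pw x * \<beta>" using beta by (intro mult_left_mono) (auto simp: two_le)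
 then show ?thesis by (simp add: pw mult_2_right)
qed

lemma pw_gt: "x < pw x"
proof (rule ind[of "%x. x < pw x"])
 show "df (%e. e 0 < pw (e 0))" by (intro df_intros tm_pw)
 show "a + 1 < pw (a + 1)" if "a < pw a" for a
  using that pw_step[of a] pw_pos[of a] unfolding zz by linarith
qed (simp add: pw)

lemma pw_dvd: "EX k. 0 < k & pw (x + y) = k * pw x"
proof (rule ind[of "%y. EX k. 0 < k & pw (x + y) = k * pw x"])
 show "df (%e. EX k. 0 < k & pw (x + e 0) = k * pw x)" by (intro df_intros tm_pw)
 show "EX k. 0 < k & pw (x + 0) = k * pw x" by (intro exI[of _ 1]) simp
 show "EX k. 0 < k & pw (x + (a + 1)) = k * pw x" if h: "EX k. 0 < k & pw (x + a) = k * pw x" for a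
 proof -
  obtain k where "0 < k" "pw (x + a) = k * pw x" using h by blast
  moreover have "0 < \<beta>" using beta by (rule order.strict_trans[rotated]) simp
  ultimately have "0 < k * \<beta> & pw (x + (a + 1)) = k * \<beta> * pw x"
   using pw(2)[of "x + a"] by (simp add: ac_simps)
  then show ?thesis by blast
 qed
qed

text \<open>The digit of \<open>s\<close> at position \<open>x\<close> in base \<beta> is 1. Digits
  other than 0 and 1 may occur; they count as absence.\<close>

definition bit :: "mnum => mnum => bool" where
 "bit s x <-> (EX q r. s = q * pw (x + 1) + pw x + r & r < pw x)"

lemma df_bit: "tm f ==> tm g ==> df (%e. bit (f e) (g e))"
proof -
 have "df (%e. bit (e 0) (e 1))" unfolding bit_def by (intro df_intros tm_pw)
 then have 1: "tm (%e. if bit (e 0) (e 1) then 1 else 0)"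
 proof -
  have "df (%e. (bit (e 1) (e 2) & e 0 = 1) \<or> (\<not> bit (e 1) (e 2) & e 0 = 0))"
   unfolding bit_def by (intro df_intros tm_pw)
  then have "df (%e. e 0 = (if bit (e 1) (e 2) then 1 else 0))"
   by (rule ar_cong[rotated]) auto
  then show ?thesis by (simp add: tm_def numeral_2_eq_2)
 qed
 show "tm f ==> tm g ==> df (%e. bit (f e) (g e))"
  by (rule ar_cong[OF _ ar_eq[OF tm_comp2[OF 1, of f g] tm_one]]) auto
qed

lemma bit_less: assumes "bit s x" shows "x < s"
proof -
 obtain q r where "s = q * pw (x + 1) + pw x + r" using assms by (auto simp: bit_def)
 then have "pw x <= s" by (simp add: add_increasing add_increasing2)
 then show ?thesis using pw_gt[of x] by simp
qed

text \<open>\<open>pw n\<close> is a multiple of \<open>pw (x + 1)\<close>, so adding it changes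
  only the quotient \<open>q\<close>.\<close>

lemma bit_add: assumes "x < n" shows "bit (s + pw n) x <-> bit s x"
proof -
 obtain y where "n = (x + 1) + y" using assms by (metis less_iff add.assoc add.commute)
 then obtain k where k: "pw n = k * pw (x + 1)" using pw_dvd by blast
 show ?thesis
 proof
  assume "bit s x"
  then obtain q r where "s = q * pw (x + 1) + pw x + r" "r < pw x" by (auto simp: bit_def)
  then have "s + pw n = (q + k) * pw (x + 1) + pw x + r" "r < pw x" using k by (simp_all add: algebra_simps)
  then show "bit (s + pw n) x" unfolding bit_def by blast
 next
  assume "bit (s + pw n) x"
  then obtain q r where q: "s + pw n = q * pw (x + 1) + pw x + r" "r < pw x" by (auto simp: bit_def)
  have "k <= q"
  proof (rule ccontr)
   assume "\<not> k <= q"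
   then have "q + 1 <= k" by simp
   then have "(q + 1) * pw (x + 1) <= k * pw (x + 1)" by (intro mult_right_mono) simp_all
   then have "(q + 1) * pw (x + 1) <= s + pw n" using k by (simp add: add_increasing)
   then show False using q pw_step[of x] unfolding zz by (simp add: algebra_simps)
  qed
  then obtain q' where "q = k + q'" by (auto simp: le_iff)
  then have "s + k * pw (x + 1) = (q' * pw (x + 1) + pw x + r) + k * pw (x + 1)" using q(1) k by (simp add: algebra_simps)
  then have "s = q' * pw (x + 1) + pw x + r" by (rule add_right_imp_eq)
  then show "bit s x" using q(2) by (auto simp: bit_def)
 qed
qed

text \<open>Induction on \<open>n\<close>. The bound \<open>s < pw n\<close> means that no digit is
  set from \<open>n\<close> on, so adding \<open>pw n\<close> sets the digit \<open>n\<close> and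
  nothing else.\<close>

lemma code: assumes "A : SS" shows "EX s. s < pw n & (ALL x. bit s x <-> x < n & x : A)"
proof (rule ind[of "%n. EX s. s < pw n & (ALL x. bit s x <-> x < n & x : A)"])
 show "df (%e. EX s. s < pw (e 0) & (ALL x. bit s x <-> x < e 0 & x : A))"
  by (intro df_intros tm_pw df_bit assms)
 have "\<not> bit 0 x" for x using bit_less[of 0 x] by (meson mnum_nonneg not_less)
 then show "EX s. s < pw 0 & (ALL x. bit s x <-> x < 0 & x : A)"
  using pw_pos by (intro exI[of _ 0]) (simp add: not_less)
 fix n assume "EX s. s < pw n & (ALL x. bit s x <-> x < n & x : A)"
 then obtain s where s: "s < pw n" "!!x. bit s x <-> x < n & x : A" by blast
 have ge: "x < n" if "bit t x" "t < pw n" for t x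
 proof (rule ccontr)
  assume "\<not> x < n"
  then obtain y where "x = n + y" by (auto simp: not_less le_iff)
  then obtain k where k: "0 < k" "pw x = k * pw n" using pw_dvd by blast
  have "1 * pw n <= k * pw n" using k by (intro mult_right_mono) (simp_all flip: add1_le)
  moreover have "pw x <= t" using that(1) by (auto simp: bit_def add_increasing add_increasing2)
  ultimately show False using that(2) k by simp
 qed
 show "EX s. s < pw (n + 1) & (ALL x. bit s x <-> x < n + 1 & x : A)"
 proof (cases "n : A")
  case False
  then have "bit s x <-> x < n + 1 & x : A" for x using s(2) by (auto simp: le_less)
  moreover have "s < pw (n + 1)" using s(1) pw_step[of n] pw_pos[of n] unfolding zz by linarith
  ultimately show ?thesis by blast
 next
  case True
  have lt: "s + pw n < pw (n + 1)" using s(1) pw_step[of n] unfolding zz by linarith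
  have "bit (s + pw n) x <-> x < n + 1 & x : A" for x
  proof (cases "x < n")
   case True
   then show ?thesis using bit_add s(2) by auto
  next
   case F: False
   have "bit (s + pw n) n" unfolding bit_def using s(1) by (intro exI[of _ 0] exI[of _ s]) (simp add: add.commute)
   moreover have "x = n" if "bit (s + pw n) x"
   proof (rule ccontr)
    assume "x ~= n"
    then have "n < x" using F by simp
    then obtain y where "x = (n + 1) + y" by (metis less_iff add.assoc add.commute)
    then obtain k where k: "0 < k" "pw x = k * pw (n + 1)" using pw_dvd by blast
    have "1 * pw (n + 1) <= k * pw (n + 1)" using k by (intro mult_right_mono) (simp_all flip: add1_le)
    moreover have "pw x <= s + pw n" using that by (auto simp: bit_def add_increasing add_increasing2)
    ultimately show False using lt k by simp
   qed
   ultimately show ?thesis using F True by (auto simp: not_less)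
  qed
  then show ?thesis using lt by blast
 qed
qed

text \<open>\<open>ok p s k\<close> says that \<open>s\<close> codes a functional relation that
  contains the start and is closed under the step below \<open>k\<close>. It may contain further
  pairs, but functionality fixes its values up to \<open>k\<close>; two codes agree there by
  induction.\<close>

theorem recursion:
 assumes f: "tm (%e. f (e 0) (e 1) (e 2))" and a: "tm (%e. a (e 0))"
 obtains g where "!!p. g p 0 = a p" "!!p k. g p (k + 1) = f p k (g p k)" "tm (%e. g (e 0) (e 1))"
proof -
 note tmf = tm_op3[OF f] tm_comp1[OF a]
 define ok where "ok = (%p s k. bit s (pp 0 (a p)) &
  (ALL i v. i < k --> bit s (pp i v) --> bit s (pp (i + 1) (f p i v))) &
  (ALL i v w. bit s (pp i v) --> bit s (pp i w) --> v = w))"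
 have dok: "df (%e. ok (x e) (y e) (z e))" if "tm x" "tm y" "tm z" for x y z
 proof -
  have "df (%e. EX p s k. p = x e & s = y e & k = z e & ok p s k)"
   unfolding ok_def using that
   by (intro df_intros df_bit tm_pp tmf tm_shift[OF that(1)] tm_shift[OF that(2)] tm_shift[OF that(3)])
  then show ?thesis by simp
 qed
 define R where "R = (%p k v. EX s. ok p s k & bit s (pp k v))"
 have agree: "ALL v w. i <= k --> ok p s k --> ok p t k --> bit s (pp i v) --> bit t (pp i w) --> v = w" for p s t i k
 proof (rule ind[of "%i. ALL v w. i <= k --> ok p s k --> ok p t k --> bit s (pp i v) --> bit t (pp i w) --> v = w"])
  show "df (%e. ALL v w. e 0 <= k --> ok p s k --> ok p t k --> bit s (pp (e 0) v) --> bit t (pp (e 0) w) --> v = w)"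
   by (intro df_intros df_bit tm_pp)
  show "ALL v w. 0 <= k --> ok p s k --> ok p t k --> bit s (pp 0 v) --> bit t (pp 0 w) --> v = w"
   unfolding ok_def by metis
  fix i assume IH: "ALL v w. i <= k --> ok p s k --> ok p t k --> bit s (pp i v) --> bit t (pp i w) --> v = w"
  have ex: "EX v. bit s (pp i v)" if "i <= k" "ok p s k" for s
  proof -
   have "i <= k --> (EX v. bit s (pp i v))"
   proof (rule ind[of "%i. i <= k --> (EX v. bit s (pp i v))"])
    show "df (%e. e 0 <= k --> (EX v. bit s (pp (e 0) v)))" by (intro df_intros df_bit tm_pp)
   qed (use that(2) in \<open>auto simp: ok_def\<close>)
   then show ?thesis using that by blast
  qed
  show "ALL v w. i + 1 <= k --> ok p s k --> ok p t k --> bit s (pp (i + 1) v) --> bit t (pp (i + 1) w) --> v = w"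
  proof (intro allI impI)
   fix v w assume h: "i + 1 <= k" "ok p s k" "ok p t k" "bit s (pp (i + 1) v)" "bit t (pp (i + 1) w)"
   then have ik: "i < k" "i <= k" by auto
   obtain v' w' where vw: "bit s (pp i v')" "bit t (pp i w')" using ex[OF ik(2)] h by blast
   then have "v' = w'" using IH ik h by blast
   then show "v = w" using h vw ik unfolding ok_def by metis
  qed
 qed
 have Rex: "EX v. R p k v" for p k
 proof (rule ind[of "%k. EX v. R p k v"])
  show "df (%e. EX v. R p (e 0) v)" unfolding R_def by (intro df_intros df_bit tm_pp dok)
  have ext: "EX s. ok p s k & bit s (pp k v)" if "A : SS" "!!x. x : A ==> x < n" "pp k v : A" "pp 0 (a p) : A"
   "!!i v. i < k ==> pp i v : A ==> pp (i + 1) (f p i v) : A"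
   "!!i v w. pp i v : A ==> pp i w : A ==> v = w" for A n k v
  proof -
   note h = that
   obtain s where "!!x. bit s x <-> x < n & x : A" using code[OF h(1)] by blast
   then have "bit s x <-> x : A" for x using h(2) by blast
   then show ?thesis unfolding ok_def using h by (intro exI[of _ s]) simp
  qed
  show "EX v. R p 0 v"
   unfolding R_def
  proof (rule exI, rule ext[of "{x. x = pp 0 (a p)}" "pp 0 (a p) + 1"])
   show "{x. x = pp 0 (a p)} : SS" by (rule comprehension[of "%e. e 0 = pp 0 (a p)"]) (intro df_intros)
  qed (auto simp: not_less[symmetric])
  fix k assume "EX v. R p k v"
  then obtain s v where s: "ok p s k" "bit s (pp k v)" by (auto simp: R_def)
  let ?w = "f p k v"
  \<comment> \<open>The old code is cut down to arguments up to \<open>k\<close> first, since it may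
    hold an unrelated pair at \<open>k + 1\<close>.\<close>
  let ?A = "{x. (EX i v. i <= k & x = pp i v & bit s x) \<or> x = pp (k + 1) ?w}"
  show "EX v. R p (k + 1) v"
   unfolding R_def
  proof (rule exI, rule ext[of ?A "s + pp (k + 1) ?w + 1"])
   show "?A : SS"
    by (rule comprehension[of "%e. (EX i v. i <= k & e 0 = pp i v & bit s (e 0)) \<or> e 0 = pp (k + 1) ?w"])
     (intro df_intros df_bit tm_pp)
   show "x < s + pp (k + 1) ?w + 1" if "x : ?A" for x
    using that bit_less[of s x] by (auto simp: add_increasing add_increasing2)
   show "pp (k + 1) ?w : ?A" by simp
   show "pp 0 (a p) : ?A" using s(1) by (auto simp: ok_def)
   show "pp (i + 1) (f p i u) : ?A" if "i < k + 1" "pp i u : ?A" for i u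
   proof -
    have i: "i <= k" using that(1) by simp
    have b: "bit s (pp i u)" using that(2) i by auto
    show ?thesis
    proof (cases "i = k")
     case True
     then have "u = v" using s b unfolding ok_def by blast
     then show ?thesis using True by simp
    next
     case False
     then have "i < k" using i by simp
     then show ?thesis using s(1) b unfolding ok_def by auto
    qed
   qed
   show "u = w" if "pp i u : ?A" "pp i w : ?A" for i u w
    using that s(1) unfolding ok_def by auto
  qed
 qed
 have Run: "v = w" if "R p k v" "R p k w" for p k v w
  using that agree[of k k p] unfolding R_def by blast
 define g where "g = (%p k. THE v. R p k v)"
 have g: "R p k v <-> v = g p k" for p k v
  unfolding g_def using Rex[of p k] Run by (metis the_equality)
 show thesis
 proof (rule that)
  have "R p 0 (a p)" for p
  proof -
   obtain v where "R p 0 v" using Rex by blast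
   then show ?thesis unfolding R_def ok_def by blast
  qed
  then show "g p 0 = a p" for p using g by metis
  show "g p (k + 1) = f p k (g p k)" for p k
  proof -
   obtain s where s: "ok p s (k + 1)" "bit s (pp (k + 1) (g p (k + 1)))" using g[of p "k + 1"] unfolding R_def by blast
   have "EX u. bit s (pp k u)"
   proof -
    have "i <= k --> (EX v. bit s (pp i v))" for i
    proof (rule ind[of "%i. i <= k --> (EX v. bit s (pp i v))"])
     show "df (%e. e 0 <= k --> (EX v. bit s (pp (e 0) v)))" by (intro df_intros df_bit tm_pp)
     show "i + 1 <= k --> (EX v. bit s (pp (i + 1) v))" if "i <= k --> (EX v. bit s (pp i v))" for i
      using that s(1) unfolding ok_def by (metis add1_le less_add1 less_imp_le)
    qed (use s(1) in \<open>auto simp: ok_def\<close>)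
    then show ?thesis by blast
   qed
   then obtain u where u: "bit s (pp k u)" by blast
   have "ok p s k" using s(1) unfolding ok_def by (auto intro: less_imp_le)
   then have "u = g p k" using u g unfolding R_def by blast
   moreover have "bit s (pp (k + 1) (f p k u))" using s(1) u unfolding ok_def by auto
   ultimately show ?thesis using s unfolding ok_def by blast
  qed
  have "df (%e. R (e 1) (e 2) (e 0))" unfolding R_def by (intro df_intros df_bit tm_pp dok)
  then show "tm (%e. g (e 0) (e 1))" by (rule tm_graph[of "%v p k. R p k v"]) (simp add: g)
 qed
qed

end

section \<open>A single upgrade step in the generic model\<close>

lemma mul_add_less: assumes "x < y" "r < d" shows "d * x + r < d * (y::mnum)"
proof -
 have "d * x + r < d * (x + 1)" using assms(2) by (simp add: distrib_left)
 also have "\<dots> <= d * y" using assms(1) by (intro mult_left_mono) simp_all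
 finally show ?thesis .
qed

lemma mul_less_cancel: "d * a < d * b ==> a < (b::mnum)"
 by (rule mult_left_less_imp_less[of d]) simp_all

lemma mul_cancel: "0 < c ==> a * c = b * c <-> a = (b::mnum)"
 by (metis less_lin mult_strict_right_mono less_irr)

lemma dec_unique: assumes "d * x + r = d * y + (s::mnum)" "r < d" "s < d" shows "x = y & r = s"
proof -
 have "\<not> x < y" using mul_add_less[of x y r d] assms by (metis add_increasing2 leD mnum_nonneg order_refl)
 moreover have "\<not> y < x" using mul_add_less[of y x s d] assms by (metis add_increasing2 leD mnum_nonneg order_refl)
 ultimately show ?thesis using assms(1) by auto
qed

lemma mnum_le [simp]: "a < b \<or> a = b <-> a <= (b::mnum)" by auto

lemmas MS_simps = std_simps ball_UNIV bex_UNIV mnum_le pr_MS simp_thms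

lemma mnum_le0 [simp]: "a <= 0 <-> a = (0::mnum)" by (auto intro: antisym)
lemma mnum_lt1 [simp]: "a < 1 <-> a = (0::mnum)" using less_add1[of a 0] by simp

lemma mnum_less0 [simp]: "\<not> a < (0::mnum)" by (rule basic)

lemma pos_iff: "0 < (a::mnum) <-> a ~= 0" by (simp add: less_le)

definition mn :: "(mnum => bool) => mnum" where "mn B = (THE m. s_min MS B m)"
definition bs :: "(mnum => bool) => mnum => mnum" where
 "bs B n = (THE b. B b & b <= n & (ALL x. B x & x <= n --> x <= b))"
definition sc :: "(mnum => bool) => mnum => mnum" where "sc B n = (THE s. s_succ MS B n s)"
text \<open>The invariant of the whole first half. It forces every \<open>n\<close> to lie below the
  square of its base, so the decomposition of \<open>n\<close> has exponent 1 and the nested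
  exponents of base changes disappear.\<close>

definition square :: "(mnum => bool) => bool" where
 "square B <-> (ALL b. B b --> (EX s. s_succ MS B b s & s <= b * b))"

locale hier =
 fixes B :: "mnum => bool"
 assumes dB: "df (%e. B (e 0))" and bh: "s_bh MS B"
begin

lemma df_B: "tm f ==> df (%e. B (f e))"
 using ar_mem[of f "{x. B x}"] comprehension[OF dB] by simp

lemma min_iff: "s_min MS B m <-> m = mn B"
proof -
 obtain b where "B b" using bh by (auto simp: s_bh_def)
 from least[OF dB this] obtain m where "s_min MS B m" by (auto simp: s_min_def)
 then have *: "s_min MS B m' <-> m' = m" for m' by (auto simp: s_min_def intro: antisym)
 show ?thesis unfolding mn_def * by simp
qed

lemma mn: "B (mn B)" "B b ==> mn B <= b"
 using min_iff[of "mn B"] by (simp_all add: s_min_def)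

lemma B_gt1: "B b ==> 1 < b"
proof (rule ccontr)
 assume b: "B b" "\<not> 1 < b"
 moreover have "b = 0 \<or> b = 1" using b(2) mnum_lt1[of b] by (metis less_lin)
 moreover have "\<not> B 0" "\<not> B 1" using bh by (simp_all add: s_bh_def)
 ultimately show False by metis
qed

lemma mn_gt1: "1 < mn B" using B_gt1 mn(1) .
lemma mn_pos: "0 < mn B" using mn_gt1 by (rule order.strict_trans[rotated]) simp

lemma base_iff: assumes "mn B <= n"
 shows "B b & b <= n & (ALL x. B x & x <= n --> x <= b) <-> b = bs B n"
proof -
 have "EX b. (B b & b <= n) & (ALL x. B x & x <= n --> x <= b)"
  by (rule greatest[of "%x. B x & x <= n" "mn B" n]) 
   (intro df_intros df_B, use assms mn in simp_all)
 then obtain c where c: "B c" "c <= n" "!!x. B x ==> x <= n ==> x <= c" by blast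
 have *: "B b & b <= n & (ALL x. B x & x <= n --> x <= b) <-> b = c" for b
  using c by (auto intro: antisym)
 show ?thesis unfolding bs_def * by simp
qed

lemma bs: assumes "mn B <= n" shows "B (bs B n)" "bs B n <= n" "B x ==> x <= n ==> x <= bs B n"
 using base_iff[OF assms, of "bs B n"] by auto

lemma s_base_iff: "mn B <= n ==> s_base MS B n b <-> b = bs B n"
 using base_iff[of n b] by (auto simp: s_base_def min_iff)

lemma succ_sc: "s_succ MS B n s ==> sc B n = s"
 unfolding sc_def by (rule the_equality) (auto simp: s_succ_def intro: antisym)

lemma succ_ex: assumes "B x" "n < x" shows "EX s. s_succ MS B n s"
proof -
 have "EX s. (B s & n < s) & (ALL x. B x & n < x --> s <= x)"
  by (rule least[of "%s. B s & n < s" x]) (intro df_intros df_B, use assms in simp_all)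
 then show ?thesis by (auto simp: s_succ_def)
qed

lemma succ_dvd: "s_succ MS B b s ==> B b ==> EX k. s = b * k"
 using bh by (auto simp: s_bh_def s_dvd_def)

end

locale hq = hier +
 assumes sq: "square B"
begin

lemma sc: assumes "B b"
 shows "s_succ MS B b (sc B b)" "B (sc B b)" "b < sc B b" "B x ==> b < x ==> sc B b <= x" "sc B b <= b * b" "EX k. sc B b = b * k"
proof -
 obtain s where s: "s_succ MS B b s" "s <= b * b" using sq assms by (auto simp: square_def)
 then show 1: "s_succ MS B b (sc B b)" using succ_sc by simp
 show "sc B b <= b * b" using s succ_sc by simp
 show "EX k. sc B b = b * k" using succ_dvd[OF 1 assms] .
 show "B (sc B b)" "b < sc B b" "B x ==> b < x ==> sc B b <= x" using 1 by (auto simp: s_succ_def)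
qed

lemma lsucc_iff: "B b ==> s_lsucc MS B b t <-> t < sc B b"
 using sc(1) succ_sc by (auto simp: s_lsucc_def)

lemma bs_lt: "mn B <= n ==> n < sc B (bs B n)"
 by (metis bs sc(2,3) not_le)

lemma bs_eq: "B b ==> b <= n ==> n < sc B b ==> bs B n = b"
proof -
 assume h: "B b" "b <= n" "n < sc B b"
 have m: "mn B <= n" using h mn(2) by (meson order.trans)
 have "b <= bs B n" using bs(3)[OF m] h by blast
 moreover have "\<not> b < bs B n" using sc(4)[OF h(1) bs(1)[OF m]] bs(2)[OF m] h(3) by auto
 ultimately show ?thesis by simp
qed

lemma digit_less: "B b ==> b * a < sc B b ==> a < b"
 using mul_less_cancel[of b a b] sc(5)[of b] by (meson less_le_trans)

lemma dec: assumes "mn B <= n"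
 obtains a r where "n = bs B n * a + r" "r < bs B n" "0 < a" "a < bs B n" "bs B n * a < sc B (bs B n)"
proof -
 note b = bs[OF assms]
 have "0 < bs B n" using B_gt1[OF b(1)] by (rule order.strict_trans[rotated]) simp
 from division[OF this] obtain a r where n: "n = bs B n * a + r" "r < bs B n" by blast
 have "0 < a"
 proof (rule ccontr)
  assume "\<not> 0 < a"
  then have "a = 0" by (simp add: pos_iff)
  then show False using n b(2) by simp
 qed
 moreover have "bs B n * a < sc B (bs B n)" using bs_lt[OF assms] n(1) by (metis add_increasing2 leD leI mnum_nonneg order_refl order.strict_trans1)
 ultimately show thesis using that n digit_less b(1) by blast
qed

text \<open>The next base is a multiple of \<open>b\<close>, so the numbers with base
  \<open>b\<close> form complete blocks of length \<open>b\<close>.\<close>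

lemma bs_dec: assumes "B b" "0 < a" "b * a < sc B b" "r < b"
 shows "b * a + r < sc B b" "bs B (b * a + r) = b" "mn B <= b * a + r"
proof -
 obtain k where k: "sc B b = b * k" using sc(6)[OF assms(1)] by blast
 then have "a < k" using assms(3) by (simp add: mul_less_cancel)
 then show 1: "b * a + r < sc B b" using mul_add_less assms(4) k by simp
 have "b * 1 <= b * a" using assms(2) by (intro mult_left_mono) (simp_all flip: add1_le)
 then have 2: "b <= b * a + r" by (simp add: add_increasing2)
 then show "bs B (b * a + r) = b" using 1 assms(1) by (intro bs_eq)
 show "mn B <= b * a + r" using mn(2)[OF assms(1)] 2 by simp
qed

end

lemma expo_of_set:
 assumes "E : SS" "s_fun MS E" "pp 0 1 : E" "!!x y. pp x y : E ==> pp (x + 1) (y * b) : E"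
 obtains h where "h 0 = 1" "!!x. h (x + 1) = h x * b" "tm (%e. h (e 0))" "!!x y. pp x y : E <-> y = h x"
proof -
 define h where "h = (%x. THE y. pp x y : E)"
 have h: "pp x y : E <-> y = h x" for x y
  using assms(2) unfolding h_def s_fun_def by simp (metis (mono_tags, lifting) the_equality)
 moreover have "tm (%e. h (e 0))"
 proof -
  have "df (%e. pp (e 1) (e 0) : E)" by (intro df_intros tm_pp assms(1))
  then show ?thesis using tm_graph[of "%a b c. pp b a : E" "%b c. h b"] by (simp add: h tm_def)
 qed
 moreover have "h 0 = 1" using h[of 0 1] assms(3) by simp
 moreover have "h (x + 1) = h x * b" for x using h[of x "h x"] h[of "x + 1" "h x * b"] assms(4)[of x "h x"] by simp
 ultimately show thesis using that[of h] by simp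
qed

lemma expo_of_pow: assumes "s_pow MS b e p" "1 < b" obtains pw where "expo pw b"
proof -
 obtain E where E: "E : SS" "s_fun MS E" "pp 0 1 : E" "!!x y. pp x y : E ==> pp (x + 1) (y * b) : E"
  using assms(1) by (auto simp: s_pow_def)
 then obtain h where "h 0 = 1" "!!x. h (x + 1) = h x * b" "tm (%e. h (e 0))" by (rule expo_of_set) blast+
 then have "expo h b" using assms(2) by unfold_locales
 then show thesis using that by blast
qed

context expo
begin

lemma pow_ex: obtains h where "h 0 = 1" "!!x. h (x + 1) = h x * d" "tm (%e. h (e 0))" "!!e p. s_pow MS d e p <-> p = h e"
proof -
 obtain g where g: "!!p. g p 0 = 1" "!!p k. g p (k + 1) = g p k * d" "tm (%e. g (e 0) (e 1))"
 proof (rule recursion[of "%p k v. v * d" "%p. 1"])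
  show "tm (%e. e 2 * d)" "tm (%e. 1)" by (intro df_intros)+
 qed blast
 define h where "h = g 0"
 have th: "tm (%e. h (f e))" if "tm f" for f
  unfolding h_def by (rule tm_comp2[OF g(3) tm_zero that])
 let ?E = "{z. EX x. z = pp x (h x)}"
 have E: "?E : SS" by (rule comprehension[of "%e. EX x. e 0 = pp x (h x)"]) (intro df_intros tm_pp th)
 have "s_pow MS d e p <-> p = h e" for e p
 proof
  assume "p = h e"
  then show "s_pow MS d e p"
   unfolding s_pow_def using E by (intro bexI[of _ ?E]) (auto simp: s_fun_def h_def g)
 next
  assume "s_pow MS d e p"
  then obtain E where E: "E : SS" "s_fun MS E" "pp 0 1 : E" "!!x y. pp x y : E ==> pp (x + 1) (y * d) : E" "pp e p : E"
   by (auto simp: s_pow_def)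
  from E(1-4) obtain k where k: "k 0 = 1" "!!x. k (x + 1) = k x * d" "tm (%e. k (e 0))" "!!x y. pp x y : E <-> y = k x"
   by (rule expo_of_set) blast+
  have "k x = h x" for x
  proof (rule ind[of "%x. k x = h x"])
   show "df (%e. k (e 0) = h (e 0))" by (intro df_intros th k(3))
  qed (simp_all add: k h_def g)
  then show "p = h e" using E(5) k(4) by simp
 qed
 then show thesis using that[of h] g th[OF tm_var[of 0]] by (simp add: h_def)
qed

lemma pow1: "s_pow MS d 1 p <-> p = d"
proof -
 obtain h where "h 0 = 1" "!!x. h (x + 1) = h x * d" "!!e p. s_pow MS d e p <-> p = h e" by (rule pow_ex[of d]) blast
 then show ?thesis by (metis add_0 mult_1)
qed

lemma s_dec_iff: assumes "1 < b" "b <= n" "n < b * b"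
 shows "s_dec MS b n e a r <-> e = 1 & n = b * a + r & 0 < a & a < b & r < b"
proof -
 obtain h where h: "h 0 = 1" "!!x. h (x + 1) = h x * b" "tm (%e. h (e 0))" "!!e p. s_pow MS b e p <-> p = h e" by (rule pow_ex[of b]) blast
 interpret H: expo h b by unfold_locales (use h assms in auto)
 have h1: "h 1 = b" using h(1) h(2)[of 0] by simp
 have "e = 1" if "h e <= n" "n < h (e + 1)"
 proof (rule ccontr)
  assume ne: "e ~= 1"
  from mnum_cases[of e] show False
  proof
   assume "e = 0"
   then show False using that h1 assms(2) by simp
  next
   assume "EX x. e = x + 1"
   then obtain x where x: "e = x + 1" by blast
   then have "x ~= 0" using ne by auto
   then obtain y where "x = y + 1" using mnum_cases[of x] by blast
   then have "e = (1 + 1) + y" using x by (metis add.assoc add.commute)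
   then obtain k where k: "0 < k" "h e = k * h (1 + 1)" using H.pw_dvd[of "1 + 1" y] by auto
   have "1 * (b * b) <= k * (b * b)" using k(1) by (intro mult_right_mono) (simp_all flip: add1_le)
   also have "\<dots> = h e" using k h(2)[of 1] h1 by simp
   finally show False using that(1) assms(3) by simp
  qed
 qed
 moreover have "h 1 <= n" "n < h (1 + 1)" using assms h(2)[of 1] h1 by simp_all
 ultimately show ?thesis unfolding s_dec_def h(4) using h1 h(2)[of 1] by (auto simp: h(4))
qed

end

locale step =
 B: hq B + C: hier C for B C :: "mnum => bool" +
 assumes good: "s_good MS B C"
begin

lemma mn_le: "mn B <= mn C" using good by (auto simp: s_good_def B.min_iff C.min_iff)

lemma U_cl:
 assumes "s_ur MS B C U V"
 shows "pp n v : U <-> (n < mn B & v = n) \<or> (mn B <= n & (EX b d. s_base MS B n b & s_adm MS C U V b n d &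
  (ALL d'. s_adm MS C U V b n d' --> d <= d') & s_inV MS V b d n v))"
proof -
 note assms[unfolded s_ur_def B.min_iff MS_simps, THEN conjunct1, THEN spec, of n, THEN spec, of v]
 then show ?thesis .
qed

lemma V_cl:
 assumes "s_ur MS B C U V" "B b" "C d"
 shows "s_inV MS V b d m v <-> (m < b & pp m v : U) \<or> (b <= m & (EX e a r e' a' r' p. s_dec MS b m e a r &
   s_inV MS V b d e e' & pp a a' : U & s_inV MS V b d r r' & s_pow MS d e' p & v = p * a' + r'))"
proof -
 note assms(1)[unfolded s_ur_def B.min_iff MS_simps, THEN conjunct2, THEN spec, of b, THEN spec, of d, THEN spec, of m,
  THEN spec, of v, THEN HOL.mp, OF conjI[OF assms(2,3)]]
 then show ?thesis .
qed

text \<open>The upgrade of \<open>mn B\<close> exists, and its computation decomposes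
  \<open>mn B\<close> in base \<open>mn B\<close>. The set that witnesses the power in this
  decomposition is the graph of an exponential function.\<close>

lemma expo_ex: "EX pw. expo pw (mn B)"
proof -
 have "EX v. s_up MS B C (mn B) v" using good by (simp add: s_good_def)
 then obtain v U V where UV: "s_ur MS B C U V" "pp (mn B) v : U" unfolding s_up_def by auto
 then obtain b d where b: "s_base MS B (mn B) b" "s_inV MS V b d (mn B) v" "C d"
  using UV(2) unfolding U_cl[OF UV(1)] s_adm_def by auto
 have bm: "b = mn B" using b(1) B.s_base_iff[of "mn B"] B.bs[of "mn B"] B.mn by (metis antisym order_refl)
 have "B b" unfolding bm by (rule B.mn)
 then have "EX e a r. s_dec MS b (mn B) e a r"
  using V_cl[OF UV(1) \<open>B b\<close> b(3), THEN iffD1, OF b(2)] bm by auto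
 then obtain e p where "s_pow MS b e p" by (auto simp: s_dec_def)
 then show ?thesis using expo_of_pow[of b e p] B.mn_gt1 bm by metis
qed

definition wv :: "mnum set => mnum => mnum => mnum => mnum => bool" where
 "wv U a r d v <-> (EX a' r'. pp a a' : U & pp r r' : U & v = d * a' + r')"
definition adm :: "mnum set => mnum => mnum => mnum => mnum => bool" where
 "adm U n a r d <-> C d & (EX u v. pp (n - 1) u : U & wv U a r d v & u < v & s_lsucc MS C d v)"

lemma U_small: assumes "s_ur MS B C U V" "n < mn B" shows "pp n v : U <-> v = n"
 unfolding U_cl[OF assms(1)] using assms(2) by (simp add: not_le[symmetric])

text \<open>Since \<open>n\<close> is below the square of its base, the exponent is 1; the base
  change of 1 is 1, because 1 is below every base; and the remainder is below the base too. Hence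
  \<open>V\<close> drops out and the clause speaks of \<open>U\<close> alone.\<close>

lemma U_large:
 assumes ur: "s_ur MS B C U V" and n: "mn B <= n" "n = bs B n * a + r" "r < bs B n"
 shows "pp n v : U <-> (EX d. adm U n a r d & (ALL d'. adm U n a r d' --> d <= d') & wv U a r d v)"
proof -
 obtain pw where "expo pw (mn B)" using expo_ex by blast
 then interpret expo pw "mn B" .
 let ?b = "bs B n"
 note b = B.bs[OF n(1)]
 have b1: "1 < ?b" using B.B_gt1 b by blast
 have lt: "n < ?b * ?b" using B.bs_lt[OF n(1)] B.sc(5)[OF b(1)] by simp
 have V: "s_inV MS V b d m v <-> (m < b & pp m v : U) \<or> (b <= m & (EX e a r e' a' r' p. s_dec MS b m e a r &
   s_inV MS V b d e e' & pp a a' : U & s_inV MS V b d r r' & s_pow MS d e' p & v = p * a' + r'))"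
  if "B b" "C d" for b d m v
  using V_cl[OF ur that] .
 have Vs: "s_inV MS V ?b d m v <-> pp m v : U" if "C d" "m < ?b" for d m v
  using V[OF b(1) that(1), of m v] that(2) by auto
 have a: "0 < a" "a < ?b"
 proof -
  obtain a' r' where "n = ?b * a' + r'" "r' < ?b" "0 < a'" "a' < ?b" by (rule B.dec[OF n(1)])
  moreover from this have "a' = a" using dec_unique[of ?b a' r' a r] n by metis
  ultimately show "0 < a" "a < ?b" by simp_all
 qed
 have V1: "s_inV MS V ?b d 1 v <-> v = 1" if "C d" for d v
  using Vs[OF that b1] U_small[OF ur B.mn_gt1] by simp
 have dec: "s_dec MS ?b n e a' r' <-> e = 1 & a' = a & r' = r" for e a' r'
  unfolding s_dec_iff[OF b1 b(2) lt] using dec_unique[of ?b a' r' a r] n a by metis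
 have Vn: "s_inV MS V ?b d n v <-> wv U a r d v" if "C d" for d v
 proof -
  have "s_inV MS V ?b d n v <-> (EX e' a' r' p. s_inV MS V ?b d 1 e' & pp a a' : U & s_inV MS V ?b d r r' &
    s_pow MS d e' p & v = p * a' + r')"
   using V[OF b(1) that, of n v] b(2) dec by (simp only: not_less[symmetric]) blast
  then show ?thesis unfolding V1[OF that] Vs[OF that n(3)] wv_def by (auto simp: pow1)
 qed
 have n0: "0 < n" using B.mn_pos n(1) by simp
 have ad: "s_adm MS C U V ?b n d <-> adm U n a r d" for d
 proof -
  have "n = n' + 1 <-> n' = n - 1" for n' using mnum_minus1[OF n0] by auto
  then show ?thesis unfolding s_adm_def adm_def using Vn by auto blast+
 qed
 have "pp n v : U <-> (EX d. s_adm MS C U V ?b n d & (ALL d'. s_adm MS C U V ?b n d' --> d <= d') & s_inV MS V ?b d n v)"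
  unfolding U_cl[OF ur] using n(1) by (simp add: B.s_base_iff not_less[symmetric])
 then show ?thesis unfolding ad using Vn by (auto simp: adm_def)
qed

text \<open>Course-of-values induction: digit, remainder and predecessor of \<open>n\<close> are
  smaller than \<open>n\<close>. Agreement is definable because both graphs are sets of the
  model.\<close>

lemma U_unique:
 assumes ur: "s_ur MS B C U V" "s_ur MS B C U' V'" and U: "U : SS" "U' : SS"
 shows "pp n v : U ==> pp n w : U' ==> v = w"
proof -
 let ?P = "%n. (ALL v. pp n v : U <-> pp n v : U') & (ALL v w. pp n v : U --> pp n w : U --> v = w)"
 have "?P n"
 proof (rule less_ind[of ?P])
  show "df (%e. ?P (e 0))" by (intro df_intros tm_pp U)
  fix n assume IH: "!!m. m < n ==> ?P m"
  show "?P n"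
  proof (cases "n < mn B")
   case True
   then show ?thesis using U_small[OF ur(1)] U_small[OF ur(2)] by simp
  next
   case False
   then have n: "mn B <= n" by simp
   obtain a r where ar: "n = bs B n * a + r" "r < bs B n" "a < bs B n" using B.dec[OF n] by metis
   have bn: "bs B n <= n" using B.bs(2)[OF n] .
   have lt: "a < n" "r < n" "n - 1 < n"
    using ar bn mnum_minus1[of n] B.mn_pos n by (auto intro: less_le_trans) (metis add1_le order_refl less_le_trans)
   have wv: "wv U a r d v <-> wv U' a r d v" for d v
    unfolding wv_def using IH[OF lt(1)] IH[OF lt(2)] by simp
   have ad: "adm U n a r d <-> adm U' n a r d" for d
    unfolding adm_def wv using IH[OF lt(3)] by simp
   have "v = w" if "wv U a r d v" "wv U a r d w" for d v w
    using that IH[OF lt(1)] IH[OF lt(2)] unfolding wv_def by metis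
   then have "v = w" if "adm U n a r d" "ALL d'. adm U n a r d' --> d <= d'" "wv U a r d v"
    "adm U n a r d'" "ALL d''. adm U n a r d'' --> d' <= d''" "wv U a r d' w" for d d' v w
    using that antisym[of d d'] by blast
   then have "ALL v w. pp n v : U --> pp n w : U --> v = w"
    unfolding U_large[OF ur(1) n ar(1,2)] by blast
   moreover have "ALL v. pp n v : U <-> pp n v : U'"
    unfolding U_large[OF ur(1) n ar(1,2)] U_large[OF ur(2) n ar(1,2)] by (simp only: wv ad simp_thms)
   ultimately show ?thesis by blast
  qed
 qed
 then show "pp n v : U ==> pp n w : U' ==> v = w" by blast
qed

definition up :: "mnum => mnum" where "up n = (THE v. s_up MS B C n v)"

lemma up_iff: "s_up MS B C n v <-> v = up n"
proof -
 have "EX v. s_up MS B C n v" using good by (simp add: s_good_def)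
 moreover have "s_up MS B C n v ==> s_up MS B C n w ==> v = w" for v w
  unfolding s_up_def using U_unique by auto
 ultimately show ?thesis unfolding up_def by (metis the_equality)
qed

text \<open>A priori each argument comes with its own witness. By induction all values of any other
  witness also occur in the one fixed here.\<close>

lemma U_ex: obtains U V where "U : SS" "s_ur MS B C U V" "!!n v. pp n v : U <-> v = up n"
proof -
 obtain U V where U: "U : SS" "V : SS" "s_ur MS B C U V" using good unfolding s_good_def s_up_def by auto
 have "pp n v : U <-> v = up n" for n v
 proof
  assume "pp n v : U"
  then show "v = up n" using U up_iff unfolding s_up_def by auto
 next
  obtain U' V' where U': "U' : SS" "s_ur MS B C U' V'" "pp n (up n) : U'"
   using up_iff[of n "up n"] unfolding s_up_def by auto
  assume v: "v = up n"
  have "pp n (up n) : U"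
  proof -
   let ?P = "%n. ALL v. pp n v : U' --> pp n v : U"
   have "?P n"
   proof (rule less_ind[of ?P])
    show "df (%e. ?P (e 0))" by (intro df_intros tm_pp U U')
    fix n assume IH: "!!m. m < n ==> ?P m"
    show "?P n"
    proof (cases "n < mn B")
     case True
     then show ?thesis using U_small[OF U(3)] U_small[OF U'(2)] by simp
    next
     case False
     then have n: "mn B <= n" by simp
     obtain a r where ar: "n = bs B n * a + r" "r < bs B n" "a < bs B n" using B.dec[OF n] by metis
     have lt: "a < n" "r < n" "n - 1 < n"
      using ar B.bs(2)[OF n] mnum_minus1[of n] B.mn_pos n by (auto intro: less_le_trans) (metis add1_le order_refl less_le_trans)
     have imp: "pp m v : U' --> pp m v : U" if "m < n" for m v using IH[OF that] by blast
     show ?thesis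
     proof (intro allI impI)
      fix v assume v: "pp n v : U'"
      then obtain d where d: "adm U' n a r d" "ALL d'. adm U' n a r d' --> d <= d'" "wv U' a r d v"
       unfolding U_large[OF U'(2) n ar(1,2)] by blast
      then obtain a' r' u where *: "pp a a' : U'" "pp r r' : U'" "pp (n - 1) u : U'" unfolding adm_def wv_def by blast
      have un: "pp m x : U <-> x = y" "pp m x : U' <-> x = y" if "pp m y : U'" "m < n" for m x y
       using U_unique[OF U(3) U'(2) U(1) U'(1)] U_unique[OF U'(2) U'(2) U'(1) U'(1)] imp that by blast+
      have "wv U a r d v <-> wv U' a r d v" for d v
       unfolding wv_def using un[OF *(1) lt(1)] un[OF *(2) lt(2)] by simp
      moreover from this have "adm U n a r d <-> adm U' n a r d" for d
       unfolding adm_def using un[OF *(3) lt(3)] by simp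
      ultimately show "pp n v : U" unfolding U_large[OF U(3) n ar(1,2)] using d by blast
     qed
    qed
   qed
   then show ?thesis using U'(3) by blast
  qed
  then show "pp n v : U" using v by simp
 qed
 then show thesis using that U by blast
qed

lemma tm_up0: "tm (%e. up (e 0))"
proof -
 obtain U V where U: "U : SS" "!!n v. pp n v : U <-> v = up n" using U_ex by metis
 have "df (%e. pp (e 1) (e 0) : U)" by (intro df_intros tm_pp U)
 then show ?thesis using U(2) by (simp add: tm_def)
qed
lemma tm_up: "tm f ==> tm (%e. up (f e))" by (rule tm_comp1[OF tm_up0])

lemma up_small: "n < mn B ==> up n = n"
 using U_ex U_small by metis

section \<open>The base chosen by an upgrade\<close>

definition dd :: "mnum => mnum" where
 "dd n = (THE d. EX a r. n = bs B n * a + r & r < bs B n & up n = d * up a + up r)"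

lemma up_large0: assumes n: "mn B <= n" "n = bs B n * a + r" "r < bs B n"
 shows "EX d. C d & up n = d * up a + up r & up (n - 1) < up n & s_lsucc MS C d (up n) &
  (ALL d'. C d' --> up (n - 1) < d' * up a + up r --> s_lsucc MS C d' (d' * up a + up r) --> d <= d')"
proof -
 obtain U V where U: "U : SS" "s_ur MS B C U V" "!!n v. pp n v : U <-> v = up n" using U_ex by metis
 have "pp n (up n) : U" using U(3) by simp
 then obtain d where d: "adm U n a r d" "ALL d'. adm U n a r d' --> d <= d'" "wv U a r d (up n)"
  unfolding U_large[OF U(2) n] by blast
 then show ?thesis unfolding adm_def wv_def U(3) by (intro exI[of _ d]) auto
qed

lemma up_0: "up 0 = 0" and up_1: "up 1 = 1"
 using up_small B.mn_gt1 B.mn_pos by auto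

lemma up_step: "up n < up (n + 1)"
proof (cases "n + 1 < mn B")
 case True
 then have "n < mn B" by (metis less_add1 less_trans order_refl)
 then show ?thesis using up_small True by simp
next
 case False
 then have n: "mn B <= n + 1" by simp
 obtain a r where "n + 1 = bs B (n + 1) * a + r" "r < bs B (n + 1)" using B.dec[OF n] by metis
 then show ?thesis using up_large0[OF n] by auto
qed

lemma up_mono: "m < n ==> up m < up n"
proof -
 have "m < n --> up m < up n"
 proof (rule ind[of "%n. m < n --> up m < up n"])
  show "df (%e. m < e 0 --> up m < up (e 0))" by (intro df_intros tm_up)
  show "m < n + 1 --> up m < up (n + 1)" if "m < n --> up m < up n" for n
  proof
   assume "m < n + 1"
   then have "m < n \<or> m = n" by (simp only: less_add1 le_less)
   then show "up m < up (n + 1)" using that up_step[of n] less_trans[of "up m" "up n"] by blast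
  qed
 qed (simp add: not_less)
 then show "m < n ==> up m < up n" by blast
qed

lemma up_less: "up m < up n <-> m < n" by (metis less_asym less_lin up_mono)
lemma up_le: "up m <= up n <-> m <= n" by (metis not_le up_less)

lemma up_ge: "n <= up n"
proof (rule ind[of "%n. n <= up n"])
 show "df (%e. e 0 <= up (e 0))" by (intro df_intros tm_up)
 show "n + 1 <= up (n + 1)" if "n <= up n" for n
  using that up_step[of n] by (simp only: add1_le)
qed simp

lemma up_pos: "0 < a ==> 0 < up a" using up_mono[of 0 a] up_0 by simp

lemma dd:
 assumes n: "mn B <= n" "n = bs B n * a + r" "r < bs B n"
 shows "C (dd n)" "up n = dd n * up a + up r" "s_lsucc MS C (dd n) (up n)"
  "C d ==> up (n - 1) < d * up a + up r ==> s_lsucc MS C d (d * up a + up r) ==> dd n <= d"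
proof -
 obtain d where d: "C d" "up n = d * up a + up r" "s_lsucc MS C d (up n)"
  "!!d'. C d' ==> up (n - 1) < d' * up a + up r ==> s_lsucc MS C d' (d' * up a + up r) ==> d <= d'"
  using up_large0[OF n] by blast
 have "0 < a"
 proof (rule ccontr)
  assume "\<not> 0 < a"
  then have "a = 0" by (simp add: pos_iff)
  then show False using n B.bs(2)[OF n(1)] by simp
 qed
 then have up: "0 < up a" by (rule up_pos)
 have "dd n = d"
  unfolding dd_def
 proof (rule the_equality)
  show "EX a r. n = bs B n * a + r & r < bs B n & up n = d * up a + up r" using n d by blast
  fix d' assume "EX a r. n = bs B n * a + r & r < bs B n & up n = d' * up a + up r"
  then obtain a' r' where ar: "n = bs B n * a' + r'" "r' < bs B n" "up n = d' * up a' + up r'" by blast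
  then have "a' = a & r' = r" using dec_unique[of "bs B n" a' r' a r] n by metis
  then have "d' * up a = d * up a" using ar(3) d(2) by simp
  then show "d' = d" using up by (simp add: mul_cancel)
 qed
 then show "C (dd n)" "up n = dd n * up a + up r" "s_lsucc MS C (dd n) (up n)"
  "C d' ==> up (n - 1) < d' * up a + up r ==> s_lsucc MS C d' (d' * up a + up r) ==> dd n <= d'" for d'
  using d by blast+
qed

lemma dd_le: assumes "mn B <= n" shows "dd n <= up n" "C (dd n)"
proof -
 obtain a r where ar: "n = bs B n * a + r" "r < bs B n" "0 < a" using B.dec[OF assms] by metis
 note d = dd[OF assms ar(1,2)]
 have "dd n * 1 <= dd n * up a" using up_pos[OF ar(3)] by (intro mult_left_mono) (simp_all flip: add1_le)
 then show "dd n <= up n" unfolding d(2) by (simp add: add_increasing2)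
 show "C (dd n)" by (rule d)
qed

text \<open>If the chosen base dropped, \<open>up (n + 1)\<close> would lie below the successor of
  the new base, hence below \<open>dd n <= up n\<close>.\<close>

lemma dd_mono: assumes "mn B <= n" shows "dd n <= dd (n + 1)"
proof (rule ccontr)
 have n1: "mn B <= n + 1" using assms by (simp add: add_increasing2)
 obtain a r where ar: "n + 1 = bs B (n + 1) * a + r" "r < bs B (n + 1)" using B.dec[OF n1] by metis
 assume "\<not> dd n <= dd (n + 1)"
 then have lt: "dd (n + 1) < dd n" by simp
 then obtain s where s: "s_succ MS C (dd (n + 1)) s" using C.succ_ex[of "dd n"] dd_le[OF assms] by blast
 then have "s <= dd n" using lt dd_le[OF assms] by (auto simp: s_succ_def)
 moreover have "up (n + 1) < s" using dd(3)[OF n1 ar] s by (simp add: s_lsucc_def)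
 ultimately have "up (n + 1) < up n" using dd_le(1)[OF assms] by simp
 then show False using up_step[of n] by simp
qed

lemma bs_B: "B b ==> bs B b = b" using B.bs_eq B.sc(3) by blast

lemma base_dec: "B b ==> b = bs B b * 1 + 0" "B b ==> 0 < bs B b" "B b ==> mn B <= b"
 using bs_B B.B_gt1[of b] B.mn(2) by (auto intro: order.strict_trans[rotated])

lemma up_base_dd: "B b ==> up b = dd b"
 using dd(2)[OF base_dec(3,1,2)] by (simp add: up_0 up_1)

lemma dd_ge_base: assumes "B b" "n < sc B b" "b <= n" shows "up b <= dd n"
proof -
 \<comment> \<open>The base is described through digits and values of \<open>up\<close>: induction
   applies to definable statements, and \<open>up\<close> is known to be definable.\<close>
 have "b <= n --> n < sc B b --> (EX d a r. up b <= d & n = b * a + r & r < b & up n = d * up a + up r)"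
 proof (rule ind[of "%n. b <= n --> n < sc B b --> (EX d a r. up b <= d & n = b * a + r & r < b & up n = d * up a + up r)"])
  show "df (%e. b <= e 0 --> e 0 < sc B b --> (EX d a r. up b <= d & e 0 = b * a + r & r < b & up (e 0) = d * up a + up r))"
   by (intro df_intros tm_up)
  show "b <= 0 --> 0 < sc B b --> (EX d a r. up b <= d & 0 = b * a + r & r < b & up 0 = d * up a + up r)"
   using B.B_gt1[OF assms(1)] by (auto simp: not_le[symmetric] intro: order.strict_trans[rotated])
  fix n assume IH: "b <= n --> n < sc B b --> (EX d a r. up b <= d & n = b * a + r & r < b & up n = d * up a + up r)"
  show "b <= n + 1 --> n + 1 < sc B b --> (EX d a r. up b <= d & n + 1 = b * a + r & r < b & up (n + 1) = d * up a + up r)"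
  proof (intro impI)
   assume n: "b <= n + 1" "n + 1 < sc B b"
   have m: "mn B <= n + 1" using B.mn(2)[OF assms(1)] n(1) by simp
   have bb: "bs B (n + 1) = b" using B.bs_eq assms(1) n by blast
   obtain a r where ar: "n + 1 = b * a + r" "r < b" using B.dec[OF m] bb by metis
   have "up b <= dd (n + 1)"
   proof (cases "n + 1 = b")
    case True
    then show ?thesis using up_base_dd[OF assms(1)] by simp
   next
    case False
    then have bn: "b <= n" using n(1) by (metis less_add1 less_le)
    have "n < n + 1" by simp
    then have n2: "n < sc B b" using n(2) by (rule less_trans)
    obtain d a' r' where d: "up b <= d" "n = b * a' + r'" "r' < b" "up n = d * up a' + up r'" using IH bn n2 by blast
    have m': "mn B <= n" using B.mn(2)[OF assms(1)] bn by simp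
    have b': "bs B n = b" using B.bs_eq assms(1) bn n2 by blast
    have "0 < a'"
    proof (rule ccontr)
     assume "\<not> 0 < a'"
     then show False using d bn by (simp add: pos_iff)
    qed
    moreover have "up n = dd n * up a' + up r'" using dd(2)[OF m'] b' d by metis
    ultimately have "dd n = d" using d(4) up_pos[of a'] by (simp add: mul_cancel)
    then show ?thesis using dd_mono[OF m'] d(1) by simp
   qed
   then show "EX d a r. up b <= d & n + 1 = b * a + r & r < b & up (n + 1) = d * up a + up r"
    using dd(2)[OF m, of a r] bb ar by metis
  qed
 qed
 then obtain d a r where d: "up b <= d" "n = b * a + r" "r < b" "up n = d * up a + up r" using assms by blast
 have m': "mn B <= n" using B.mn(2)[OF assms(1)] assms(3) by simp
 have b': "bs B n = b" using B.bs_eq assms by blast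
 have "0 < a"
 proof (rule ccontr)
  assume "\<not> 0 < a"
  then show False using d assms(3) by (simp add: pos_iff)
 qed
 moreover have "up n = dd n * up a + up r" using dd(2)[OF m'] b' d by metis
 ultimately have "dd n = d" using d(4) up_pos[of a] by (simp add: mul_cancel)
 then show ?thesis using d(1) by simp
qed

lemma succ_gt_mult: assumes "s_succ MS C d s" "C d" "d * x < s" "r < d" shows "d * x + r < s"
proof -
 obtain k where k: "s = d * k" using C.succ_dvd assms by blast
 then have "x < k" using assms(3) by (simp add: mul_less_cancel)
 then show ?thesis using mul_add_less assms(4) k by simp
qed

text \<open>When only the remainder grows, the base \<open>?d\<close> stays admissible: its
  successor is a multiple of it, and the new upgraded remainder is below \<open>up b <= ?d\<close>.
  By monotonicity no smaller base is possible.\<close>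

lemma dd_const:
 assumes b: "B b" "0 < a" "b * a < sc B b" and r: "r < b"
 shows "dd (b * a + r) = dd (b * a)"
proof -
 have b0: "0 < b" using B.B_gt1[OF b(1)] by (rule order.strict_trans[rotated]) simp
 have "r < b --> up (b * a + r) = dd (b * a) * up a + up r"
 proof (rule ind[of "%r. r < b --> up (b * a + r) = dd (b * a) * up a + up r"])
  show "df (%e. e 0 < b --> up (b * a + e 0) = dd (b * a) * up a + up (e 0))" by (intro df_intros tm_up)
  show "0 < b --> up (b * a + 0) = dd (b * a) * up a + up 0"
   using dd(2)[of "b * a" a 0] B.bs_dec[OF b b0] b0 by simp
  fix r assume IH: "r < b --> up (b * a + r) = dd (b * a) * up a + up r"
  show "r + 1 < b --> up (b * a + (r + 1)) = dd (b * a) * up a + up (r + 1)"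
  proof
   assume r1: "r + 1 < b"
   then have r: "r < b" by (metis less_add1 less_trans order_refl)
   note f = B.bs_dec[OF b r] and g = B.bs_dec[OF b r1] and z = B.bs_dec[OF b b0, unfolded add_0_right]
   let ?n = "b * a + r" let ?m = "b * a + (r + 1)" let ?d = "dd ?n"
   have e: "?m - 1 = ?n" "?m = ?n + 1" by (simp_all add: add.assoc[symmetric])
   have n: "up ?n = ?d * up a + up r" "C ?d" "s_lsucc MS C ?d (up ?n)" using dd[OF f(3), of a r] f r by metis+
   have ub: "up b <= ?d"
   proof (rule dd_ge_base[OF b(1) f(1)])
    have "b * 1 <= b * a" using b(2) by (intro mult_left_mono) (simp_all flip: add1_le)
    then show "b <= ?n" by (simp add: add_increasing2)
   qed
   then have lt: "up (r + 1) < ?d" using up_mono[OF r1] by simp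
   have "dd ?m <= ?d"
   proof (rule dd(4)[OF g(3), of a "r + 1"])
    show "?m = bs B ?m * a + (r + 1)" "r + 1 < bs B ?m" using g r1 by simp_all
    show "C ?d" by (rule n)
    show "up (?m - 1) < ?d * up a + up (r + 1)" using up_step[of r] n(1) e(1) by simp
    show "s_lsucc MS C ?d (?d * up a + up (r + 1))"
     unfolding s_lsucc_def
    proof (intro ballI impI)
     fix s assume s: "s_succ MS C ?d s"
     have "?d * up a <= up ?n" unfolding n(1) by simp
     then have "?d * up a < s" using n(3) s by (auto simp: s_lsucc_def intro: order.strict_trans1)
     then show "Ls MS (?d * up a + up (r + 1)) s" using succ_gt_mult[OF s n(2) _ lt] by simp
    qed
   qed
   moreover have "?d <= dd ?m" unfolding e(2) by (rule dd_mono[OF f(3)])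
   ultimately have dm: "dd ?m = ?d" by simp
   have "up ?n = dd (b * a) * up a + up r" using IH r by blast
   then have "?d * up a = dd (b * a) * up a" using n(1) by simp
   then have "?d = dd (b * a)" using up_pos[OF b(2)] by (simp add: mul_cancel)
   moreover have "up ?m = dd ?m * up a + up (r + 1)" using dd(2)[OF g(3), of a "r + 1"] g r1 by metis
   ultimately show "up ?m = dd (b * a) * up a + up (r + 1)" using dm by simp
  qed
 qed
 then have "up (b * a + r) = dd (b * a) * up a + up r" using r by blast
 moreover have "up (b * a + r) = dd (b * a + r) * up a + up r"
  using dd(2)[of "b * a + r" a r] B.bs_dec[OF b r] r by metis
 ultimately show ?thesis using up_pos[OF b(2)] by (simp add: mul_cancel)
qed

lemma up_dec:
 assumes b: "B b" "0 < a" "b * a < sc B b"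
 shows "C (dd (b * a))" "up b <= dd (b * a)" "up a < dd (b * a)"
  "r < b ==> up (b * a + r) = dd (b * a) * up a + up r" "r < b ==> up r < dd (b * a)"
  "s_lsucc MS C (dd (b * a)) (dd (b * a) * up a)"
  "C e ==> up (b * a - 1) < e * up a ==> s_lsucc MS C e (e * up a) ==> dd (b * a) <= e"
proof -
 have b0: "0 < b" using B.B_gt1[OF b(1)] by (rule order.strict_trans[rotated]) simp
 note z = B.bs_dec[OF b b0, unfolded add_0_right]
 have zd: "b * a = bs B (b * a) * a + 0" "0 < bs B (b * a)" using z b0 by simp_all
 note d = dd[OF z(3) zd]
 have "b * 1 <= b * a" using b(2) by (intro mult_left_mono) (simp_all flip: add1_le)
 then show ub: "up b <= dd (b * a)" using dd_ge_base[OF b(1) z(1)] by simp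
 show "C (dd (b * a))" by (rule d)
 have "a < b" using B.digit_less b by blast
 then show "up a < dd (b * a)" using up_mono ub by (meson less_le_trans)
 show "r < b ==> up r < dd (b * a)" using up_mono ub by (meson less_le_trans)
 show "s_lsucc MS C (dd (b * a)) (dd (b * a) * up a)" using d(2,3) by (simp add: up_0)
 show "C e ==> up (b * a - 1) < e * up a ==> s_lsucc MS C e (e * up a) ==> dd (b * a) <= e"
  using d(4)[of e] by (simp add: up_0)
 assume r: "r < b"
 show "up (b * a + r) = dd (b * a) * up a + up r"
  using dd(2)[of "b * a + r" a r] B.bs_dec[OF b r] r dd_const[OF b r] by metis
qed

lemma up_mn: "up (mn B) = mn C"
proof -
 have m: "B (mn B)" by (rule B.mn)
 note d = dd[OF base_dec(3)[OF m] base_dec(1)[OF m] base_dec(2)[OF m]]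
 have "dd (mn B) <= mn C"
 proof (rule d(4)[unfolded up_1 up_0])
  have "mn B - 1 < mn B" using mnum_minus1[OF B.mn_pos] by (metis add1_le order_refl)
  then show "up (mn B - 1) < mn C * 1 + 0" using mn_le up_small by simp
  show "s_lsucc MS C (mn C) (mn C * 1 + 0)" by (auto simp: s_lsucc_def s_succ_def)
 qed (rule C.mn)
 then show ?thesis using up_base_dd[OF m] C.mn(2)[OF d(1)] by simp
qed

text \<open>The decomposition of a base is \<open>b * 1 + 0\<close>, so the upgrade merely asks for
  an element of \<open>C\<close> above \<open>up (b - 1)\<close>.\<close>

lemma up_base: assumes b: "B b" shows "s_succ MS C (up (b - 1)) (up b)"
proof -
 note d = dd[OF base_dec(3)[OF b] base_dec(1)[OF b] base_dec(2)[OF b]]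
 have "b - 1 < b" using mnum_minus1[of b] base_dec(2)[OF b] bs_B[OF b] by (metis add1_le order_refl)
 moreover have "up b <= e" if "C e" "up (b - 1) < e" for e
  unfolding up_base_dd[OF b] by (rule d(4)[unfolded up_1 up_0]) (use that in \<open>auto simp: s_lsucc_def s_succ_def\<close>)
 moreover have "up (b - 1) < up b" by (rule up_mono) fact
 ultimately show ?thesis using d(1) up_base_dd[OF b] by (auto simp: s_succ_def)
qed

lemma no_mult:
 assumes b: "B b" "mn B < b" and q: "up (b - 1) < bs C (up (b - 1)) * q" shows "up b <= bs C (up (b - 1)) * q"
proof (rule ccontr)
 assume n: "\<not> ?thesis"
 let ?x = "up (b - 1)"
 have b0: "0 < b" using base_dec(2)[OF b(1)] bs_B[OF b(1)] by simp
 have "mn B <= b - 1" using b(2) mnum_minus1[OF b0] by (metis less_add1)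
 then have "mn C <= ?x" using up_le up_mn by metis
 then have base: "s_base MS C ?x (bs C ?x)" using C.s_base_iff by simp
 have "s_lsucc MS C ?x (bs C ?x * q)"
  using n up_base[OF b(1)] by (auto simp: s_lsucc_def s_succ_def not_le)
 then have l: "s_lsucc MS C ?x (bs C ?x * q)" .
 have g: "\<not> s_lsucc MS C (up b') z" if "B (b' + 1)" "mn B < b' + 1" "s_base MS C (up b') y" "s_dvd MS y z" "up b' < z" for b' y z
  using good that up_iff unfolding s_good_def by (auto simp: B.min_iff)
 have "s_dvd MS (bs C ?x) (bs C ?x * q)" by (auto simp: s_dvd_def)
 then show False using g[of "b - 1"] l b base q mnum_minus1[OF b0] by simp
qed

text \<open>Suppose that \<open>C\<close> has no element in the interval from \<open>d\<close>,
  excluded, to \<open>d * d\<close>, included, and take the first \<open>n\<close> whose upgrade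
  reaches \<open>d * d\<close>. The value before \<open>n\<close> was computed with a base at most
  \<open>d\<close>, and then the value at \<open>n\<close> cannot reach \<open>d * d\<close> either.
  If \<open>n\<close> is itself a base, the clause on multiples is needed.\<close>

lemma square_C: "square C"
 unfolding square_def
proof (intro allI impI, rule ccontr)
 fix d assume d: "C d" "\<not> (EX s. s_succ MS C d s & s <= d * d)"
 have none: "x <= d" if h: "C x" "x <= d * d" for x
 proof (rule ccontr)
  assume "\<not> x <= d"
  then have dx: "d < x" by simp
  from C.succ_ex[OF h(1) dx] obtain s where s: "s_succ MS C d s" by blast
  then have "s <= x" using h(1) dx by (auto simp: s_succ_def)
  then show False using s d(2) h(2) by (meson order.trans)
 qed
 have d1: "1 < d" using C.B_gt1 d(1) .
 then have d0: "0 < d" by (rule order.strict_trans[rotated]) simp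
 have dlt: "d < d * d" using d1 d0 by (metis mult_1 mult_strict_right_mono)
 have "d * d <= up (d * d)" by (rule up_ge)
 have "EX n. d * d <= up n & (ALL m. d * d <= up m --> n <= m)"
  by (rule least[of "%n. d * d <= up n" "d * d"]) (intro df_intros tm_up, rule up_ge)
 then obtain n where n: "d * d <= up n" "!!m. d * d <= up m ==> n <= m" by blast
 have m: "mn B <= n"
 proof (rule ccontr)
  assume "\<not> mn B <= n"
  then have "up n < mn C" using up_small mn_le by (simp add: not_le)
  then show False using C.mn(2)[OF d(1)] dlt n(1) by simp
 qed
 have n0: "0 < n" using B.mn_pos m by simp
 have n1: "n - 1 + 1 = n" "n - 1 < n" using mnum_minus1[OF n0] by (auto, metis add1_le order_refl)
 have un: "up (n - 1) < d * d" using n(2)[of "n - 1"] n1 by (metis not_le)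
 obtain a r where ar: "n = bs B n * a + r" "r < bs B n" "0 < a" "a < bs B n" "bs B n * a < sc B (bs B n)"
  by (rule B.dec[OF m])
 define b where "b = bs B n"
 note ar = ar[folded b_def]
 have b: "B b" using B.bs(1)[OF m] by (simp add: b_def)
 have b0: "0 < b" using ar(2) by (metis le_less_trans mnum_nonneg)
 note u = up_dec[OF b ar(3,5)]
 show False
 proof (cases "r = 0")
  case False
  then obtain r' where r': "r = r' + 1" using mnum_cases by blast
  then have r'b: "r' < b" using ar(2) by (metis less_add1 less_trans order_refl)
  have "n - 1 = b * a + r'" unfolding ar(1) r' by (simp add: add.assoc[symmetric])
  then have "dd (b * a) * up a + up r' < d * d" using u(4)[OF r'b] un by simp
  moreover have "dd (b * a) * 1 <= dd (b * a) * up a" using up_pos[OF ar(3)] by (intro mult_left_mono) (simp_all flip: add1_le)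
  ultimately have "dd (b * a) <= d * d" by (metis add_increasing2 less_imp_le mnum_nonneg mult_1_right order.strict_trans1)
  then have le: "dd (b * a) <= d" using none u(1) by blast
  have "up n = dd (b * a) * up a + up r" using u(4)[OF ar(2)] ar(1) by simp
  also have "\<dots> < dd (b * a) * dd (b * a)" using mul_add_less u(3) u(5)[OF ar(2)] by blast
  also have "\<dots> <= d * d" using le by (intro mult_mono) simp_all
  finally show False using n(1) by simp
 next
  case r0: True
  then have nb: "n = b * a" using ar(1) by simp
  have unn: "up n = dd (b * a) * up a" using u(4)[OF b0] nb by (simp add: up_0)
  show False
  proof (cases "a = 1")
   case False
   obtain a' where a': "a = a' + 1" using mnum_cases[of a] ar(3) by auto
   then have a'0: "0 < a'" using False by (auto simp: pos_iff)
   have a'a: "a' < a" using a' by simp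
   have lt': "b * a' < sc B b" using ar(5) mult_strict_left_mono[OF a'a b0] by (meson less_trans)
   note u' = up_dec[OF b a'0 lt']
   obtain b' where b': "b = b' + 1" using mnum_cases[of b] b0 by auto
   have b'b: "b' < b" using b' by simp
   have "n - 1 = b * a' + b'"
    unfolding nb a' by (subst (2) b') (simp add: distrib_left add.assoc[symmetric] b')
   then have un1: "up (n - 1) = dd (b * a') * up a' + up b'" using u'(4)[OF b'b] by simp
   have "dd (b * a') * 1 <= dd (b * a') * up a'" using up_pos[OF a'0] by (intro mult_left_mono) (simp_all flip: add1_le)
   then have "dd (b * a') <= d * d" using un un1 by (metis add_increasing2 less_imp_le mnum_nonneg mult_1_right order.strict_trans1)
   then have le: "dd (b * a') <= d" using none u'(1) by blast
   have ad: "up a < d" using up_mono[OF ar(4)[folded b_def]] u'(2) le by (meson less_le_trans)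
   \<comment> \<open>\<open>d\<close> is admissible for \<open>n\<close>: the base used before
     \<open>n\<close> is at most \<open>d\<close>, and \<open>d * up a <= d * d\<close> lies below
     every successor of \<open>d\<close>.\<close>
   have "dd (b * a) <= d"
   proof (rule u(7)[OF d(1)])
    have "up (n - 1) < dd (b * a') * up a"
     unfolding un1 by (rule mul_add_less) (use up_mono a'a u'(5)[OF b'b] in auto)
    also have "\<dots> <= d * up a" using le by (intro mult_right_mono) simp_all
    finally show "up (b * a - 1) < d * up a" unfolding nb .
    show "s_lsucc MS C d (d * up a)"
     unfolding s_lsucc_def
    proof (intro ballI impI)
     fix s assume s: "s_succ MS C d s"
     then have "d * d < s" using d(2) by (auto simp: not_le)
     moreover have "d * up a <= d * d" using ad by (intro mult_left_mono) simp_all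
     ultimately show "Ls MS (d * up a) s" by simp
    qed
   qed
   then have "up n <= d * up a" unfolding unn by (intro mult_right_mono) simp_all
   also have "\<dots> < d * d" using ad d0 by (rule mult_strict_left_mono)
   finally show False using n(1) by simp
  next
   case True
   then have nb: "n = b" using nb by simp
   show False
   proof (cases "b = mn B")
    case True
    then have "up n = mn C" using nb up_mn by simp
    then show False using C.mn(2)[OF d(1)] dlt n(1) by simp
   next
    case False
    then have mb: "mn B < b" using B.mn(2)[OF b] by (simp add: less_le)
    let ?x = "up (b - 1)" let ?y = "bs C ?x"
    have x: "?x < d * d" using un nb by simp
    have "mn B <= b - 1" using mb mnum_minus1[OF b0] by (metis less_add1)
    then have mx: "mn C <= ?x" using up_le up_mn by metis
    note y = C.bs[OF mx]
    have sx: "s_succ MS C ?x (up b)" by (rule up_base[OF b])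
    show False
    proof (cases "d <= ?x")
     case False
     then have "up b <= d" using sx d(1) by (auto simp: s_succ_def)
     then show False using n(1) nb dlt by simp
    next
     case True
     \<comment> \<open>As \<open>C\<close> has no element above \<open>d\<close> up to
       \<open>d * d\<close>, the base of \<open>?x\<close> is \<open>d\<close>. The first multiple
       of \<open>d\<close> above \<open>?x\<close> is at most \<open>d * d\<close>, and by
       \<open>no_mult\<close> the value \<open>up b\<close> cannot pass it.\<close>
     have yd: "?y = d"
     proof (rule antisym)
      show "?y <= d" using none[OF y(1)] y(2) x by simp
      show "d <= ?y" using y(3)[OF d(1) True] .
     qed
     obtain q r where q: "?x = d * q + r" "r < d" using division[OF d0] by blast
     have "q < d"
     proof (rule ccontr)
      assume "\<not> q < d"
      then have "d * d <= d * q" by (intro mult_left_mono) simp_all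
      then have "d * d <= d * q + r" by (simp add: add_increasing2)
      then show False using x q(1) by simp
     qed
     then have "d * (q + 1) <= d * d" by (intro mult_left_mono) simp_all
     moreover have "?x < d * (q + 1)" unfolding q(1) using q(2) by (simp add: distrib_left)
     ultimately have "up b <= d * d" using no_mult[OF b mb, of "q + 1"] yd by simp
     then have "up b <= d" using none sx by (auto simp: s_succ_def)
     then show False using n(1) nb dlt by simp
    qed
   qed
  qed
 qed
qed

sublocale C: hq C by unfold_locales (rule square_C)

end

section \<open>Termination in the generic model\<close>

lemma df_shift: assumes "df P" shows "df (%e. P (%n. e (g n)))"
proof -
 obtain \<phi> E p where *: "!!i. E i : SS" "!!e. P e = asat MS E (mix e p) \<phi>"
  using assms unfolding ar_def by auto
 let ?h = "%n. if even n then 2 * g (n div 2) else n"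
 have "(%n. mix e p (?h n)) = mix (%n. e (g n)) p" for e by (rule ext) (auto simp: mix_def)
 then have "P (%n. e (g n)) = asat MS E (mix e p) (renf ?h id \<phi>)" for e
  by (simp only: asat_renf id_apply *(2))
 then show ?thesis using *(1) by (intro arI[of E _ p MS _ "renf ?h id \<phi>"]) simp_all
qed

lemma df_comp3:
 assumes "df (%e. Q (e 0) (e 1) (e 2))" "tm f" "tm g" "tm h" shows "df (%e. Q (f e) (g e) (h e))"
proof -
 have "df (%e. Q (e 2) (e 1) (e 0))"
  using df_shift[OF assms(1), of "%n. if n = 0 then 2 else if n = 1 then 1 else 0"] by simp
 then have "df (%e. EX a b c. a = f e & b = g e & c = h e & Q a b c)"
  by (intro df_ex ar_and ar_eq tm_var tm_shift[OF assms(2)] tm_shift[OF assms(3)] tm_shift[OF assms(4)])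
   (simp_all add: numeral_2_eq_2)
 then show ?thesis by simp
qed

lemma df_comp2: assumes "df (%e. Q (e 0) (e 1))" "tm f" "tm g" shows "df (%e. Q (f e) (g e))"
 by (rule df_comp3[of "%a b c. Q a b" f g f]) (use assms in auto)

text \<open>The recursion clause of the upgrade with a table \<open>T\<close> in place of the
  earlier values. It contains no set quantifier, which makes it usable for a definition that is
  uniform in the stage.\<close>

definition cl :: "(mnum => bool) => (mnum => bool) => (mnum => mnum => bool) => mnum => mnum => bool" where
 "cl B C T n v <-> (EX m. s_min MS B m & ((n < m & v = n) \<or> (m <= n & (EX b a r a' r' n' u d.
  B b & b <= n & (ALL x. B x & x <= n --> x <= b) & n = b * a + r & r < b & n = n' + 1 &
  T a a' & T r r' & T n' u & v = d * a' + r' &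
  (C d & u < d * a' + r' & s_lsucc MS C d (d * a' + r')) &
  (ALL e. C e & u < e * a' + r' & s_lsucc MS C e (e * a' + r') --> d <= e)))))"

lemma s_min_MS: "s_min MS B m <-> B m & (ALL b. B b --> m <= b)"
 by (simp add: s_min_def)
lemma s_succ_MS: "s_succ MS B n s <-> B s & n < s & (ALL b. B b & n < b --> s <= b)"
 by (simp add: s_succ_def)
lemma s_lsucc_MS: "s_lsucc MS B n t <-> (ALL s. s_succ MS B n s --> t < s)"
 by (simp add: s_lsucc_def)

context step
begin

lemma dec_less: assumes "mn B <= n" "n = bs B n * a + r" "r < bs B n" shows "a < n" "r < n" "n - 1 < n"
proof -
 obtain a' r' where ar: "n = bs B n * a' + r'" "r' < bs B n" "a' < bs B n" using B.dec[OF assms(1)] by metis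
 then have "a' = a" using dec_unique[of "bs B n" a' r' a r] assms by metis
 then show "a < n" "r < n" using ar assms B.bs(2)[OF assms(1)] by (auto intro: less_le_trans)
 have "0 < n" using B.mn_pos assms(1) by (rule less_le_trans)
 then show "n - 1 < n" using mnum_minus1[of n] by (metis add1_le order_refl)
qed

lemma cl_iff:
 assumes T: "!!m v. m < n ==> T m v <-> v = up m"
 shows "cl B C T n v <-> v = up n"
proof (cases "n < mn B")
 case True
 then have "(mn B <= n) = False" by simp
 then show ?thesis unfolding cl_def B.min_iff using True up_small[OF True] by (simp only: simp_thms ex_simps)
next
 case False
 then have n: "mn B <= n" by simp
 have n0: "0 < n" using B.mn_pos n by (rule less_le_trans)
 obtain a r where ar: "n = bs B n * a + r" "r < bs B n" using B.dec[OF n] by metis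
 note lt = dec_less[OF n ar] and d = dd[OF n ar]
 let ?ok = "%e. C e & up (n - 1) < e * up a + up r & s_lsucc MS C e (e * up a + up r)"
 have "up (n - 1) < up n" using up_mono lt(3) .
 then have ok: "?ok (dd n)" "!!e. ?ok e ==> dd n <= e" using d by (metis, blast)
 have "cl B C T n v <-> (EX d. v = d * up a + up r & ?ok d & (ALL e. ?ok e --> d <= e))"
 proof
  assume "cl B C T n v"
  then obtain b a' r' x y n' u d where h: "B b & b <= n & (ALL x. B x & x <= n --> x <= b)" "n = b * a' + r'" "r' < b"
   "n = n' + 1" "T a' x" "T r' y" "T n' u" "v = d * x + y"
   "C d & u < d * x + y & s_lsucc MS C d (d * x + y)"
   "ALL e. C e & u < e * x + y & s_lsucc MS C e (e * x + y) --> d <= e"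
   unfolding cl_def B.min_iff using False by (elim exE conjE disjE) (simp, metis)
  have "b = bs B n" using B.base_iff[OF n, THEN iffD1] h(1) .
  then have 1: "a' = a" "r' = r" using dec_unique[of "bs B n" a' r' a r] h(2,3) ar by metis+
  have 2: "n' = n - 1" using h(4) by simp
  have "x = up a" "y = up r" "u = up (n - 1)" using h(5-7) T lt unfolding 1 2 by blast+
  then show "EX d. v = d * up a + up r & ?ok d & (ALL e. ?ok e --> d <= e)" using h(8-10) by blast
 next
  assume "EX d. v = d * up a + up r & ?ok d & (ALL e. ?ok e --> d <= e)"
  then obtain d where d: "v = d * up a + up r" "?ok d" "ALL e. ?ok e --> d <= e" by blast
  have 1: "T a (up a)" "T r (up r)" "T (n - 1) (up (n - 1))" using T lt by blast+
  have 2: "n = n - 1 + 1" using mnum_minus1[OF n0] by simp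
  have 3: "B (bs B n)" "bs B n <= n" "ALL x. B x & x <= n --> x <= bs B n" using B.bs[OF n] by blast+
  have 4: "C d" "up (n - 1) < d * up a + up r" "s_lsucc MS C d (d * up a + up r)" using d(2) by blast+
  have all: "B (bs B n) & bs B n <= n & (ALL x. B x & x <= n --> x <= bs B n) & n = bs B n * a + r & r < bs B n &
   n = n - 1 + 1 & T a (up a) & T r (up r) & T (n - 1) (up (n - 1)) & v = d * up a + up r &
   (C d & up (n - 1) < d * up a + up r & s_lsucc MS C d (d * up a + up r)) &
   (ALL e. C e & up (n - 1) < e * up a + up r & s_lsucc MS C e (e * up a + up r) --> d <= e)"
   by (intro conjI 1 2 3 4 ar d(1,3))
  show "cl B C T n v" unfolding cl_def B.min_iff
   by (rule exI[of _ "mn B"], rule conjI, rule refl, rule disjI2, rule conjI, rule n, (rule exI)+, rule all)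
 qed
 also have "\<dots> <-> v = up n" using ok d(2) antisym[of _ "dd n"] by metis
 finally show ?thesis .
qed

end

locale dyn =
 fixes X :: "mnum set" and c :: mnum
 assumes XS: "X : SS" and dynX: "s_dyn MS X" and slowX: "s_slow MS X c"
begin

definition B :: "mnum => mnum => bool" where "B i t <-> pp i t : X"

lemma B_sl: "sl MS X i = B i" by (intro ext) (simp add: sl_def B_def)

lemma df_B: "tm f ==> tm g ==> df (%e. B (f e) (g e))"
 unfolding B_def by (intro df_intros tm_pp XS)

lemma hierB: "hier (B i)"
proof
 show "df (%e. B i (e 0))" by (intro df_intros df_B)
 show "s_bh MS (B i)" using dynX by (simp add: s_dyn_def B_sl)
qed

lemma goodB: "s_good MS (B i) (B (i + 1))"
 using dynX by (simp add: s_dyn_def B_sl)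

lemma slow: "B 0 b ==> EX s. s_succ MS (B 0) b s & s <= b * b & s <= b * c"
 using slowX by (simp add: s_slow_def B_sl)

lemma df_succ: assumes "tm f" "tm g" "tm h" shows "df (%e. s_succ MS (B (f e)) (g e) (h e))"
 by (rule df_comp3[of "%a b c. s_succ MS (B a) b c", OF _ assms], unfold s_succ_MS, intro df_intros df_B)

lemma df_lsucc: assumes "tm f" "tm g" "tm h" shows "df (%e. s_lsucc MS (B (f e)) (g e) (h e))"
 by (rule df_comp3[of "%a b c. s_lsucc MS (B a) b c", OF _ assms], unfold s_lsucc_MS, intro df_intros df_succ)

lemma hqB: "hq (B i)"
proof -
 have "square (B i)"
 proof (rule ind[of "%i. square (B i)"])
  show "df (%e. square (B (e 0)))" unfolding square_def by (intro df_intros df_B df_succ)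
  show "square (B 0)" using slow unfolding square_def by blast
  show "square (B (i + 1))" if "square (B i)" for i
  proof -
   interpret step "B i" "B (i + 1)"
    using that hierB goodB by (intro step.intro step_axioms.intro hq.intro hq_axioms.intro)
   show ?thesis by (rule square_C)
  qed
 qed
 then show ?thesis using hierB by (intro hq.intro hq_axioms.intro)
qed

sublocale St: step "B i" "B (i + 1)" for i
 using hqB hierB goodB by (intro step.intro step_axioms.intro)

definition pw :: "mnum => mnum" where "pw = (SOME pw. expo pw (mn (B 0)))"

sublocale expo pw "mn (B 0)"
 unfolding pw_def by (rule someI_ex[OF St.expo_ex])

abbreviation "up \<equiv> St.up"

text \<open>The official graph is given by quantified sets, which may vary with the stage, so it
  yields no arithmetical definition in \<open>i\<close> and \<open>n\<close> jointly. A number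
  \<open>s\<close> that codes the table of values up to \<open>n\<close> replaces these
  sets.\<close>

lemma up_code:
 "v = up i n <-> (EX s. (ALL m w. m <= n --> (bit s (pp m w) <-> cl (B i) (B (i + 1)) (%x y. bit s (pp x y)) m w)) & bit s (pp n v))"
proof
 assume v: "v = up i n"
 let ?A = "{z. EX m. m <= n & z = pp m (up i m)}"
 have "?A : SS" by (rule comprehension[of "%e. EX m. m <= n & e 0 = pp m (up i m)"]) (intro df_intros tm_pp St.tm_up)
 moreover have "EX K. ALL m. m <= n --> pp m (up i m) < K"
 proof (rule ind[of "%n. EX K. ALL m. m <= n --> pp m (up i m) < K"])
  show "df (%e. EX K. ALL m. m <= e 0 --> pp m (up i m) < K)" by (intro df_intros tm_pp St.tm_up)
  show "EX K. ALL m. m <= 0 --> pp m (up i m) < K" by (intro exI[of _ "pp 0 (up i 0) + 1"]) simp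
  fix n assume "EX K. ALL m. m <= n --> pp m (up i m) < K"
  then obtain K where K: "!!m. m <= n ==> pp m (up i m) < K" by blast
  have "pp m (up i m) < K + pp (n + 1) (up i (n + 1)) + 1" if "m <= n + 1" for m
  proof (cases "m = n + 1")
   case False
   then have "m <= n" using that by (metis less_add1 less_le)
   then have "pp m (up i m) <= K" using K less_imp_le by blast
   then have "pp m (up i m) <= K + pp (n + 1) (up i (n + 1))" by (rule add_increasing2[rotated]) simp
   then show ?thesis by simp
  qed (simp add: add_increasing)
  then show "EX K. ALL m. m <= n + 1 --> pp m (up i m) < K" by blast
 qed
 then obtain K where K: "!!m. m <= n ==> pp m (up i m) < K" by blast
 ultimately obtain s where "!!x. bit s x <-> x < K & x : ?A" using code[of ?A K] by blast
 then have s: "m <= n ==> bit s (pp m w) <-> w = up i m" for m w using K by auto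
 have "cl (B i) (B (i + 1)) (%x y. bit s (pp x y)) m w <-> w = up i m" if "m <= n" for m w
 proof (rule St.cl_iff)
  fix k v assume "k < m"
  then have "k <= n" using that by simp
  then show "bit s (pp k v) <-> v = up i k" by (rule s)
 qed
 then show "EX s. (ALL m w. m <= n --> (bit s (pp m w) <-> cl (B i) (B (i + 1)) (%x y. bit s (pp x y)) m w)) & bit s (pp n v)"
  using s v by (intro exI[of _ s]) simp
next
 assume "EX s. (ALL m w. m <= n --> (bit s (pp m w) <-> cl (B i) (B (i + 1)) (%x y. bit s (pp x y)) m w)) & bit s (pp n v)"
 then obtain s where s: "!!m w. m <= n ==> bit s (pp m w) <-> cl (B i) (B (i + 1)) (%x y. bit s (pp x y)) m w" "bit s (pp n v)" by blast
 have "m <= n --> (ALL w. bit s (pp m w) <-> w = up i m)" for m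
 proof (rule less_ind[of "%m. m <= n --> (ALL w. bit s (pp m w) <-> w = up i m)"])
  show "df (%e. e 0 <= n --> (ALL w. bit s (pp (e 0) w) <-> w = up i (e 0)))" by (intro df_intros tm_pp St.tm_up df_bit)
  fix m assume IH: "!!k. k < m ==> k <= n --> (ALL w. bit s (pp k w) <-> w = up i k)"
  show "m <= n --> (ALL w. bit s (pp m w) <-> w = up i m)"
  proof (intro impI allI)
   fix w assume m: "m <= n"
   show "bit s (pp m w) <-> w = up i m"
    unfolding s(1)[OF m]
   proof (rule St.cl_iff)
    fix k v assume "k < m"
    then show "bit s (pp k v) <-> v = up i k" using IH[of k] m by simp
   qed
  qed
 qed
 then show "v = up i n" using s(2) by blast
qed

lemma tm_up2: "tm (%e. up (e 0) (e 1))"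
proof (rule tm_graph[OF _ up_code[symmetric]])
 show "df (%e. EX s. (ALL m w. m <= e 2 --> (bit s (pp m w) <->
   cl (B (e 1)) (B (e 1 + 1)) (%x y. bit s (pp x y)) m w)) & bit s (pp (e 2) (e 0)))"
  unfolding cl_def s_min_MS by (intro df_intros df_bit tm_pp df_B df_lsucc)
qed

lemma tm_up: "tm f ==> tm g ==> tm (%e. up (f e) (g e))" by (rule tm_comp2[OF tm_up2])

section \<open>Iterated upgrades and sums that they respect\<close>

definition fs :: "mnum => mnum" where "fs p = (if EX a b. p = pp a b then THE a. EX b. p = pp a b else 0)"
definition sn :: "mnum => mnum" where "sn p = (if EX a b. p = pp a b then THE b. EX a. p = pp a b else 0)"

lemma fs_pp [simp]: "fs (pp a b) = a" and sn_pp [simp]: "sn (pp a b) = b" by (auto simp: fs_def sn_def)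

lemma tm_fs: "tm f ==> tm (%e. fs (f e))" and tm_sn: "tm f ==> tm (%e. sn (f e))"
proof -
 have "df (%e. (EX b. e 1 = pp (e 0) b) \<or> (\<not> (EX a b. e 1 = pp a b) & e 0 = 0))"
  "df (%e. (EX b. e 1 = pp b (e 0)) \<or> (\<not> (EX a b. e 1 = pp a b) & e 0 = 0))" by (intro df_intros tm_pp)+
 moreover have "(EX b. y = pp x b) \<or> (\<not> (EX a b. y = pp a b) & x = 0) <-> x = fs y"
  "(EX b. y = pp b x) \<or> (\<not> (EX a b. y = pp a b) & x = 0) <-> x = sn y" for x y
  by (auto simp: fs_def sn_def)
 ultimately have f: "tm (%e. fs (e 0))" and g: "tm (%e. sn (e 0))" by (simp_all add: tm_def)
 show "tm f ==> tm (%e. fs (f e))" by (rule tm_comp1[OF f])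
 show "tm f ==> tm (%e. sn (f e))" by (rule tm_comp1[OF g])
qed

lemma it_ex: "EX g. (ALL p. g p 0 = sn p) & (ALL p k. g p (k + 1) = up (fs p + k) (g p k)) & tm (%e. g (e 0) (e 1))"
proof (rule recursion[of "%p k v. up (fs p + k) v" sn])
 show "tm (%e. up (fs (e 0) + e 1) (e 2))" "tm (%e. sn (e 0))" by (intro df_intros tm_up tm_fs tm_sn)+
qed blast

definition itp where "itp = (SOME g. (ALL p. g p 0 = sn p) & (ALL p k. g p (k + 1) = up (fs p + k) (g p k)) & tm (%e. g (e 0) (e 1)))"
text \<open>\<open>it j k n\<close> is the image at stage \<open>j + k\<close> of the number
  \<open>n\<close> at stage \<open>j\<close>. Stage and number are packed into one parameter because
  \<open>recursion\<close> allows only one.\<close>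

definition it :: "mnum => mnum => mnum => mnum" where "it j k n = itp (pp j n) k"

lemma it_0: "it j 0 n = n" and it_Suc: "it j (k + 1) n = up (j + k) (it j k n)" and tm_itp: "tm (%e. itp (e 0) (e 1))"
 using someI_ex[OF it_ex, folded itp_def] by (simp_all add: it_def)

lemma tm_it: "tm f ==> tm g ==> tm h ==> tm (%e. it (f e) (g e) (h e))"
 unfolding it_def by (intro tm_comp2[OF tm_itp] tm_pp)

lemma it_comp: "it (j + k) l (it j k n) = it j (k + l) n"
proof (rule ind[of "%l. it (j + k) l (it j k n) = it j (k + l) n"])
 show "df (%e. it (j + k) (e 0) (it j k n) = it j (k + e 0) n)" by (intro df_intros tm_it)
 show "it (j + k) (l + 1) (it j k n) = it j (k + (l + 1)) n" if "it (j + k) l (it j k n) = it j (k + l) n" for l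
  using it_Suc[of j "k + l" n] that by (simp add: it_Suc add.assoc[symmetric])
qed (simp add: it_0)

lemma it_1: "it j 1 n = up j n" using it_Suc[of j 0 n] by (simp add: it_0)

lemma it_mono: "m < n ==> it j k m < it j k n"
proof (rule ind[of "%k. it j k m < it j k n"])
 show "df (%e. it j (e 0) m < it j (e 0) n)" by (intro df_intros tm_it)
qed (simp_all add: it_0 it_Suc St.up_mono)

lemma it_le: "m <= n ==> it j k m <= it j k n"
 using it_mono[of m n j k] by (cases "m = n") (auto simp: less_le)

lemma it_zero: "it j k 0 = 0"
proof (rule ind[of "%k. it j k 0 = 0"])
 show "df (%e. it j (e 0) 0 = 0)" by (intro df_intros tm_it)
qed (simp_all add: it_0 it_Suc St.up_0)

lemma it_pos: "0 < n ==> 0 < it j k n" using it_mono[of 0 n j k] it_zero by simp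

lemma it_small: assumes "n < mn (B j)" shows "it j k n = n & n < mn (B (j + k))"
proof -
 have "it j k n = n & (EX m. s_min MS (B (j + k)) m & n < m)"
 proof (rule ind[of "%k. it j k n = n & (EX m. s_min MS (B (j + k)) m & n < m)"])
  show "df (%e. it j (e 0) n = n & (EX m. s_min MS (B (j + e 0)) m & n < m))"
   unfolding s_min_MS by (intro df_intros tm_it df_B)
  show "it j 0 n = n & (EX m. s_min MS (B (j + 0)) m & n < m)" using assms it_0 by (simp add: St.B.min_iff)
  fix k assume "it j k n = n & (EX m. s_min MS (B (j + k)) m & n < m)"
  then have k: "it j k n = n" "n < mn (B (j + k))" by (simp_all add: St.B.min_iff)
  have "n < mn (B (j + k + 1))" using k(2) St.mn_le[of "j + k"] by (rule less_le_trans)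
  then show "it j (k + 1) n = n & (EX m. s_min MS (B (j + (k + 1))) m & n < m)"
   using k St.up_small[OF k(2)] by (simp add: it_Suc St.B.min_iff add.assoc)
 qed
 then show ?thesis by (simp add: St.B.min_iff)
qed

text \<open>By \<open>up_dec\<close> each upgrade replaces the base \<open>d\<close> by one common
  new base for the whole block, and remainders stay below it; induction on \<open>k\<close> iterates
  this.\<close>

lemma inv:
 assumes "B j d" "0 < q" "d * q < sc (B j) d"
 shows "EX d'. B (j + k) d' & s_lsucc MS (B (j + k)) d' (d' * it j k q) & it j k (d * q) = d' * it j k q &
  (ALL r. r < d --> it j k r < d' & it j k (d * q + r) = d' * it j k q + it j k r)"
proof (rule ind[of "%k. EX d'. B (j + k) d' & s_lsucc MS (B (j + k)) d' (d' * it j k q) & it j k (d * q) = d' * it j k q &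
  (ALL r. r < d --> it j k r < d' & it j k (d * q + r) = d' * it j k q + it j k r)"])
 show "df (%e. EX d'. B (j + e 0) d' & s_lsucc MS (B (j + e 0)) d' (d' * it j (e 0) q) & it j (e 0) (d * q) = d' * it j (e 0) q &
  (ALL r. r < d --> it j (e 0) r < d' & it j (e 0) (d * q + r) = d' * it j (e 0) q + it j (e 0) r))"
  by (intro df_intros tm_it df_B df_lsucc)
 show "EX d'. B (j + 0) d' & s_lsucc MS (B (j + 0)) d' (d' * it j 0 q) & it j 0 (d * q) = d' * it j 0 q &
  (ALL r. r < d --> it j 0 r < d' & it j 0 (d * q + r) = d' * it j 0 q + it j 0 r)"
  using assms St.B.lsucc_iff by (intro exI[of _ d]) (simp add: it_0)
 fix k assume "EX d'. B (j + k) d' & s_lsucc MS (B (j + k)) d' (d' * it j k q) & it j k (d * q) = d' * it j k q &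
  (ALL r. r < d --> it j k r < d' & it j k (d * q + r) = d' * it j k q + it j k r)"
 then obtain d' where d': "B (j + k) d'" "d' * it j k q < sc (B (j + k)) d'" "it j k (d * q) = d' * it j k q"
  "!!r. r < d ==> it j k r < d'" "!!r. r < d ==> it j k (d * q + r) = d' * it j k q + it j k r"
  using St.B.lsucc_iff by blast
 note u = St.up_dec[OF d'(1) it_pos[OF assms(2)] d'(2)]
 let ?D = "St.dd (j + k) (d' * it j k q)"
 have "0 < d'" using d'(1) St.B.B_gt1 by (meson less_trans zero_less_one)
 then have "up (j + k) (d' * it j k q) = ?D * up (j + k) (it j k q)" using u(4)[of 0] by (simp add: St.up_0)
 then show "EX d'. B (j + (k + 1)) d' & s_lsucc MS (B (j + (k + 1))) d' (d' * it j (k + 1) q) & it j (k + 1) (d * q) = d' * it j (k + 1) q &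
  (ALL r. r < d --> it j (k + 1) r < d' & it j (k + 1) (d * q + r) = d' * it j (k + 1) q + it j (k + 1) r)"
  using u(1,6) u(4,5)[OF d'(4)] d' by (intro exI[of _ ?D]) (simp add: it_Suc add.assoc[symmetric])
qed

text \<open>From stage \<open>j\<close> on, upgrades are additive on the image of \<open>p\<close>
  plus anything up to the image of \<open>y\<close>. It plays the role of the condition that in a
  Cantor normal form the second summand starts with an exponent not above the last one of the
  first.\<close>

definition al :: "mnum => mnum => mnum => bool" where
 "al j p y <-> (ALL k m l. m <= it j k y --> it (j + k) l (it j k p + m) = it j (k + l) p + it (j + k) l m)"

lemma df_al: assumes "tm f" "tm g" "tm h" shows "df (%e. al (f e) (g e) (h e))"
 by (rule df_comp3[of al, OF _ assms], unfold al_def, intro df_intros tm_it)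

lemma al_down: "al j p y ==> x <= y ==> al j p x"
 unfolding al_def using it_le order.trans by meson

lemma al_pers: assumes "al j p y" shows "al (j + k) (it j k p) (it j k y)"
 unfolding al_def
proof (intro allI impI)
 fix k' m l assume "m <= it (j + k) k' (it j k y)"
 then show "it (j + k + k') l (it (j + k) k' (it j k p) + m) = it (j + k) (k' + l) (it j k p) + it (j + k + k') l m"
  using assms unfolding al_def it_comp by (simp add: add.assoc)
qed

lemma al_sum: assumes "al j p y" shows "it j k (p + y) = it j k p + it j k y"
 using assms[unfolded al_def, rule_format, of y 0 k] by (simp add: it_0)

lemma al_dec: assumes "B j d" "0 < q" "d * q < sc (B j) d" "r < d" shows "al j (d * q) r"
 unfolding al_def
proof (intro allI impI)
 fix k m l assume m: "m <= it j k r"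
 obtain d' where d': "B (j + k) d'" "d' * it j k q < sc (B (j + k)) d'" "it j k (d * q) = d' * it j k q" "it j k r < d'"
  using inv[OF assms(1-3), of k] assms(4) St.B.lsucc_iff by blast
 have "m < d'" using m d'(4) by simp
 then have "it (j + k) l (d' * it j k q + m) = it (j + k) l (d' * it j k q) + it (j + k) l m"
  using inv[OF d'(1) it_pos[OF assms(2)] d'(2), of l] by auto
 then show "it (j + k) l (it j k (d * q) + m) = it j (k + l) (d * q) + it (j + k) l m"
  using d'(3) by (metis it_comp)
qed

lemma al_split: assumes "B j d" "0 < q" "d * q < sc (B j) d" "r < d" "al j p (d * q + r)" shows "al j (p + d * q) r"
 unfolding al_def
proof (intro allI impI)
 fix k m l assume m: "m <= it j k r"
 have a: "al j p (d * q)" by (rule al_down[OF assms(5)]) simp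
 note s = al_sum[OF a] and t = al_sum[OF al_dec[OF assms(1-4)]]
 have "it (j + k) l (it j k (p + d * q) + m) = it (j + k) l (it j k p + (it j k (d * q) + m))"
  unfolding s by (simp add: add.assoc)
 also have "\<dots> = it j (k + l) p + it (j + k) l (it j k (d * q) + m)"
  using assms(5)[unfolded al_def, rule_format, of "it j k (d * q) + m" k l] m t by simp
 also have "it (j + k) l (it j k (d * q) + m) = it j (k + l) (d * q) + it (j + k) l m"
  using al_dec[OF assms(1-4)] m unfolding al_def by blast
 finally show "it (j + k) l (it j k (p + d * q) + m) = it j (k + l) (p + d * q) + it (j + k) l m"
  unfolding s by (simp add: add.assoc)
qed

text \<open>A set of codes of pairs \<open>(j, n)\<close> is progressive if it contains \<open>(j, n)\<close> as soon as it contains all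
 pairs below it at the stages from \<open>j\<close> on. \<open>A\<close> and \<open>J\<close> are the additive and the multiplicative jump in the
 manner of Gentzen.\<close>

definition G :: "mnum set => mnum => mnum => bool" where
 "G S j n <-> (ALL k y. y < it j k n --> pp (j + k) y : S)"
definition prog :: "mnum set => bool" where
 "prog S <-> (ALL j n. G S j n --> pp j n : S)"
definition A :: "mnum set => mnum => mnum => bool" where
 "A S j x <-> (ALL k y p. y <= it j k x --> al (j + k) p y --> G S (j + k) p --> G S (j + k) (p + y))"
definition J :: "mnum set => mnum => mnum => bool" where
 "J S i a <-> (ALL k b. B (i + k) b --> s_lsucc MS (B (i + k)) b (b * it i k a) -->
  (ALL y. y < b --> A S (i + k) y) --> A S (i + k) (b * it i k a))"

lemma df_G: assumes "S : SS" "tm f" "tm g" shows "df (%e. G S (f e) (g e))"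
 by (rule df_comp2[of "G S", OF _ assms(2,3)], unfold G_def, intro df_intros tm_it tm_pp assms)
lemma df_A: assumes "S : SS" "tm f" "tm g" shows "df (%e. A S (f e) (g e))"
 by (rule df_comp2[of "A S", OF _ assms(2,3)], unfold A_def, intro df_intros tm_it df_al df_G assms)
lemma df_J: assumes "S : SS" "tm f" "tm g" shows "df (%e. J S (f e) (g e))"
 by (rule df_comp2[of "J S", OF _ assms(2,3)], unfold J_def, intro df_intros tm_it df_A df_B df_lsucc assms)

lemma pair_set: assumes "df (%e. Q (e 1) (e 0))" shows "{z. EX j n. z = pp j n & Q j n} : SS"
proof (rule comprehension[of "%e. EX j n. e 0 = pp j n & Q j n"])
 show "df (%e. EX j n. e 0 = pp j n & Q j n)" using assms by (intro df_intros tm_pp) simp_all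
qed

lemma G_pers: assumes "G S j n" shows "G S (j + k) (it j k n)"
 using assms unfolding G_def it_comp by (metis add.assoc)

lemma G_0: "G S j 0" by (simp add: G_def it_zero)

lemma A_pers: assumes "A S j x" shows "A S (j + k) (it j k x)"
 using assms unfolding A_def it_comp by (metis add.assoc)

lemma A_down: "A S j x ==> y <= x ==> A S j y"
 unfolding A_def using it_le order.trans by meson

lemma A_D: "A S j x ==> al j p x ==> G S j p ==> G S j (p + x)"
 unfolding A_def by (metis add_0_right it_0 order_refl)

text \<open>A number below the image of \<open>p + x\<close> lies below the image of
  \<open>p\<close>, or it is that image plus some \<open>m\<close> below the image of
  \<open>x\<close>. The second case is reached by the jump at \<open>m\<close>, for which
  \<open>al\<close> supplies additivity.\<close>

lemma prog_A: assumes S: "prog S" and h: "!!k m. m < it j k x ==> A S (j + k) m" shows "A S j x"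
proof -
 have main: "G S j (p + x)" if h: "!!k m. m < it j k x ==> A S (j + k) m" and p: "al j p x" "G S j p" for j x p
  unfolding G_def
 proof (intro allI impI)
  fix k z assume z: "z < it j k (p + x)"
  show "pp (j + k) z : S"
  proof (cases "z < it j k p")
   case True
   then show ?thesis using p(2) by (simp add: G_def)
  next
   case False
   then obtain m where m: "z = it j k p + m" by (auto simp: not_less le_iff)
   then have "m < it j k x" using z al_sum[OF p(1)] by simp
   then have "A S (j + k) m" "al (j + k) (it j k p) m" using h al_down[OF al_pers[OF p(1)]] by auto
   then have "G S (j + k) z" unfolding m using A_D G_pers[OF p(2)] by blast
   then show ?thesis using S by (simp add: prog_def)
  qed
 qed
 show ?thesis
  unfolding A_def
 proof (intro allI impI)
  fix k y p assume y: "y <= it j k x" "al (j + k) p y" "G S (j + k) p"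
  show "G S (j + k) (p + y)"
  proof (cases "y = it j k x")
   case False
   then have "A S (j + k) y" using h y(1) by (simp add: less_le)
   then show ?thesis using A_D y by blast
  next
   case True
   show ?thesis
   proof (rule main[OF _ y(2,3)])
    fix l m assume "m < it (j + k) l y"
    then have "m < it j (k + l) x" by (simp add: True it_comp)
    then show "A S (j + k + l) m" using h[of m "k + l"] by (simp add: add.assoc)
   qed
  qed
 qed
qed

lemma A_0: "A S j 0" by (simp add: A_def it_zero)

text \<open>The two summands are appended to \<open>p\<close> one after the other;
  \<open>al_split\<close> says that \<open>p\<close> plus the first one still admits the
  second.\<close>

lemma A_sum:
 assumes d: "B j d" "d * q < sc (B j) d" "r < d" and a: "A S j (d * q)" "A S j r"
 shows "A S j (d * q + r)"
proof (cases "q = 0")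
 case True
 then show ?thesis using a by simp
next
 case False
 then have q: "0 < q" by (simp add: pos_iff)
 show ?thesis
  unfolding A_def
 proof (intro allI impI)
  fix k y p assume y: "y <= it j k (d * q + r)" "al (j + k) p y" "G S (j + k) p"
  obtain d' where d': "B (j + k) d'" "d' * it j k q < sc (B (j + k)) d'" "it j k (d * q) = d' * it j k q" "it j k r < d'"
   "it j k (d * q + r) = d' * it j k q + it j k r"
   using inv[OF d(1) q d(2), of k] d(3) St.B.lsucc_iff by blast
  show "G S (j + k) (p + y)"
  proof (cases "y <= it j k (d * q)")
   case True
   then show ?thesis using a(1) y(2,3) unfolding A_def by blast
  next
   case False
   then obtain y' where y': "y = d' * it j k q + y'" unfolding d'(3) by (metis le_iff less_imp_le not_le)
   then have le: "y' <= it j k r" using y(1) d'(5) by simp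
   then have lt: "y' < d'" using d'(4) by simp
   have al: "al (j + k) p (d' * it j k q)" by (rule al_down[OF y(2)]) (simp add: y')
   have "G S (j + k) (p + d' * it j k q)" using a(1) al y(3) d'(3) unfolding A_def by (metis order_refl)
   moreover have "al (j + k) (p + d' * it j k q) y'"
    using al_split[OF d'(1) it_pos[OF q] d'(2) lt] y(2) y' by simp
   ultimately have "G S (j + k) (p + d' * it j k q + y')" using a(2) le unfolding A_def by blast
   then show ?thesis using y' by (simp add: add.assoc)
  qed
 qed
qed

text \<open>Numbers below the least base are fixed by all later upgrades, so ordinary induction
  suffices here.\<close>

lemma A_finite: assumes "prog S" "S : SS" "y < mn (B j)" shows "A S j y"
proof -
 have "ALL j. (EX m. s_min MS (B j) m & y < m) --> A S j y"
 proof (rule ind[of "%y. ALL j. (EX m. s_min MS (B j) m & y < m) --> A S j y"])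
  show "df (%e. ALL j. (EX m. s_min MS (B j) m & e 0 < m) --> A S j (e 0))"
   unfolding s_min_MS by (intro df_intros df_B df_A assms)
  fix y assume IH: "ALL j. (EX m. s_min MS (B j) m & y < m) --> A S j y"
  show "ALL j. (EX m. s_min MS (B j) m & y + 1 < m) --> A S j (y + 1)"
  proof (intro allI impI)
   fix j assume "EX m. s_min MS (B j) m & y + 1 < m"
   then have y: "y + 1 < mn (B j)" by (simp add: St.B.min_iff)
   show "A S j (y + 1)"
   proof (rule prog_A[OF assms(1)])
    fix k m assume "m < it j k (y + 1)"
    moreover have f: "it j k (y + 1) = y + 1" "y + 1 < mn (B (j + k))" using it_small[OF y] by auto
    ultimately have "m <= y" by simp
    moreover have "y < mn (B (j + k))" using f(2) by (metis less_add1 less_trans order_refl)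
    ultimately show "A S (j + k) m" using IH A_down by (auto simp: St.B.min_iff)
   qed
  qed
 qed (simp add: A_0)
 then show ?thesis using assms(3) by (simp add: St.B.min_iff)
qed

text \<open>The heart of the multiplicative jump. Upgrading replaces the base \<open>d\<close> by
  \<open>?D\<close>, possibly far above the images of the numbers below \<open>d\<close>, and the
  additive jump has to be established for everything below \<open>?D\<close>. Intermediate bases
  only admit digits below the image of \<open>a\<close>, and for those \<open>J\<close> is given. If
  \<open>d * a\<close> is a base, the clause on multiples leaves no new digit at all.\<close>

lemma A_step:
 assumes S: "prog S" "S : SS" and d: "B j d" "0 < a" "d * a < sc (B j) d" and below: "!!y. y < d ==> A S j y"
  and IHj: "!!m. m < a ==> J S j m" and IHs: "!!m. m < up j a ==> J S (j + 1) m"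
  and y: "y < St.dd j (d * a)"
 shows "A S (j + 1) y"
proof -
 have JD: "A S j (b * q)" if "J S j q" "B j b" "b * q < sc (B j) b" "!!y. y < b ==> A S j y" for j b q
  using that(1)[unfolded J_def, rule_format, of 0 b] that(2-) St.B.lsucc_iff by (simp add: it_0)
 let ?D = "St.dd j (d * a)"
 note u = St.up_dec[OF d]
 have d0: "0 < d" using d(1) St.B.B_gt1 by (meson less_trans zero_less_one)
 obtain d' where d': "d = d' + 1" using mnum_cases[of d] d0 by auto
 obtain q where q: "a = q + 1" using mnum_cases[of a] d(2) by auto
 have qa: "q < a" "d' < d" using q d' by simp_all
 have dq: "d * q < sc (B j) d" using d(3) mult_strict_left_mono[OF qa(1) d0] by (rule less_trans[rotated])
 have "A S j (d * q)" by (rule JD[OF IHj[OF qa(1)] d(1) dq below])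
 then have "A S j (d * q + d')" using A_sum[OF d(1) dq qa(2)] below[OF qa(2)] by blast
 then have pred: "A S (j + 1) (up j (d * q + d'))" using A_pers[of S j _ 1] by (simp add: it_1)
 have n1: "d * a - 1 = d * q + d'" unfolding q by (subst (2) d') (simp add: distrib_left d' add.assoc[symmetric])
 show ?thesis
 proof (cases "q = 0")
  case False
  then have q0: "0 < q" by (simp add: pos_iff)
  note u' = St.up_dec[OF d(1) q0 dq]
  let ?E = "St.dd j (d * q)"
  have un: "up j (d * q + d') = ?E * up j q + up j d'" by (rule u'(4)[OF qa(2)])
  have "?E * 1 <= ?E * up j q" using St.up_pos[OF q0] by (intro mult_left_mono) (simp_all flip: add1_le)
  then have Ele: "?E <= up j (d * q + d')" unfolding un by (simp add: add_increasing2)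
  have aE: "up j a < ?E" using St.up_mono[OF St.B.digit_less[OF d(1,3)]] u'(2) by (rule less_le_trans)
  \<comment> \<open>Induction over the bases of the next hierarchy from the old base
    \<open>?E\<close> up to the new base \<open>?D\<close>.\<close>
  have chain: "B (j + 1) e --> ?E <= e --> e <= ?D --> (ALL y. y < e --> A S (j + 1) y)" for e
  proof (rule less_ind[of "%e. B (j + 1) e --> ?E <= e --> e <= ?D --> (ALL y. y < e --> A S (j + 1) y)"])
   show "df (%ee. B (j + 1) (ee 0) --> ?E <= ee 0 --> ee 0 <= ?D --> (ALL y. y < ee 0 --> A S (j + 1) y))"
    by (intro df_intros df_B df_A S)
   fix e assume IH: "!!e'. e' < e ==> B (j + 1) e' --> ?E <= e' --> e' <= ?D --> (ALL y. y < e' --> A S (j + 1) y)"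
   show "B (j + 1) e --> ?E <= e --> e <= ?D --> (ALL y. y < e --> A S (j + 1) y)"
   proof (intro impI allI)
    fix y assume e: "B (j + 1) e" "?E <= e" "e <= ?D" and y: "y < e"
    show "A S (j + 1) y"
    proof (cases "y < ?E")
     case True
     then show ?thesis using A_down[OF pred] Ele by (meson less_imp_le order.trans)
    next
     case False
     then have Ey: "?E <= y" by simp
     have my: "mn (B (j + 1)) <= y" using St.B.mn(2)[OF u'(1)] Ey by simp
     let ?f = "bs (B (j + 1)) y"
     note f = St.B.bs[OF my]
     have Ef: "?E <= ?f" using f(3)[OF u'(1) Ey] .
     have fe: "?f < e" using f(2) y by simp
     \<comment> \<open>A base below \<open>?D\<close> is not admissible since \<open>?D\<close> is
       the least one. The lower inequality holds for it, so the upper one must fail.\<close>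
     have sf: "sc (B (j + 1)) ?f <= ?f * up j a"
     proof (rule ccontr)
      assume n: "\<not> ?thesis"
      have "?D <= ?f"
      proof (rule u(7)[OF f(1)])
       have "up j (d * a - 1) < ?E * up j a"
        unfolding n1 un by (rule mul_add_less) (use St.up_mono[OF qa(1)] u'(5)[OF qa(2)] in auto)
       also have "\<dots> <= ?f * up j a" using Ef by (intro mult_right_mono) simp_all
       finally show "up j (d * a - 1) < ?f * up j a" .
       show "s_lsucc MS (B (j + 1)) ?f (?f * up j a)" using n St.B.lsucc_iff[OF f(1)] by simp
      qed
      then show False using fe e(3) by simp
     qed
     obtain q' r' where qr: "y = ?f * q' + r'" "r' < ?f" "?f * q' < sc (B (j + 1)) ?f" using St.B.dec[OF my] by metis
     have "q' < up j a" using qr(3) sf by (meson mul_less_cancel less_le_trans)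
     then have "J S (j + 1) q'" using IHs by blast
     moreover have bf: "!!y. y < ?f ==> A S (j + 1) y" using IH[OF fe] f(1) Ef fe e(3) by (meson less_imp_le order.trans)
     ultimately have "A S (j + 1) (?f * q')" using JD f(1) qr(3) by blast
     then show ?thesis using A_sum[OF f(1) qr(3,2)] bf[OF qr(2)] qr(1) by simp
    qed
   qed
  qed
  have "?E <= ?D"
  proof (rule ccontr)
   assume n: "\<not> ?thesis"
   then have "?D < ?E" by simp
   then have "sc (B (j + 1)) ?D <= ?E" using St.B.sc(4)[OF u(1) u'(1)] by simp
   moreover have "?D * up j a < sc (B (j + 1)) ?D" using u(6) St.B.lsucc_iff[OF u(1)] by simp
   moreover have "up j (d * a) = ?D * up j a" using u(4)[OF d0] by (simp add: St.up_0)
   ultimately have "up j (d * a) < up j (d * q + d')" using Ele by simp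
   then show False using n1 St.up_less mnum_minus1[of "d * a"] d(2) d0
    by (metis less_add1 less_imp_le less_asym mult_pos_pos order_refl)
  qed
  then show ?thesis using chain[of ?D] u(1) y by blast
 next
  case True
  then have a1: "d * a = d" using q by simp
  have D: "?D = up j d" using St.up_base_dd[OF d(1)] a1 by simp
  show ?thesis
  proof (cases "d = mn (B j)")
   case True
   then have "?D = mn (B (j + 1))" using D St.up_mn by simp
   then show ?thesis using A_finite[OF S] y by simp
  next
   case False
   then have md: "mn (B j) < d" using St.B.mn(2)[OF d(1)] by (simp add: less_le)
   let ?x = "up j (d - 1)"
   have x: "?x = up j (d * q + d')" using n1 a1 by simp
   show ?thesis
   proof (cases "y <= ?x")
    case True
    then show ?thesis using A_down[OF pred] x by simp
   next
    case False
    have "mn (B j) <= d - 1" using md mnum_minus1[OF d0] by (metis less_add1)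
    then have mx: "mn (B (j + 1)) <= ?x" using St.up_le St.up_mn by metis
    let ?f = "bs (B (j + 1)) ?x"
    note f = St.B.bs[OF mx]
    have "0 < ?f" using f(1) St.B.B_gt1 by (meson less_trans zero_less_one)
    from division[OF this] obtain q' r' where qr: "y = ?f * q' + r'" "r' < ?f" by blast
    \<comment> \<open>Otherwise this multiple would be at least \<open>up j d\<close> by
      \<open>no_mult\<close>, although \<open>y\<close> lies below \<open>up j d\<close>. So both
      parts of \<open>y\<close> are images, or smaller than images, of numbers already
      treated.\<close>
    have "?f * q' <= ?x"
    proof (rule ccontr)
     assume "\<not> ?thesis"
     then have "up j d <= ?f * q'" using St.no_mult[OF d(1) md, of q'] by simp
     then have "up j d <= y" using qr(1) by (simp add: add_increasing2)
     then show False using y D by simp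
    qed
    then have "A S (j + 1) (?f * q')" using A_down[OF pred] x by simp
    moreover have "A S (j + 1) r'" using A_down[OF pred] x qr(2) f(2) by (metis less_imp_le less_le_trans)
    moreover have "?f * q' < sc (B (j + 1)) ?f" using St.B.bs_lt[OF mx] \<open>?f * q' <= ?x\<close> by simp
    ultimately show ?thesis using A_sum[OF f(1) _ qr(2)] qr(1) by simp
   qed
  qed
 qed
qed

text \<open>\<open>claim\<close> follows the product through \<open>l\<close> upgrades: it remains a
  base \<open>d\<close> times the image of \<open>x\<close>, and by \<open>A_step\<close> the
  additive jump holds below \<open>d\<close>. A smaller number is \<open>d * q + r\<close> with
  \<open>q\<close> below the image of \<open>x\<close>, where \<open>J\<close> is known.\<close>

lemma prog_J:
 assumes S: "prog S" "S : SS" and h: "!!k m. m < it i k a ==> J S (i + k) m" shows "J S i a"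
 unfolding J_def
proof (intro allI impI)
 fix k b
 assume b: "B (i + k) b" "s_lsucc MS (B (i + k)) b (b * it i k a)" and below: "ALL y. y < b --> A S (i + k) y"
 define j where "j = i + k"
 define x where "x = it i k a"
 have bj: "B j b" "b * x < sc (B j) b" "!!y. y < b ==> A S j y"
  using b below St.B.lsucc_iff unfolding j_def x_def by blast+
 have hj: "J S (j + l) m" if "m < it j l x" for l m
  using that h[of m "k + l"] unfolding j_def x_def it_comp by (simp add: add.assoc)
 show "A S (i + k) (b * it i k a)"
  unfolding j_def[symmetric] x_def[symmetric]
 proof (cases "x = 0")
  case False
  then have x0: "0 < x" by (simp add: pos_iff)
  have claim: "EX d. B (j + l) d & s_lsucc MS (B (j + l)) d (d * it j l x) & it j l (b * x) = d * it j l x &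
    (ALL y. y < d --> A S (j + l) y)" for l
  proof (rule ind[of "%l. EX d. B (j + l) d & s_lsucc MS (B (j + l)) d (d * it j l x) & it j l (b * x) = d * it j l x &
    (ALL y. y < d --> A S (j + l) y)"])
   show "df (%e. EX d. B (j + e 0) d & s_lsucc MS (B (j + e 0)) d (d * it j (e 0) x) & it j (e 0) (b * x) = d * it j (e 0) x &
    (ALL y. y < d --> A S (j + e 0) y))"
    by (intro df_intros df_B df_lsucc tm_it df_A S)
   show "EX d. B (j + 0) d & s_lsucc MS (B (j + 0)) d (d * it j 0 x) & it j 0 (b * x) = d * it j 0 x &
    (ALL y. y < d --> A S (j + 0) y)"
    using bj St.B.lsucc_iff[OF bj(1)] by (intro exI[of _ b]) (simp add: it_0)
   fix l assume "EX d. B (j + l) d & s_lsucc MS (B (j + l)) d (d * it j l x) & it j l (b * x) = d * it j l x &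
    (ALL y. y < d --> A S (j + l) y)"
   then obtain d where d: "B (j + l) d" "d * it j l x < sc (B (j + l)) d" "it j l (b * x) = d * it j l x"
    "!!y. y < d ==> A S (j + l) y" using St.B.lsucc_iff by blast
   note p = it_pos[OF x0, of j l] and u = St.up_dec[OF d(1) it_pos[OF x0] d(2)]
   let ?D = "St.dd (j + l) (d * it j l x)"
   have d0: "0 < d" using d(1) St.B.B_gt1 by (meson less_trans zero_less_one)
   have "A S (j + l + 1) y" if "y < ?D" for y
   proof (rule A_step[OF S d(1) p d(2,4) _ _ that])
    show "J S (j + l) m" if "m < it j l x" for m using hj that .
    show "J S (j + l + 1) m" if "m < up (j + l) (it j l x)" for m
     using hj[of m "l + 1"] that by (simp add: it_Suc add.assoc)
   qed
   moreover have "up (j + l) (d * it j l x) = ?D * up (j + l) (it j l x)" using u(4)[OF d0] by (simp add: St.up_0)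
   ultimately show "EX d. B (j + (l + 1)) d & s_lsucc MS (B (j + (l + 1))) d (d * it j (l + 1) x) &
     it j (l + 1) (b * x) = d * it j (l + 1) x & (ALL y. y < d --> A S (j + (l + 1)) y)"
    using u(1,6) d(3) by (intro exI[of _ ?D]) (simp add: it_Suc add.assoc[symmetric])
  qed
  show "A S j (b * x)"
  proof (rule prog_A[OF S(1)])
   fix l m assume m: "m < it j l (b * x)"
   obtain d where d: "B (j + l) d" "d * it j l x < sc (B (j + l)) d" "it j l (b * x) = d * it j l x"
    "!!y. y < d ==> A S (j + l) y" using claim St.B.lsucc_iff by blast
   have d0: "0 < d" using d(1) St.B.B_gt1 by (meson less_trans zero_less_one)
   obtain q r where qr: "m = d * q + r" "r < d" using division[OF d0] by blast
   have "d * q < d * it j l x" using m d(3) qr by (metis add_increasing2 leD leI mnum_nonneg order_refl order.strict_trans1)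
   then have q: "q < it j l x" "d * q < sc (B (j + l)) d" using mul_less_cancel d(2) less_trans by blast+
   have "A S (j + l) (d * q)"
    using hj[OF q(1), unfolded J_def, rule_format, of 0 d] d q(2) St.B.lsucc_iff[OF d(1)] by (simp add: it_0)
   then show "A S (j + l) m" using A_sum[OF d(1) q(2) qr(2)] d(4)[OF qr(2)] qr(1) by simp
  qed
 qed (simp add: A_0)
qed

section \<open>Transfinite induction for all sets, and termination\<close>

definition TI :: "mnum => bool" where
 "TI x <-> (ALL S:SS. prog S --> (ALL k y. y <= it 0 k x --> pp k y : S))"

lemma A_imp: assumes "prog S" "A S 0 x" "y <= it 0 k x" shows "pp k y : S"
proof -
 have "al k 0 y" by (simp add: al_def it_zero)
 then have "G S k (0 + y)" using assms(2,3) G_0 unfolding A_def by (metis add_0)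
 then show ?thesis using assms(1) by (simp add: prog_def)
qed

text \<open>The jump of \<open>S\<close> is again a set of the model by arithmetical comprehension,
  and it is progressive, so \<open>TI\<close> can be applied to it in place of
  \<open>S\<close>.\<close>

lemma TI_A: assumes "TI y" "prog S" "S : SS" shows "A S 0 y"
proof -
 let ?S = "{z. EX j n. z = pp j n & A S j n}"
 have S: "?S : SS" by (rule pair_set[of "A S"]) (intro df_intros df_A assms(3))
 have "prog ?S"
  unfolding prog_def
 proof (intro allI impI)
  fix j n assume h: "G ?S j n"
  then have "A S (j + k) m" if "m < it j k n" for k m using h[unfolded G_def, rule_format, OF that] by simp
  then have "A S j n" by (rule prog_A[OF assms(2)])
  then show "pp j n : ?S" by blast
 qed
 from assms(1)[unfolded TI_def, rule_format, OF S this, of y 0] have "pp 0 y : ?S" by (simp only: it_0 order_refl)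
 then show ?thesis by simp
qed

lemma TI_J: assumes "TI y" "prog S" "S : SS" shows "J S 0 y"
proof -
 let ?S = "{z. EX j n. z = pp j n & J S j n}"
 have S: "?S : SS" by (rule pair_set[of "J S"]) (intro df_intros df_J assms(3))
 have "prog ?S"
  unfolding prog_def
 proof (intro allI impI)
  fix j n assume h: "G ?S j n"
  then have "J S (j + k) m" if "m < it j k n" for k m using h[unfolded G_def, rule_format, OF that] by simp
  then have "J S j n" by (rule prog_J[OF assms(2,3)])
  then show "pp j n : ?S" by blast
 qed
 from assms(1)[unfolded TI_def, rule_format, OF S this, of y 0] have "pp 0 y : ?S" by (simp only: it_0 order_refl)
 then show ?thesis by simp
qed

lemma J_0: "J S 0 q ==> B 0 b ==> b * q < sc (B 0) b ==> (!!y. y < b ==> A S 0 y) ==> A S 0 (b * q)"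
 unfolding J_def by (metis St.B.lsucc_iff add_0 it_0)

text \<open>The digit of \<open>x\<close> receives its multiplicative jump, and the numbers below
  the base of \<open>x\<close> their additive jump, from smaller instances of \<open>TI\<close>. As
  \<open>TI\<close> quantifies over sets, the induction principle \<open>ind\<close> of the model
  cannot iterate this step.\<close>

lemma TI_step: assumes "!!y. y < x ==> TI y" shows "TI x"
 unfolding TI_def
proof (intro ballI impI)
 fix S assume S: "S : SS" "prog S"
 have "A S 0 x"
 proof (cases "x < mn (B 0)")
  case True
  then show ?thesis using A_finite S by blast
 next
  case False
  then have m: "mn (B 0) <= x" by simp
  obtain a r where ar: "x = bs (B 0) x * a + r" "r < bs (B 0) x" "a < bs (B 0) x" "bs (B 0) x * a < sc (B 0) (bs (B 0) x)"
   using St.B.dec[OF m] by metis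
  note b = St.B.bs[OF m]
  have "y < bs (B 0) x ==> A S 0 y" for y using TI_A assms S b(2) by (meson less_le_trans)
  moreover have "J S 0 a" using TI_J assms S b(2) ar(3) by (meson less_le_trans)
  ultimately have "A S 0 (bs (B 0) x * a)" "A S 0 r" using J_0 b(1) ar by blast+
  then show ?thesis using A_sum[OF b(1) ar(4,2)] ar(1) by simp
 qed
 then show "ALL k y. y <= it 0 k x --> pp k y : S" using A_imp S by blast
qed

text \<open>Slowness bounds all digits in the first hierarchy by \<open>c\<close>, so
  \<open>J\<close> is needed only below \<open>c\<close>. What remains is an induction on
  \<open>x\<close> for \<open>A S 0\<close>, which is definable for fixed \<open>S\<close>.\<close>

lemma TI_all: assumes c: "!!y. y < c ==> TI y" and S: "S : SS" "prog S" shows "pp k y : S"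
proof -
 have "A S 0 x" for x
 proof (rule less_ind[of "A S 0"])
  show "df (%e. A S 0 (e 0))" by (intro df_intros df_A S)
  fix x assume IH: "!!y. y < x ==> A S 0 y"
  show "A S 0 x"
  proof (cases "x < mn (B 0)")
   case True
   then show ?thesis using A_finite S by blast
  next
   case False
   then have m: "mn (B 0) <= x" by simp
   obtain a r where ar: "x = bs (B 0) x * a + r" "r < bs (B 0) x" "bs (B 0) x * a < sc (B 0) (bs (B 0) x)"
    using St.B.dec[OF m] by metis
   note b = St.B.bs[OF m]
   have "sc (B 0) (bs (B 0) x) <= bs (B 0) x * c" using slow[OF b(1)] St.B.succ_sc by blast
   then have "a < c" using ar(3) by (meson mul_less_cancel less_le_trans)
   then have "J S 0 a" using TI_J c S by blast
   moreover have lt: "y < bs (B 0) x ==> A S 0 y" for y using IH b(2) by (meson less_le_trans)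
   ultimately have "A S 0 (bs (B 0) x * a)" using J_0 b(1) ar(3) by blast
   then show ?thesis using A_sum[OF b(1) ar(3,2)] lt[OF ar(2)] ar(1) by simp
  qed
 qed
 then have A: "A S 0 y" for y .
 have "y <= it 0 k y"
 proof (rule ind[of "%k. y <= it 0 k y"])
  show "df (%e. y <= it 0 (e 0) y)" by (intro df_intros tm_it)
  show "y <= it 0 (k + 1) y" if "y <= it 0 k y" for k
   using that St.up_ge[of "it 0 k y" "0 + k"] by (simp add: it_Suc)
 qed (simp add: it_0)
 then show ?thesis using A_imp[OF S(2) A] by blast
qed

lemma gs_ex: "EX g. (ALL p. g p 0 = sn p) & (ALL p k. g p (k + 1) = (if g p k = 0 then 0 else up (fs p + k) (g p k) - 1)) & tm (%e. g (e 0) (e 1))"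
proof (rule recursion[of "%p k v. if v = 0 then 0 else up (fs p + k) v - 1" sn])
 have "up j v = w + 1 <-> w = up j v - 1" if "v ~= 0" for j v w
  using mnum_minus1[of "up j v"] St.up_pos[of v j] that by (auto simp: pos_iff)
 then have *: "((v = 0 & w = 0) \<or> (v ~= 0 & up j v = w + 1)) <-> w = (if v = 0 then 0 else up j v - 1)" for j v w
  by auto
 have "df (%e. (e 3 = 0 & e 0 = 0) \<or> (e 3 ~= 0 & up (fs (e 1) + e 2) (e 3) = e 0 + 1))"
  by (intro df_intros tm_up tm_fs)
 then have "df (%e. e 0 = (if e 3 = 0 then 0 else up (fs (e 1) + e 2) (e 3) - 1))" by (simp only: *)
 then show "tm (%e. if e 2 = 0 then 0 else up (fs (e 0) + e 1) (e 2) - 1)"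
  by (simp only: tm_def std_simps UNIV_I simp_thms numeral_3_eq_3 numeral_2_eq_2 One_nat_def)
 show "tm (%e. sn (e 0))" by (intro df_intros tm_sn)
qed blast

text \<open>The set of pairs from which the sequence reaches 0 is progressive: one step leads from
  \<open>(j, n)\<close> to a number below the image of \<open>n\<close> at stage
  \<open>j + 1\<close>.\<close>

theorem terminates: assumes c: "!!y. y < c ==> TI y" shows "EX i. s_gval MS X n i 0"
proof -
 obtain g where g: "!!p. g p 0 = sn p" "!!p k. g p (k + 1) = (if g p k = 0 then 0 else up (fs p + k) (g p k) - 1)"
  "tm (%e. g (e 0) (e 1))" using gs_ex by blast
 note tmg = tm_comp2[OF g(3)]
 let ?Q = "%j n. EX k. g (pp j n) k = 0"
 let ?S = "{z. EX j n. z = pp j n & ?Q j n}"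
 have S: "?S : SS" by (rule pair_set[of ?Q]) (intro df_intros tmg tm_pp)
 have shift: "g (pp (j + 1) (g (pp j n) 1)) k = g (pp j n) (1 + k)" for j n k
 proof (rule ind[of "%k. g (pp (j + 1) (g (pp j n) 1)) k = g (pp j n) (1 + k)"])
  show "df (%e. g (pp (j + 1) (g (pp j n) 1)) (e 0) = g (pp j n) (1 + e 0))" by (intro df_intros tmg tm_pp)
  show "g (pp (j + 1) (g (pp j n) 1)) (k + 1) = g (pp j n) (1 + (k + 1))"
   if "g (pp (j + 1) (g (pp j n) 1)) k = g (pp j n) (1 + k)" for k
   using that g(2)[of "pp j n" "1 + k"] g(2)[of "pp (j + 1) (g (pp j n) 1)" k] by (simp add: add.assoc)
 qed (simp add: g)
 have "prog ?S"
  unfolding prog_def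
 proof (intro allI impI)
  fix j n assume h: "G ?S j n"
  have "?Q j n"
  proof (cases "n = 0")
   case True
   then have "g (pp j n) 0 = 0" by (simp add: g)
   then show ?thesis by blast
  next
   case False
   then have n: "0 < n" by (simp add: pos_iff)
   have "g (pp j n) 1 = up j n - 1" using g(2)[of "pp j n" 0] False by (simp add: g)
   then have "g (pp j n) 1 < it j 1 n" using mnum_minus1[OF St.up_pos[OF n]] by (metis add1_le it_1 order_refl)
   then have "pp (j + 1) (g (pp j n) 1) : ?S" using h unfolding G_def by blast
   then show ?thesis using shift by auto
  qed
  then show "pp j n : ?S" by blast
 qed
 then have "pp 0 n : ?S" using TI_all[OF c S] by blast
 then obtain i where i: "g (pp 0 n) i = 0" by auto
 let ?G = "{z. EX k. z = pp k (g (pp 0 n) k)}"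
 have "?G : SS" by (rule comprehension[of "%e. EX k. e 0 = pp k (g (pp 0 n) k)"]) (intro df_intros tmg tm_pp)
 moreover have "s_gseq MS X n ?G"
 proof -
  have "(0 < x & s_up MS (B k) (B (k + 1)) x (y + 1)) \<or> (x = 0 & y = 0)"
   if "x = g (pp 0 n) k" "y = g (pp 0 n) (k + 1)" for k x y
   using that g(2)[of "pp 0 n" k] mnum_minus1[OF St.up_pos[of x k]] St.up_iff[of k x "y + 1"] by (auto simp: pos_iff)
  then show ?thesis by (auto simp: s_gseq_def s_fun_def B_sl g)
 qed
 moreover have "pp i 0 : ?G" by (intro CollectI exI[of _ i]) (simp add: i)
 ultimately have "s_gval MS X n i 0" unfolding s_gval_def std_simps pr_MS by blast
 then show ?thesis by blast
qed

end

lemma below_num: "y < tval MS e (num m) ==> EX m'<m. y = tval MS e (num m')"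
proof (induction m)
 case (Suc m)
 then have "y < tval MS e (num m) \<or> y = tval MS e (num m)" by (simp only: num.simps tval.simps std_simps less_add1 le_less)
 then show ?case using Suc.IH less_SucI by blast
qed simp

lemma s_term_num: "s_term MS (tval MS e (num m))"
 unfolding s_term_def
proof (rule ballI, rule impI)
 fix X assume X: "X : Ss MS" "s_dyn MS X & s_slow MS X (tval MS e (num m))"
 then interpret dyn X "tval MS e (num m)" by unfold_locales auto
 \<comment> \<open>This induction takes place outside the model, over genuine natural numbers. It is
   the point where \<open>c\<close> has to be a numeral.\<close>
 have "TI (tval MS e (num k))" for k
 proof (induction k rule: less_induct)
  case (less k)
  then show ?case using TI_step below_num by metis
 qed
 then have "TI y" if "y < tval MS e (num m)" for y using below_num[OF that] by blast
 then have "EX i. s_gval MS X n i 0" for n using terminates by blast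
 then show "ALL n:Dom MS. EX i:Dom MS. s_gval MS X n i (Ze MS)" by simp
qed

lemma MS_str: "is_str MS" by (simp add: is_str_def SS_ne)

theorem ACA0_targets: assumes "\<phi> : targets" shows "ACA0 \<turnstile> \<phi>"
proof (rule targets_provable[OF _ assms])
 fix \<phi> assume "\<phi> : targets"
 then consider "\<phi> = upgrade_unique" | m where "\<phi> = sentence (goodstein_terminates (num m))"
  unfolding targets_def by blast
 then have "valid MS \<phi>"
 proof cases
  case 1
  have "v = w" if "X : SS" "s_dyn MS X" "s_slow MS X c" "s_up MS (sl MS X i) (sl MS X (i + 1)) n v"
   "s_up MS (sl MS X i) (sl MS X (i + 1)) n w" for X c i n v w
  proof -
   interpret dyn X c using that by unfold_locales
   show ?thesis using that(4,5) unfolding B_sl St.up_iff by simp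
  qed
  then show ?thesis unfolding 1 valid_unique[OF MS_str] by auto
 next
  case 2
  then show ?thesis using valid_terminates[OF MS_str] s_term_num by simp
 qed
 then show "valid M0 \<phi>" using valid_mnum by simp
qed

section \<open>Ordinals below epsilon zero\<close>

text \<open>The hereditary multiset \<open>HM M\<close> stands for the natural sum of the powers of \<open>\<omega>\<close> with exponents in \<open>M\<close>.\<close>

datatype hm = HM (un: "hm multiset")

text \<open>The order on trees is to be the multiset extension of itself. Layer \<open>k\<close>
  approximates this from below and is final for trees of height at most \<open>k\<close>.\<close>

primrec lay :: "nat => (hm \<times> hm) set" where
 "lay 0 = {}"
| "lay (Suc k) = inv_image (mult (lay k)) un"

primrec ht :: "hm => nat" where
 "ht (HM M) = Suc (Max (insert 0 (set_mset (image_mset ht M))))"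

lemma ht_mem: "x \<in># M ==> ht x < ht (HM M)"
 by (simp add: less_Suc_eq_le)

lemma ht_le: "(!!x. x \<in># M ==> ht x < k) ==> 0 < k ==> ht (HM M) <= k"
 by (auto simp: Suc_le_eq)

lemma lay_mono: "k <= l ==> lay k <= lay l"
proof (rule lift_Suc_mono_le[of lay])
 show "lay n <= lay (Suc n)" for n
 proof (induction n)
  case (Suc n)
  show ?case using mono_mult[OF Suc] by (simp only: lay.simps) (auto simp: in_inv_image)
 qed simp
qed

lemma trans_lay: "trans (lay k)"
 by (induction k) (auto intro: trans_inv_image simp: trans_mult)

lemma wf_lay: "wf (lay k)"
 by (induction k) (auto intro: wf_inv_image wf_mult)

text \<open>A smaller tree is never higher, so the layer given by the height of the larger tree
  already decides the comparison.\<close>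

lemma lay_ht: "(x, y) : lay k ==> (x, y) : lay (ht y) & ht x <= ht y"
proof (induction k arbitrary: x y)
 case (Suc k)
 obtain M N where xy: "x = HM M" "y = HM N" by (cases x, cases y) auto
 have "(M, N) : mult (lay k)" using Suc.prems by (simp add: xy in_inv_image)
 then obtain I J K where IJK: "N = I + J" "M = I + K" "J ~= {#}" "\<forall>z\<in>#K. \<exists>j\<in>#J. (z, j) : lay k"
  using mult_implies_one_step[OF trans_lay] by metis
 obtain n where n: "ht (HM N) = Suc n" by simp
 have K: "\<exists>j\<in>#J. (z, j) : lay n & ht z <= n" if z: "z \<in># K" for z
 proof -
  obtain j where j: "j \<in># J" "(z, j) : lay k" using bspec[OF IJK(4) z] by blast
  then have "ht j <= n" using ht_mem[of j N] n IJK(1) by simp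
  then show ?thesis using Suc.IH[OF j(2)] lay_mono[of "ht j" n] j(1) by auto
 qed
 then have "(M, N) : mult (lay n)" unfolding IJK by (intro one_step_implies_mult) (use IJK in auto)
 moreover have "ht (HM M) <= Suc n"
 proof (rule ht_le)
  fix z assume "z \<in># M"
  then consider "z \<in># N" | "z \<in># K" unfolding IJK by auto
  then show "ht z < Suc n" using ht_mem[of z N] n K[of z] by cases auto
 qed simp
 ultimately show ?case by (simp add: xy n in_inv_image del: ht.simps)
qed simp

lemma total_lay: "total_on {x. ht x <= k} (lay k)"
proof (induction k)
 case 0
 have "ht x ~= 0" for x by (cases x) simp
 then show ?case unfolding total_on_def by (metis (mono_tags) le_zero_eq mem_Collect_eq)
next
 case (Suc k)
 have *: "total_on {M. set_mset M <= {x. ht x <= k}} (mult (lay k))"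
  by (rule total_on_mult[OF Suc trans_lay]) auto
 show ?case
 proof (rule total_onI)
  fix x y assume xy: "x : {x. ht x <= Suc k}" "y : {x. ht x <= Suc k}" "x ~= y"
  have "set_mset (un z) <= {x. ht x <= k}" if "ht z <= Suc k" for z
   using that ht_mem[of _ "un z"] by (auto simp del: ht.simps dest!: ht_mem[of _ "un z"])
  moreover have "un x ~= un y" using xy(3) by (cases x, cases y) simp
  ultimately show "(x, y) : lay (Suc k) \<or> (y, x) : lay (Suc k)"
   using * xy unfolding total_on_def by (simp add: in_inv_image)
 qed
qed

instantiation hm :: linorder
begin

definition less_hm :: "hm => hm => bool" where "x < y <-> (x, y) : lay (ht y)"
definition less_eq_hm :: "hm => hm => bool" where "(x :: hm) <= y <-> x < y \<or> x = y"

lemma less_hmI: "(x, y) : lay k ==> x < y"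
 using lay_ht unfolding less_hm_def by blast

lemma less_hm_lay: "x < y ==> ht y <= k ==> (x, y) : lay k"
 using lay_mono unfolding less_hm_def by blast

lemma less_hm_ht: "x < y ==> ht x <= ht y"
 using lay_ht unfolding less_hm_def by blast

instance
proof -
 have irr: "\<not> x < x" for x :: hm using wf_not_refl[OF wf_lay] unfolding less_hm_def by blast
 have tr: "x < z" if "x < y" "y < z" for x y z :: hm
  using transD[OF trans_lay less_hm_lay[OF that(1) less_hm_ht[OF that(2)]]] that(2) by (auto simp: less_hm_def)
 have tot: "x < y \<or> x = y \<or> y < x" for x y :: hm
  using total_lay[of "max (ht x) (ht y)"] unfolding total_on_def
  by (metis (mono_tags, lifting) less_hmI max.cobounded1 max.cobounded2 mem_Collect_eq)
 show "OFCLASS(hm, linorder_class)"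
 proof
  show "x <= y \<or> y <= x" for x y :: hm using tot[of x y] by (auto simp: less_eq_hm_def)
 qed (use irr tr in \<open>auto simp: less_eq_hm_def\<close>)
qed

end

instance hm :: wellorder
proof (rule wf_wellorderI)
 show "wf {(x, y :: hm). x < y}"
 proof (rule wfI_min)
  fix y :: hm and Q assume "y : Q"
  then obtain z where z: "z : {x : Q. ht x <= ht y}" "!!x. (x, z) : lay (ht y) ==> x ~: {x : Q. ht x <= ht y}"
   using wfE_min[OF wf_lay, of y "{x : Q. ht x <= ht y}"] by blast
  have "x ~: Q" if "x < z" for x using z(1) z(2)[of x] less_hm_ht[OF that] less_hm_lay[OF that, of "ht y"] by simp
  then show "EX z:Q. ALL x. (x, z) : {(x, y). x < y} --> x ~: Q" using z(1) by auto
 qed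
qed intro_classes

text \<open>The fixed-point property behind the layers; from here on they are no longer
  mentioned.\<close>

lemma HM_less [simp]: "HM M < HM N <-> M < N"
proof
 assume "HM M < HM N"
 then have "(M, N) : mult (lay (Max (insert 0 (ht ` set_mset N))))" by (simp add: less_hm_def in_inv_image)
 then show "M < N" unfolding less_multiset_def multp_def
  by (rule rev_subsetD[OF _ mono_mult]) (auto intro: less_hmI)
next
 assume "M < N"
 then have "(M, N) : mult {(x, y). x < y}" unfolding less_multiset_def multp_def .
 then obtain I J K where IJK: "N = I + J" "M = I + K" "J ~= {#}" "\<forall>z\<in>#K. \<exists>j\<in>#J. z < j"
  using mult_implies_one_step[of "{(x, y :: hm). x < y}" M N] unfolding trans_def
  by (simp add: case_prod_beta) (metis order_less_trans)
 have "(M, N) : mult (lay (ht (HM N)))" unfolding IJK(1,2)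
 proof (rule one_step_implies_mult)
  show "\<forall>z\<in>#K. \<exists>j\<in>#J. (z, j) : lay (ht (HM (I + J)))"
   using IJK(4) less_hm_lay ht_mem[of _ "I + J"] by (metis less_imp_le union_iff)
 qed (use IJK in auto)
 then have "(HM M, HM N) : lay (Suc (ht (HM N)))" by (simp add: in_inv_image del: ht.simps)
 then show "HM M < HM N" by (rule less_hmI)
qed

lemma HM_le [simp]: "HM M <= HM N <-> M <= N"
 by (auto simp: le_less)

instantiation hm :: "{ordered_cancel_comm_monoid_add, order_bot}"
begin
definition zero_hm :: hm where "0 = HM {#}"
definition plus_hm :: "hm => hm => hm" where "x + y = HM (un x + un y)"
definition minus_hm :: "hm => hm => hm" where "x - y = HM (un x - un y)"
definition bot_hm :: hm where "bot = HM {#}"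
instance
proof
 fix a b c :: hm
 show "a + b - a = b" "a - b - c = a - (b + c)" "bot <= a"
  by (simp_all add: plus_hm_def minus_hm_def bot_hm_def) (cases a; simp)
 show "a <= b ==> c + a <= c + b" by (cases a, cases b, cases c) (simp add: plus_hm_def)
qed (simp_all add: plus_hm_def zero_hm_def ac_simps)
end

lemma HM_plus: "HM M + HM N = HM (M + N)" by (simp add: plus_hm_def)
lemma hm_ge_0 [simp]: "0 <= (x :: hm)" using bot_least[of x] by (simp add: bot_hm_def zero_hm_def)
lemma hm_not_less_0 [simp]: "\<not> (x :: hm) < 0" using hm_ge_0[of x] by (simp add: not_less)
lemma hm_pos: "0 < (x :: hm) <-> x ~= 0" using hm_ge_0[of x] by (auto simp: le_less)
lemma hm_add_less_iff [simp]: "a + b < a + c <-> b < (c :: hm)" "b + a < c + a <-> b < (c :: hm)"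
 by (cases a; cases b; cases c; simp add: HM_plus)+
lemma hm_le_add [simp]: "a <= a + (b :: hm)" "b <= a + (b :: hm)"
 using add_left_mono[of 0 b a] add_right_mono[of 0 a b] by simp_all

text \<open>\<open>w x\<close> is \<omega> to the power \<open>x\<close>, and \<open>fin n\<close>
  is the finite ordinal \<open>n\<close>.\<close>

definition w :: "hm => hm" where "w x = HM {#x#}"
definition fin :: "nat => hm" where "fin n = HM (replicate_mset n 0)"

lemma w_less [simp]: "w x < w y <-> x < y" by (simp add: w_def)

lemma HM_less_w: "HM M < w x <-> (\<forall>y\<in>#M. y < x)"
proof
 assume "HM M < w x"
 then have M: "M < {#x#}" by (simp add: w_def)
 show "\<forall>y\<in>#M. y < x"
 proof
  fix y assume "y \<in># M"
  then obtain N where N: "M = add_mset y N" by (metis insert_DiffM)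
  have "{#y#} <= M" by (simp add: N)
  then have "{#y#} < {#x#}" using M by (rule le_less_trans)
  then show "y < x" by simp
 qed
next
 assume "\<forall>y\<in>#M. y < x"
 then show "HM M < w x" unfolding w_def by (simp add: ex_gt_imp_less_multiset)
qed

lemma w_add_less: "x < w z ==> y < w z ==> x + y < w z"
 by (cases x, cases y) (auto simp: HM_plus HM_less_w)

text \<open>Notations are finite trees, so they stay below the first fixed point of
  exponentiation.\<close>

lemma less_w: "x < w x"
proof (induction x)
 case (HM M)
 have "y < HM M" if "y \<in># M" for y
 proof -
  have "w y <= HM M" unfolding w_def using that by (simp add: subset_eq_imp_le_multiset)
  then show ?thesis using HM[OF that] by (rule less_le_trans[rotated])
 qed
 then show ?case by (simp add: HM_less_w)
qed

lemma fin_add [simp]: "fin m + fin n = fin (m + n)" by (simp add: fin_def HM_plus multiset_eq_iff)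
lemma fin_0 [simp]: "fin 0 = 0" by (simp add: fin_def zero_hm_def)
lemma fin_less [simp]: "fin m < fin n <-> m < n"
proof -
 have *: "fin m < fin n" if mn: "m < n" for m n
 proof -
  have "replicate_mset m (0 :: hm) \<subset># replicate_mset n 0"
   using mn by (simp add: subset_mset.less_le multiset_eq_iff count_replicate_mset mset_subset_eqI)
  then show ?thesis by (simp add: fin_def subset_imp_less_mset)
 qed
 show ?thesis using *[of m n] *[of n m] by (metis less_asym linorder_neqE_nat less_irrefl)
qed
lemma fin_le [simp]: "fin m <= fin n <-> m <= n" by (metis fin_less not_less)
lemma fin_less_w: "0 < x ==> fin n < w x" by (auto simp: fin_def HM_less_w)

lemma ltp [simp]: "x < x + fin n <-> 0 < n"
 using hm_add_less_iff(1)[of x 0 "fin n"] fin_less[of 0 n] by simp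

section \<open>Cut elimination for arithmetic with the omega rule\<close>

text \<open>Negation normal form over a single set of numbers. Statements without the set are
  evaluated to constants at once, and negation is the operation \<open>dual\<close>.\<close>

datatype inf = Cst bool | Lit bool nat | Conj "nat => inf" | Disj "nat => inf"

primrec dual :: "inf => inf" where
 "dual (Cst b) = Cst (\<not> b)"
| "dual (Lit b n) = Lit (\<not> b) n"
| "dual (Conj f) = Disj (%n. dual (f n))"
| "dual (Disj f) = Conj (%n. dual (f n))"

text \<open>A relation of upper bounds instead of a rank function, since the components of an
  infinite conjunction may have unbounded ranks.\<close>

primrec rb :: "inf => nat => bool" where
 "rb (Cst b) = (%m. True)"
| "rb (Lit b n) = (%m. True)"
| "rb (Conj f) = (%m. 0 < m & (ALL n. rb (f n) (m - 1)))"
| "rb (Disj f) = (%m. 0 < m & (ALL n. rb (f n) (m - 1)))"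

lemma dual_dual [simp]: "dual (dual \<phi>) = \<phi>" by (induction \<phi>) auto
lemma rb_dual [simp]: "rb (dual \<phi>) m = rb \<phi> m" by (induction \<phi> arbitrary: m) auto
lemma rb_mono: "rb \<phi> m ==> m <= m' ==> rb \<phi> m'"
proof (induction \<phi> arbitrary: m m')
 case (Conj f)
 have "rb (f n) (m' - 1)" for n by (rule Conj.IH[of _ "m - 1"]) (use Conj.prems in auto)
 then show ?case using Conj.prems by auto
next
 case (Disj f)
 have "rb (f n) (m' - 1)" for n by (rule Disj.IH[of _ "m - 1"]) (use Disj.prems in auto)
 then show ?case using Disj.prems by auto
qed auto

text \<open>A Tait calculus with sets as sequents: the principal formula may persist in the
  premises, which makes contraction implicit. Cut ranks lie strictly below \<open>k\<close>, so
  \<open>k = 0\<close> means cut free.\<close>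

inductive der :: "hm => nat => inf set => bool" where
 Tru: "Cst True : \<Gamma> ==> der \<alpha> k \<Gamma>"
| Axm: "Lit True n : \<Gamma> ==> Lit False n : \<Gamma> ==> der \<alpha> k \<Gamma>"
| Cnj: "Conj f : \<Gamma> ==> (!!n. \<beta> n < \<alpha>) ==> (!!n. der (\<beta> n) k (insert (f n) \<Gamma>)) ==> der \<alpha> k \<Gamma>"
| Dsj: "Disj f : \<Gamma> ==> \<beta> < \<alpha> ==> der \<beta> k (insert (f n) \<Gamma>) ==> der \<alpha> k \<Gamma>"
| Cut: "rb \<phi> m ==> m < k ==> \<beta> < \<alpha> ==> der \<beta> k (insert \<phi> \<Gamma>) ==> der \<beta> k (insert (dual \<phi>) \<Gamma>) ==> der \<alpha> k \<Gamma>"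

lemma der_weak: "der \<alpha> k \<Gamma> ==> \<alpha> <= \<alpha>' ==> k <= k' ==> \<Gamma> <= \<Gamma>' ==> der \<alpha>' k' \<Gamma>'"
proof (induction arbitrary: \<alpha>' k' \<Gamma>' rule: der.induct)
 case (Cnj f \<Gamma> \<beta> \<alpha> k)
 show ?case
 proof (rule der.Cnj[of f _ \<beta>])
  show "\<beta> n < \<alpha>'" for n using Cnj.hyps(2) Cnj.prems(1) by (rule less_le_trans)
  show "der (\<beta> n) k' (insert (f n) \<Gamma>')" for n by (rule Cnj.IH) (use Cnj.prems in auto)
 qed (use Cnj in auto)
next
 case (Dsj f \<Gamma> \<beta> \<alpha> k n)
 show ?case
 proof (rule der.Dsj[of f _ \<beta> _ _ n])
  show "\<beta> < \<alpha>'" using Dsj.hyps(2) Dsj.prems(1) by (rule less_le_trans)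
  show "der \<beta> k' (insert (f n) \<Gamma>')" by (rule Dsj.IH) (use Dsj.prems in auto)
 qed (use Dsj in auto)
next
 case (Cut \<phi> m k \<beta> \<alpha> \<Gamma>)
 show ?case
 proof (rule der.Cut[of \<phi> m _ \<beta>])
  show "\<beta> < \<alpha>'" using Cut.hyps(3) Cut.prems(1) by (rule less_le_trans)
  show "der \<beta> k' (insert \<phi> \<Gamma>')" "der \<beta> k' (insert (dual \<phi>) \<Gamma>')" by (rule Cut.IH; use Cut.prems in auto)+
 qed (use Cut in auto)
qed (auto intro: der.Tru der.Axm)

lemma der_Cst_False: "der \<alpha> k \<Delta> ==> \<Delta> <= insert (Cst False) \<Gamma> ==> der \<alpha> k \<Gamma>"
proof (induction arbitrary: \<Gamma> rule: der.induct)
 case (Cnj f \<Delta> \<beta> \<alpha> k)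
 have D: "der (\<beta> n) k (insert (f n) \<Gamma>)" for n by (rule Cnj.IH) (use Cnj.prems in auto)
 show ?case by (rule der.Cnj[of f _ \<beta>]) (use D Cnj.hyps(1,2) Cnj.prems in \<open>auto\<close>)
next
 case (Dsj f \<Delta> \<beta> \<alpha> k n)
 have D: "der \<beta> k (insert (f n) \<Gamma>)" by (rule Dsj.IH) (use Dsj.prems in auto)
 show ?case by (rule der.Dsj[of f _ \<beta>]) (use D Dsj.hyps(1,2) Dsj.prems in \<open>auto\<close>)
next
 case (Cut \<phi> m k \<beta> \<alpha> \<Delta>)
 have D: "der \<beta> k (insert \<phi> \<Gamma>)" "der \<beta> k (insert (dual \<phi>) \<Gamma>)" by (rule Cut.IH; use Cut.prems in auto)+
 show ?case by (rule der.Cut[of \<phi> m _ \<beta>]) (use D Cut.hyps(1-3) in \<open>auto\<close>)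
qed (auto intro: der.Tru der.Axm)

text \<open>The hypothesis is an inclusion, as in the related lemmas, because the conjunction may
  persist in the premises of its own rule and must be removed there as well.\<close>

lemma der_inversion: "der \<alpha> k \<Delta> ==> \<Delta> <= insert (Conj f) \<Gamma> ==> der \<alpha> k (insert (f n) \<Gamma>)"
proof (induction arbitrary: \<Gamma> rule: der.induct)
 case (Cnj g \<Delta> \<beta> \<alpha> k)
 show ?case
 proof (cases "g = f")
  case True
  have "der (\<beta> n) k (insert (f n) (insert (f n) \<Gamma>))" by (rule Cnj.IH) (use Cnj.prems True in auto)
  then show ?thesis by (rule der_weak) (use Cnj.hyps(2)[of n] in auto)
 next
  case False
  have D: "der (\<beta> i) k (insert (f n) (insert (g i) \<Gamma>))" for i by (rule Cnj.IH) (use Cnj.prems in auto)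
  show ?thesis by (rule der.Cnj[of g _ \<beta>]) (use D Cnj.hyps(1,2) Cnj.prems False in \<open>(auto simp: insert_commute)\<close>)
 qed
next
 case (Dsj g \<Delta> \<beta> \<alpha> k i)
 have D: "der \<beta> k (insert (f n) (insert (g i) \<Gamma>))" by (rule Dsj.IH) (use Dsj.prems in auto)
 show ?case by (rule der.Dsj[of g _ \<beta>]) (use D Dsj.hyps(1,2) Dsj.prems in \<open>(auto simp: insert_commute)\<close>)
next
 case (Cut \<phi> m k \<beta> \<alpha> \<Delta>)
 have D: "der \<beta> k (insert (f n) (insert \<phi> \<Gamma>))" "der \<beta> k (insert (f n) (insert (dual \<phi>) \<Gamma>))"
  by (rule Cut.IH; use Cut.prems in auto)+
 show ?case by (rule der.Cut[of \<phi> m _ \<beta>]) (use D Cut.hyps(1-3) in \<open>(simp_all add: insert_commute)\<close>)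
qed (auto intro: der.Tru der.Axm)

text \<open>Each use of \<phi> in the first derivation is replaced by a cut of smaller rank against
  an inverted instance of its dual. The natural sum is strictly monotone, so the heights simply add
  up.\<close>

lemma der_reduction:
 "der \<beta> k \<Delta> ==> \<Delta> <= insert \<phi> \<Gamma> ==> der \<alpha> k (insert (dual \<phi>) \<Gamma>) ==> rb \<phi> k ==>
  (EX f. \<phi> = Disj f) \<or> (EX n. \<phi> = Lit False n) ==> der (\<alpha> + \<beta>) k \<Gamma>"
proof (induction arbitrary: \<Gamma> rule: der.induct)
 case (Tru \<Delta> \<beta> k)
 then show ?case by (auto intro: der.Tru der.Axm)
next
 case (Axm n \<Delta> \<beta> k)
 show ?case
 proof (cases "\<phi> = Lit False n")
  case True
  then have "der \<alpha> k \<Gamma>" using Axm by (auto simp: insert_absorb)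
  then show ?thesis by (rule der_weak) auto
 next
  case False
  then show ?thesis using Axm by (auto intro: der.Tru der.Axm)
 qed
next
 case (Cnj g \<Delta> \<beta>' \<beta> k)
 have D: "der (\<alpha> + \<beta>' n) k (insert (g n) \<Gamma>)" for n
  by (rule Cnj.IH) (use Cnj.prems in \<open>auto intro: der_weak\<close>)
 show ?case by (rule der.Cnj[of g _ "%n. \<alpha> + \<beta>' n"]) (use D Cnj.hyps(1,2) Cnj.prems in \<open>auto\<close>)
next
 case (Dsj g \<Delta> \<beta>' \<beta> k n)
 have 1: "der (\<alpha> + \<beta>') k (insert (g n) \<Gamma>)"
  by (rule Dsj.IH) (use Dsj.prems in \<open>auto intro: der_weak\<close>)
 show ?case
 proof (cases "\<phi> = Disj g")
  case True
  have 2: "der \<alpha> k (insert (dual (g n)) \<Gamma>)"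
   using der_inversion[OF Dsj.prems(2), of "%n. dual (g n)" \<Gamma> n] True by auto
  have "rb (g n) (k - 1)" "k - 1 < k" using Dsj.prems(3) True by auto
  then show ?thesis
   by (rule der.Cut[of _ _ _ "\<alpha> + \<beta>'"]) (use Dsj.hyps(2) 1 2 in \<open>auto intro: der_weak\<close>)
 next
  case False
  show ?thesis by (rule der.Dsj[of g _ "\<alpha> + \<beta>'"]) (use False Dsj.hyps(1,2) Dsj.prems 1 in \<open>auto\<close>)
 qed
next
 case (Cut \<psi> m k \<beta>' \<beta> \<Delta>)
 have D: "der (\<alpha> + \<beta>') k (insert \<psi> \<Gamma>)" "der (\<alpha> + \<beta>') k (insert (dual \<psi>) \<Gamma>)"
  by (rule Cut.IH; use Cut.prems in \<open>auto intro: der_weak\<close>)+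
 show ?case by (rule der.Cut[of \<psi> m _ "\<alpha> + \<beta>'"]) (use D Cut.hyps(1-3) in \<open>auto\<close>)
qed

text \<open>After reduction a cut of top rank costs \<open>w \<beta> + w \<beta>\<close>, which is
  below \<open>w \<alpha>\<close> because \<beta> is below \<alpha>.\<close>

lemma cut_elim: "der \<alpha> k' \<Gamma> ==> k' = Suc k ==> der (w \<alpha>) k \<Gamma>"
proof (induction rule: der.induct)
 case (Cnj f \<Gamma> \<beta> \<alpha> k')
 show ?case by (rule der.Cnj[of f _ "%n. w (\<beta> n)"]) (use Cnj  in \<open>auto\<close>)
next
 case (Dsj f \<Gamma> \<beta> \<alpha> k' n)
 show ?case by (rule der.Dsj[of f _ "w \<beta>"]) (use Dsj  in \<open>auto\<close>)
next
 case (Cut \<phi> m k' \<beta> \<alpha> \<Gamma>)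
 have IH: "der (w \<beta>) k (insert \<phi> \<Gamma>)" "der (w \<beta>) k (insert (dual \<phi>) \<Gamma>)" using Cut by auto
 have r: "rb \<phi> k" using rb_mono[OF Cut.hyps(1)] Cut.hyps(2) Cut.prems by simp
 have le: "w \<beta> + w \<beta> <= w \<alpha>" using w_add_less[of "w \<beta>" \<alpha> "w \<beta>"] Cut.hyps(3) by simp
 have "der (w \<beta> + w \<beta>) k \<Gamma>"
 proof (cases \<phi>)
  case (Cst b)
  have "der (w \<beta>) k \<Gamma>"
  proof (cases b)
   case True
   then show ?thesis using der_Cst_False[OF IH(2), of \<Gamma>] Cst by simp
  next
   case False
   then show ?thesis using der_Cst_False[OF IH(1), of \<Gamma>] Cst by simp
  qed
  then show ?thesis by (rule der_weak) auto
 next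
  case (Lit b n)
  show ?thesis
  proof (cases b)
   case True
   show ?thesis by (rule der_reduction[OF IH(2) subset_refl]) (use IH(1) r Lit True in auto)
  next
   case False
   show ?thesis by (rule der_reduction[OF IH(1) subset_refl IH(2) r]) (use Lit False in auto)
  qed
 next
  case (Conj f)
  show ?thesis by (rule der_reduction[OF IH(2) subset_refl]) (use IH(1) r Conj in auto)
 next
  case (Disj f)
  show ?thesis by (rule der_reduction[OF IH(1) subset_refl IH(2) r]) (use Disj in auto)
 qed
 then show ?case by (rule der_weak) (use le in auto)
qed (auto intro: der.Tru der.Axm)

lemma cut_free: "der \<alpha> k \<Gamma> ==> \<exists>\<beta>. der \<beta> 0 \<Gamma>"
 by (induction k arbitrary: \<alpha>) (auto dest: cut_elim)

primrec itr :: "nat set => inf => bool" where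
 "itr Y (Cst b) <-> b"
| "itr Y (Lit b n) <-> (b <-> n : Y)"
| "itr Y (Conj f) <-> (ALL n. itr Y (f n))"
| "itr Y (Disj f) <-> (EX n. itr Y (f n))"

primrec lits :: "inf => nat set" where
 "lits (Cst b) = {}"
| "lits (Lit b n) = {n}"
| "lits (Conj f) = (\<Union>n. lits (f n))"
| "lits (Disj f) = (\<Union>n. lits (f n))"

lemma itr_dual [simp]: "itr Y (dual \<phi>) <-> \<not> itr Y \<phi>" by (induction \<phi>) auto
lemma lits_dual [simp]: "lits (dual \<phi>) = lits \<phi>" by (induction \<phi>) auto

lemma itr_cong: "(!!n. n : lits \<phi> ==> n : Y <-> n : Z) ==> itr Y \<phi> = itr Z \<phi>"
proof (induction \<phi>)
 case (Conj f)
 have "itr Y (f n) = itr Z (f n)" for n by (rule Conj.IH) (use Conj.prems in auto)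
 then show ?case by simp
next
 case (Disj f)
 have "itr Y (f n) = itr Z (f n)" for n by (rule Disj.IH) (use Disj.prems in auto)
 then show ?case by simp
qed auto

text \<open>The state \<open>h\<close> decides the membership in \<open>Y\<close> of all numbers of index less than \<open>L h\<close>, and the
 states extending a state of size \<open>\<alpha>\<close> allow a descent along a cut-free derivation of height \<open>\<alpha>\<close>:
 the side formulas are refuted at every state which decides the chosen instance.\<close>

lemma descent:
 fixes big :: "hm => 'h => bool" and Y :: "'h => nat set" and L :: "'h => nat" and idx :: "nat => nat"
 assumes ext: "!!\<alpha> \<beta> h n. big \<alpha> h ==> \<beta> < \<alpha> ==> EX h'. big \<beta> h' & n <= L h' & L h <= L h' &
   (ALL x. idx x < L h --> (x : Y h' <-> x : Y h))"
  and N: "!!\<phi>. \<phi> : N ==> EX f b. \<phi> = Disj f & (ALL i. ALL x:lits (f i). idx x < b i) &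
   (ALL i x h. big x h --> b i <= L h --> \<not> itr (Y h) (f i))"
 shows "der \<alpha> k \<Gamma> ==> k = 0 ==> (!!\<phi>. \<phi> : \<Gamma> ==> \<phi> : N \<or> (ALL x:lits \<phi>. idx x < L h) & \<not> itr (Y h) \<phi>) ==>
  big \<alpha> h ==> False"
proof (induction arbitrary: h rule: der.induct)
 case (Tru \<Gamma> \<alpha> k)
 then show ?case using Tru.prems(2)[OF Tru.hyps] N[of "Cst True"] by auto
next
 case (Axm n \<Gamma> \<alpha> k)
 show ?case using Axm.prems(2)[OF Axm.hyps(1)] Axm.prems(2)[OF Axm.hyps(2)] N[of "Lit True n"] N[of "Lit False n"] by auto
next
 case (Cnj f \<Gamma> \<beta> \<alpha> k)
 have f: "ALL x:lits (Conj f). idx x < L h" "\<not> itr (Y h) (Conj f)"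
  using Cnj.prems(2)[OF Cnj.hyps(1)] N[of "Conj f"] by auto
 then obtain n where n: "\<not> itr (Y h) (f n)" "ALL x:lits (f n). idx x < L h" by auto
 \<comment> \<open>The false instance \<open>n\<close> is already decided by the current state; the
   extension only serves to descend to the height of this premise.\<close>
 obtain h' where h': "big (\<beta> n) h'" "L h <= L h'" "!!x. idx x < L h ==> x : Y h' <-> x : Y h"
  using ext[OF Cnj.prems(3) Cnj.hyps(2)] by blast
 show ?case
 proof (rule Cnj.IH[OF Cnj.prems(1) _ h'(1)])
  fix \<phi> assume "\<phi> : insert (f n) \<Gamma>"
  then have "\<phi> : N \<or> (ALL x:lits \<phi>. idx x < L h) & \<not> itr (Y h) \<phi>" using n Cnj.prems(2) by auto
  moreover have "itr (Y h') \<phi> = itr (Y h) \<phi>" if "ALL x:lits \<phi>. idx x < L h"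
   by (rule itr_cong) (use that h'(3) in blast)
  ultimately show "\<phi> : N \<or> (ALL x:lits \<phi>. idx x < L h') & \<not> itr (Y h') \<phi>"
   using h'(2) less_le_trans by blast
 qed
next
 case (Dsj f \<Gamma> \<beta> \<alpha> k n)
 have f: "Disj f : N \<or> (ALL x:lits (Disj f). idx x < L h) & \<not> itr (Y h) (Disj f)"
  using Dsj.prems(2)[OF Dsj.hyps(1)] by auto
 \<comment> \<open>For a side formula from \<open>N\<close> the state is extended until it has
   decided the chosen instance, and from then on that instance is false.\<close>
 obtain b where b: "Disj f : N ==> (ALL x:lits (f n). idx x < b) & (ALL x h. big x h --> b <= L h --> \<not> itr (Y h) (f n))"
  using N[of "Disj f"] by blast
 obtain h' where h': "big \<beta> h'" "L h <= L h'" "b <= L h'" "!!x. idx x < L h ==> x : Y h' <-> x : Y h"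
  using ext[OF Dsj.prems(3) Dsj.hyps(2)] by blast
 show ?case
 proof (rule Dsj.IH[OF Dsj.prems(1) _ h'(1)])
  fix \<phi> assume \<phi>: "\<phi> : insert (f n) \<Gamma>"
  have *: "(ALL x:lits \<phi>. idx x < L h') & \<not> itr (Y h') \<phi>" if "(ALL x:lits \<phi>. idx x < L h) & \<not> itr (Y h) \<phi>"
   using that itr_cong[of \<phi> "Y h'" "Y h"] h'(2,4) less_le_trans by blast
  have "\<phi> : N \<or> (ALL x:lits \<phi>. idx x < L h') & \<not> itr (Y h') \<phi>" if "\<phi> : \<Gamma>"
   using Dsj.prems(2)[OF that] * by blast
  moreover have "(ALL x:lits (f n). idx x < L h') & \<not> itr (Y h') (f n)"
  proof (cases "Disj f : N")
   case True
   then show ?thesis using b h'(1,3) less_le_trans by blast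
  next
   case False
   then have "(ALL x:lits (f n). idx x < L h) & \<not> itr (Y h) (f n)" using f by auto
   then show ?thesis using itr_cong[of "f n" "Y h'" "Y h"] h'(2,4) less_le_trans by blast
  qed
  ultimately show "\<phi> : N \<or> (ALL x:lits \<phi>. idx x < L h') & \<not> itr (Y h') \<phi>" using \<phi> by blast
 qed
qed simp

text \<open>The language only has countable disjunctions, so the second disjunct is repeated at all
  positions but the first.\<close>

definition IMP :: "inf => inf => inf" where "IMP A B = Disj (case_nat (dual A) (%_. B))"

abbreviation NN :: "nat set => nat mdl" where "NN Y \<equiv> std {Y}"

lemma tval_NN: "tval (NN Y) e t = tval (NN {}) e t" by (induction t) auto

text \<open>The standard meaning of a formula as an infinitary formula about one set of numbers, which
 interprets all set variables.\<close>

primrec F :: "(nat => nat) => fm => inf" where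
 "F e Falsum = Cst False"
| "F e (Eq s t) = Cst (tval (NN {}) e s = tval (NN {}) e t)"
| "F e (Less s t) = Cst (tval (NN {}) e s < tval (NN {}) e t)"
| "F e (Mem t X) = Lit True (tval (NN {}) e t)"
| "F e (Imp \<phi> \<psi>) = IMP (F e \<phi>) (F e \<psi>)"
| "F e (AllN x \<phi>) = Conj (%n. F (e(x := n)) \<phi>)"
| "F e (AllS X \<phi>) = F e \<phi>"

primrec rk :: "fm => nat" where
 "rk Falsum = 0"
| "rk (Eq s t) = 0"
| "rk (Less s t) = 0"
| "rk (Mem t X) = 0"
| "rk (Imp \<phi> \<psi>) = Suc (max (rk \<phi>) (rk \<psi>))"
| "rk (AllN x \<phi>) = Suc (rk \<phi>)"
| "rk (AllS X \<phi>) = rk \<phi>"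

lemma rb_F: "rb (F e \<phi>) (rk \<phi>)"
proof (induction \<phi> arbitrary: e)
 case (Imp \<phi> \<psi>)
 then show ?case
  using rb_mono[OF Imp(1)[of e], of "max (rk \<phi>) (rk \<psi>)"] rb_mono[OF Imp(2)[of e], of "max (rk \<phi>) (rk \<psi>)"]
  by (auto simp: IMP_def split: nat.split)
qed auto

lemma itr_F: "itr Y (F e \<phi>) = sat (NN Y) e (%_. Y) \<phi>"
proof (induction \<phi> arbitrary: e)
 case (Imp \<phi> \<psi>)
 have "itr Y (IMP A B) = (itr Y A --> itr Y B)" for A B
 proof -
  have "itr Y (IMP A B) <-> (EX n. itr Y (case_nat (dual A) (%_. B) n))" by (simp add: IMP_def)
  also have "\<dots> <-> itr Y (case_nat (dual A) (%_. B) 0) \<or> (EX n. itr Y (case_nat (dual A) (%_. B) (Suc n)))"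
   by (metis not0_implies_Suc)
  finally show ?thesis by simp
 qed
 then show ?case by (simp add: Imp)
next
 case (AllS X \<phi>)
 have "(%_. Y)(X := Y) = (%_ :: nat. Y)" by auto
 then show ?case by (simp add: AllS)
qed (auto simp: tval_NN[of Y])

lemma F_cong: "(!!x. x : fvN \<phi> ==> e x = e' x) ==> F e \<phi> = F e' \<phi>"
proof (induction \<phi> arbitrary: e e')
 case (Imp \<phi> \<psi>)
 have "F e \<phi> = F e' \<phi>" "F e \<psi> = F e' \<psi>" by (rule Imp.IH; use Imp.prems in auto)+
 then show ?case by simp
next
 case (AllN x \<phi>)
 have "F (e(x := a)) \<phi> = F (e'(x := a)) \<phi>" for a by (rule AllN.IH) (use AllN.prems in auto)
 then show ?case by simp
next
 case (Eq s t)
 then show ?case using tval_cong[of s e e' "NN {}"] tval_cong[of t e e' "NN {}"] by simp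
next
 case (Less s t)
 then show ?case using tval_cong[of s e e' "NN {}"] tval_cong[of t e e' "NN {}"] by simp
next
 case (Mem t X)
 then show ?case using tval_cong[of t e e' "NN {}"] by simp
next
 case (AllS X \<phi>)
 have "F e \<phi> = F e' \<phi>" by (rule AllS.IH) (use AllS.prems in auto)
 then show ?case by simp
qed simp

lemma F_upd: "x ~: fvN \<phi> ==> F (e(x := a)) \<phi> = F e \<phi>" by (rule F_cong) auto

lemma F_substN: "free_forN u x \<phi> ==> F e (substN x u \<phi>) = F (e(x := tval (NN {}) e u)) \<phi>"
proof (induction \<phi> arbitrary: e)
 case (AllN y \<phi>)
 show ?case
 proof (cases "x : fvN (AllN y \<phi>)")
  case False
  then have "substN x u (AllN y \<phi>) = AllN y \<phi>" by (rule substN_id)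
  then show ?thesis using False by (metis F_upd)
 next
  case True
  then have y: "y ~= x" "y ~: vars_trm u" "free_forN u x \<phi>" using AllN.prems by auto
  have "F (e(y := a)) (substN x u \<phi>) = F ((e(x := tval (NN {}) e u))(y := a)) \<phi>" for a
   by (simp only: AllN.IH[OF y(3)] tval_upd[OF y(2)] fun_upd_twist[OF y(1)])
  then show ?thesis by (simp only: substN.simps F.simps y(1) if_False)
 qed
qed (auto simp: tval_subst)

lemma F_substS: "F e (substS X Z \<phi>) = F e \<phi>" by (induction \<phi> arbitrary: e) auto

lemma lits_F: "arithmetical \<phi> ==> fvS \<phi> = {} ==> lits (F e \<phi>) = {}"
 by (induction \<phi> arbitrary: e) (auto simp: IMP_def split: nat.splits)

text \<open>Each level of the formula costs one conjunction and one disjunction inference, hence the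
  factor 2.\<close>

lemma der_id: "rb \<phi> m ==> \<phi> : \<Gamma> ==> dual \<phi> : \<Gamma> ==> der (fin (2 * m)) k \<Gamma>"
proof (induction \<phi> arbitrary: m \<Gamma>)
 case (Cst b)
 then show ?case by (cases b) (auto intro: der.Tru)
next
 case (Lit b n)
 then show ?case by (cases b) (auto intro: der.Axm)
next
 case (Conj f)
 show ?case
 proof (rule der.Cnj[of f _ "%_. fin (2 * m - 1)"])
  fix n
  have D: "der (fin (2 * (m - 1))) k (insert (dual (f n)) (insert (f n) \<Gamma>))"
   by (rule Conj.IH) (use Conj.prems in auto)
  show "der (fin (2 * m - 1)) k (insert (f n) \<Gamma>)"
   by (rule der.Dsj[of "%n. dual (f n)" _ "fin (2 * (m - 1))" _ _ n]) (use D Conj.prems in auto)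
 qed (use Conj.prems in auto)
next
 case (Disj f)
 show ?case
 proof (rule der.Cnj[of "%n. dual (f n)" _ "%_. fin (2 * m - 1)"])
  fix n
  have D: "der (fin (2 * (m - 1))) k (insert (f n) (insert (dual (f n)) \<Gamma>))"
   by (rule Disj.IH) (use Disj.prems in auto)
  show "der (fin (2 * m - 1)) k (insert (dual (f n)) \<Gamma>)"
   by (rule der.Dsj[of f _ "fin (2 * (m - 1))" _ _ n]) (use D Disj.prems in auto)
 qed (use Disj.prems in auto)
qed

lemma der_true: "lits \<phi> = {} ==> itr {} \<phi> ==> rb \<phi> m ==> \<phi> : \<Gamma> ==> der (fin m) k \<Gamma>"
proof (induction \<phi> arbitrary: m \<Gamma>)
 case (Cst b)
 then show ?case by (auto intro: der.Tru)
next
 case (Conj f)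
 have D: "der (fin (m - 1)) k (insert (f n) \<Gamma>)" for n by (rule Conj.IH) (use Conj.prems in auto)
 show ?case by (rule der.Cnj[of f _ "%_. fin (m - 1)"]) (use D Conj.prems in auto)
next
 case (Disj f)
 then obtain n where "itr {} (f n)" by auto
 then have D: "der (fin (m - 1)) k (insert (f n) \<Gamma>)" by (intro Disj.IH) (use Disj.prems in auto)
 show ?case by (rule der.Dsj[of f _ "fin (m - 1)"]) (use D Disj.prems in auto)
qed auto

lemma der_all: "Conj f : \<Gamma> ==> (!!n. der \<alpha> k (insert (f n) \<Gamma>)) ==> der (\<alpha> + fin 1) k \<Gamma>"
 by (rule der.Cnj[of f _ "%_. \<alpha>"]) auto
lemma der_ex: "Disj f : \<Gamma> ==> der \<alpha> k (insert (f n) \<Gamma>) ==> der (\<alpha> + fin 1) k \<Gamma>"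
 by (rule der.Dsj[of f _ "\<alpha>" _ _ n]) auto
lemma der_imp: assumes "IMP A B : \<Gamma>" "der \<alpha> k (insert B (insert (dual A) \<Gamma>))" shows "der (\<alpha> + fin 2) k \<Gamma>"
proof -
 have "der (\<alpha> + fin 1) k (insert (dual A) \<Gamma>)"
  by (rule der_ex[of "case_nat (dual A) (%_. B)" _ _ _ 1]) (use assms in \<open>auto simp: IMP_def\<close>)
 then have "der (\<alpha> + fin 1) k (insert (case_nat (dual A) (%_. B) 0) \<Gamma>)" by simp
 then have "der (\<alpha> + fin 1 + fin 1) k \<Gamma>" by (rule der_ex[rotated]) (use assms(1) in \<open>simp add: IMP_def\<close>)
 then show ?thesis by (simp add: add.assoc numeral_2_eq_2)
qed
lemma der_nimp: assumes "dual (IMP A B) : \<Gamma>" "der \<alpha> k (insert A \<Gamma>)" "der \<alpha> k (insert (dual B) \<Gamma>)"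
 shows "der (\<alpha> + fin 1) k \<Gamma>"
proof (rule der_all)
 show "Conj (%n. dual (case_nat (dual A) (%_. B) n)) : \<Gamma>" using assms(1) by (simp add: IMP_def)
 show "der \<alpha> k (insert (dual (case_nat (dual A) (%_. B) n)) \<Gamma>)" for n using assms by (cases n) auto
qed

text \<open>Derivability in \<open>\<omega> + n\<close> steps. The bound \<open>\<omega>\<^sup>2\<close> is then uniform, which settles the side
 conditions on heights in the derivations of logical axioms.\<close>

definition ded :: "inf set => bool" where "ded \<Gamma> <-> (EX n. der (w (fin 1) + fin n) 0 \<Gamma>)"

lemma dedI: "der (w (fin 1) + fin n) 0 \<Gamma> ==> ded \<Gamma>" by (auto simp: ded_def)
lemma ded_fin: "der (fin n) 0 \<Gamma> ==> ded \<Gamma>" by (rule dedI[of n], rule der_weak) auto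
lemma ded_tru: "Cst True : \<Gamma> ==> ded \<Gamma>" by (rule ded_fin[of 0], rule der.Tru)
lemma ded_id: "F e \<phi> : \<Gamma> ==> dual (F e \<phi>) : \<Gamma> ==> ded \<Gamma>"
 using ded_fin der_id rb_F by blast
lemma ded_imp: "IMP A B : \<Gamma> ==> ded (insert B (insert (dual A) \<Gamma>)) ==> ded \<Gamma>"
 unfolding ded_def using der_imp[of A B \<Gamma>] by (metis add.assoc fin_add)
lemma ded_ex: "Disj f : \<Gamma> ==> ded (insert (f n) \<Gamma>) ==> ded \<Gamma>"
 unfolding ded_def using der_ex[of f \<Gamma>] by (metis add.assoc fin_add)
lemma ded_nimp: assumes "dual (IMP A B) : \<Gamma>" "ded (insert A \<Gamma>)" "ded (insert (dual B) \<Gamma>)" shows "ded \<Gamma>"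
proof -
 obtain m n where "der (w (fin 1) + fin m) 0 (insert A \<Gamma>)" "der (w (fin 1) + fin n) 0 (insert (dual B) \<Gamma>)"
  using assms(2,3) unfolding ded_def by blast
 moreover have "w (fin 1) + fin m <= w (fin 1) + fin (m + n)" "w (fin 1) + fin n <= w (fin 1) + fin (m + n)"
  by (rule add_left_mono, simp)+
 ultimately have "der (w (fin 1) + fin (m + n)) 0 (insert A \<Gamma>)" "der (w (fin 1) + fin (m + n)) 0 (insert (dual B) \<Gamma>)"
  by (blast intro: der_weak)+
 then show ?thesis using der_nimp[OF assms(1)] unfolding ded_def by (metis add.assoc fin_add)
qed
lemma ded_der: assumes "ded \<Gamma>" shows "der (w (fin 2)) k \<Gamma>"
proof -
 obtain n where n: "der (w (fin 1) + fin n) 0 \<Gamma>" using assms by (auto simp: ded_def)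
 have "w (fin 1) + fin n < w (fin 2)"
  by (rule w_add_less) (use fin_less_w[of "fin 2" n] fin_less[of 0 2] in \<open>simp_all del: fin_less, simp\<close>)
 then show ?thesis using der_weak[OF n] by (simp add: less_imp_le)
qed

text \<open>Induction for \<open>\<psi>\<close> with respect to the variable \<open>0\<close>, stated without substitution.\<close>

definition indf :: "nat => fm => fm" where
 "indf z \<psi> = Imp (AllN 0 (Imp (Eq (Var 0) \<^bold>0) \<psi>))
  (Imp (AllN z (Imp (AllN 0 (Imp (Eq (Var 0) (Var z)) \<psi>)) (AllN 0 (Imp (Eq (Var 0) (Var z \<^bold>+ \<^bold>1)) \<psi>))))
   (AllN 0 \<psi>))"

definition inds :: "fm set" where "inds = {indf z \<psi> | z \<psi>. z ~= 0 & z ~: fvN \<psi>}"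

text \<open>All of true arithmetic is as cheap as the basic axioms: without the set a true formula
  is derived directly, in height bounded by its rank. In return every true fact about the order is
  available in the resulting model.\<close>

definition true_arith :: "fm set" where
 "true_arith = {\<phi>. arithmetical \<phi> & fvS \<phi> = {} & (ALL e. sat (NN {}) e (%_. {}) \<phi>)}"

text \<open>The instance for \<open>n\<close> has a cut-free derivation of finite height, obtained
  by running through \<open>n\<close> induction steps; one application of the \<omega>-rule then
  collects all instances.\<close>

lemma ded_indf:
 assumes "z ~= 0" "z ~: fvN \<psi>" "F e (indf z \<psi>) : \<Gamma>" shows "ded \<Gamma>"
proof (rule ded_imp[OF assms(3)[unfolded indf_def F.simps(5)]], rule ded_imp)
 let ?P = "%n. F (e(0 := n)) \<psi>"
 let ?st = "AllN z (Imp (AllN 0 (Imp (Eq (Var 0) (Var z)) \<psi>)) (AllN 0 (Imp (Eq (Var 0) (Var z \<^bold>+ \<^bold>1)) \<psi>)))"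
 let ?ba = "AllN 0 (Imp (Eq (Var 0) \<^bold>0) \<psi>)"
 have zP: "F (e(z := m, 0 := a)) \<psi> = ?P a" for m a
  by (rule F_cong) (use assms(1,2) in auto)
 define \<Delta> where "\<Delta> = insert (F e (AllN 0 \<psi>)) (insert (dual (F e ?st)) (insert (IMP (F e ?st) (F e (AllN 0 \<psi>))) (insert (dual (F e ?ba)) \<Gamma>)))"
 \<comment> \<open>The allowance for one induction step: an identity derivation of height
   \<open>2 * rk \<psi>\<close> and a few further inferences.\<close>
 let ?c = "2 * rk \<psi> + 10"
 have main: "?P n : \<Xi> ==> \<Delta> <= \<Xi> ==> der (fin (?c * n + ?c)) 0 \<Xi>" for n \<Xi>
 proof (induction n arbitrary: \<Xi>)
  case 0
  have "der (fin (2 * rk \<psi>) + fin 1 + fin 1) 0 \<Xi>"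
  proof (rule der_ex[of "%a. dual (IMP (Cst (a = 0)) (?P a))" _ _ _ 0])
   show "Disj (%a. dual (IMP (Cst (a = 0)) (?P a))) : \<Xi>" using 0(2) by (simp add: \<Delta>_def)
   show "der (fin (2 * rk \<psi>) + fin 1) 0 (insert (dual (IMP (Cst (0 = 0)) (?P 0))) \<Xi>)"
   proof (rule der_nimp[of "Cst (0 = 0)" "?P 0"])
    show "der (fin (2 * rk \<psi>)) 0 (insert (dual (?P 0)) (insert (dual (IMP (Cst (0 = 0)) (?P 0))) \<Xi>))"
     by (rule der_id[OF rb_F, of "e(0 := 0)"]) (simp_all only: insert_iff 0(1) simp_thms)
   qed (auto intro: der.Tru)
  qed
  then show ?case by (rule der_weak) auto
 next
  case (Suc n)
  let ?I = "IMP (F (e(z := n)) (AllN 0 (Imp (Eq (Var 0) (Var z)) \<psi>))) (F (e(z := n)) (AllN 0 (Imp (Eq (Var 0) (Var z \<^bold>+ \<^bold>1)) \<psi>)))"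
  have "der (fin (?c * n + ?c) + fin 3 + fin 1 + fin 1) 0 \<Xi>"
  proof (rule der_ex[of "%m. dual (F (e(z := m)) (Imp (AllN 0 (Imp (Eq (Var 0) (Var z)) \<psi>)) (AllN 0 (Imp (Eq (Var 0) (Var z \<^bold>+ \<^bold>1)) \<psi>))))" _ _ _ n])
   show "Disj (%m. dual (F (e(z := m)) (Imp (AllN 0 (Imp (Eq (Var 0) (Var z)) \<psi>)) (AllN 0 (Imp (Eq (Var 0) (Var z \<^bold>+ \<^bold>1)) \<psi>))))) : \<Xi>"
    using Suc.prems(2) by (simp add: \<Delta>_def)
   let ?\<Xi> = "insert (dual (F (e(z := n)) (Imp (AllN 0 (Imp (Eq (Var 0) (Var z)) \<psi>)) (AllN 0 (Imp (Eq (Var 0) (Var z \<^bold>+ \<^bold>1)) \<psi>))))) \<Xi>"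
   show "der (fin (?c * n + ?c) + fin 3 + fin 1) 0 ?\<Xi>"
   proof (rule der_nimp)
    show "dual (IMP (F (e(z := n)) (AllN 0 (Imp (Eq (Var 0) (Var z)) \<psi>))) (F (e(z := n)) (AllN 0 (Imp (Eq (Var 0) (Var z \<^bold>+ \<^bold>1)) \<psi>)))) : ?\<Xi>"
     by simp
    have "der (fin (?c * n + ?c) + fin 2 + fin 1) 0 (insert (F (e(z := n)) (AllN 0 (Imp (Eq (Var 0) (Var z)) \<psi>))) ?\<Xi>)"
    proof (rule der_all[of "%a. IMP (Cst (a = n)) (?P a)"], simp add: zP assms(1), rule der_imp, simp)
     fix a
     let ?\<Xi>' = "insert (?P a) (insert (dual (Cst (a = n))) (insert (IMP (Cst (a = n)) (?P a))
       (insert (F (e(z := n)) (AllN 0 (Imp (Eq (Var 0) (Var z)) \<psi>))) ?\<Xi>)))"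
     show "der (fin (?c * n + ?c)) 0 ?\<Xi>'"
     proof (cases "a = n")
      case True
      show ?thesis by (rule Suc.IH) (simp only: True insert_iff simp_thms, rule subset_trans[OF Suc.prems(2)], blast)
     next
      case False
      then show ?thesis by (intro der.Tru) simp
     qed
    qed simp_all
    then show "der (fin (?c * n + ?c) + fin 3) 0 (insert (F (e(z := n)) (AllN 0 (Imp (Eq (Var 0) (Var z)) \<psi>))) ?\<Xi>)"
     by (rule der_weak) auto
    have "der (fin (2 * rk \<psi>) + fin 1 + fin 1) 0 (insert (dual (F (e(z := n)) (AllN 0 (Imp (Eq (Var 0) (Var z \<^bold>+ \<^bold>1)) \<psi>)))) ?\<Xi>)"
    proof (rule der_ex[of "%a. dual (IMP (Cst (a = n + 1)) (?P a))" _ _ _ "n + 1"])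
     let ?\<Xi>1 = "insert (dual (F (e(z := n)) (AllN 0 (Imp (Eq (Var 0) (Var z \<^bold>+ \<^bold>1)) \<psi>)))) ?\<Xi>"
     show "Disj (%a. dual (IMP (Cst (a = n + 1)) (?P a))) : ?\<Xi>1" by (simp add: zP assms(1))
     show "der (fin (2 * rk \<psi>) + fin 1) 0 (insert (dual (IMP (Cst (n + 1 = n + 1)) (?P (n + 1)))) ?\<Xi>1)"
     proof (rule der_nimp[of "Cst (n + 1 = n + 1)" "?P (n + 1)"])
      have "?P (n + 1) : \<Xi>" using Suc.prems(1) by (simp only: Suc_eq_plus1)
      then show "der (fin (2 * rk \<psi>)) 0 (insert (dual (?P (n + 1))) (insert (dual (IMP (Cst (n + 1 = n + 1)) (?P (n + 1)))) ?\<Xi>1))"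
       by (intro der_id[OF rb_F, of "e(0 := n + 1)"]) (simp_all only: insert_iff simp_thms)
     qed (auto intro: der.Tru)
    qed
    then show "der (fin (?c * n + ?c) + fin 3) 0 (insert (dual (F (e(z := n)) (AllN 0 (Imp (Eq (Var 0) (Var z \<^bold>+ \<^bold>1)) \<psi>)))) ?\<Xi>)"
     by (rule der_weak) auto
   qed
  qed
  then show ?case by (rule der_weak) auto
 qed
 have "der (w (fin 1) + fin 1) 0 \<Delta>"
 proof (rule der_all[of ?P])
  fix n
  have "der (fin (?c * n + ?c)) 0 (insert (?P n) \<Delta>)" by (rule main) auto
  then show "der (w (fin 1)) 0 (insert (?P n) \<Delta>)"
   by (rule der_weak) (use fin_less_w[of "fin 1"] fin_less[of 0 1] in \<open>auto intro: less_imp_le simp del: fin_less simp: fin_less\<close>)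
 qed (simp add: \<Delta>_def)
 then show "ded (insert (F e (AllN 0 \<psi>)) (insert (dual (F e ?st)) (insert (IMP (F e ?st) (F e (AllN 0 \<psi>))) (insert (dual (F e ?ba)) \<Gamma>))))"
  unfolding \<Delta>_def by (rule dedI)
qed (simp only: F.simps insert_iff simp_thms)

text \<open>Cuts are used only for modus ponens. The axioms about the coded set are not derived:
  their duals in \<open>N\<close> stay in every sequent as side formulas.\<close>

lemma embedding:
 assumes "T \<turnstile> \<phi>" "!!\<theta> e. \<theta> : T ==> \<theta> : inds \<or> \<theta> : true_arith \<or> dual (F e \<theta>) : N"
 shows "\<exists>\<alpha> k. \<forall>e \<Gamma>. N <= \<Gamma> --> F e \<phi> : \<Gamma> --> der \<alpha> k \<Gamma>"
proof -
 have ded: "\<exists>\<alpha> k. \<forall>e \<Gamma>. N <= \<Gamma> --> F e \<phi> : \<Gamma> --> der \<alpha> k \<Gamma>"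
  if "!!e \<Gamma>. N <= \<Gamma> ==> F e \<phi> : \<Gamma> ==> ded \<Gamma>" for \<phi>
  using that ded_der by blast
 show ?thesis using assms(1)
 proof induction
  case (Ax \<phi>)
  show ?case
  proof (rule ded)
   fix e \<Gamma> assume G: "N <= \<Gamma>" "F e \<phi> : \<Gamma>"
   consider "\<phi> : inds" | "\<phi> : true_arith" | "dual (F e \<phi>) : N" using assms(2)[OF Ax] by blast
   then show "ded \<Gamma>"
   proof cases
    case 1
    then show ?thesis using G(2) ded_indf unfolding inds_def by blast
   next
    case 2
    have "der (fin (rk \<phi>)) 0 \<Gamma>"
     by (rule der_true[OF lits_F _ rb_F G(2)]) (use 2 in \<open>auto simp: true_arith_def itr_F\<close>)
    then show ?thesis by (rule ded_fin)
   next
    case 3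
    then show ?thesis using G ded_id by blast
   qed
  qed
 next
  case (K \<phi> \<psi>)
  show ?case by (rule ded, simp, rule ded_imp, assumption, rule ded_imp, rule insertI1, rule ded_id) auto
 next
  case (S \<phi> \<psi> \<chi>)
  show ?case
  proof (rule ded)
   fix e \<Gamma> assume "F e (Imp (Imp \<phi> (Imp \<psi> \<chi>)) (Imp (Imp \<phi> \<psi>) (Imp \<phi> \<chi>))) : \<Gamma>"
   then show "ded \<Gamma>"
    apply (simp only: F.simps)
    apply (rule ded_imp, assumption, rule ded_imp, rule insertI1, rule ded_imp, rule insertI1)
    apply (rule ded_nimp[of "F e \<phi>" "IMP (F e \<psi>) (F e \<chi>)"], simp, rule ded_id[of e \<phi>], simp, simp)
    apply (rule ded_nimp[of "F e \<phi>" "F e \<psi>"], simp, rule ded_id[of e \<phi>], simp, simp)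
    apply (rule ded_nimp[of "F e \<psi>" "F e \<chi>"], simp, rule ded_id[of e \<psi>], simp, simp, rule ded_id[of e \<chi>], simp, simp)
    done
  qed
 next
  case (DN \<phi>)
  show ?case
  proof (rule ded)
   fix e \<Gamma> assume "F e (Imp (Neg (Neg \<phi>)) \<phi>) : \<Gamma>"
   then show "ded \<Gamma>"
    apply (simp only: F.simps)
    apply (rule ded_imp, assumption)
    apply (rule ded_nimp[of "IMP (F e \<phi>) (Cst False)" "Cst False"], simp)
    apply (rule ded_imp[of "F e \<phi>" "Cst False"], simp, rule ded_id[of e \<phi>], simp, simp)
    apply (rule ded_tru, simp)
    done
  qed
 next
  case (MP \<phi> \<psi>)
  obtain \<alpha> k where 1: "!!e \<Gamma>. N <= \<Gamma> ==> F e (Imp \<phi> \<psi>) : \<Gamma> ==> der \<alpha> k \<Gamma>" using MP.IH(1) by blast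
  obtain \<beta> l where 2: "!!e \<Gamma>. N <= \<Gamma> ==> F e \<phi> : \<Gamma> ==> der \<beta> l \<Gamma>" using MP.IH(2) by blast
  let ?\<gamma> = "\<alpha> + \<beta> + fin (2 * rk \<psi>) + fin 1"
  let ?m = "k + l + Suc (rk (Imp \<phi> \<psi>))"
  have "der (?\<gamma> + fin 1) ?m \<Gamma>" if G: "N <= \<Gamma>" "F e \<psi> : \<Gamma>" for e \<Gamma>
  proof (rule der.Cut[OF rb_F[of e "Imp \<phi> \<psi>"], of _ ?\<gamma>])
   show "der ?\<gamma> ?m (insert (F e (Imp \<phi> \<psi>)) \<Gamma>)"
    by (rule der_weak[OF 1[of "insert (F e (Imp \<phi> \<psi>)) \<Gamma>" e]]) (use G in \<open>auto simp: add.assoc\<close>)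
   show "der ?\<gamma> ?m (insert (dual (F e (Imp \<phi> \<psi>))) \<Gamma>)"
   proof (rule der_nimp[of "F e \<phi>" "F e \<psi>"])
    have b: "\<beta> <= \<alpha> + \<beta> + fin (2 * rk \<psi>)" using hm_le_add(1)[of "\<alpha> + \<beta>" "fin (2 * rk \<psi>)"] hm_le_add(2)[of \<beta> \<alpha>] by (rule order_trans[rotated])
    show "der (\<alpha> + \<beta> + fin (2 * rk \<psi>)) ?m (insert (F e \<phi>) (insert (dual (F e (Imp \<phi> \<psi>))) \<Gamma>))"
     by (rule der_weak[OF 2[of "insert (F e \<phi>) \<Gamma>" e] b]) (use G in auto)
    show "der (\<alpha> + \<beta> + fin (2 * rk \<psi>)) ?m (insert (dual (F e \<psi>)) (insert (dual (F e (Imp \<phi> \<psi>))) \<Gamma>))"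
     by (rule der_weak[OF der_id[OF rb_F[of e \<psi>], of "insert (dual (F e \<psi>)) \<Gamma>"]]) (use G in auto)
   qed simp
  qed (simp_all add: less_Suc_eq_le trans_le_add2)
  then show ?case by blast
 next
  case (InstN t x \<phi>)
  show ?case
  proof (rule ded)
   fix e \<Gamma> assume "F e (Imp (AllN x \<phi>) (substN x t \<phi>)) : \<Gamma>"
   then show "ded \<Gamma>"
    apply (simp only: F.simps F_substN[OF InstN])
    apply (rule ded_imp, assumption, rule ded_ex[of "%n. dual (F (e(x := n)) \<phi>)"], simp)
    apply (rule ded_id[of "e(x := tval (NN {}) e t)" \<phi>], simp, rule insertI1)
    done
  qed
 next
  case (DistN x \<phi> \<psi>)
  show ?case
  proof (rule ded)
   fix e \<Gamma> assume G: "F e (Imp (AllN x (Imp \<phi> \<psi>)) (Imp \<phi> (AllN x \<psi>))) : \<Gamma>"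
   show "ded \<Gamma>"
   proof (rule ded_imp[OF G[unfolded F.simps(5)[of e "AllN x (Imp \<phi> \<psi>)"]]], rule ded_imp[of "F e \<phi>" "F e (AllN x \<psi>)"])
    show "IMP (F e \<phi>) (F e (AllN x \<psi>)) : insert (F e (Imp \<phi> (AllN x \<psi>))) (insert (dual (F e (AllN x (Imp \<phi> \<psi>)))) \<Gamma>)"
     by (simp only: F.simps insert_iff simp_thms)
    let ?r = "2 * rk \<phi> + 2 * rk \<psi>"
    let ?G = "insert (F e (AllN x \<psi>)) (insert (dual (F e \<phi>)) (insert (F e (Imp \<phi> (AllN x \<psi>))) (insert (dual (F e (AllN x (Imp \<phi> \<psi>)))) \<Gamma>)))"
    have "der (fin ?r + fin 1 + fin 1 + fin 1) 0 ?G"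
    proof (rule der_all[of "%n. F (e(x := n)) \<psi>"], simp)
     fix n
     let ?G1 = "insert (F (e(x := n)) \<psi>) ?G"
     show "der (fin ?r + fin 1 + fin 1) 0 ?G1"
     proof (rule der_ex[of "%n. dual (F (e(x := n)) (Imp \<phi> \<psi>))" _ _ _ n], simp)
      let ?G2 = "insert (dual (F (e(x := n)) (Imp \<phi> \<psi>))) ?G1"
      show "der (fin ?r + fin 1) 0 ?G2"
      proof (rule der_nimp[of "F (e(x := n)) \<phi>" "F (e(x := n)) \<psi>"])
       show "der (fin ?r) 0 (insert (F (e(x := n)) \<phi>) ?G2)"
        by (rule der_weak[OF der_id[OF rb_F[of e \<phi>], of "insert (F (e(x := n)) \<phi>) ?G2"]]) (auto simp: F_upd[OF DistN])
       show "der (fin ?r) 0 (insert (dual (F (e(x := n)) \<psi>)) ?G2)"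
        by (rule der_weak[OF der_id[OF rb_F[of "e(x := n)" \<psi>], of "insert (dual (F (e(x := n)) \<psi>)) ?G2"]]) auto
      qed simp
     qed
    qed
    then have "der (fin (?r + 1 + 1 + 1)) 0 ?G" by (simp only: fin_add)
    then show "ded (insert (F e (AllN x \<psi>)) (insert (dual (F e \<phi>)) (insert (F e (Imp \<phi> (AllN x \<psi>))) (insert (dual (F e (AllN x (Imp \<phi> \<psi>)))) \<Gamma>))))"
     by (rule ded_fin)
   qed
  qed
 next
  case (GenN \<phi> x)
  obtain \<alpha> k where 1: "!!e \<Gamma>. N <= \<Gamma> ==> F e \<phi> : \<Gamma> ==> der \<alpha> k \<Gamma>" using GenN.IH by blast
  have "der (\<alpha> + fin 1) k \<Gamma>" if "N <= \<Gamma>" "F e (AllN x \<phi>) : \<Gamma>" for e \<Gamma>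
   by (rule der_all[of "%n. F (e(x := n)) \<phi>"]) (use that in \<open>auto intro!: 1\<close>)
  then show ?case by blast
 next
  case (InstS Y X \<phi>)
  show ?case by (rule ded, simp add: F_substS, rule ded_imp, assumption, rule ded_id) auto
 next
  case (DistS X \<phi> \<psi>)
  show ?case
  proof (rule ded)
   fix e \<Gamma> assume "F e (Imp (AllS X (Imp \<phi> \<psi>)) (Imp \<phi> (AllS X \<psi>))) : \<Gamma>"
   then have "IMP (F e (Imp \<phi> \<psi>)) (F e (Imp \<phi> \<psi>)) : \<Gamma>" by simp
   then show "ded \<Gamma>" by (rule ded_imp) (rule ded_id[of e "Imp \<phi> \<psi>"], auto)
  qed
 next
  case (EqRefl t)
  show ?case by (rule ded) (auto intro: ded_tru)
 next
  case (EqSubst s x \<phi> t)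
  show ?case
  proof (rule ded)
   fix e \<Gamma> assume G: "F e (Imp (Eq s t) (Imp (substN x s \<phi>) (substN x t \<phi>))) : \<Gamma>"
   show "ded \<Gamma>"
   proof (cases "tval (NN {}) e s = tval (NN {}) e t")
    case True
    show ?thesis
     apply (rule ded_imp[OF G[unfolded F.simps F_substN[OF EqSubst(1)] F_substN[OF EqSubst(2)]]], rule ded_imp, rule insertI1)
     apply (rule ded_id[of "e(x := tval (NN {}) e s)" \<phi>])
     using True by auto
   next
    case False
    show ?thesis
     by (rule ded_imp[OF G[unfolded F.simps(5)[of e "Eq s t"]]], rule ded_tru) (use False in auto)
   qed
  qed
 qed auto
qed

text \<open>The stagewise form of the axioms enters through the last two hypotheses: instance
  \<open>i\<close> mentions only numbers of index up to \<open>i + 1\<close>, and every state that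
  has decided these makes the instance true. Hence the descent never meets a refuted axiom.\<close>

theorem consistency:
 fixes big :: "hm => 'h => bool" and Y :: "'h => nat set" and L :: "'h => nat" and idx :: "nat => nat"
 assumes ext: "!!\<alpha> \<beta> h n. big \<alpha> h ==> \<beta> < \<alpha> ==> EX h'. big \<beta> h' & n <= L h' & L h <= L h' &
   (ALL x. idx x < L h --> (x : Y h' <-> x : Y h))"
  and big: "!!\<alpha>. EX h. big \<alpha> h"
  and lits: "!!e \<theta> x i. \<theta> : \<Theta> ==> x : lits (F (e(0 := i)) \<theta>) ==> idx x <= i + 1"
  and true: "!!e \<theta> i x h. \<theta> : \<Theta> ==> big x h ==> i + 2 <= L h ==> sat (NN (Y h)) (e(0 := i)) (%_. Y h) \<theta>"
 shows "\<not> inds \<union> true_arith \<union> AllN 0 ` \<Theta> \<turnstile> Falsum"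
proof
 assume T: "inds \<union> true_arith \<union> AllN 0 ` \<Theta> \<turnstile> Falsum"
 define N where "N = {dual (F e (AllN 0 \<theta>)) | e \<theta>. \<theta> : \<Theta>}"
 obtain \<alpha> k where "\<forall>e \<Gamma>. N <= \<Gamma> --> F e Falsum : \<Gamma> --> der \<alpha> k \<Gamma>"
  using embedding[OF T, of N] unfolding N_def by blast
 then have "der \<alpha> k (insert (Cst False) N)" by (auto simp: N_def)
 then obtain \<beta> where \<beta>: "der \<beta> 0 (insert (Cst False) N)" using cut_free by blast
 obtain h where h: "big \<beta> h" using big by blast
 show False
 proof (rule descent[of big L idx Y N, OF ext _ \<beta> refl _ h])
  fix \<phi> assume "\<phi> : N"
  then obtain e \<theta> where \<theta>: "\<theta> : \<Theta>" "\<phi> = Disj (%i. dual (F (e(0 := i)) \<theta>))" by (auto simp: N_def)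
  show "EX f b. \<phi> = Disj f & (ALL i. ALL x:lits (f i). idx x < b i) & (ALL i x h. big x h --> b i <= L h --> \<not> itr (Y h) (f i))"
   by (rule exI[of _ "%i. dual (F (e(0 := i)) \<theta>)"], rule exI[of _ "%i. i + 2"])
    (use \<theta> lits[OF \<theta>(1)] true[OF \<theta>(1)] in \<open>auto simp: itr_F less_Suc_eq_le\<close>)
 qed auto
qed

section \<open>Fast growing upgrades\<close>

definition b0 :: "nat set => nat" where "b0 B = (LEAST b. b : B)"
definition bse :: "nat set => nat => nat" where "bse B n = Max {b : B. b <= n}"

definition nxt :: "nat set => nat => nat => bool" where
 "nxt B b s <-> s : B & b < s & (ALL c:B. b < c --> s <= c)"

locale nh =
 fixes B :: "nat set"
 assumes ne: "B ~= {}" and ge2: "b : B ==> 2 <= b"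
  and nxt: "b : B ==> EX s. nxt B b s & s <= b * b & b dvd s"
begin

lemma b0_in: "b0 B : B" unfolding b0_def using ne by (auto intro: LeastI)
lemma b0_le: "b : B ==> b0 B <= b" unfolding b0_def by (rule Least_le)
lemma b0_ge2: "2 <= b0 B" using b0_in ge2 by blast

lemma bse: assumes "b0 B <= n"
 shows bs_in: "bse B n : B" and bs_le: "bse B n <= n" and bs_max: "c : B ==> c <= n ==> c <= bse B n"
proof -
 have f: "finite {b : B. b <= n}" by simp
 have "{b : B. b <= n} ~= {}" using b0_in assms by auto
 then have "bse B n : {b : B. b <= n}" unfolding bse_def by (rule Max_in[OF f])
 then show "bse B n : B" "bse B n <= n" by auto
 show "c : B ==> c <= n ==> c <= bse B n" unfolding bse_def by (rule Max_ge[OF f]) simp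
qed

lemma bs_ge2: "b0 B <= n ==> 2 <= bse B n" using bs_in ge2 by blast

lemma bs_eq: assumes "b : B" "b <= n" "!!c. c : B ==> c <= n ==> c <= b" shows "bse B n = b"
proof -
 have "b0 B <= n" using b0_le[OF assms(1)] assms(2) by simp
 then show ?thesis using assms bs_in bs_le bs_max by (meson le_antisym)
qed

lemma bs_B: "b : B ==> bse B b = b" by (rule bs_eq) auto

lemma bs_between: "b0 B <= n ==> bse B n <= m ==> m <= n ==> bse B m = bse B n"
 by (rule bs_eq) (auto intro: bs_in bs_max order_trans)

lemma below_square: assumes "b0 B <= n" shows "n < bse B n * bse B n"
proof -
 obtain s where s: "nxt B (bse B n) s" "s <= bse B n * bse B n" using nxt[OF bs_in[OF assms]] by blast
 then have "n < s" using bs_max[OF assms, of s] by (metis nxt_def not_less)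
 then show ?thesis using s(2) by simp
qed

lemma digit: assumes "b0 B <= n"
 shows "n div bse B n < bse B n" "0 < n div bse B n" "n mod bse B n < bse B n" "n div bse B n < n" "n mod bse B n < n"
proof -
 have b: "2 <= bse B n" "bse B n <= n" using bs_ge2 bs_le assms by auto
 show "n div bse B n < bse B n" using below_square[OF assms] by (simp add: less_mult_imp_div_less)
 show "0 < n div bse B n" using b by (simp add: div_greater_zero_iff)
 show 1: "n mod bse B n < bse B n" using b by simp
 show "n div bse B n < n" using b by simp
 show "n mod bse B n < n" using 1 b(2) by (rule less_le_trans)
qed

text \<open>With \<open>pred_digit\<close> and \<open>pred_base\<close> this covers the three ways
  in which the predecessor of a number above the least base is written: smaller remainder, smaller
  digit, or smaller base. Later inductions follow this division.\<close>

lemma pred_rem: assumes "b0 B <= n" "0 < n mod bse B n"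
 shows "b0 B <= n - 1" "bse B (n - 1) = bse B n" "(n - 1) div bse B n = n div bse B n" "(n - 1) mod bse B n = n mod bse B n - 1"
proof -
 have ne: "bse B n ~= n" using assms(2) by auto
 then have lt: "bse B n <= n - 1" using bs_le[OF assms(1)] by simp
 then show "b0 B <= n - 1" using b0_le[OF bs_in[OF assms(1)]] by simp
 show "bse B (n - 1) = bse B n" by (rule bs_between[OF assms(1) lt]) simp
 have e: "n - 1 = bse B n * (n div bse B n) + (n mod bse B n - 1)"
  using mult_div_mod_eq[of "bse B n" n] assms(2) by linarith
 have l: "n mod bse B n - 1 < bse B n" using digit(3)[OF assms(1)] by simp
 show "(n - 1) div bse B n = n div bse B n" "(n - 1) mod bse B n = n mod bse B n - 1"
  unfolding e using l by simp_all
qed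

lemma pred_digit: assumes "b0 B <= n" "n mod bse B n = 0" "n div bse B n ~= 1"
 shows "b0 B <= n - 1" "bse B (n - 1) = bse B n" "(n - 1) div bse B n = n div bse B n - 1" "(n - 1) mod bse B n = bse B n - 1"
  "2 <= n div bse B n" "bse B n < n"
proof -
 let ?b = "bse B n" and ?a = "n div bse B n"
 show a: "2 <= ?a" using digit(2)[OF assms(1)] assms(3) by linarith
 have n: "n = ?b * ?a" using assms(2) mult_div_mod_eq[of ?b n] by simp
 have b: "2 <= ?b" by (rule bs_ge2[OF assms(1)])
 have "?b * 2 <= n" using a n mult_le_mono2[OF a, of ?b] by linarith
 then have lt: "?b <= n - 1" "?b < n" using b by linarith+
 then show "?b < n" "b0 B <= n - 1" using b0_le[OF bs_in[OF assms(1)]] by linarith+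
 show "bse B (n - 1) = ?b" by (rule bs_between[OF assms(1) lt(1)]) simp
 obtain a' where a': "?a = Suc a'" using a by (cases ?a) auto
 have e: "n - 1 = ?b * (?a - 1) + (?b - 1)" using n b unfolding a' by simp
 show "(n - 1) div ?b = ?a - 1" "(n - 1) mod ?b = ?b - 1"
  unfolding e using b div_mult_self4[of ?b "?b - 1" "?a - 1"] mod_mult_self4[of ?b "?a - 1" "?b - 1"]
  by (simp_all del: add_diff_assoc)
qed

lemma pred_base: assumes "b0 B <= n" "n mod bse B n = 0" "n div bse B n = 1" "n ~= b0 B"
 shows "n : B" "bse B n = n" "b0 B <= n - 1"
proof -
 have "n = bse B n" using assms mult_div_mod_eq[of "bse B n" n] by simp
 then show "n : B" "bse B n = n" "b0 B <= n - 1" using bs_in[OF assms(1)] assms by auto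
qed

end

text \<open>The upgrade operator of a hierarchy \<open>B\<close>, together with the base used for its values, for a target
 hierarchy which is built along the way: a new digit \<open>a \<ge> 2\<close> of \<open>n\<close> inserts \<open>e\<close> new bases.\<close>

function Uf :: "nat set => nat => nat => nat \<times> nat" where
 "Uf B e n = (if n < b0 B \<or> bse B n < 2 \<or> n < bse B n then (0, n) else
  (let dn = (if n = b0 B then b0 B + e
    else if 0 < n mod bse B n then fst (Uf B e (n - 1))
    else if n div bse B n = 1 then fst (Uf B e (n - 1)) * (snd (Uf B e (n - 1)) div fst (Uf B e (n - 1)) + 1)
    else fst (Uf B e (n - 1)) * snd (Uf B e (n div bse B n)) ^ e)
  in (dn, dn * snd (Uf B e (n div bse B n)) + snd (Uf B e (n mod bse B n)))))"
 by pat_completeness auto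
termination
proof (relation "measure (%(B, e, n). n)", goal_cases)
 case 1
 show ?case by simp
qed (auto simp: not_less intro: less_le_trans[OF mod_less_divisor])

declare Uf.simps [simp del]

definition Db :: "nat set => nat => nat => nat" where "Db B e n = fst (Uf B e n)"
definition up :: "nat set => nat => nat => nat" where "up B e n = snd (Uf B e n)"

text \<open>At a new digit the bases form a geometric progression with ratio the upgraded digit. For
  a base \<open>d\<close> short of the last one the successor is exactly the value that would have
  to lie below it, so the definition of the upgrade is forced past all of them.\<close>

definition Cn :: "nat set => nat => nat => nat set" where
 "Cn B e n = insert (Db B e n) (if n mod bse B n = 0 & n div bse B n ~= 1
  then {Db B e (n - 1) * up B e (n div bse B n) ^ i | i. i <= e} else {})"

definition Cs :: "nat set => nat => nat set" where "Cs B e = (\<Union>n\<in>{b0 B..}. Cn B e n)"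

locale nhe = nh + fixes e :: nat assumes e1: "1 <= e"
begin

abbreviation "dn \<equiv> Db B e"
abbreviation "u \<equiv> up B e"
abbreviation "b \<equiv> bse B"

lemma u_small: "n < b0 B ==> u n = n" by (simp add: up_def Uf.simps[of B e n])

lemma u_eq: assumes "b0 B <= n" shows "u n = dn n * u (n div b n) + u (n mod b n)"
 using assms bs_ge2[OF assms] bs_le[OF assms] by (simp add: up_def Db_def Uf.simps[of B e n] Let_def)

lemma dn_eqs: assumes "b0 B <= n"
 shows dn_b0: "n = b0 B ==> dn n = b0 B + e"
  and dn_rem: "0 < n mod b n ==> dn n = dn (n - 1)"
  and dn_base: "n ~= b0 B ==> n mod b n = 0 ==> n div b n = 1 ==> dn n = dn (n - 1) * (u (n - 1) div dn (n - 1) + 1)"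
  and dn_digit: "n mod b n = 0 ==> n div b n ~= 1 ==> dn n = dn (n - 1) * u (n div b n) ^ e"
proof -
 have b: "\<not> (n < b0 B \<or> b n < 2 \<or> n < b n)" using assms bs_ge2[OF assms] bs_le[OF assms] by simp
 note eq = Uf.simps[of B e n, unfolded if_not_P[OF b] Let_def]
 show "n = b0 B ==> dn n = b0 B + e" unfolding Db_def by (subst eq) simp
 have nb: "0 < n mod b n ==> n ~= b0 B" using bs_B[OF b0_in] by auto
 show "0 < n mod b n ==> dn n = dn (n - 1)" using nb unfolding Db_def by (subst eq) simp
 show "n ~= b0 B ==> n mod b n = 0 ==> n div b n = 1 ==> dn n = dn (n - 1) * (u (n - 1) div dn (n - 1) + 1)"
  unfolding Db_def up_def by (subst eq) simp
 have "n = b0 B ==> n div b n = 1" using bs_B[OF b0_in] b0_ge2 by auto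
 then show "n mod b n = 0 ==> n div b n ~= 1 ==> dn n = dn (n - 1) * u (n div b n) ^ e"
  unfolding Db_def up_def by (subst eq) auto
qed

lemma u01: "u 0 = 0" "u 1 = 1" using u_small[of 0] u_small[of 1] b0_ge2 by simp_all

text \<open>The inequality \<open>u (b n - 1) < dn n\<close> says that upgraded digits and
  remainders are proper digits and remainders for the new base. Monotonicity of \<open>u\<close>
  depends on it and conversely, hence one simultaneous induction.\<close>

lemma main: "(0 < n --> u (n - 1) < u n) &
 (b0 B <= n --> u (b n - 1) < dn n & (b0 B <= n - 1 --> dn (n - 1) <= dn n) &
  (n mod b n = 0 --> n div b n ~= 1 --> u (n - 1) < dn (n - 1) * u (n div b n)))"
proof (induction n rule: less_induct)
 case (less n)
 have mono: "u k <= u m" if "k <= m" "m < n" for k m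
  using that(1)
 proof (induction rule: inc_induct)
  case (step k)
  have "u (Suc k - 1) < u (Suc k)" using less[of "Suc k"] step that by simp
  then show ?case using step by simp
 qed simp
 have smono: "u k < u m" if "k < m" "m < n" for k m
 proof -
  have "u k <= u (m - 1)" using that by (intro mono) auto
  also have "\<dots> < u m" using less[OF that(2)] that(1) by simp
  finally show ?thesis .
 qed
 consider "n < b0 B" | "b0 B <= n" "n = b0 B" | "b0 B <= n" "0 < n mod b n"
  | "b0 B <= n" "n ~= b0 B" "n mod b n = 0" "n div b n = 1" | "b0 B <= n" "n mod b n = 0" "n div b n ~= 1"
  by (meson not_le neq0_conv)
 then show ?case
 proof cases
  case 1
  then show ?thesis by (simp add: u_small)
 next
  case 2
  have b: "b n = n" using 2 bs_B[OF b0_in] by simp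
  have "u n = b0 B + e" using u_eq[OF 2(1)] dn_b0[OF 2] b0_ge2 b by (simp add: 2(2)[symmetric] u01[unfolded One_nat_def])
  moreover have "u (n - 1) = b0 B - 1" using u_small[of "n - 1"] 2 b0_ge2 by simp
  moreover have "n div n = 1" using 2 b0_ge2 by simp
  moreover have "\<not> b0 B <= n - 1" "b0 B - 1 < b0 B + e" using 2 b0_ge2 by linarith+
  ultimately show ?thesis using dn_b0[OF 2] b 2 by simp
 next
  case 3
  note p = pred_rem[OF 3]
  have n1: "n - 1 < n" using 3 by (cases n) auto
  have dn: "dn n = dn (n - 1)" by (rule dn_rem[OF 3])
  have "u (n mod b n - 1) < u (n mod b n)" by (rule smono) (use 3 digit(5)[OF 3(1)] in auto)
  then have "u (n - 1) < u n" unfolding u_eq[OF 3(1)] u_eq[OF p(1)] p(2-4) dn by simp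
  moreover have "u (b n - 1) < dn n" using less[OF n1] p dn by simp
  ultimately show ?thesis using 3 dn by simp
 next
  case 4
  note p = pred_base[OF 4(1,3,4,2)]
  have n1: "n - 1 < n" using p b0_ge2 4 by linarith
  have lt: "u (n - 1) < dn n" unfolding dn_base[OF 4] 
   using dividend_less_times_div[of "dn (n - 1)" "u (n - 1)"] less[OF n1] p by auto
  have "u n = dn n" using u_eq[OF 4(1)] 4 by (simp add: u01[unfolded One_nat_def])
  moreover have "dn (n - 1) <= dn n" unfolding dn_base[OF 4] by simp
  ultimately show ?thesis using lt p 4 by simp
 next
  case 5
  note p = pred_digit[OF 5]
  have n1: "n - 1 < n" using p by linarith
  have a: "n div b n < n" "n div b n - 1 < n div b n" using digit(4)[OF 5(1)] p by auto
  have D1: "u (b n - 1) < dn (n - 1)" using less[OF n1] p by simp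
  have "u (n - 1) = dn (n - 1) * u (n div b n - 1) + u (b n - 1)" unfolding u_eq[OF p(1)] p(2-4) ..
  also have "\<dots> < dn (n - 1) * (u (n div b n - 1) + 1)" using D1 by simp
  also have "\<dots> <= dn (n - 1) * u (n div b n)" using smono[OF a(2,1)] by (intro mult_le_mono2) simp
  finally have 1: "u (n - 1) < dn (n - 1) * u (n div b n)" .
  have "1 <= u (n div b n)" using mono[of 1 "n div b n"] p a u01 by simp
  then have 2: "dn (n - 1) <= dn n" unfolding dn_digit[OF 5] by simp
  have "u n = dn n * u (n div b n)" using u_eq[OF 5(1)] 5 by (simp add: u01)
  then have "u (n - 1) < u n" using 1 2 mult_le_mono1[OF 2, of "u (n div b n)"] by linarith
  then show ?thesis using 1 2 D1 by simp
 qed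
qed

lemma u_strict: "m < n ==> u m < u n"
proof (induction n)
 case (Suc n)
 then show ?case using main[of "Suc n"] by (cases "m = n") auto
qed simp
lemma u_less [simp]: "u m < u n <-> m < n" by (metis u_strict less_asym linorder_neqE_nat less_irrefl)
lemma u_le [simp]: "u m <= u n <-> m <= n" by (metis u_less not_less)
lemma u_pos: "0 < n ==> 0 < u n" using u_strict[of 0 n] u01 by simp
lemma u_ge2: "2 <= n ==> 2 <= u n" using u_strict[of 1 n] u01(2) by linarith

lemma dn_gt: "b0 B <= n ==> u (b n - 1) < dn n" using main[of n] by simp
lemma dn_step: "b0 B <= n ==> dn n <= dn (Suc n)" using main[of "Suc n"] by simp
lemma dn_mono: "b0 B <= m ==> m <= n ==> dn m <= dn n"
proof (induction n)
 case (Suc n)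
 then show ?case using dn_step[of n] by (cases "m = Suc n") auto
qed simp
lemma digit_lt: "b0 B <= n ==> n mod b n = 0 ==> n div b n ~= 1 ==> u (n - 1) < dn (n - 1) * u (n div b n)"
 using main[of n] by simp

lemma u_digit: assumes "b0 B <= n" shows "u (n div b n) < dn n" "u (n mod b n) < dn n" "0 < u (n div b n)"
 "u n div dn n = u (n div b n)" "u n mod dn n = u (n mod b n)" "dn n <= u n" "u n < dn n * dn n"
proof -
 show 1: "u (n div b n) < dn n" using dn_gt[OF assms] digit(1)[OF assms] u_le[of "n div b n" "b n - 1"] by linarith
 show 2: "u (n mod b n) < dn n" using dn_gt[OF assms] digit(3)[OF assms] u_le[of "n mod b n" "b n - 1"] by linarith
 show 3: "0 < u (n div b n)" using u_pos digit(2)[OF assms] by simp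
 show 4: "u n div dn n = u (n div b n)" "u n mod dn n = u (n mod b n)"
  using 2 by (simp_all add: u_eq[OF assms])
 show "dn n <= u n" using 3 by (simp add: u_eq[OF assms] trans_le_add1)
 have "u n < dn n * (u (n div b n) + 1)" using 2 by (simp add: u_eq[OF assms])
 also have "\<dots> <= dn n * dn n" using 1 by (intro mult_le_mono2) simp
 finally show "u n < dn n * dn n" .
qed

lemma dn_ge2: assumes "b0 B <= n" shows "2 <= dn n"
 using dn_mono[OF order_refl assms] dn_b0[OF order_refl refl] b0_ge2 by simp

abbreviation "C \<equiv> Cs B e"

lemma dn_in: "b0 B <= n ==> dn n : C" by (auto simp: Cs_def Cn_def)

lemma Cn_le: assumes "b0 B <= n" "c : Cn B e n" shows "c <= dn n"
proof (cases "c = dn n")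
 case False
 then obtain i where i: "n mod b n = 0" "n div b n ~= 1" "c = dn (n - 1) * u (n div b n) ^ i" "i <= e"
  using assms(2) by (auto simp: Cn_def split: if_splits)
 have "u (n div b n) ^ i <= u (n div b n) ^ e" using u_digit(3)[OF assms(1)] i(4) by (intro power_increasing) auto
 then show ?thesis unfolding i(3) dn_digit[OF assms(1) i(1,2)] by simp
qed simp

lemma Cn_gt: assumes "b0 B <= n" "b0 B ~= n" "c : Cn B e n" shows "c = dn (n - 1) \<or> u (n - 1) < c"
proof -
 consider "0 < n mod b n" | "n mod b n = 0" "n div b n = 1" | "n mod b n = 0" "n div b n ~= 1" by (meson neq0_conv)
 then show ?thesis
 proof cases
  case 1
  then show ?thesis using assms(3) dn_rem[OF assms(1)] by (auto simp: Cn_def)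
 next
  case 2
  then have "c = dn n" using assms(3) by (simp add: Cn_def)
  then show ?thesis using dn_gt[OF assms(1)] pred_base[OF assms(1) 2] assms(2) by auto
 next
  case 3
  then obtain i where i: "c = dn (n - 1) * u (n div b n) ^ i"
   using assms(3) dn_digit[OF assms(1)] by (auto simp: Cn_def)
  show ?thesis
  proof (cases i)
   case (Suc j)
   have "dn (n - 1) * u (n div b n) * 1 <= c"
    unfolding i Suc using u_digit(3)[OF assms(1)] by (simp add: mult.assoc[symmetric])
   then show ?thesis using digit_lt[OF assms(1) 3] by simp
  qed (use i in simp)
 qed
qed

text \<open>By \<open>Cn_gt\<close> the bases inserted for a number after the least base exceed the
  preceding value, unless they repeat the preceding base. So nothing is inserted later between
  \<open>dn n\<close> and \<open>u n\<close>, and \<open>dn n\<close> is the base of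
  \<open>u n\<close>.\<close>

lemma C_gap: assumes "c : C" "b0 B <= n" shows "c <= dn n \<or> u n < c"
proof -
 obtain m where m: "b0 B <= m" "c : Cn B e m" using assms(1) by (auto simp: Cs_def)
 then show ?thesis
 proof (induction m rule: less_induct)
  case (less m)
  show ?case
  proof (cases "m <= n")
   case True
   then show ?thesis using Cn_le[OF less.prems] dn_mono[OF less.prems(1) True] by simp
  next
   case False
   then have "b0 B ~= m" "n <= m - 1" "b0 B <= m - 1" "m - 1 < m" using assms(2) b0_ge2 by auto
   from Cn_gt[OF less.prems(1) this(1) less.prems(2)] consider "c = dn (m - 1)" | "u (m - 1) < c" by blast
   then show ?thesis
   proof cases
    case 1
    then have "c : Cn B e (m - 1)" by (simp add: Cn_def)
    then show ?thesis using less.IH[of "m - 1"] \<open>m - 1 < m\<close> \<open>b0 B <= m - 1\<close> by blast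
   next
    case 2
    then show ?thesis using \<open>n <= m - 1\<close> u_le[of n "m - 1"] by linarith
   qed
  qed
 qed
qed

lemma C_cases: assumes "c : C" "b0 B <= n" "b0 B ~= n" shows "c <= dn (n - 1) \<or> c : Cn B e n \<or> dn n < c"
proof -
 obtain m where m: "b0 B <= m" "c : Cn B e m" using assms(1) by (auto simp: Cs_def)
 consider "m <= n - 1" | "m = n" | "n < m" by linarith
 then show ?thesis
 proof cases
  case 1
  then show ?thesis using Cn_le[OF m] dn_mono[OF m(1) 1] by simp
 next
  case 2
  then show ?thesis using m by simp
 next
  case 3
  then have n: "b0 B ~= m" "n <= m - 1" using assms(2) by auto
  have "dn n <= c"
   using Cn_gt[OF m(1) n(1) m(2)]
  proof
   assume "c = dn (m - 1)"
   then show ?thesis using dn_mono[OF assms(2) n(2)] by simp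
  next
   assume "u (m - 1) < c"
   then show ?thesis using u_digit(6)[OF assms(2)] u_le[of n "m - 1"] n(2) by linarith
  qed
  moreover have "dn n : Cn B e n" by (simp add: Cn_def)
  ultimately show ?thesis by (cases "c = dn n") auto
 qed
qed

lemma nxt_digit: assumes "b0 B <= n" "n mod b n = 0" "n div b n ~= 1" "i < e"
 shows "nxt C (dn (n - 1) * u (n div b n) ^ i) (dn (n - 1) * u (n div b n) ^ Suc i)"
proof -
 let ?a = "u (n div b n)" and ?dn = "dn (n - 1)"
 note p = pred_digit[OF assms(1-3)]
 have a: "2 <= ?a" using u_ge2 p by simp
 have dn: "0 < ?dn" using dn_ge2[OF p(1)] by simp
 have n: "b0 B ~= n" using p(1) b0_ge2 by auto
 have Dn: "dn n = ?dn * ?a ^ e" by (rule dn_digit[OF assms(1-3)])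
 have lt: "?a ^ j < ?a ^ k <-> j < k" for j k using a by simp
 show ?thesis unfolding nxt_def
 proof (intro conjI ballI impI)
  have "?dn * ?a ^ Suc i : Cn B e n" unfolding Cn_def using assms by (auto simp del: power_Suc intro!: exI[of _ "Suc i"])
  then show "?dn * ?a ^ Suc i : C" unfolding Cs_def using assms(1) by auto
  show "?dn * ?a ^ i < ?dn * ?a ^ Suc i" using dn lt[of i "Suc i"] by (simp del: power_Suc)
  fix c assume c: "c : C" "?dn * ?a ^ i < c"
  have "1 <= ?a ^ i" using a by simp
  then have "?dn * 1 <= ?dn * ?a ^ i" by (rule mult_le_mono2)
  then have "\<not> c <= ?dn" using le_less_trans[OF _ c(2), of "?dn * 1"] by simp
  then consider "c : Cn B e n" | "dn n < c" using C_cases[OF c(1) assms(1) n] by blast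
  then show "?dn * ?a ^ Suc i <= c"
  proof cases
   case 1
   then obtain j where j: "c = ?dn * ?a ^ j" using Dn by (auto simp: Cn_def split: if_splits)
   then have "i < j" using c(2) dn lt by simp
   then have "?a ^ Suc i <= ?a ^ j" using a by (intro power_increasing) auto
   then show ?thesis unfolding j by (rule mult_le_mono2)
  next
   case 2
   have "?a ^ Suc i <= ?a ^ e" using a assms(4) by (intro power_increasing) auto
   then have "?dn * ?a ^ Suc i <= dn n" unfolding Dn by (rule mult_le_mono2)
   then show ?thesis using 2 by simp
  qed
 qed
qed

lemma nxt_base: assumes "b0 B <= n" "n ~= b0 B" "n mod b n = 0" "n div b n = 1"
 shows "nxt C (dn (n - 1)) (dn n)"
proof -
 note p = pred_base[OF assms(1,3,4,2)]
 have "dn (n - 1) < dn n" using dn_gt[OF assms(1)] p u_digit(6)[OF p(3)] by simp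
 moreover have "dn n <= c" if "c : C" "dn (n - 1) < c" for c
  using C_cases[OF that(1) assms(1)] assms(2,4) that(2) by (auto simp: Cn_def)
 ultimately show ?thesis using dn_in[OF assms(1)] by (simp add: nxt_def)
qed

lemma C_nxt: assumes "c : C" shows "EX s. nxt C c s & s <= c * c & c dvd s"
proof -
 have dn: "EX s. nxt C (dn n) s & s <= dn n * dn n & dn n dvd s" if n: "b0 B <= n" for n
 proof -
  \<comment> \<open>The base can change only at the next number with remainder 0; up to there
    \<open>dn\<close> is constant.\<close>
  define m where "m = (LEAST m. n < m & m mod b m = 0)"
  obtain s where s: "nxt B (b n) s" using nxt[OF bs_in[OF n]] by blast
  have "n < s" using s bs_max[OF n, of s] by (metis nxt_def not_less)
  moreover have "s mod b s = 0" using s bs_B[of s] by (simp add: nxt_def)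
  ultimately have m: "n < m & m mod b m = 0" unfolding m_def by (intro LeastI[of "%m. n < m & m mod b m = 0" s]) simp
  have bm: "b0 B <= m" using m n by simp
  have same: "dn k = dn n" if "n <= k" "k < m" for k
   using that
  proof (induction k rule: dec_induct)
   case (step k)
   have "Suc k mod b (Suc k) ~= 0" using not_less_Least[of "Suc k" "%m. n < m & m mod b m = 0"] step unfolding m_def by auto
   then show ?case using dn_rem[of "Suc k"] step n by simp
  qed simp
  have D1: "dn (m - 1) = dn n" by (rule same) (use m in auto)
  show ?thesis
  proof (cases "m div b m = 1")
   case True
   have m0: "m ~= b0 B" using m n by simp
   note p = pred_base[OF bm _ True m0]
   have "dn m = dn n * (u (m - 1) div dn n + 1)" using dn_base[OF bm m0 _ True] m D1 by simp
   have "u (m - 1) div dn n + 1 <= dn n"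
    using u_digit(7)[of "m - 1"] p(3) m D1 by (simp add: Suc_le_eq less_mult_imp_div_less)
   then have "dn m <= dn n * dn n" "dn n dvd dn m" unfolding \<open>dn m = _\<close> by (simp_all only: mult_le_mono2 dvd_triv_left)
   moreover have "nxt C (dn n) (dn m)" using nxt_base[OF bm m0 _ True] m D1 by simp
   ultimately show ?thesis by blast
  next
   case False
   have "b0 B <= m - 1" using pred_digit(1)[OF bm conjunct2[OF m] False] .
   have "u (m div b m) <= u (b m - 1)" using digit(1)[OF bm] by simp
   also have "\<dots> < dn (m - 1)" using dn_gt[OF \<open>b0 B <= m - 1\<close>] pred_digit(2)[OF bm _ False] m by simp
   finally have "u (m div b m) <= dn n" using D1 by simp
   then have "dn n * u (m div b m) <= dn n * dn n" by (rule mult_le_mono2)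
   moreover have "nxt C (dn n) (dn n * u (m div b m))" using nxt_digit[OF bm _ False, of 0] m e1 D1 by simp
   ultimately show ?thesis by (intro exI[of _ "dn n * u (m div b m)"]) simp
  qed
 qed
 obtain n where n: "b0 B <= n" "c : Cn B e n" using assms by (auto simp: Cs_def)
 show ?thesis
 proof (cases "c = dn n")
  case False
  then obtain i where i: "n mod b n = 0" "n div b n ~= 1" "c = dn (n - 1) * u (n div b n) ^ i" "i <= e"
   using n(2) by (auto simp: Cn_def split: if_splits)
  have ie: "i < e" using i False dn_digit[OF n(1) i(1,2)] by (metis le_neq_implies_less)
  note p = pred_digit[OF n(1) i(1,2)]
  have "u (n div b n) <= dn (n - 1)" using dn_gt[OF p(1)] p(2) digit(1)[OF n(1)] u_le[of "n div b n" "b n - 1"] by (simp only: p(2)) linarith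
  also have "\<dots> <= c" using u_digit(3)[OF n(1)] by (simp add: i(3))
  finally have "c * u (n div b n) <= c * c" by (rule mult_le_mono2)
  then show ?thesis using nxt_digit[OF n(1) i(1,2) ie] i(3) 
   by (intro exI[of _ "c * u (n div b n)"]) (simp add: mult_ac)
 qed (use dn n in auto)
qed

lemma C_ge: assumes "c : C" shows "dn (b0 B) <= c"
proof -
 have "dn (b0 B) <= c" if "b0 B <= n" "c : Cn B e n" for n
  using that
 proof (induction n)
  case (Suc n)
  show ?case
  proof (cases "b0 B = Suc n")
   case True
   have "b (Suc n) = Suc n" using True bs_B[OF b0_in] by simp
   then have "c = dn (Suc n)" using Suc.prems(2) by (simp add: Cn_def)
   then show ?thesis using True by simp
  next
   case False
   then have n: "b0 B <= n" using Suc.prems(1) by simp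
   from Cn_gt[OF Suc.prems(1) False Suc.prems(2)] show ?thesis
    using dn_mono[OF order_refl n] u_digit(6)[OF n] by auto
  qed
 qed (use b0_ge2 in simp)
 then show ?thesis using assms by (auto simp: Cs_def)
qed

lemma b0_C: "b0 C = b0 B + e"
 unfolding b0_def[of C] dn_b0[OF order_refl refl, symmetric] by (rule Least_equality) (auto intro: dn_in C_ge)

sublocale C: nh C
proof
 show "C ~= {}" using dn_in[OF order_refl] by auto
 show "2 <= c" if "c : C" for c using C_ge[OF that] dn_ge2[OF order_refl] by simp
qed (rule C_nxt)

lemma bs_C: assumes "b0 B <= n" "dn n <= m" "m <= u n" shows "bse C m = dn n"
 by (rule C.bs_eq[OF dn_in]) (use assms C_gap[OF _ assms(1)] in fastforce)+

lemma b0_C_le: "b0 B <= n ==> dn n <= m ==> b0 C <= m"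
 using C.b0_le[OF dn_in] order_trans by blast

text \<open>\<open>dn n\<close> is the base which the definition of the upgrade operator asks for.\<close>

lemma dn_minimal: assumes "b0 B <= n" "d : C" "u (n - 1) < d * u (n div b n) + u (n mod b n)"
 "!!s. nxt C d s ==> d * u (n div b n) + u (n mod b n) < s" shows "dn n <= d"
proof (rule ccontr)
 assume "\<not> dn n <= d"
 then have lt: "d < dn n" by simp
 then have n: "n ~= b0 B" using C_ge[OF assms(2)] by auto
 then have n1: "b0 B <= n - 1" using assms(1) by simp
 obtain s where s: "nxt C d s" using C_nxt[OF assms(2)] by blast
 have ge: "dn (n - 1) <= d"
 proof (rule ccontr)
  assume "\<not> dn (n - 1) <= d"
  then have "s <= dn (n - 1)" using s dn_in[OF n1] by (simp add: nxt_def)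
  then show False using u_digit(6)[OF n1] assms(3) assms(4)[OF s] by simp
 qed
 consider "0 < n mod b n" | "n mod b n = 0" "n div b n = 1" | "n mod b n = 0" "n div b n ~= 1" by (meson neq0_conv)
 then show False
 proof cases
  case 1
  then show ?thesis using ge lt dn_rem[OF assms(1)] by simp
 next
  case 2
  have "d = dn (n - 1)" using C_cases[OF assms(2,1)] n ge lt 2 by (auto simp: Cn_def)
  then show ?thesis using assms(3) 2 u_digit(6)[OF n1] by (simp add: u01 u01[unfolded One_nat_def])
 next
  case 3
  have "d : Cn B e n"
  proof (cases "d = dn (n - 1)")
   case True
   then show ?thesis using 3 by (auto simp: Cn_def intro!: exI[of _ 0])
  next
   case False
   then show ?thesis using C_cases[OF assms(2,1)] n ge lt by auto
  qed
  then obtain i where i: "d = dn (n - 1) * u (n div b n) ^ i" "i <= e" using lt 3 by (auto simp: Cn_def)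
  then have "i < e" using lt dn_digit[OF assms(1) 3] by (metis le_neq_implies_less less_irrefl)
  \<comment> \<open>The successor of such a base coincides with the value that is required to be
    strictly smaller.\<close>
  from nxt_digit[OF assms(1) 3 this] have "nxt C d (d * u (n div b n))" by (simp add: i(1) mult_ac)
  from assms(4)[OF this] show ?thesis by simp
 qed
qed

lemma dn_admissible: assumes "b0 B <= n"
 shows "u (n - 1) < u n" "nxt C (dn n) s ==> u n < s"
 using assms b0_ge2 C_gap[OF _ assms, of s] by (auto simp: nxt_def)

text \<open>By \<open>dn_base\<close> the new base is the least multiple of the preceding one above
  \<open>u (n - 1)\<close>, which is just what clause (3) of good successors asks for.\<close>

lemma no_multiple: assumes "n : B" "b0 B < n" "dn (n - 1) dvd z" "u (n - 1) < z"
 shows "dn n <= z" "dn n : C" "u (n - 1) < dn n"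
proof -
 have n: "b0 B <= n" "n ~= b0 B" "n mod b n = 0" "n div b n = 1"
  using assms bs_B[OF assms(1)] ge2[OF assms(1)] by auto
 show "dn n : C" by (rule dn_in[OF n(1)])
 show "u (n - 1) < dn n" using dn_gt[OF n(1)] bs_B[OF assms(1)] by simp
 obtain k where k: "z = dn (n - 1) * k" using assms(3) by blast
 then have "u (n - 1) div dn (n - 1) < k" using assms(4) by (simp add: less_mult_imp_div_less mult.commute)
 then show "dn n <= z" unfolding dn_base[OF n] k by (intro mult_le_mono2) simp
qed

end

section \<open>Ordinals assigned to numbers by a hierarchy\<close>

definition rep :: "nat => hm => hm" where "rep k z = HM (replicate_mset k z)"
definition tp :: "hm => hm" where "tp y = Max (insert 0 (set_mset (un y)))"
text \<open>The ordinary, not the natural, sum of \<open>z\<close> and \<omega> to the power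
  \<open>x\<close>: smaller terms of \<open>z\<close> are absorbed. For positive \<open>k\<close>,
  \<open>bumpk\<close> adds \<open>k\<close> such terms.\<close>

definition bump :: "hm => hm => hm" where "bump z x = HM (filter_mset (%v. x <= v) (un z) + {#x#})"
definition bumpk :: "hm => hm => nat => hm" where
 "bumpk z x k = HM (filter_mset (%v. x <= v) (un z) + replicate_mset k x)"

lemma lexI: assumes "count M z < count N z" "!!y. z < y ==> count M y <= count N y" shows "M < (N :: 'a :: linorder multiset)"
 unfolding less_multiset\<^sub>H\<^sub>O
proof (intro conjI allI impI)
 show "M ~= N" using assms(1) by auto
 fix y assume y: "count N y < count M y"
 then have "y < z" using assms by (metis less_irrefl less_trans linorder_neqE not_le)
 then show "\<exists>x>y. count M x < count N x" using assms(1) by blast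
qed

lemma lexE: assumes "M < (N :: 'a :: linorder multiset)"
 obtains z where "count M z < count N z" "!!y. z < y ==> count M y = count N y"
proof -
 let ?S = "{z : set_mset M \<union> set_mset N. count M z ~= count N z}"
 have S: "z : ?S <-> count M z ~= count N z" for z
  by (auto simp: not_in_iff)
 have "M ~= N" using assms by auto
 then have "?S ~= {}" using S by (metis all_not_in_conv multiset_eqI)
 then have m: "Max ?S : ?S" by (intro Max_in) auto
 have eq: "count M y = count N y" if "Max ?S < y" for y
 proof (rule ccontr)
  assume "count M y ~= count N y"
  then have "y : ?S" using S by blast
  then have "y <= Max ?S" by (intro Max_ge) simp_all
  then show False using that by simp
 qed
 have "\<not> count N (Max ?S) < count M (Max ?S)"
 proof
  assume "count N (Max ?S) < count M (Max ?S)"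
  then obtain x where "Max ?S < x" "count M x < count N x" using assms unfolding less_multiset\<^sub>H\<^sub>O by blast
  then show False using eq[of x] by linarith
 qed
 moreover have "count M (Max ?S) ~= count N (Max ?S)" using m S by blast
 ultimately have "count M (Max ?S) < count N (Max ?S)" by linarith
 then show thesis using eq by (rule that)
qed

lemma rep_less_w: "0 < k ==> rep k z < w x <-> z < x"
 by (auto simp: rep_def HM_less_w)
lemma w_le_rep: "0 < k ==> w z <= rep k z"
 by (auto simp: rep_def w_def intro: subset_eq_imp_le_multiset)
lemma rep_add: "rep k z + rep l z = rep (k + l) z" by (simp add: rep_def HM_plus multiset_eq_iff)
lemma w_rep: "w z = rep 1 z" by (simp add: rep_def w_def)
lemma tp_rep: "0 < k ==> tp (rep k z) = z" by (simp add: tp_def rep_def max_def)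
lemma rep_mono_exp: assumes "rep k z <= rep l x" "0 < k" "0 < l" shows "z <= x"
proof (rule ccontr)
 assume "\<not> z <= x"
 then have "rep l x < w z" using rep_less_w[OF assms(3)] by simp
 then show False using w_le_rep[OF assms(2), of z] assms(1) by simp
qed
lemma rep_mono: "k <= l ==> rep k z <= rep l z"
 using hm_le_add(1)[of "rep k z" "rep (l - k) z"] by (simp add: rep_add)
lemma rep_pos: "0 < k ==> 0 < rep k z" by (auto simp: hm_pos rep_def zero_hm_def)

lemma bump_less: "x < x' ==> bump z x < bump z x'"
 unfolding bump_def HM_less by (rule lexI[of _ x']) auto

lemma bump_mono1: assumes "z <= z'" shows "bump z x <= bump z' x"
proof (cases "z = z'")
 case False
 then have "un z < un z'" using assms by (cases z; cases z') auto
 then obtain v where v: "count (un z) v < count (un z') v" "!!y. v < y ==> count (un z) y = count (un z') y" by (rule lexE) blast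
 show ?thesis
 proof (cases "x <= v")
  case True
  show ?thesis unfolding bump_def HM_le
  proof (rule less_imp_le, rule lexI[of _ v])
   fix y assume "v < y"
   then show "count (filter_mset (%v. x <= v) (un z) + {#x#}) y <= count (filter_mset (%v. x <= v) (un z') + {#x#}) y"
    by (simp add: v(2))
  qed (use v(1) True in simp)
 next
  case False
  have "filter_mset (%v. x <= v) (un z) = filter_mset (%v. x <= v) (un z')"
   by (rule multiset_eqI) (use False v(2) in auto)
  then show ?thesis by (simp add: bump_def)
 qed
qed simp

lemma bump_mono: "z <= z' ==> x <= x' ==> bump z x <= bump z' x'"
 using bump_mono1[of z z' x] bump_less[of x x' z'] by (cases "x = x'") (auto dest: order_trans[OF _ less_imp_le] simp: le_less)

lemma bump_gt: "z < bump z x"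
proof (cases z)
 case (HM M)
 then show ?thesis by (auto simp: bump_def intro!: lexI[of _ x])
qed

lemma w_le_bump: "w x <= bump z x" unfolding w_def bump_def HM_le by (simp add: subset_eq_imp_le_multiset)

lemma bumpk_Suc: "bump (bumpk z x k) x = bumpk z x (Suc k)"
 unfolding bump_def bumpk_def by (simp add: multiset_eq_iff)
lemma bumpk_0: "bumpk z x 0 <= z" by (cases z) (simp add: bumpk_def subset_eq_imp_le_multiset)
text \<open>A cofinality statement: for positive \<open>x\<close> the sum is the supremum of the
  sums with finitely many equal terms of smaller exponent, and for \<open>x = 0\<close> it is the
  successor of \<open>z\<close>.\<close>

lemma less_bump:
 assumes "v < bump z x" shows "v <= z \<or> (EX t<x. EX k. v < bumpk z t k)"
proof -
 obtain M where M: "v = HM M" by (cases v)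
 obtain Z where Z: "z = HM Z" by (cases z)
 have "M < filter_mset (%v. x <= v) Z + {#x#}" using assms by (simp add: M Z bump_def)
 then obtain p where p: "count M p < count (filter_mset (%v. x <= v) Z + {#x#}) p"
  "!!y. p < y ==> count M y = count (filter_mset (%v. x <= v) Z + {#x#}) y" by (rule lexE) blast
 have px: "x <= p" using p(1) by (auto split: if_splits)
 have above: "count M y = count Z y" if "p < y" for y using p(2)[OF that] px that by auto
 consider "count M p < count Z p" | "p = x" "count M x = count Z x" using p(1) px
  by (cases "count M p < count Z p") (auto split: if_splits)
 then show ?thesis
 proof cases
  case 1
  then have "M < Z" using above by (intro lexI[of _ p]) auto
  then show ?thesis by (simp add: M Z less_imp_le)
 next
  case 2
  have ge: "count M y = count Z y" if "x <= y" for y using above 2 that by (cases "y = x") auto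
  show ?thesis
  proof (cases "\<exists>y\<in>#M. y < x")
   case False
   have "M <=# Z"
   proof (rule mset_subset_eqI)
    fix y
    show "count M y <= count Z y" using ge[of y] False by (cases "x <= y") (auto simp: not_le count_eq_zero_iff[symmetric] intro: order.trans[OF eq_refl])
   qed
   then show ?thesis by (simp add: M Z subset_eq_imp_le_multiset)
  next
   case True
   define t where "t = Max {y : set_mset M. y < x}"
   have "t : {y : set_mset M. y < x}" unfolding t_def using True by (intro Max_in) auto
   then have t: "t < x" by simp
   have tmax: "count M y = 0" if "t < y" "y < x" for y
   proof (rule ccontr)
    assume "count M y ~= 0"
    then have "y <= t" unfolding t_def using that by (intro Max_ge) (auto simp: count_eq_zero_iff)
    then show False using that by simp
   qed
   have "M < filter_mset (%v. t <= v) Z + replicate_mset (Suc (count M t)) t"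
   proof (rule lexI[of _ t])
    fix y assume y: "t < y"
    show "count M y <= count (filter_mset (%v. t <= v) Z + replicate_mset (Suc (count M t)) t) y"
     using y tmax[OF y] ge[of y] by (cases "x <= y") auto
   qed simp
   then have "v < bumpk z t (Suc (count M t))" by (simp only: M Z bumpk_def HM_less hm.sel)
   then show ?thesis using t by blast
  qed
 qed
qed

text \<open>The analogous cofinality for a power of \<omega>: finite multiples of smaller powers are
  cofinal in it.\<close>

lemma less_w_rep: assumes "v < w z" "0 < z" shows "EX x<z. EX k. v <= rep k x"
proof -
 obtain M where M: "v = HM M" by (cases v)
 show ?thesis
 proof (cases "M = {#}")
  case True
  then show ?thesis using assms(2) M hm_ge_0 by (auto simp: zero_hm_def[symmetric])
 next
  case False
  let ?x = "Max (set_mset M)"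
  have x: "?x \<in># M" using False by (intro Max_in) auto
  have "M < replicate_mset (Suc (count M ?x)) ?x"
  proof (rule lexI[of _ ?x])
   fix y assume "?x < y"
   then have "y ~:# M" using Max_ge[OF finite_set_mset, of y M] by (meson leD)
   then show "count M y <= count (replicate_mset (Suc (count M ?x)) ?x) y" by (simp add: not_in_iff)
  qed simp
  then have "v <= rep (Suc (count M ?x)) ?x" by (simp add: M rep_def)
  moreover have "?x < z" using assms(1) x by (auto simp: M HM_less_w)
  ultimately show ?thesis by blast
 qed
qed

text \<open>The bound on \<open>x\<close> excludes exponents above \<open>z\<close>. The natural sum
  is then the ordinary one, and an ordinal below it lies in the first or in the second part.\<close>

lemma less_rep_add:
 assumes "v < rep k z + x" "x < w z + rep l z" 
 shows "v < rep k z \<or> (EX v'<x. v = rep k z + v')"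
proof -
 obtain M X where MX: "v = HM M" "x = HM X" by (cases v; cases x) auto
 have X: "count X y = 0" if "z < y" for y
 proof -
  have "X < replicate_mset (Suc l) z" using assms(2) by (simp add: MX w_def rep_def HM_plus)
  then obtain p where p: "count X p < count (replicate_mset (Suc l) z) p"
   "!!y. p < y ==> count X y = count (replicate_mset (Suc l) z) y" by (rule lexE) blast
  have "p = z" using p(1) by (auto split: if_splits)
  then show ?thesis using p(2)[of y] that by auto
 qed
 have "M < replicate_mset k z + X" using assms(1) by (simp add: MX rep_def HM_plus)
 then obtain p where p: "count M p < count (replicate_mset k z + X) p"
  "!!y. p < y ==> count M y = count (replicate_mset k z + X) y" by (rule lexE) blast
 have pz: "p <= z"
 proof (rule ccontr)
  assume "\<not> p <= z"
  then have "p ~= z" "count X p = 0" using X[of p] by auto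
  then show False using p(1) by simp
 qed
 have Mz: "count M y = 0" if "z < y" for y
 proof -
  have "y ~= z" "p < y" using that pz by auto
  then show ?thesis using p(2)[of y] X[OF that] by simp
 qed
 show ?thesis
 proof (cases "k <= count M z")
  case False
  have "M < replicate_mset k z" by (rule lexI[of _ z]) (use False Mz in auto)
  then show ?thesis by (simp add: MX rep_def)
 next
  case True
  then have M: "M = replicate_mset k z + (M - replicate_mset k z)"
   by (auto simp: multiset_eq_iff)
  then have "HM (M - replicate_mset k z) < x" "v = rep k z + HM (M - replicate_mset k z)"
   using assms(1) by (simp_all add: MX rep_def HM_plus) (metis add_less_cancel_left)
  then show ?thesis by blast
 qed
qed

text \<open>The first component belongs to the number without its remainder, the second to the whole
  number. A base doubles the first component of its predecessor. A digit of at least 2 at base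
  \<open>b\<close> gives a power of \<omega> whose exponent is the leading exponent of
  \<open>b\<close> plus a power of \<omega> that measures the digit. Exactly these two operations
  are repeated by inserting many bases. Since such digits start at 2, digits below the least base
  are shifted by 2.\<close>

function Od :: "nat set => nat => hm \<times> hm" where
 "Od B n = (if n < b0 B \<or> bse B n < 2 \<or> n < bse B n then (0, fin n) else
  (let y = (if n = b0 B then w (fin 1)
    else if 0 < n mod bse B n then fst (Od B (n - 1))
    else if n div bse B n = 1 then fst (Od B (n - 1)) + fst (Od B (n - 1))
    else w (bump (tp (fst (Od B (bse B n))))
     (if n div bse B n < b0 B then fin (n div bse B n - 2) else snd (Od B (n div bse B n)))))
  in (y, y + snd (Od B (n mod bse B n)))))"
 by pat_completeness auto
termination
proof (relation "measure (%(B, n). n)", goal_cases)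
 case 1
 show ?case by simp
next
 case (5 B n)
 then have "bse B n ~= n" by auto
 then show ?case using 5 by simp
qed (auto simp: not_less intro: less_le_trans[OF mod_less_divisor])

declare Od.simps [simp del]

definition yv :: "nat set => nat => hm" where "yv B n = fst (Od B n)"
definition od :: "nat set => nat => hm" where "od B n = snd (Od B n)"
definition hx :: "nat set => nat => hm" where "hx B a = (if a < b0 B then fin (a - 2) else od B a)"

context nh
begin

lemma od_small: "n < b0 B ==> od B n = fin n" by (simp add: od_def Od.simps[of B n])

lemma od_eqs: assumes "b0 B <= n"
 shows od_eq: "od B n = yv B n + od B (n mod bse B n)"
  and yv_b0: "n = b0 B ==> yv B n = w (fin 1)"
  and yv_rem: "0 < n mod bse B n ==> yv B n = yv B (n - 1)"
  and yv_base: "n ~= b0 B ==> n mod bse B n = 0 ==> n div bse B n = 1 ==> yv B n = yv B (n - 1) + yv B (n - 1)"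
  and yv_digit: "n mod bse B n = 0 ==> n div bse B n ~= 1 ==>
   yv B n = w (bump (tp (yv B (bse B n))) (hx B (n div bse B n)))"
proof -
 have b: "\<not> (n < b0 B \<or> bse B n < 2 \<or> n < bse B n)" using assms bs_ge2[OF assms] bs_le[OF assms] by simp
 note eq = Od.simps[of B n, unfolded if_not_P[OF b] Let_def]
 show "od B n = yv B n + od B (n mod bse B n)" unfolding od_def yv_def by (simp add: eq)
 show "n = b0 B ==> yv B n = w (fin 1)" unfolding yv_def by (subst eq) simp
 have nb: "0 < n mod bse B n ==> n ~= b0 B" using bs_B[OF b0_in] by auto
 show "0 < n mod bse B n ==> yv B n = yv B (n - 1)" using nb unfolding yv_def by (subst eq) simp
 show "n ~= b0 B ==> n mod bse B n = 0 ==> n div bse B n = 1 ==> yv B n = yv B (n - 1) + yv B (n - 1)"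
  unfolding yv_def by (subst eq) simp
 have "n = b0 B ==> n div bse B n = 1" using bs_B[OF b0_in] b0_ge2 by auto
 then show "n mod bse B n = 0 ==> n div bse B n ~= 1 ==>
   yv B n = w (bump (tp (yv B (bse B n))) (hx B (n div bse B n)))"
  unfolding yv_def od_def hx_def by (subst eq) auto
qed

lemma od_0 [simp]: "od B 0 = 0" using od_small[of 0] b0_ge2 by simp

lemma yv_mult: assumes "b0 B <= n" shows "yv B n = yv B (bse B n * (n div bse B n))"
proof -
 have "yv B n = yv B (n - k)" if "k <= n mod bse B n" for k
  using that
 proof (induction k)
  case (Suc k)
  have m: "b0 B <= n - k" "bse B (n - k) = bse B n" "(n - k) mod bse B n = n mod bse B n - k"
  proof -
   have e: "n - k = bse B n * (n div bse B n) + (n mod bse B n - k)"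
    using mult_div_mod_eq[of "bse B n" n] Suc.prems by linarith
   have "bse B n * 1 <= bse B n * (n div bse B n)" using digit(2)[OF assms] by (intro mult_le_mono2) simp
   then have "bse B n <= n - k" unfolding e by linarith
   then show "b0 B <= n - k" "bse B (n - k) = bse B n"
    using b0_le[OF bs_in[OF assms]] bs_between[OF assms, of "n - k"] by auto
   have "n mod bse B n - k < bse B n" using digit(3)[OF assms] by simp
   then show "(n - k) mod bse B n = n mod bse B n - k" unfolding e by simp
  qed
  then have "yv B (n - k) = yv B (n - k - 1)" using Suc.prems by (intro yv_rem) auto
  then show ?case using Suc by simp
 qed simp
 from this[OF order_refl] show ?thesis by (simp add: minus_mod_eq_mult_div)
qed

lemma bse_mult: assumes "b0 B <= n" "1 <= a" "a <= n div bse B n" shows "bse B (bse B n * a) = bse B n" "b0 B <= bse B n * a"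
proof -
 have "bse B n * 1 <= bse B n * a" using assms(2) by (rule mult_le_mono2)
 moreover have "bse B n * a <= bse B n * (n div bse B n)" using assms(3) by (rule mult_le_mono2)
 moreover have "bse B n * (n div bse B n) <= n" by simp
 ultimately have "bse B n <= bse B n * a" "bse B n * a <= n" by linarith+
 then show "bse B (bse B n * a) = bse B n" "b0 B <= bse B n * a"
  using bs_between[OF assms(1), of "bse B n * a"] b0_le[OF bs_in[OF assms(1)]] by (blast intro: order_trans)+
qed

lemma yv_digit_eq: assumes "b0 B <= n" "2 <= n div bse B n"
 shows "yv B n = w (bump (tp (yv B (bse B n))) (hx B (n div bse B n)))"
proof -
 note b = bse_mult[OF assms(1) _ order_refl]
 have "yv B (bse B n * (n div bse B n)) = w (bump (tp (yv B (bse B n))) (hx B (n div bse B n)))"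
  using yv_digit[OF b(2)] b(1) assms bs_ge2[OF assms(1)] by simp
 then show ?thesis using yv_mult[OF assms(1)] by simp
qed

lemma yv_one: "b0 B <= n ==> n div bse B n = 1 ==> yv B n = yv B (bse B n)"
 using yv_mult[of n] by simp

text \<open>That \<open>yv\<close> is always a finite multiple of a single power is part of the
  invariant: the leading exponent of a base then suffices to bound its ordinal by the power assigned
  to a larger digit.\<close>

lemma omain: "(0 < n --> od B (n - 1) < od B n) &
 (b0 B <= n --> (\<exists>k>0. yv B n = rep k (tp (yv B n))) & (b0 B <= n - 1 --> yv B (n - 1) <= yv B n) &
  od B (n mod bse B n) < yv B n)"
proof (induction n rule: less_induct)
 case (less n)
 have smono: "od B k < od B m" if "k < m" "m < n" for k m
  using that
 proof (induction m)
  case (Suc m)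
  have "od B m < od B (Suc m)" using less.IH[of "Suc m"] Suc.prems by simp
  moreover have "k = m \<or> od B k < od B m" using Suc by (cases "k = m") auto
  ultimately show ?case by auto
 qed simp
 have ymono: "yv B k <= yv B m" if "b0 B <= k" "k <= m" "m < n" for k m
  using that
 proof (induction m)
  case (Suc m)
  show ?case
  proof (cases "k = Suc m")
   case False
   then have "yv B k <= yv B m" "b0 B <= m" using Suc by auto
   moreover from this have "yv B m <= yv B (Suc m)" using less.IH[of "Suc m"] Suc.prems by simp
   ultimately show ?thesis by simp
  qed simp
 qed simp
 have unif: "\<exists>k>0. yv B m = rep k (tp (yv B m))" if "b0 B <= m" "m < n" for m using less.IH[of m] that by blast
 consider "n < b0 B" | "b0 B <= n" "n = b0 B" | "b0 B <= n" "0 < n mod bse B n"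
  | "b0 B <= n" "n ~= b0 B" "n mod bse B n = 0" "n div bse B n = 1" | "b0 B <= n" "n mod bse B n = 0" "n div bse B n ~= 1"
  by (meson not_le neq0_conv)
 then show ?case
 proof cases
  case 1
  then show ?thesis by (simp add: od_small)
 next
  case 2
  have b: "n mod bse B n = 0" using 2 bs_B[OF b0_in] by simp
  have y: "yv B n = w (fin 1)" by (rule yv_b0[OF 2])
  have "fin m < w (fin 1)" for m by (rule fin_less_w) (use fin_less[of 0 1] in simp)
  moreover have "od B n = w (fin 1)" using od_eq[OF 2(1)] b y by simp
  moreover have "od B (n - 1) = fin (n - 1)" "\<not> b0 B <= n - 1" using 2 b0_ge2 by (auto intro: od_small)
  moreover have "0 < w (fin 1)" by (rule le_less_trans[OF hm_ge_0 less_w])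
  ultimately show ?thesis using b y by (auto simp: w_rep tp_rep)
 next
  case 3
  note p = pred_rem[OF 3]
  have n1: "n - 1 < n" using 3 by (cases n) auto
  have y: "yv B n = yv B (n - 1)" by (rule yv_rem[OF 3])
  have "od B (n mod bse B n - 1) < od B (n mod bse B n)" by (rule smono) (use 3 digit(5)[OF 3(1)] in auto)
  then have o: "od B (n - 1) < od B n" unfolding od_eq[OF 3(1)] od_eq[OF p(1)] p(2-4) y by simp
  have bn: "bse B n < n" using bs_le[OF 3(1)] 3(2) by (cases "bse B n = n") auto
  have "od B (n mod bse B n) < od B (bse B n)" by (rule smono) (use digit(3)[OF 3(1)] bn in auto)
  also have "\<dots> = yv B (bse B n)" using od_eq[OF b0_le[OF bs_in[OF 3(1)]]] bs_B[OF bs_in[OF 3(1)]] by simp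
  also have "\<dots> <= yv B (n - 1)" by (rule ymono) (use b0_le[OF bs_in[OF 3(1)]] bn n1 in auto)
  finally show ?thesis using o y unif[OF p(1) n1] by simp
 next
  case 4
  note p = pred_base[OF 4(1,3,4,2)]
  have n1: "n - 1 < n" using p b0_ge2 4 by linarith
  obtain k where k: "0 < k" "yv B (n - 1) = rep k (tp (yv B (n - 1)))" using unif[OF p(3) n1] by blast
  have y: "yv B n = yv B (n - 1) + yv B (n - 1)" by (rule yv_base[OF 4])
  then have yr: "yv B n = rep (k + k) (tp (yv B (n - 1)))" using k(2) rep_add by metis
  have "od B ((n - 1) mod bse B (n - 1)) < yv B (n - 1)" using less.IH[OF n1] p(3) by blast
  then have "od B (n - 1) < od B n" unfolding od_eq[OF 4(1)] od_eq[OF p(3)] 4(3) y by simp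
  moreover have "tp (yv B n) = tp (yv B (n - 1))" using yr k(1) tp_rep by simp
  moreover have "0 < yv B n" using yr rep_pos[of "k + k"] k(1) by simp
  ultimately show ?thesis using yr k(1) y 4(3) by (metis add_pos_pos hm_le_add(1) od_0)
 next
  case 5
  note p = pred_digit[OF 5]
  let ?b = "bse B n" and ?a = "n div bse B n"
  have n1: "n - 1 < n" using p by linarith
  have bB: "?b : B" "b0 B <= ?b" using bs_in[OF 5(1)] b0_le by auto
  obtain k where k: "0 < k" "yv B ?b = rep k (tp (yv B ?b))" using unif[OF bB(2) p(6)] by blast
  let ?z = "tp (yv B ?b)"
  have y: "yv B n = w (bump ?z (hx B ?a))" by (rule yv_digit[OF 5])
  have yb: "yv B ?b < yv B n" by (subst k(2), unfold y rep_less_w[OF k(1)]) (rule bump_gt)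
  have odb: "od B ?b = yv B ?b" using od_eq[OF bB(2)] bs_B[OF bB(1)] by simp
  have "od B (?b - 1) < od B ?b" using bs_ge2[OF 5(1)] by (intro smono) (use p(6) in auto)
  then have 1: "od B (?b - 1) < yv B n" using odb yb by simp
  have a1: "?a - 1 < ?a" "?a < n" using p(5) digit(4)[OF 5(1)] by auto
  have 2: "yv B (n - 1) < yv B n"
  proof (cases "?a = 2")
   case True
   then show ?thesis using yv_one[OF p(1)] p yb by simp
  next
   case False
   have hx: "hx B (?a - 1) < hx B ?a"
   proof -
    consider "?a < b0 B" | "?a = b0 B" | "b0 B < ?a" by linarith
    then show ?thesis
    proof cases
     case 1
     then have "?a - 1 - 2 < ?a - 2" "?a - 1 < b0 B" using False p(5) by linarith+
     then show ?thesis using 1 unfolding hx_def by (simp only: if_True fin_less)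
    next
     case 2
     have "od B (b0 B) = w (fin 1)" using od_eq[OF order_refl] bs_B[OF b0_in] yv_b0[OF order_refl refl] by simp
     then show ?thesis using 2 a1 fin_less_w[of "fin 1"] fin_less[of 0 1] by (simp add: hx_def)
    next
     case 3
     then show ?thesis using smono[OF a1] by (simp add: hx_def)
    qed
   qed
   have "yv B (n - 1) = w (bump ?z (hx B (?a - 1)))"
    using yv_digit_eq[OF p(1)] p False by (simp add: p(2,3))
   then show ?thesis unfolding y using bump_less[OF hx] by simp
  qed
  have "yv B (n - 1) + od B (?b - 1) < yv B n" using w_add_less 1 2 unfolding y by blast
  then have "od B (n - 1) < od B n" unfolding od_eq[OF 5(1)] od_eq[OF p(1)] p(2,4) 5(2) by simp
  moreover have "0 < yv B n" using yb hm_ge_0 le_less_trans by blast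
  ultimately show ?thesis using 2 5(2) y by (auto simp: w_rep tp_rep)
 qed
qed

lemma od_strict: "m < n ==> od B m < od B n"
proof (induction n)
 case (Suc n)
 then show ?case using omain[of "Suc n"] by (cases "m = n") auto
qed simp
lemma od_mono: "m <= n ==> od B m <= od B n" using od_strict[of m n] by (cases "m = n") auto
lemma yv_mono: "b0 B <= m ==> m <= n ==> yv B m <= yv B n"
proof (induction n)
 case (Suc n)
 then show ?case using omain[of "Suc n"] by (cases "m = Suc n") auto
qed simp
lemma yv_rep: assumes "b0 B <= n" obtains k where "0 < k" "yv B n = rep k (tp (yv B n))" using omain[of n] assms by blast
lemma od_rem: "b0 B <= n ==> od B (n mod bse B n) < yv B n" using omain[of n] by simp
lemma od_base: "b : B ==> od B b = yv B b" using od_eq[OF b0_le] bs_B by simp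
lemma yv_le_od: "b0 B <= n ==> yv B n <= od B n" using od_eq[of n] by simp

lemma tp_mono: assumes "b0 B <= n" "rep k z <= yv B n" "0 < k" shows "z <= tp (yv B n)"
proof -
 obtain l where "0 < l" "yv B n = rep l (tp (yv B n))" by (rule yv_rep[OF assms(1)])
 then show ?thesis using rep_mono_exp[of k z l "tp (yv B n)"] assms by simp
qed

end

section \<open>Ordinals along an upgrade and one Goodstein step\<close>

lemma w_le [simp]: "w x <= w y <-> x <= y" using w_less[of y x] by (simp add: not_less[symmetric] del: w_less)

context nhe
begin

lemma uC: assumes "b0 B <= n" shows "b0 C <= u n" "bse C (u n) = dn n" "dn n : C"
 using b0_C_le[OF assms u_digit(6)[OF assms]] bs_C[OF assms u_digit(6)[OF assms]] dn_in[OF assms] by auto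

lemma yvC_u: assumes "b0 B <= n" shows "yv C (u n) = yv C (dn n * u (n div b n))"
 using C.yv_mult[OF uC(1)[OF assms]] uC(2)[OF assms] u_digit(4)[OF assms] by simp

text \<open>The upgrade carries digit and remainder over to base \<open>dn n\<close>, and every
  clause of the assignment is monotone in the ordinals it uses. Inserting bases can only add
  doublings.\<close>

lemma preserve: "od B n <= od C (u n) & (b0 B <= n --> yv B n <= yv C (u n))"
proof (induction n rule: less_induct)
 case (less n)
 show ?case
 proof (cases "n < b0 B")
  case True
  then show ?thesis using od_small[OF True] C.od_small[of n] b0_C u_small by simp
 next
  case False
  then have n: "b0 B <= n" by simp
  have y: "yv B n <= yv C (u n)"
  proof -
   consider "n = b0 B" | "0 < n mod b n" | "n ~= b0 B" "n mod b n = 0" "n div b n = 1" | "n mod b n = 0" "n div b n ~= 1"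
    by (meson neq0_conv)
   then show ?thesis
   proof cases
    case 1
    have "b n = n" using 1 bs_B[OF b0_in] by simp
    then have "u n = b0 C" using u_eq[OF n] dn_b0[OF n 1] b0_C b0_ge2 1 by (simp add: u01 u01[unfolded One_nat_def])
    then show ?thesis using yv_b0[OF n 1] C.yv_b0[OF order_refl refl] by simp
   next
    case 2
    note p = pred_rem[OF n 2]
    have n1: "n - 1 < n" using 2 by (cases n) auto
    have "yv C (u n) = yv C (u (n - 1))" unfolding yvC_u[OF n] yvC_u[OF p(1)] p(2,3) dn_rem[OF n 2] ..
    then show ?thesis using less.IH[OF n1] p(1) yv_rem[OF n 2] by simp
   next
    case 3
    note p = pred_base[OF n 3(2,3,1)]
    have n1: "n - 1 < n" using p b0_ge2 n by linarith
    have un: "u n = dn n" using u_eq[OF n] 3 by (simp add: u01 u01[unfolded One_nat_def])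
    have lt: "u (n - 1) < dn n" using dn_gt[OF n] p(2) by simp
    have c: "b0 C <= dn n" "dn n : C" "dn n ~= b0 C" "b0 C <= u (n - 1)"
     using uC[OF n] un uC(1)[OF p(3)] lt by auto
    have d: "0 < dn n" using dn_ge2[OF n] by simp
    have "yv C (dn n) = yv C (dn n - 1) + yv C (dn n - 1)"
     by (rule C.yv_base[OF c(1,3)]) (use C.bs_B[OF c(2)] d in auto)
    have "yv C (u (n - 1)) <= yv C (dn n - 1)" using lt by (intro C.yv_mono[OF c(4)]) simp
    moreover have "yv B (n - 1) <= yv C (u (n - 1))" using less.IH[OF n1] p(3) by simp
    ultimately have "yv B (n - 1) <= yv C (dn n - 1)" by (metis order_trans)
    then have "yv B (n - 1) + yv B (n - 1) <= yv C (dn n - 1) + yv C (dn n - 1)" by (intro add_mono)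
    then show ?thesis unfolding yv_base[OF n 3] un \<open>yv C (dn n) = _\<close> .
   next
    case 4
    note p = pred_digit[OF n 4]
    have bB: "b n : B" "b0 B <= b n" using bs_in[OF n] b0_le by auto
    have a: "2 <= u n div bse C (u n)" using uC(2)[OF n] u_digit(4)[OF n] u_ge2[OF p(5)] by simp
    have ub: "u (b n) = dn (b n)" using u_eq[OF bB(2)] bs_B[OF bB(1)] ge2[OF bB(1)] by (simp add: u01 u01[unfolded One_nat_def])
    have "yv B (b n) <= yv C (dn (b n))" using less.IH[OF p(6)] bB(2) ub by simp
    also have "\<dots> <= yv C (dn n)"
     using C.yv_mono[OF uC(1)[OF bB(2)], of "dn n"] dn_mono[OF bB(2) bs_le[OF n]] ub by simp
    finally have yb: "yv B (b n) <= yv C (dn n)" .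
    obtain k where k: "0 < k" "yv B (b n) = rep k (tp (yv B (b n)))" using yv_rep[OF bB(2)] by blast
    have "tp (yv B (b n)) <= tp (yv C (dn n))"
     by (rule C.tp_mono[OF C.b0_le[OF dn_in[OF n]] _ k(1)]) (use k(2) yb in simp)
    moreover have "hx B (n div b n) <= hx C (u (n div b n))"
    proof (cases "n div b n < b0 B")
     case True
     then show ?thesis using u_small[OF True] b0_C by (simp add: hx_def)
    next
     case False
     then have "b0 C <= u (n div b n)" using uC(1) by simp
     then show ?thesis using False less.IH[OF digit(4)[OF n]] by (simp add: hx_def)
    qed
    ultimately show ?thesis
     unfolding yv_digit[OF n 4] C.yv_digit_eq[OF uC(1)[OF n] a] uC(2)[OF n] u_digit(4)[OF n]
     using bump_mono by (simp add: w_le)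
   qed
  qed
  have "od C (u n) = yv C (u n) + od C (u (n mod b n))"
   using C.od_eq[OF uC(1)[OF n]] uC(2)[OF n] u_digit(5)[OF n] by simp
  then show ?thesis using y less.IH[OF digit(5)[OF n]] od_eq[OF n] by (simp add: add_mono)
 qed
qed

lemma step_rem: assumes "b0 B <= n" "0 < n mod b n"
 shows "yv B n + od C (u (n mod b n) - 1) <= od C (u n - 1)"
proof -
 note p = pred_rem[OF assms]
 have un: "u n - 1 = dn n * u (n div b n) + (u (n mod b n) - 1)"
  using u_eq[OF assms(1)] u_pos[OF assms(2)] by simp
 have "dn n * 1 <= dn n * u (n div b n)" using u_digit(3)[OF assms(1)] by (intro mult_le_mono2) simp
 then have ge: "dn n <= u n - 1" unfolding un by linarith
 have b: "bse C (u n - 1) = dn n" "b0 C <= u n - 1"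
  using bs_C[OF assms(1) ge] b0_C_le[OF assms(1) ge] by auto
 have m: "(u n - 1) mod dn n = u (n mod b n) - 1" unfolding un using u_digit(2)[OF assms(1)] by simp
 have "yv B n = yv B (n - 1)" by (rule yv_rem[OF assms])
 also have "\<dots> <= yv C (u (n - 1))" using preserve p(1) by blast
 also have "\<dots> <= yv C (u n - 1)" 
 proof (rule C.yv_mono[OF uC(1)[OF p(1)]])
  have "n - 1 < n" using assms(2) by (cases n) auto
  then show "u (n - 1) <= u n - 1" using u_strict[of "n - 1" n] by linarith
 qed
 finally show ?thesis using C.od_eq[OF b(2)] b(1) m by (simp add: add_mono)
qed

lemma bs_below_nxt: assumes "c : C" "nxt C c s" "c <= m" "m < s" shows "bse C m = c"
 by (rule C.bs_eq[OF assms(1,3)]) (use assms(2,4) in \<open>auto simp: nxt_def not_le dest!: leI\<close>)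

text \<open>The number before the new base is written at base \<open>dn (n - 1)\<close> with the
  largest possible remainder, \<open>dn (n - 1) - 1\<close>.\<close>

lemma step_base: assumes "b0 B <= n" "n ~= b0 B" "n mod b n = 0" "n div b n = 1"
 shows "yv B (n - 1) + od C (dn (n - 1) - 1) <= od C (dn n - 1)"
proof -
 note p = pred_base[OF assms(1,3,4,2)]
 have lt: "u (n - 1) < dn n" using dn_gt[OF assms(1)] p(2) by simp
 have d: "0 < dn (n - 1)" using dn_ge2[OF p(3)] by simp
 have c: "b0 C <= u (n - 1)" "dn (n - 1) : C" using uC[OF p(3)] by auto
 have b: "bse C (dn n - 1) = dn (n - 1)"
  by (rule bs_below_nxt[OF c(2) nxt_base[OF assms]]) (use u_digit(6)[OF p(3)] lt in auto)
 have eq: "dn n - 1 = dn (n - 1) * (u (n - 1) div dn (n - 1)) + (dn (n - 1) - 1)"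
  unfolding dn_base[OF assms] using d by (simp add: algebra_simps)
 have c1: "dn (n - 1) - 1 < dn (n - 1)" using d by simp
 have m: "(dn n - 1) mod dn (n - 1) = dn (n - 1) - 1" by (simp only: eq mod_mult_self4 mod_less[OF c1])
 have "yv B (n - 1) <= yv C (u (n - 1))" using preserve p(3) by blast
 also have "\<dots> <= yv C (dn n - 1)" using lt by (intro C.yv_mono[OF c(1)]) simp
 finally show ?thesis using C.od_eq[of "dn n - 1"] b m c lt by (simp add: add_mono)
qed

context
 fixes n assumes n: "b0 B <= n" "n mod b n = 0" "n div b n ~= 1"
begin

abbreviation "a \<equiv> u (n div b n)"
definition "ch i = dn (n - 1) * a ^ i"

lemma ch_simps: "ch 0 = dn (n - 1)" "ch (Suc i) = ch i * a" "ch e = dn n" "0 < ch i" "2 <= a" "b0 B <= n - 1"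
proof -
 note p = pred_digit[OF n]
 show a: "2 <= a" using u_ge2[OF p(5)] .
 show "b0 B <= n - 1" by (rule p)
 show "0 < ch i" using a dn_ge2[OF p(1)] by (simp add: ch_def)
qed (auto simp: ch_def dn_digit[OF n])

lemma ch_nxt: "i < e ==> nxt C (ch i) (ch (Suc i))" unfolding ch_def by (rule nxt_digit[OF n])

lemma ch_in: "i <= e ==> ch i : C"
 using dn_in[OF ch_simps(6)] ch_nxt[of "i - 1"] ch_simps(1) by (cases i) (auto simp: nxt_def)

lemma ch_pos: assumes "i < e" "ch i <= m" "m < ch (Suc i)" shows "bse C m = ch i" "b0 C <= m" "yv C (ch i) <= yv C m"
proof -
 have i: "ch i : C" using ch_in assms(1) by simp
 show "bse C m = ch i" by (rule bs_below_nxt[OF i ch_nxt[OF assms(1)] assms(2,3)])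
 show "b0 C <= m" using C.b0_le[OF i] assms(2) by simp
 show "yv C (ch i) <= yv C m" by (rule C.yv_mono[OF C.b0_le[OF i] assms(2)])
qed

lemma ch_double: assumes "i < e" shows "yv C (ch (Suc i)) = yv C (ch (Suc i) - 1) + yv C (ch (Suc i) - 1)"
  "ch i <= ch (Suc i) - 1" "ch (Suc i) - 1 < ch (Suc i)"
proof -
 have c: "ch (Suc i) : C" using ch_in assms by simp
 have "ch i * 2 <= ch i * a" using ch_simps(5) by (intro mult_le_mono2)
 then show 1: "ch i <= ch (Suc i) - 1" "ch (Suc i) - 1 < ch (Suc i)" using ch_simps(4)[of i] unfolding ch_simps(2) by linarith+
 have "ch (Suc i) ~= b0 C" using ch_pos(2)[OF assms 1] 1 by simp
 then show "yv C (ch (Suc i)) = yv C (ch (Suc i) - 1) + yv C (ch (Suc i) - 1)"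
  by (intro C.yv_base[OF C.b0_le[OF c]]) (use C.bs_B[OF c] ch_simps(4)[of "Suc i"] in auto)
qed

lemma ch_start: "w (tp (yv B (b n))) <= yv C (ch 0)"
proof -
 have bB: "b n : B" "b0 B <= b n" using bs_in[OF n(1)] b0_le by auto
 have ub: "u (b n) = dn (b n)" using u_eq[OF bB(2)] bs_B[OF bB(1)] ge2[OF bB(1)] by (simp add: u01 u01[unfolded One_nat_def])
 obtain k where k: "0 < k" "yv B (b n) = rep k (tp (yv B (b n)))" using yv_rep[OF bB(2)] by blast
 have "w (tp (yv B (b n))) <= yv B (b n)" using w_le_rep[OF k(1)] k(2) by metis
 also have "\<dots> <= yv C (u (b n))" using preserve bB(2) by blast
 also have "\<dots> <= yv C (ch 0)"
  unfolding ub ch_simps(1) by (rule C.yv_mono) (use uC(1)[OF bB(2)] ub dn_mono[OF bB(2), of "n - 1"] pred_digit(6)[OF n] in auto)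
 finally show ?thesis .
qed

text \<open>Each inserted base doubles the ordinal, which is more than one additional copy of the
  leading power.\<close>

lemma ch_rep: "i <= e ==> rep (Suc i) (tp (yv B (b n))) <= yv C (ch i)"
proof (induction i)
 case 0
 then show ?case using ch_start by (simp add: w_rep)
next
 case (Suc i)
 then have i: "i < e" by simp
 have "rep (Suc (Suc i)) (tp (yv B (b n))) <= rep (Suc i + Suc i) (tp (yv B (b n)))" by (rule rep_mono) simp
 also have "\<dots> = rep (Suc i) (tp (yv B (b n))) + rep (Suc i) (tp (yv B (b n)))" by (simp add: rep_add)
 also have "\<dots> <= yv C (ch i) + yv C (ch i)" using Suc by (intro add_mono) auto
 also have "\<dots> <= yv C (ch (Suc i))"
  using ch_pos(3)[OF i ch_double(2,3)[OF i]] unfolding ch_double(1)[OF i] by (intro add_mono)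
 finally show ?case .
qed

lemma step_double: assumes "k <= e" shows "rep k (tp (yv B (b n))) <= od C (dn n - 1)"
proof -
 obtain i where i: "e = Suc i" using e1 by (cases e) auto
 have ie: "i < e" using i by simp
 have "rep k (tp (yv B (b n))) <= rep (Suc i) (tp (yv B (b n)))" using assms i by (intro rep_mono) simp
 also have "\<dots> <= yv C (ch i)" by (rule ch_rep) (use ie in simp)
 also have "\<dots> <= yv C (ch (Suc i) - 1)" by (rule ch_pos(3)[OF ie ch_double(2,3)[OF ie]])
 also have "\<dots> <= od C (ch (Suc i) - 1)" by (rule C.yv_le_od, rule ch_pos(2)[OF ie ch_double(2,3)[OF ie]])
 finally show ?thesis using i ch_simps(3) by simp
qed

text \<open>The number before the next inserted base has base \<open>ch i\<close> and the largest
  digit \<open>a - 1\<close>. This digit is at least 2, so the digit clause of the assignment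
  applies.\<close>

lemma ch_bump: assumes "3 <= a" "t <= hx C (a - 1)" "i < e"
 shows "w (bump (tp (yv C (ch i))) t) <= yv C (ch (Suc i) - 1)"
proof -
 have "ch i * (a - 1) + (ch i - 1) = ch (Suc i) - 1"
  using ch_simps(4)[of i] assms(1) unfolding ch_simps(2) by (cases a) (auto simp: algebra_simps)
 then have d: "(ch (Suc i) - 1) div ch i = a - 1"
  using ch_simps(4)[of i] by (metis diff_less div_mult_self4 div_less add.right_neutral less_numeral_extra(1) less_not_refl2 add.commute)
 note c = ch_pos[OF assms(3) ch_double(2,3)[OF assms(3)]]
 have "yv C (ch (Suc i) - 1) = w (bump (tp (yv C (ch i))) (hx C (a - 1)))"
  using C.yv_digit_eq[OF c(2)] c(1) d assms(1) by simp
 moreover have "bump (tp (yv C (ch i))) t <= bump (tp (yv C (ch i))) (hx C (a - 1))" by (rule bump_mono[OF order_refl assms(2)])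
 ultimately show ?thesis by (auto simp: le_less)
qed

text \<open>Each inserted base contributes a further term with exponent \<open>t\<close> to the
  leading exponent, so \<open>e\<close> of them exceed \<open>bumpk\<close> for every
  \<open>k\<close> up to \<open>e\<close>; the multiple \<open>m\<close> is absorbed by the next
  power.\<close>

lemma step_bump: assumes "3 <= a" "t <= hx C (a - 1)" "k <= e" "v < bumpk (tp (yv B (b n))) t k"
 shows "rep m v <= od C (dn n - 1)"
proof -
 let ?z = "tp (yv B (b n))"
 have "i <= e ==> bumpk ?z t i <= tp (yv C (ch i))" for i
 proof (induction i)
  case 0
  have "?z <= tp (yv C (ch 0))"
   by (rule C.tp_mono[of _ 1]) (use ch_start ch_in[of 0] C.b0_le in \<open>auto simp: w_rep\<close>)
  then show ?case using bumpk_0[of ?z t] by simp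
 next
  case (Suc i)
  then have i: "i < e" by simp
  have c: "b0 C <= ch (Suc i)" using C.b0_le ch_in Suc.prems by blast
  have "bumpk ?z t (Suc i) <= bump (tp (yv C (ch i))) t"
   using bump_mono[OF Suc.IH order_refl, of t] i by (simp add: bumpk_Suc)
  also have "\<dots> <= tp (yv C (ch (Suc i)))"
  proof (rule C.tp_mono[OF c, of 1])
   show "rep 1 (bump (tp (yv C (ch i))) t) <= yv C (ch (Suc i))"
    using ch_bump[OF assms(1,2) i] unfolding ch_double(1)[OF i] w_rep by (rule order_trans) simp
  qed simp
  finally show ?case .
 qed
 note main = this
 obtain i where i: "e = Suc i" using e1 by (cases e) auto
 have ie: "i < e" using i by simp
 have "bumpk ?z t k <= bumpk ?z t (Suc i)"
 proof -
  have "filter_mset ((<=) t) (un ?z) + replicate_mset k t <=# filter_mset ((<=) t) (un ?z) + replicate_mset (Suc i) t"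
   using assms(3) i by (intro mset_subset_eqI) auto
  then show ?thesis unfolding bumpk_def HM_le by (rule subset_eq_imp_le_multiset)
 qed
 also have "\<dots> <= bump (tp (yv C (ch i))) t"
  using bump_mono[OF main order_refl, of i t] ie by (simp add: bumpk_Suc)
 finally have "v < bump (tp (yv C (ch i))) t" using assms(4) by simp
 then have "rep m v < w (bump (tp (yv C (ch i))) t)" by (cases "m = 0") (auto simp: rep_less_w rep_def HM_less_w)
 also have "\<dots> <= yv C (ch (Suc i) - 1)" by (rule ch_bump[OF assms(1,2) ie])
 also have "\<dots> <= od C (ch (Suc i) - 1)" by (rule C.yv_le_od, rule ch_pos(2)[OF ie ch_double(2,3)[OF ie]])
 finally show ?thesis using i ch_simps(3) by simp
qed

end

lemma dn_pred_le: "b0 B <= n ==> od C (dn n - 1) <= od C (u n - 1)"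
 using u_digit(6)[of n] by (intro C.od_mono diff_le_mono)

end

context nh
begin

lemma nheI: "1 <= e ==> nhe B e" by unfold_locales

text \<open>Formulated for all large \<open>e\<close> rather than for some \<open>e\<close>, so that
  the statements for predecessor, digit and remainder can be met by a common parameter. The second
  conjunct, about the number before the new base, is what the inductions pass on.\<close>

lemma step_ev:
 "(0 < n --> (ALL v<od B n. \<forall>\<^sub>F e in sequentially. v <= od (Cs B e) (up B e n - 1))) &
 (b0 B <= n --> (ALL v<yv B n. \<forall>\<^sub>F e in sequentially. v <= od (Cs B e) (Db B e n - 1)))"
proof (induction n rule: less_induct)
 case (less n)
 have ev: "\<forall>\<^sub>F e in sequentially. k <= e" for k :: nat by (rule eventually_ge_at_top)
 show ?case
 proof (cases "n < b0 B")
  case True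
  have "v <= od (Cs B e) (up B e n - 1)" if "0 < n" "v < od B n" "1 <= e" for v e
  proof -
   interpret nhe B e by (rule nheI[OF that(3)])
   have "v < fin (Suc (n - 1))" using that od_small[OF True] by simp
   moreover have "od C (u n - 1) = fin (n - 1)" using u_small[OF True] True b0_C C.od_small[of "n - 1"] by simp
   moreover have "v <= fin m" if "v < fin (Suc m)" for m
   proof (rule ccontr)
    assume "\<not> v <= fin m"
    then have *: "fin m < v" by simp
    obtain V where V: "v = HM V" by (cases v)
    have "V < replicate_mset (Suc m) 0" using that by (simp add: V fin_def)
    then obtain z where z: "count V z < count (replicate_mset (Suc m) 0) z"
     "!!y. z < y ==> count V y = count (replicate_mset (Suc m) 0) y" by (rule lexE) blast
    have z0: "z = 0" using z(1) by (auto split: if_splits)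
    have "V <=# replicate_mset m 0"
    proof (rule mset_subset_eqI)
     fix y :: hm
     show "count V y <= count (replicate_mset m 0) y"
      using z(1) z(2)[of y] z0 by (cases "y = 0") (auto simp: hm_pos)
    qed
    then show False using * by (simp add: V fin_def) (metis leD subset_eq_imp_le_multiset)
   qed
   ultimately show ?thesis by simp
  qed
  then show ?thesis using True by (auto intro: eventually_mono[OF ev[of 1]])
 next
  case False
  then have n: "b0 B <= n" by simp
  have L: "\<forall>\<^sub>F e in sequentially. v <= od (Cs B e) (Db B e n - 1)" if v: "v < yv B n" for v
  proof -
   consider "n = b0 B" | "0 < n mod bse B n" | "n ~= b0 B" "n mod bse B n = 0" "n div bse B n = 1" | "n mod bse B n = 0" "n div bse B n ~= 1"
    by (meson neq0_conv)
   then show ?thesis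
   proof cases
    case 1
    have "0 < fin 1" using fin_less[of 0 1] by simp
    then obtain x k where x: "x < fin 1" "v <= rep k x" using less_w_rep[of v "fin 1"] v yv_b0[OF n 1] by auto
    have "x = 0"
    proof (rule ccontr)
     assume "x ~= 0"
     then have "un x ~= {#}" by (cases x) (auto simp: zero_hm_def)
     moreover have "un x < {#0#}" using x(1) by (cases x) (simp add: fin_def)
     ultimately show False using HM_less_w[of "un x" 0] by (simp add: w_def)
    qed
    then have v: "v <= fin k" using x(2) by (simp add: rep_def fin_def)
    show ?thesis
    proof (rule eventually_mono[OF ev[of "k + 1"]])
     fix e assume e: "k + 1 <= e"
     interpret nhe B e by (rule nheI) (use e in simp)
     have "od C (dn n - 1) = fin (n + e - 1)" using dn_b0[OF n 1] b0_C 1 b0_ge2 C.od_small[of "b0 B + e - 1"] by simp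
     moreover have "fin k <= fin (n + e - 1)" using e by simp
     ultimately show "v <= od C (dn n - 1)" using v by (simp del: fin_le)
    qed
   next
    case 2
    note p = pred_rem[OF n 2]
    have n1: "n - 1 < n" using 2 by (cases n) auto
    have "\<forall>\<^sub>F e in sequentially. v <= od (Cs B e) (Db B e (n - 1) - 1)"
     using less.IH[OF n1] p(1) v yv_rem[OF n 2] by simp
    then show ?thesis
    proof (rule eventually_mp[rotated], intro eventually_mono[OF ev[of 1]] impI)
     fix e assume e: "1 <= e" "v <= od (Cs B e) (Db B e (n - 1) - 1)"
     interpret nhe B e by (rule nheI[OF e(1)])
     show "v <= od C (dn n - 1)" using e(2) dn_rem[OF n 2] by simp
    qed
   next
    case 3
    note p = pred_base[OF n 3(2,3,1)]
    have n1: "n - 1 < n" using p b0_ge2 n by linarith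
    obtain k where k: "0 < k" "yv B (n - 1) = rep k (tp (yv B (n - 1)))" using yv_rep[OF p(3)] by blast
    let ?z = "tp (yv B (n - 1))"
    have "rep k ?z < w ?z + rep k ?z" using hm_add_less_iff(2)[of 0 "rep k ?z" "w ?z"] le_less_trans[OF hm_ge_0 less_w] by simp
    then consider "v < rep k ?z" | v' where "v' < yv B (n - 1)" "v = rep k ?z + v'"
     using less_rep_add[of v k ?z "rep k ?z" k] v k(2) yv_base[OF n 3] by metis
    then obtain v' where v': "v' < yv B (n - 1)" "v <= yv B (n - 1) + v'"
    proof cases
     case 1
     have "0 < yv B (n - 1)" using k rep_pos[OF k(1)] by metis
     then show thesis using that[of 0] 1 k(2) by (simp add: less_imp_le)
    next
     case 2
     then show thesis using that[of v'] k(2) by simp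
    qed
    have "\<forall>\<^sub>F e in sequentially. v' <= od (Cs B e) (Db B e (n - 1) - 1)"
     using less.IH[OF n1] p(3) v'(1) by simp
    then show ?thesis
    proof (rule eventually_mp[rotated], intro eventually_mono[OF ev[of 1]] impI)
     fix e assume e: "1 <= e" "v' <= od (Cs B e) (Db B e (n - 1) - 1)"
     interpret nhe B e by (rule nheI[OF e(1)])
     have "v <= yv B (n - 1) + od C (dn (n - 1) - 1)" using v'(2) add_left_mono[OF e(2)] by (rule order_trans)
     also have "\<dots> <= od C (dn n - 1)" by (rule step_base[OF n 3])
     finally show "v <= od C (dn n - 1)" .
    qed
   next
    case 4
    note p = pred_digit[OF n 4]
    let ?z = "tp (yv B (bse B n))" and ?a = "n div bse B n"
    let ?x = "hx B ?a"
    have "0 < bump ?z ?x" by (rule le_less_trans[OF hm_ge_0 bump_gt])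
    then obtain x m where x: "x < bump ?z ?x" "v <= rep m x"
     using less_w_rep[of v "bump ?z ?x"] v yv_digit[OF n 4] by auto
    from less_bump[OF x(1)] show ?thesis
    proof
     assume xz: "x <= ?z"
     have "rep m x <= rep (Suc m) ?z"
     proof (cases "x = ?z")
      case True
      then show ?thesis by (simp add: rep_mono)
     next
      case False
      then have "rep m x < w ?z" using xz by (cases "m = 0") (auto simp: rep_def HM_less_w)
      also have "\<dots> <= rep (Suc m) ?z" by (rule w_le_rep) simp
      finally show ?thesis by simp
     qed
     then have vz: "v <= rep (Suc m) ?z" using x(2) by simp
     show ?thesis
     proof (rule eventually_mono[OF ev[of "Suc m"]])
      fix e assume e: "Suc m <= e"
      interpret nhe B e by (rule nheI) (use e in simp)
      show "v <= od C (dn n - 1)" using vz step_double[OF n 4 e] by simp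
     qed
    next
     assume "EX t<?x. EX k. x < bumpk ?z t k"
     then obtain t k where t: "t < ?x" "x < bumpk ?z t k" by blast
     have H: "\<forall>\<^sub>F e in sequentially. 1 <= e --> 3 <= up B e ?a & t <= hx (Cs B e) (up B e ?a - 1)"
     proof -
      consider "?a < b0 B" | "?a = b0 B" | "b0 B < ?a" by linarith
      then show ?thesis
      proof cases
       case 1
       have a2: "?a ~= 2" using t(1) 1 by (auto simp: hx_def)
       have "t < fin (Suc (?a - 3))" using t(1) 1 a2 p(5) by (simp add: hx_def Suc_diff_le numeral_3_eq_3 Suc_diff_Suc numeral_2_eq_2)
       \<comment> \<open>The step from \<open>t < fin (a - 2)\<close> to the predecessor is read off
         from the induction hypothesis at the number \<open>a - 2\<close>, which is its own upgrade
         and has this finite ordinal.\<close>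
       have tl: "t <= fin (?a - 3)"
       proof -
        have "\<forall>\<^sub>F e in sequentially. t <= od (Cs B e) (up B e (?a - 2) - 1)"
        proof -
         have "?a - 2 < n" "0 < ?a - 2" using digit(4)[OF n] a2 p(5) by auto
         then show ?thesis using less.IH[of "?a - 2"] t(1) 1 od_small[of "?a - 2"] by (simp add: hx_def)
        qed
        then obtain e0 where "t <= od (Cs B (Suc e0)) (up B (Suc e0) (?a - 2) - 1)"
         unfolding eventually_sequentially by (meson le_SucI order_refl)
        moreover interpret nhe B "Suc e0" by (rule nheI) simp
        have "od C (u (?a - 2) - 1) = fin (?a - 3)" using u_small[of "?a - 2"] 1 b0_C C.od_small[of "?a - 3"]
         by (simp add: numeral_3_eq_3 numeral_2_eq_2)
        ultimately show ?thesis by simp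
       qed
       show ?thesis
       proof (rule always_eventually, intro allI impI)
        fix e :: nat assume e: "1 <= e"
        interpret nhe B e by (rule nheI[OF e])
        show "3 <= u ?a & t <= hx C (u ?a - 1)" using u_small[OF 1] a2 p(5) 1 b0_C tl
         by (auto simp: hx_def numeral_3_eq_3 numeral_2_eq_2)
       qed
      next
       case 2
       have "t < w (fin 1)" using t(1) 2 od_base[OF b0_in] yv_b0[OF order_refl refl] by (simp add: hx_def)
       then have t': "t < od B (b0 B)" using od_base[OF b0_in] yv_b0[OF order_refl refl] by simp
       have "\<forall>\<^sub>F e in sequentially. t + fin 3 <= od (Cs B e) (up B e ?a - 1)"
       proof -
        \<comment> \<open>The surplus of 3 pays for the shift by 2 in \<open>hx\<close>, and it
          makes the predecessor of the upgraded digit at least 3.\<close>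
        have "t + fin 3 < w (fin 1)" by (rule w_add_less[OF \<open>t < w (fin 1)\<close>], rule fin_less_w) (use fin_less[of 0 1] in simp)
        then show ?thesis using less.IH[OF digit(4)[OF n]] 2 od_base[OF b0_in] yv_b0[OF order_refl refl] b0_ge2 by simp
       qed
       then show ?thesis
       proof (rule eventually_mono, intro impI)
        fix e assume e: "t + fin 3 <= od (Cs B e) (up B e ?a - 1)" "1 <= e"
        interpret nhe B e by (rule nheI[OF e(2)])
        have ua: "u ?a = b0 B + e" using u_eq[of ?a] dn_b0[of ?a] 2 bs_B[OF b0_in] b0_ge2
         by (simp add: u01 u01[unfolded One_nat_def])
        have l: "u ?a - 1 < b0 C" using ua b0_C b0_ge2 by simp
        have "t + fin 3 <= fin (u ?a - 1)" using e(1) C.od_small[OF l] by simp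
        moreover have "3 <= u ?a - 1"
        proof (rule ccontr)
         assume "\<not> 3 <= u ?a - 1"
         then have "fin (u ?a - 1) < fin 3" by simp
         also have "\<dots> <= t + fin 3" by simp
         also have "\<dots> <= fin (u ?a - 1)" by fact
         finally show False by simp
        qed
        moreover have "fin (u ?a - 1) = fin (u ?a - 1 - 2) + fin 2"
        proof -
         have "u ?a - 1 = u ?a - 1 - 2 + 2" using calculation(2) by linarith
         then show ?thesis by (metis fin_add)
        qed
        moreover have "t + fin 2 <= t + fin 3" by (rule add_left_mono) simp
        ultimately have "t + fin 2 <= fin (u ?a - 1 - 2) + fin 2" by simp
        then have "t <= fin (u ?a - 1 - 2)" by (meson hm_add_less_iff(2) not_le)
        then show "3 <= u ?a & t <= hx C (u ?a - 1)" using l \<open>3 <= u ?a - 1\<close> by (simp add: hx_def)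
       qed
      next
       case 3
       have "\<forall>\<^sub>F e in sequentially. t <= od (Cs B e) (up B e ?a - 1)"
        using less.IH[OF digit(4)[OF n]] t(1) 3 by (simp add: hx_def)
       then show ?thesis
       proof (rule eventually_mono, intro impI)
        fix e assume e: "t <= od (Cs B e) (up B e ?a - 1)" "1 <= e"
        interpret nhe B e by (rule nheI[OF e(2)])
        have "b0 C <= u (b0 B)" by (rule uC(1)) simp
        moreover have "u (b0 B) < u ?a" by (rule u_strict[OF 3])
        moreover have "3 <= b0 C" using b0_C b0_ge2 e(2) by simp
        ultimately have "\<not> u ?a - 1 < b0 C" "3 <= u ?a" by linarith+
        then show "3 <= u ?a & t <= hx C (u ?a - 1)" using e(1) by (simp add: hx_def)
       qed
      qed
     qed
     show ?thesis
     proof (rule eventually_mp[OF _ H], rule eventually_mono[OF ev[of "k + 1"]], intro impI)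
      fix e assume e: "k + 1 <= e" "1 <= e --> 3 <= up B e ?a & t <= hx (Cs B e) (up B e ?a - 1)"
      interpret nhe B e by (rule nheI) (use e in simp)
      have "rep m x <= od C (dn n - 1)"
       by (rule step_bump[OF n 4, of t k x m]) (use e t(2) in auto)
      then show "v <= od C (dn n - 1)" using x(2) by simp
     qed
    qed
   qed
  qed
  have S: "\<forall>\<^sub>F e in sequentially. v <= od (Cs B e) (up B e n - 1)" if v: "v < od B n" for v
  proof -
   have small: ?thesis if "v < yv B n"
   proof (rule eventually_mp[OF _ L[OF that]], rule eventually_mono[OF ev[of 1]], intro impI)
    fix e assume e: "1 <= e" "v <= od (Cs B e) (Db B e n - 1)"
    interpret nhe B e by (rule nheI[OF e(1)])
    show "v <= od C (u n - 1)" using e(2) dn_pred_le[OF n] by simp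
   qed
   show ?thesis
   proof (cases "n mod bse B n = 0")
    case True
    then show ?thesis using small v od_eq[OF n] by simp
   next
    case False
    then have r: "0 < n mod bse B n" by simp
    obtain k where k: "0 < k" "yv B n = rep k (tp (yv B n))" using yv_rep[OF n] by blast
    have "od B (n mod bse B n) < w (tp (yv B n)) + rep k (tp (yv B n))"
     using od_rem[OF n] k(2) hm_le_add(2)[of "rep k (tp (yv B n))" "w (tp (yv B n))"] by (metis less_le_trans)
    then consider "v < yv B n" | v' where "v' < od B (n mod bse B n)" "v = yv B n + v'"
     using less_rep_add[of v k "tp (yv B n)" "od B (n mod bse B n)" k] v k(2) od_eq[OF n] by metis
    then show ?thesis
    proof cases
     case 1
     then show ?thesis by (rule small)
    next
     case 2
     have "\<forall>\<^sub>F e in sequentially. v' <= od (Cs B e) (up B e (n mod bse B n) - 1)"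
      using less.IH[OF digit(5)[OF n]] r 2(1) by simp
     then show ?thesis
     proof (rule eventually_mp[rotated], intro eventually_mono[OF ev[of 1]] impI)
      fix e assume e: "1 <= e" "v' <= od (Cs B e) (up B e (n mod bse B n) - 1)"
      interpret nhe B e by (rule nheI[OF e(1)])
      have "v <= yv B n + od C (u (n mod bse B n) - 1)" using 2(2) add_left_mono[OF e(2)] by simp
      also have "\<dots> <= od C (u n - 1)" by (rule step_rem[OF n r])
      finally show "v <= od C (u n - 1)" .
     qed
    qed
   qed
  qed
  show ?thesis using L S by blast
 qed
qed

lemma step: assumes "v < od B n" shows "\<exists>e\<ge>1. v <= od (Cs B e) (up B e n - 1)"
proof -
 have "0 < n" using assms by (cases n) auto
 then have "\<forall>\<^sub>F e in sequentially. v <= od (Cs B e) (up B e n - 1)" using step_ev assms by blast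
 then obtain e0 where "\<forall>e\<ge>e0. v <= od (Cs B e) (up B e n - 1)" unfolding eventually_sequentially by blast
 then show ?thesis by (intro exI[of _ "max e0 1"]) simp
qed

end

section \<open>Long Goodstein sequences\<close>

primrec bj :: "nat => nat => nat" where
 "bj c 0 = 2"
| "bj c (Suc j) = bj c j * min (bj c j) c"

lemma bj_ge2: "2 <= c ==> 2 <= bj c j" by (induction j) (auto intro: order_trans[OF _ mult_le_mono[of 2 _ 1]])

lemma bj_less: assumes "2 <= c" "i < j" shows "bj c i < bj c j"
proof (rule lift_Suc_mono_less[OF _ assms(2)])
 fix n
 have "bj c n * 2 <= bj c (Suc n)" using bj_ge2[OF assms(1), of n] assms(1) by simp
 then show "bj c n < bj c (Suc n)" using bj_ge2[OF assms(1), of n] by linarith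
qed

lemma bj_nxt: assumes "2 <= c" shows "nxt (range (bj c)) (bj c j) (bj c (Suc j))"
 unfolding nxt_def using bj_less[OF assms]
 by (auto simp del: bj.simps) (metis Suc_leI bj_less[OF assms] le_less less_irrefl linorder_neqE_nat less_trans)

lemma nh_bj: assumes "2 <= c" shows "nh (range (bj c))"
proof
 show "2 <= b" if "b : range (bj c)" for b using that bj_ge2[OF assms] by auto
 show "EX s. nxt (range (bj c)) b s & s <= b * b & b dvd s" if h: "b : range (bj c)" for b
 proof -
  obtain j where "b = bj c j" using h by auto
  then show ?thesis using bj_nxt[OF assms, of j] by (intro exI[of _ "bj c (Suc j)"]) simp
 qed
qed auto

primrec tw :: "nat => hm" where "tw 0 = 0" | "tw (Suc k) = w (tw k)"

lemma tw_mono: "k <= l ==> tw k <= tw l"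
 by (rule lift_Suc_mono_le) (auto intro: less_imp_le less_w)

lemma tw_cofinal: "EX k. x < tw k"
proof (induction x)
 case (HM M)
 have "EX k. \<forall>y\<in>#N. y < tw k" if "set_mset N <= set_mset M" for N
  using that
 proof (induction N)
  case (add y N)
  then obtain k where k: "\<forall>z\<in>#N. z < tw k" by auto
  from add.prems HM[of y] obtain l where l: "y < tw l" by auto
  then have "\<forall>z\<in>#add_mset y N. z < tw (max k l)"
   using k l tw_mono[of k "max k l"] tw_mono[of l "max k l"] by (auto intro: less_le_trans)
  then show ?case by blast
 qed simp
 then obtain k where "\<forall>y\<in>#M. y < tw k" by blast
 then have "HM M < tw (Suc k)" by (simp add: HM_less_w)
 then show ?case by blast
qed

lemma od_start: "\<exists>c\<ge>2. x <= od (range (bj c)) c"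
proof -
 obtain k where k: "x < tw k" using tw_cofinal by blast
 \<comment> \<open>Large enough that the first \<open>2 * k\<close> successors are squares, and
   equal to \<open>bj c (2 * k)\<close>, so that the starting number \<open>c\<close> is itself a
   base.\<close>
 define c :: nat where "c = 2 ^ 2 ^ (2 * k)"
 have "(2::nat) ^ 1 <= c" unfolding c_def by (rule power_increasing) auto
 then have c: "2 <= c" by simp
 interpret nh "range (bj c)" by (rule nh_bj[OF c])
 have sq: "j <= 2 * k ==> bj c j = 2 ^ 2 ^ j" for j
 proof (induction j)
  case (Suc j)
  have "(2::nat) ^ 2 ^ j <= c" unfolding c_def using Suc.prems by (intro power_increasing) auto
  then show ?case using Suc by (simp add: min_absorb1 power_add[symmetric] mult_2)
 qed simp
 note [simp del] = bj.simps(2)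
 have b0: "b0 (range (bj c)) = 2" unfolding b0_def using bj_ge2[OF c]
  by (intro Least_equality) (auto intro: range_eqI[of _ _ 0])
 have "2 * j <= 2 * k ==> tw j <= od (range (bj c)) (bj c (2 * j))" for j
 proof (induction j)
  case (Suc j)
  let ?b = "bj c (Suc (2 * j))" and ?B = "range (bj c)"
  have "?b = 2 ^ 2 ^ Suc (2 * j)" by (rule sq) (use Suc.prems in simp)
  also have "\<dots> <= c" unfolding c_def by (intro power_increasing) (use Suc.prems in auto)
  finally have "?b <= c" .
  then have s: "bj c (Suc (Suc (2 * j))) = ?b * ?b" unfolding bj.simps(2)[of c "Suc (2 * j)"] by (simp only: min_absorb1)
  have lt: "bj c (2 * j) < ?b" by (rule bj_less[OF c]) simp
  then have "3 <= ?b" using bj_ge2[OF c, of "2 * j"] by linarith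
  then have b: "3 <= ?b" "?b : ?B" by blast+
  have two: "2 <= ?b - 1" using b(1) by linarith
  \<comment> \<open>The last number with base \<open>?b\<close> has the digit \<open>?b - 1\<close>,
    which is at least the preceding base. The ordinal of the digit enters the exponent through
    \<open>bump\<close>, so two squarings gain at least one more power of \<omega>.\<close>
  let ?n = "?b * ?b - 1"
  have n: "?n = ?b * (?b - 1) + (?b - 1)" using b(1) by (cases ?b) (auto simp del: bj.simps)
  have "?b * 1 <= ?b * (?b - 1)" using b(1) by (intro mult_le_mono2) simp
  then have le: "?b <= ?n" unfolding n by linarith
  have "bse ?B ?n = ?b"
  proof (rule bs_eq[OF b(2) le], rule ccontr)
   fix x assume x: "x : ?B" "x <= ?n" "\<not> x <= ?b"
   then have "?b * ?b <= x" using bj_nxt[OF c, of "Suc (2 * j)"] unfolding s nxt_def by auto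
   moreover have "0 < ?b * ?b" using b(1) by (simp del: bj.simps)
   ultimately show False using x(2) by linarith
  qed
  moreover have "?n div ?b = ?b - 1"
  proof -
   have l: "?b - 1 < ?b" "?b ~= 0" using b(1) by linarith+
   show ?thesis unfolding n by (simp only: div_mult_self4[OF l(2)] div_less[OF l(1)] add_0_right)
  qed
  moreover have n0: "b0 ?B <= ?n" using b0 b(1) le by simp
  ultimately have y: "yv ?B ?n = w (bump (tp (yv ?B ?b)) (hx ?B (?b - 1)))"
   using yv_digit_eq[of ?n] two by simp
  have "tw j <= od ?B (bj c (2 * j))" using Suc by simp
  also have "\<dots> <= hx ?B (?b - 1)" using lt b0 two by (simp add: hx_def od_mono)
  also have "\<dots> <= w (hx ?B (?b - 1))" by (rule less_imp_le[OF less_w])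
  also have "\<dots> <= bump (tp (yv ?B ?b)) (hx ?B (?b - 1))" by (rule w_le_bump)
  finally have "w (tw j) <= yv ?B ?n" unfolding y w_le .
  also have "\<dots> <= od ?B ?n" by (rule yv_le_od[OF n0])
  also have "\<dots> <= od ?B (?b * ?b)" by (intro od_mono) simp
  finally show ?case using s by simp
 qed simp
 from this[of k] have "tw k <= od (range (bj c)) (bj c (2 * k))" by simp
 moreover have "bj c (2 * k) = c" using sq[of "2 * k"] by (simp add: c_def)
 ultimately show ?thesis using k c by (intro exI[of _ c]) auto
qed

primrec BB :: "nat => (nat => nat) => nat => nat set" where
 "BB c es 0 = range (bj c)"
| "BB c es (Suc i) = Cs (BB c es i) (es i)"

primrec gg :: "nat => (nat => nat) => nat => nat" where
 "gg c es 0 = c"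
| "gg c es (Suc i) = up (BB c es i) (es i) (gg c es i) - 1"

lemma nh_BB: assumes "2 <= c" "!!i. 1 <= es i" shows "nh (BB c es i)"
proof (induction i)
 case (Suc i)
 interpret nhe "BB c es i" "es i" using Suc assms(2) by (simp add: nhe_def nhe_axioms_def)
 show ?case by simp unfold_locales
qed (simp add: nh_bj[OF assms(1)])

lemma BB_gg_cong: "(!!j. j < i ==> es j = es' j) ==> BB c es i = BB c es' i & gg c es i = gg c es' i"
 by (induction i) auto

text \<open>A state is given by the number \<open>c\<close>, the parameters of the upgrades, and the number of steps made.\<close>

type_synonym state = "nat \<times> (nat => nat) \<times> nat"

definition ok :: "state => hm => bool" where
 "ok = (%(c, es, l) x. 2 <= c & (ALL i. 1 <= es i) & (ALL i<l. 0 < gg c es i) & x <= od (BB c es l) (gg c es l))"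
text \<open>The current ordinal dominates a power of \<omega>. A descent from \<open>x\<close> to a
  smaller \<open>y\<close> then leaves room for any finite number of Goodstein steps, because
  \<open>w y + fin n < w x\<close>.\<close>

definition big :: "hm => state => bool" where "big x h <-> ok h (w x)"

lemma ok_step: assumes "ok (c, es, l) x" "y < x"
 shows "EX es'. ok (c, es', Suc l) y & (ALL i<l. es' i = es i)"
proof -
 have c: "2 <= c" "!!i. 1 <= es i" "!!i. i < l ==> 0 < gg c es i" "y < od (BB c es l) (gg c es l)"
  using assms by (auto simp: ok_def)
 interpret nh "BB c es l" by (rule nh_BB[OF c(1,2)])
 obtain e where e: "1 <= e" "y <= od (Cs (BB c es l) e) (up (BB c es l) e (gg c es l) - 1)"
  using step[OF c(4)] by blast
 have eq: "BB c (es(l := e)) i = BB c es i & gg c (es(l := e)) i = gg c es i" if "i <= l" for i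
  using that by (intro BB_gg_cong) auto
 have "0 < gg c es l" using c(4) by (cases "gg c es l") auto
 then have "0 < gg c es i" if "i < Suc l" for i using c(3)[of i] that by (cases "i = l") auto
 then have "ok (c, es(l := e), Suc l) y" using c e eq by (auto simp: ok_def)
 then show ?thesis by (intro exI[of _ "es(l := e)"]) auto
qed

lemma ok_steps: assumes "ok (c, es, l) (x + fin n)"
 shows "EX es'. ok (c, es', l + n) x & (ALL i<l. es' i = es i)"
 using assms
proof (induction n arbitrary: es l)
 case (Suc n)
 have "x + fin n < x + fin (Suc n)" by simp
 from ok_step[OF Suc.prems this] obtain es1 where es1: "ok (c, es1, Suc l) (x + fin n)" "ALL i<l. es1 i = es i" by blast
 from Suc.IH[OF es1(1)] obtain es' where "ok (c, es', Suc l + n) x" "ALL i<Suc l. es' i = es1 i" by blast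
 then show ?case using es1(2) by (intro exI[of _ es']) auto
qed auto

lemma big_step: assumes "big x (c, es, l)" "y < x"
 shows "EX es' l'. big y (c, es', l') & n <= l' & l <= l' & (ALL i<l. es' i = es i)"
proof -
 have "0 < x" using assms(2) hm_ge_0 by (rule le_less_trans[rotated])
 then have "w y + fin n < w x" using assms(2) by (intro w_add_less fin_less_w) auto
 then have "ok (c, es, l) (w y + fin n)" using assms(1) by (auto simp: big_def ok_def)
 from ok_steps[OF this] show ?thesis unfolding big_def by (meson le_add1 le_add2)
qed

lemma big_start: "EX c es. big x (c, es, 0)"
proof -
 obtain c where "2 <= c" "w x <= od (range (bj c)) c" using od_start by blast
 then have "big x (c, %_. 1, 0)" by (simp add: big_def ok_def)
 then show ?thesis by blast
qed

definition ex :: "nat => nat => nat" where "ex b m = (LEAST e. m < b ^ Suc e)"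

lemma ex: assumes "2 <= b" "b <= m"
 shows "b ^ ex b m <= m" "m < b ^ Suc (ex b m)" "ex b m < m"
proof -
 have lt: "k < b ^ k" for k
  using less_le_trans[OF less_exp[of k] power_mono[OF assms(1), of k]] by simp
 have "m < b ^ Suc m" using lt[of m] power_increasing[of m "Suc m" b] assms(1) by linarith
 then show l: "m < b ^ Suc (ex b m)" unfolding ex_def by (rule LeastI)
 show le: "b ^ ex b m <= m"
 proof (cases "ex b m")
  case (Suc k)
  then have "\<not> m < b ^ Suc k" using not_less_Least[of k "%e. m < b ^ Suc e"] by (simp add: ex_def)
  then show ?thesis using Suc by simp
 qed (use assms in simp)
 show "ex b m < m" using lt[of "ex b m"] le by simp
qed

lemma ex_eq: assumes "2 <= b" "b ^ e <= m" "m < b ^ Suc e" shows "ex b m = e"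
 unfolding ex_def
proof (rule Least_equality, rule assms(3))
 fix k assume "m < b ^ Suc k"
 then have "b ^ e < b ^ Suc k" using assms(2) by simp
 then show "e <= k" using assms(1) by (simp only: power_strict_increasing_iff)
qed

text \<open>Base change for arbitrary \<open>m\<close> with nested exponents. The upgrade itself
  only meets \<open>m\<close> below \<open>b * b\<close>, but the official recursion constrains the
  base change at all \<open>m\<close>, so its full graph must be described.\<close>

function chg :: "(nat => nat) => nat => nat => nat => nat" where
 "chg u b d m = (if b < 2 \<or> m < b then u m
  else d ^ chg u b d (ex b m) * u (m div b ^ ex b m) + chg u b d (m mod b ^ ex b m))"
 by pat_completeness auto
termination
proof (relation "measure (%(u, b, d, m). m)", goal_cases)
 case (3 u b d m)
 then have "b ^ ex b m <= m" "0 < b ^ ex b m" using ex(1)[of b m] by auto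
 then have "m mod b ^ ex b m < m" by (meson less_le_trans mod_less_divisor)
 then show ?case by simp
qed (use ex(3) in auto)

declare chg.simps [simp del]

lemma chg_square: assumes "2 <= b" "b <= m" "m < b * b" "u 1 = 1"
 shows "chg u b d m = d * u (m div b) + u (m mod b)"
proof -
 have "ex b m = 1" by (rule ex_eq) (use assms in auto)
 moreover have "chg u b d 1 = 1" "chg u b d (m mod b) = u (m mod b)" using assms
  by (subst chg.simps; simp)+
 ultimately show ?thesis using assms by (simp add: chg.simps[of u b d m])
qed

section \<open>A consistent description of a long Goodstein sequence\<close>

definition prn :: "nat => nat => nat" where "prn a b = (a + b) * (a + b) + a"

lemma prn_inj [simp]: "prn a b = prn c d <-> a = c & b = d"
proof
 assume e: "prn a b = prn c d"
 have *: "prn a b < prn c d" if "a + b < c + d" for a b c d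
 proof -
  have "prn a b < (Suc (a + b)) * (Suc (a + b))" by (simp add: prn_def)
  also have "\<dots> <= (c + d) * (c + d)" using that by (intro mult_le_mono) auto
  finally show ?thesis by (simp add: prn_def trans_less_add1)
 qed
 have "a + b = c + d" using e *[of a b c d] *[of c d a b] by (metis less_irrefl linorder_neqE_nat)
 then show "a = c & b = d" using e by (simp add: prn_def)
qed simp

lemma pr_NN [simp]: "pr (NN Y) = prn" by (intro ext) (simp add: pr_def prn_def)
lemma tval_num [simp]: "tval (NN Y) e (num k) = k" by (induction k) auto

definition oth :: "nat => nat" where "oth x = (x + 1) * (x + 1) + (x + 1) + 1"

lemma oth_inj [simp]: "oth x = oth y <-> x = y"
proof -
 have "oth x < oth y" if "x < y" for x y
  using mult_strict_mono[of "x + 1" "y + 1" "x + 1" "y + 1"] that by (simp add: oth_def)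
 then show ?thesis by (metis less_irrefl linorder_neqE_nat)
qed

lemma oth_prn [simp]: "oth x ~= prn a b" "prn a b ~= oth x"
proof -
 show "oth x ~= prn a b"
 proof (cases "a + b <= x + 1")
  case True
  then have "(a + b) * (a + b) <= (x + 1) * (x + 1)" by (intro mult_le_mono)
  then show ?thesis using True by (simp add: oth_def prn_def)
 next
  case False
  then have "(x + 2) * (x + 2) <= (a + b) * (a + b)" by (intro mult_le_mono) auto
  then show ?thesis by (simp add: oth_def prn_def)
 qed
 then show "prn a b ~= oth x" by simp
qed

text \<open>All data of a sequence of upgrades in one set: the hierarchies are its slices, and the other data
 have codes which are not pairs.\<close>

definition YY :: "nat => (nat => nat) => nat set" where
 "YY c es = {prn i t | i t. t : BB c es i} \<union>
  {oth (prn (prn 1 i) (prn n (up (BB c es i) (es i) n))) | i n. True} \<union>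
  {oth (prn (prn 2 i) (prn (prn b d) (prn m (chg (up (BB c es i) (es i)) b d m)))) | i b d m.
   b : BB c es i & d : BB c es (Suc i)} \<union>
  {oth (prn (prn 3 b) (prn e (b ^ e))) | b e. True} \<union> {oth (prn (prn 4 i) (gg c es i)) | i. True}"

lemma YY_iff [simp]:
 "prn i t : YY c es <-> t : BB c es i"
 "oth (prn (prn (Suc 0) i) (prn n v)) : YY c es <-> v = up (BB c es i) (es i) n"
 "oth (prn (prn 2 i) (prn (prn b d) (prn m v))) : YY c es <->
  b : BB c es i & d : BB c es (Suc i) & v = chg (up (BB c es i) (es i)) b d m"
 "oth (prn (prn 3 b) (prn e p)) : YY c es <-> p = b ^ e"
 "oth (prn (prn 4 i) v) : YY c es <-> v = gg c es i"
 unfolding YY_def by auto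

text \<open>The stage whose parameter must be fixed before membership is decided. The tables of
  powers, with tag 3, do not depend on the parameters and get index 0, as do numbers that code
  nothing.\<close>

definition idx :: "nat => nat" where
 "idx x = (if EX i t. x = prn i t then (THE i. EX t. x = prn i t)
  else if EX k i t. x = oth (prn (prn k i) t) & k ~= 3 then (THE i. EX k t. x = oth (prn (prn k i) t)) else 0)"

lemma idx_prn [simp]: "idx (prn i t) = i" "idx (oth (prn (prn k i) t)) = (if k = 3 then 0 else i)"
 unfolding idx_def by auto

lemma YY_cong: assumes "!!i. i < l ==> es' i = es i" "idx x < l" shows "x : YY c es' <-> x : YY c es"
proof -
 have eq: "BB c es' i = BB c es i & gg c es' i = gg c es i" if "i <= l" for i
  by (rule BB_gg_cong) (use assms(1) that in auto)
 have "x : YY c es2" if "x : YY c es1" "!!i. i < l ==> es2 i = es1 i"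
  "!!i. i <= l ==> BB c es2 i = BB c es1 i & gg c es2 i = gg c es1 i" for es1 es2
 proof -
  have *: "i < l ==> BB c es1 (Suc i) = BB c es2 (Suc i)" for i using that(3)[of "Suc i"] by simp
  show ?thesis using that(1) assms(2) that(2) that(3)[OF less_imp_le] *
   unfolding YY_def[of c es1] by (auto simp del: BB.simps gg.simps)
 qed
 from this[of es es'] this[of es' es] show ?thesis using assms(1) eq by metis
qed

definition ot :: "trm => trm" where "ot t = (t \<^bold>+ \<^bold>1) \<^bold>* (t \<^bold>+ \<^bold>1) \<^bold>+ (t \<^bold>+ \<^bold>1) \<^bold>+ \<^bold>1"
definition p_in :: "nat => trm => trm => form" where "p_in k i t = (ot (pair (pair (num k) i) t) \<^bold>\<in> 0)"
definition hcl :: "trm => cls" where "hcl i = slice 0 i"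

lemma tval_ot [simp]: "tval (NN Y) e (ot t) = oth (tval (NN Y) e t)" by (simp add: ot_def oth_def)

text \<open>The last clause, that exponents are smaller than powers, allows inductions over base
  changes in a model that knows exponentiation only through the coded table.\<close>

definition th_pow :: "trm => form" where
 "th_pow i = ((\<^bold>\<forall>x. \<^bold>\<exists>y. p_in 3 i (pair x y) \<^bold>\<and> (\<^bold>\<forall>z. p_in 3 i (pair x z) \<^bold>\<longrightarrow> z \<^bold>= y)) \<^bold>\<and> p_in 3 i (pair \<^bold>0 \<^bold>1) \<^bold>\<and>
  (\<^bold>\<forall>x y. p_in 3 i (pair x y) \<^bold>\<longrightarrow> p_in 3 i (pair (x \<^bold>+ \<^bold>1) (y \<^bold>* i))) \<^bold>\<and>
  (\<^bold>\<forall>x y. \<^bold>\<not> i \<^bold>= \<^bold>0 \<^bold>\<and> \<^bold>\<not> i \<^bold>= \<^bold>1 \<^bold>\<and> p_in 3 i (pair x y) \<^bold>\<longrightarrow> x \<^bold>< y))"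

text \<open>Here and below the official formulas are copied with components of the one set in place
  of quantified sets. This keeps the axioms arithmetical, so they do not depend on the family of
  sets of a model.\<close>

definition th_dec :: "trm => trm => trm => trm => trm => form" where
 "th_dec b n e a r = (\<^bold>\<exists>p q. p_in 3 b (pair e p) \<^bold>\<and> p_in 3 b (pair (e \<^bold>+ \<^bold>1) q) \<^bold>\<and> p \<^bold>\<le> n \<^bold>\<and> n \<^bold>< q \<^bold>\<and>
   \<^bold>0 \<^bold>< a \<^bold>\<and> a \<^bold>< b \<^bold>\<and> r \<^bold>< p \<^bold>\<and> n \<^bold>= p \<^bold>* a \<^bold>+ r)"
definition th_adm :: "trm => trm => trm => trm => form" where
 "th_adm i b n d = (hcl (i \<^bold>+ \<^bold>1) d \<^bold>\<and> (\<^bold>\<exists>n' u v. n \<^bold>= n' \<^bold>+ \<^bold>1 \<^bold>\<and> p_in 1 i (pair n' u) \<^bold>\<and> p_in 2 i (pair (pair b d) (pair n v)) \<^bold>\<and>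
   u \<^bold>< v \<^bold>\<and> less_succ (hcl (i \<^bold>+ \<^bold>1)) d v))"
definition th_up :: "trm => form" where
 "th_up i = ((\<^bold>\<forall>n v. p_in 1 i (pair n v) \<^bold>\<longleftrightarrow> (\<^bold>\<exists>m. is_min (hcl i) m \<^bold>\<and> ((n \<^bold>< m \<^bold>\<and> v \<^bold>= n) \<^bold>\<or>
   (m \<^bold>\<le> n \<^bold>\<and> (\<^bold>\<exists>b d. is_base (hcl i) n b \<^bold>\<and> th_adm i b n d \<^bold>\<and> (\<^bold>\<forall>d'. th_adm i b n d' \<^bold>\<longrightarrow> d \<^bold>\<le> d') \<^bold>\<and>
    p_in 2 i (pair (pair b d) (pair n v))))))) \<^bold>\<and>
  (\<^bold>\<forall>b d m v. hcl i b \<^bold>\<and> hcl (i \<^bold>+ \<^bold>1) d \<^bold>\<longrightarrow> (p_in 2 i (pair (pair b d) (pair m v)) \<^bold>\<longleftrightarrow>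
   ((m \<^bold>< b \<^bold>\<and> p_in 1 i (pair m v)) \<^bold>\<or> (b \<^bold>\<le> m \<^bold>\<and> (\<^bold>\<exists>e a r e' a' r' p. th_dec b m e a r \<^bold>\<and>
    p_in 2 i (pair (pair b d) (pair e e')) \<^bold>\<and> p_in 1 i (pair a a') \<^bold>\<and> p_in 2 i (pair (pair b d) (pair r r')) \<^bold>\<and>
    p_in 3 d (pair e' p) \<^bold>\<and> v \<^bold>= p \<^bold>* a' \<^bold>+ r'))))))"
definition th_good :: "trm => form" where
 "th_good i = ((\<^bold>\<exists>m m'. is_min (hcl i) m \<^bold>\<and> is_min (hcl (i \<^bold>+ \<^bold>1)) m' \<^bold>\<and> m \<^bold>\<le> m') \<^bold>\<and>
  (\<^bold>\<forall>n. \<^bold>\<exists>v. p_in 1 i (pair n v)) \<^bold>\<and>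
  (\<^bold>\<forall>b' m x y. hcl i (b' \<^bold>+ \<^bold>1) \<^bold>\<and> is_min (hcl i) m \<^bold>\<and> m \<^bold>< b' \<^bold>+ \<^bold>1 \<^bold>\<and> p_in 1 i (pair b' x) \<^bold>\<and> is_base (hcl (i \<^bold>+ \<^bold>1)) x y \<^bold>\<longrightarrow>
   \<^bold>\<not> (\<^bold>\<exists>z. divides y z \<^bold>\<and> x \<^bold>< z \<^bold>\<and> less_succ (hcl (i \<^bold>+ \<^bold>1)) x z)))"
definition th_seq :: "trm => form" where
 "th_seq i = (\<^bold>\<exists>x y. p_in 4 i x \<^bold>\<and> (\<^bold>\<forall>z. p_in 4 i z \<^bold>\<longrightarrow> z \<^bold>= x) \<^bold>\<and> \<^bold>0 \<^bold>< x \<^bold>\<and> p_in 4 (i \<^bold>+ \<^bold>1) y \<^bold>\<and> p_in 1 i (pair x (y \<^bold>+ \<^bold>1)))"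
text \<open>The bound is existentially quantified: states with different \<open>c\<close> all
  satisfy the axiom, and in the final model the witness need not be standard.\<close>

definition th_slow :: "trm => form" where
 "th_slow i = (\<^bold>\<exists>c. num 2 \<^bold>\<le> c \<^bold>\<and> (\<^bold>\<forall>b. hcl \<^bold>0 b \<^bold>\<longrightarrow> (\<^bold>\<exists>s. is_succ (hcl \<^bold>0) b s \<^bold>\<and> s \<^bold>\<le> b \<^bold>* b \<^bold>\<and> s \<^bold>\<le> b \<^bold>* c)))"

text \<open>The variable 0 is the stage over which each axiom is generalized, so the names of bound
  variables start at 1.\<close>

definition Theta :: "fm set" where
 "Theta = (%th. th (Var 0) 1) ` {th_pow, %i. base_hierarchy (hcl i), th_up, th_good, th_seq, th_slow}"

lemma lits_con:
 "lits (F e ((\<^bold>\<forall>x. f x) k)) <= S <-> (ALL a. lits (F (e(k := a)) (f (Var k) (Suc k))) <= S)"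
 "lits (F e ((\<^bold>\<exists>x. f x) k)) <= S <-> (ALL a. lits (F (e(k := a)) (f (Var k) (Suc k))) <= S)"
 "lits (F e ((\<^bold>\<not> \<phi>) k)) <= S <-> lits (F e (\<phi> k)) <= S"
 "lits (F e ((\<phi> \<^bold>\<and> \<psi>) k)) <= S <-> lits (F e (\<phi> k)) <= S & lits (F e (\<psi> k)) <= S"
 "lits (F e ((\<phi> \<^bold>\<or> \<psi>) k)) <= S <-> lits (F e (\<phi> k)) <= S & lits (F e (\<psi> k)) <= S"
 "lits (F e ((\<phi> \<^bold>\<longrightarrow> \<psi>) k)) <= S <-> lits (F e (\<phi> k)) <= S & lits (F e (\<psi> k)) <= S"
 "lits (F e ((\<phi> \<^bold>\<longleftrightarrow> \<psi>) k)) <= S <-> lits (F e (\<phi> k)) <= S & lits (F e (\<psi> k)) <= S"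
 "lits (F e ((s \<^bold>= t) k)) <= S" "lits (F e ((s \<^bold>< t) k)) <= S" "lits (F e ((s \<^bold>\<le> t) k)) <= S"
 "lits (F e ((t \<^bold>\<in> X) k)) <= S <-> tval (NN {}) e t : S"
proof -
 have *: "lits (IMP A B) = lits A \<union> lits B" for A B
  unfolding IMP_def by (auto split: nat.splits)
 show "lits (F e ((\<^bold>\<forall>x. f x) k)) <= S <-> (ALL a. lits (F (e(k := a)) (f (Var k) (Suc k))) <= S)"
  "lits (F e ((\<^bold>\<exists>x. f x) k)) <= S <-> (ALL a. lits (F (e(k := a)) (f (Var k) (Suc k))) <= S)"
  "lits (F e ((\<^bold>\<not> \<phi>) k)) <= S <-> lits (F e (\<phi> k)) <= S"
  "lits (F e ((\<phi> \<^bold>\<and> \<psi>) k)) <= S <-> lits (F e (\<phi> k)) <= S & lits (F e (\<psi> k)) <= S"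
  "lits (F e ((\<phi> \<^bold>\<or> \<psi>) k)) <= S <-> lits (F e (\<phi> k)) <= S & lits (F e (\<psi> k)) <= S"
  "lits (F e ((\<phi> \<^bold>\<longrightarrow> \<psi>) k)) <= S <-> lits (F e (\<phi> k)) <= S & lits (F e (\<psi> k)) <= S"
  "lits (F e ((\<phi> \<^bold>\<longleftrightarrow> \<psi>) k)) <= S <-> lits (F e (\<phi> k)) <= S & lits (F e (\<psi> k)) <= S"
  "lits (F e ((s \<^bold>= t) k)) <= S" "lits (F e ((s \<^bold>< t) k)) <= S" "lits (F e ((s \<^bold>\<le> t) k)) <= S"
  "lits (F e ((t \<^bold>\<in> X) k)) <= S <-> tval (NN {}) e t : S"
  by (auto simp: all_num_def ex_num_def f_not_def f_and_def f_or_def f_imp_def f_iff_def f_eq_def f_less_def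
   f_le_def f_mem_def *)
qed

lemma Theta_lits: assumes "\<theta> : Theta" "x : lits (F (e(0 := i)) \<theta>)" shows "idx x <= i + 1"
proof -
 have "lits (F (e(0 := i)) \<theta>) <= {x. idx x <= i + 1}"
  using assms(1) unfolding Theta_def
  by (elim imageE insertE emptyE; simp only:)
   (simp_all add: lits_con th_pow_def th_up_def th_good_def th_seq_def th_slow_def th_dec_def th_adm_def p_in_def
    hcl_def slice_def is_min_def is_base_def is_succ_def less_succ_def base_hierarchy_def divides_def)
 then show ?thesis using assms(2) by auto
qed

section \<open>The axioms in semantic form, and their truth in the standard model\<close>

definition nm :: "'a mdl => nat => 'a" where "nm M k = tval M (%_. Ze M) (num k)"
lemma tval_nm: "tval M e (num k) = nm M k" by (induction k) (auto simp: nm_def)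
lemma nm_NN [simp]: "nm (NN Y) k = k" by (simp add: nm_def)

definition om :: "'a mdl => 'a => 'a" where
 "om M x = Ad M (Ad M (Mu M (Ad M x (On M)) (Ad M x (On M))) (Ad M x (On M))) (On M)"
lemma om_NN [simp]: "om (NN Y) x = oth x" by (simp add: om_def oth_def)
definition Q :: "'a mdl => 'a set => nat => 'a => 'a => bool" where
 "Q M A k i t <-> om M (pr M (pr M (nm M k) i) t) : A"

text \<open>Variants of the \<open>s_\<close> predicates that take relations for powers, upgrade and
  base change. They apply both to sets of a model and to the components coded in one set.\<close>

definition g_dec :: "'a mdl => ('a => 'a => 'a => bool) => 'a => 'a => 'a => 'a => 'a => bool" where
 "g_dec M P b n e a r <-> (EX p:Dom M. EX q:Dom M. P b e p & P b (Ad M e (On M)) q & le M p n &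
  Ls M n q & Ls M (Ze M) a & Ls M a b & Ls M r p & n = Ad M (Mu M p a) r)"
definition g_adm where
 "g_adm M C U V b n d <-> C d & (EX n':Dom M. EX u:Dom M. EX v:Dom M. n = Ad M n' (On M) & U n' u &
  V b d n v & Ls M u v & s_lsucc M C d v)"
definition g_ur :: "'a mdl => ('a => 'a => 'a => bool) => ('a => bool) => ('a => bool) => ('a => 'a => bool) =>
  ('a => 'a => 'a => 'a => bool) => bool" where
 "g_ur M P B C U V <->
  (ALL n:Dom M. ALL v:Dom M. U n v <-> (EX m:Dom M. s_min M B m &
   ((Ls M n m & v = n) \<or> (le M m n & (EX b:Dom M. EX d:Dom M. s_base M B n b & g_adm M C U V b n d &
    (ALL d':Dom M. g_adm M C U V b n d' --> le M d d') & V b d n v))))) &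
  (ALL b:Dom M. ALL d:Dom M. ALL m:Dom M. ALL v:Dom M. B b & C d --> (V b d m v <->
   (Ls M m b & U m v) \<or> (le M b m & (EX e:Dom M. EX a:Dom M. EX r:Dom M. EX e':Dom M. EX a':Dom M.
    EX r':Dom M. EX p:Dom M. g_dec M P b m e a r & V b d e e' & U a a' & V b d r r' &
    P d e' p & v = Ad M (Mu M p a') r'))))"
definition g_good where
 "g_good M B C U <-> (EX m:Dom M. EX m':Dom M. s_min M B m & s_min M C m' & le M m m') &
  (ALL n:Dom M. EX v:Dom M. U n v) &
  (ALL b':Dom M. ALL m:Dom M. ALL x:Dom M. ALL y:Dom M. B (Ad M b' (On M)) & s_min M B m & Ls M m (Ad M b' (On M)) &
   U b' x & s_base M C x y --> \<not> (EX z:Dom M. s_dvd M y z & Ls M x z & s_lsucc M C x z))"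
definition g_pow where
 "g_pow M R i <-> (ALL x:Dom M. EX y:Dom M. R x y & (ALL z:Dom M. R x z --> z = y)) & R (Ze M) (On M) &
  (ALL x:Dom M. ALL y:Dom M. R x y --> R (Ad M x (On M)) (Mu M y i)) &
  (ALL x:Dom M. ALL y:Dom M. i ~= Ze M & i ~= On M & R x y --> Ls M x y)"
definition g_seq where
 "g_seq M G G' U <-> (EX x:Dom M. EX y:Dom M. G x & (ALL z:Dom M. G z --> z = x) & Ls M (Ze M) x & G' y & U x (Ad M y (On M)))"
definition g_slow where
 "g_slow M B <-> (EX c:Dom M. le M (nm M 2) c & (ALL b:Dom M. B b -->
  (EX s:Dom M. s_succ M B b s & le M s (Mu M b b) & le M s (Mu M b c))))"

text \<open>The components of \<open>A\<close>: hierarchies, upgrade operators, base changes, powers, and Goodstein sequence.\<close>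

abbreviation "QB M A i \<equiv> sl M A i"
abbreviation "QU M A i \<equiv> (%n v. Q M A 1 i (pr M n v))"
abbreviation "QV M A i \<equiv> (%b d m v. Q M A 2 i (pr M (pr M b d) (pr M m v)))"
abbreviation "QP M A \<equiv> (%b e p. Q M A 3 b (pr M e p))"

definition Th :: "'a mdl => 'a set => 'a => bool" where
 "Th M A i <-> g_pow M (QP M A i) i & s_bh M (QB M A i) &
  g_ur M (QP M A) (QB M A i) (QB M A (Ad M i (On M))) (QU M A i) (QV M A i) &
  g_good M (QB M A i) (QB M A (Ad M i (On M))) (QU M A i) &
  g_seq M (Q M A 4 i) (Q M A 4 (Ad M i (On M))) (QU M A i) & g_slow M (QB M A (Ze M))"

lemma sat_Theta: "(\<forall>\<theta>\<in>Theta. sat M e (%_. A) \<theta>) <-> Th M A (e 0)"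
proof -
 have p: "sat M e E (p_in k i t j) <-> Q M (E 0) k (tval M e i) (tval M e t)" for k i t j e E
  by (simp add: p_in_def sat_con Q_def ot_def om_def tval_nm)
 have c: "sat M e E (hcl i t j) <-> sl M (E 0) (tval M e i) (tval M e t)" for i t j e E
  by (simp add: hcl_def)
 have m: "bt k i ==> bt k m ==> sat M e E (is_min (hcl i) m k) <-> s_min M (sl M (E 0) (tval M e i)) (tval M e m)"
  "bt k i ==> bt k n ==> bt k b ==> sat M e E (is_base (hcl i) n b k) <-> s_base M (sl M (E 0) (tval M e i)) (tval M e n) (tval M e b)"
  "bt k i ==> bt k n ==> bt k b ==> sat M e E (is_succ (hcl i) n b k) <-> s_succ M (sl M (E 0) (tval M e i)) (tval M e n) (tval M e b)"
  "bt k i ==> bt k n ==> bt k b ==> sat M e E (less_succ (hcl i) n b k) <-> s_lsucc M (sl M (E 0) (tval M e i)) (tval M e n) (tval M e b)"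
  "bt k i ==> sat M e E (base_hierarchy (hcl i) k) <-> s_bh M (sl M (E 0) (tval M e i))"
  for k i m n b e E
  by (simp_all add: hcl_def)
 have a: "bt k i ==> bt k b ==> bt k n ==> bt k d ==> sat M e (%_. A) (th_adm i b n d k) <->
   g_adm M (QB M A (Ad M (tval M e i) (On M))) (QU M A (tval M e i)) (QV M A (tval M e i)) (tval M e b) (tval M e n) (tval M e d)"
  for k i b n d e
  by (simp add: th_adm_def g_adm_def sat_con p c m del: num.simps)
 have d: "bt k b ==> bt k n ==> bt k x ==> bt k a ==> bt k r ==> sat M e (%_. A) (th_dec b n x a r k) <->
   g_dec M (QP M A) (tval M e b) (tval M e n) (tval M e x) (tval M e a) (tval M e r)" for k b n x a r e
  by (simp add: th_dec_def g_dec_def sat_con p)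
 have 1: "sat M e (%_. A) (th_pow (Var 0) 1) <-> g_pow M (QP M A (e 0)) (e 0)"
  by (simp add: th_pow_def g_pow_def sat_con p)
 have 2: "sat M e (%_. A) (base_hierarchy (hcl (Var 0)) 1) <-> s_bh M (QB M A (e 0))"
  by (simp add: m)
 have 3: "sat M e (%_. A) (th_up (Var 0) 1) <->
   g_ur M (QP M A) (QB M A (e 0)) (QB M A (Ad M (e 0) (On M))) (QU M A (e 0)) (QV M A (e 0))"
  unfolding g_ur_def by (simp add: th_up_def sat_con p c m a d)
 have 4: "sat M e (%_. A) (th_good (Var 0) 1) <-> g_good M (QB M A (e 0)) (QB M A (Ad M (e 0) (On M))) (QU M A (e 0))"
  by (simp add: th_good_def g_good_def sat_con p c m)
 have 5: "sat M e (%_. A) (th_seq (Var 0) 1) <-> g_seq M (Q M A 4 (e 0)) (Q M A 4 (Ad M (e 0) (On M))) (QU M A (e 0))"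
  by (simp add: th_seq_def g_seq_def sat_con p)
 have 6: "sat M e (%_. A) (th_slow (Var 0) 1) <-> g_slow M (QB M A (Ze M))"
  by (simp add: th_slow_def g_slow_def sat_con p c m tval_nm del: num.simps)
 show ?thesis unfolding Theta_def Th_def by (simp only: ball_simps image_insert image_empty 1 2 3 4 5 6 simp_thms)
qed

context nh
begin

lemma s_nat [simp]: "s_min (NN Y) (%t. t : B) m <-> m = b0 B"
 "s_base (NN Y) (%t. t : B) n b <-> b = (if n < b0 B then b0 B else bse B n)"
 "s_succ (NN Y) (%t. t : B) n s <-> nxt B n s"
 "s_lsucc (NN Y) (%t. t : B) n s <-> (ALL t. nxt B n t --> s < t)"
proof -
 show m: "s_min (NN Y) (%t. t : B) m <-> m = b0 B" for m
  unfolding s_min_def using b0_in b0_le by (auto simp: le_less[symmetric] intro: antisym)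
 show "s_base (NN Y) (%t. t : B) n b <-> b = (if n < b0 B then b0 B else bse B n)"
 proof (cases "n < b0 B")
  case False
  then have n: "b0 B <= n" by simp
  have "b : B & b <= n & (ALL x. x : B & x <= n --> x <= b) <-> b = bse B n"
   using bs_in[OF n] bs_le[OF n] bs_max[OF n] bs_eq[of b n] by blast
  then show ?thesis using False by (simp add: s_base_def m le_less[symmetric])
 next
  case True
  then show ?thesis by (auto simp: s_base_def m)
 qed
 show s: "s_succ (NN Y) (%t. t : B) n s <-> nxt B n s" for n s
  by (auto simp: s_succ_def nxt_def le_less[symmetric])
 show "s_lsucc (NN Y) (%t. t : B) n s <-> (ALL t. nxt B n t --> s < t)"
  by (simp add: s_lsucc_def s)
qed

lemma s_bh_nat: "s_bh (NN Y) (%t. t : B)"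
proof -
 have "b dvd s" if h: "b : B" "nxt B b s" for b s
 proof -
  obtain t where t: "nxt B b t" "b dvd t" using nxt[OF h(1)] by blast
  then have "s = t" using h(2) unfolding nxt_def by (meson antisym)
  then show ?thesis using t by simp
 qed
 moreover have "0 ~: B" "1 ~: B" using ge2[of 0] ge2[of 1] by auto
 ultimately show ?thesis using ne by (auto simp: s_bh_def s_dvd_def dvd_def)
qed

end

context nhe
begin

abbreviation "Vn \<equiv> (%b d m v. b : B & d : C & v = chg u b d m)"

lemma ur_nat: "g_ur (NN Y) (%b e p. p = b ^ e) (%t. t : B) (%t. t : C) (%n v. v = u n) Vn"
proof -
 have first: "v = u n <-> (EX m. s_min (NN Y) (%t. t : B) m & ((n < m & v = n) \<or> ((m < n \<or> m = n) &
   (EX b d. s_base (NN Y) (%t. t : B) n b & g_adm (NN Y) (%t. t : C) (%n v. v = u n) Vn b n d &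
    (ALL d'. g_adm (NN Y) (%t. t : C) (%n v. v = u n) Vn b n d' --> d < d' \<or> d = d') & Vn b d n v))))" for n v
 proof (cases "n < b0 B")
  case True
  then show ?thesis using u_small[OF True] by auto
 next
  case False
  then have n: "b0 B <= n" by simp
  have n0: "0 < n" using n b0_ge2 by simp
  let ?val = "%d. d * u (n div b n) + u (n mod b n)"
  have val: "chg u (b n) d n = ?val d" for d
   by (rule chg_square[where u = u, OF bs_ge2[OF n] bs_le[OF n] below_square[OF n] u01(2)])
  have adm: "g_adm (NN Y) (%t. t : C) (%n v. v = u n) Vn (b n) n d <->
    d : C & u (n - 1) < ?val d & (ALL s. nxt C d s --> ?val d < s)" for d
   using n0 bs_in[OF n] by (auto simp: g_adm_def val intro!: exI[of _ "n - 1"])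
  have D: "g_adm (NN Y) (%t. t : C) (%n v. v = u n) Vn (b n) n (dn n)"
   unfolding adm using dn_in[OF n] dn_admissible[OF n] u_eq[OF n] by simp
  have m: "dn n <= d" if "g_adm (NN Y) (%t. t : C) (%n v. v = u n) Vn (b n) n d" for d
   using dn_minimal[OF n] that unfolding adm by blast
  have "(EX d. g_adm (NN Y) (%t. t : C) (%n v. v = u n) Vn (b n) n d &
    (ALL d'. g_adm (NN Y) (%t. t : C) (%n v. v = u n) Vn (b n) n d' --> d <= d') & Vn (b n) d n v) <-> v = u n" (is "?l <-> _")
  proof
   assume ?l
   then obtain d where d: "g_adm (NN Y) (%t. t : C) (%n v. v = u n) Vn (b n) n d" "d <= dn n" "v = chg u (b n) d n"
    using D by blast
   then have "d = dn n" using m[OF d(1)] by simp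
   then show "v = u n" using d(3) val u_eq[OF n] by simp
  next
   assume "v = u n"
   then show ?l using D m bs_in[OF n] dn_in[OF n] val u_eq[OF n] by (intro exI[of _ "dn n"]) auto
  qed
  then show ?thesis using False n by (simp add: le_less[symmetric])
 qed
 have dec: "g_dec (NN Y) (%b e p. p = b ^ e) c m x a r <-> x = ex c m & a = m div c ^ x & r = m mod c ^ x"
  if c: "2 <= c" "c <= m" for c m x a r
 proof
  assume "g_dec (NN Y) (%b e p. p = b ^ e) c m x a r"
  then have h: "c ^ x <= m" "m < c ^ Suc x" "r < c ^ x" "m = c ^ x * a + r" by (auto simp: g_dec_def le_less)
  have nz: "c ^ x ~= 0" using c by simp
  have "m div c ^ x = a" unfolding h(4) by (simp only: div_mult_self4[OF nz] div_less[OF h(3)] add_0_right)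
  moreover have "m mod c ^ x = r" unfolding h(4) by (simp only: mod_mult_self4 mod_less[OF h(3)])
  ultimately show "x = ex c m & a = m div c ^ x & r = m mod c ^ x" using ex_eq[OF c(1) h(1,2)] by simp
 next
  assume h: "x = ex c m & a = m div c ^ x & r = m mod c ^ x"
  note l = ex[OF c]
  have "0 < c ^ x" using c by simp
  moreover have "m div c ^ x < c" using l(2) h by (simp add: less_mult_imp_div_less)
  moreover have "0 < m div c ^ x" using l(1) h \<open>0 < c ^ x\<close> by (simp add: div_greater_zero_iff)
  ultimately show "g_dec (NN Y) (%b e p. p = b ^ e) c m x a r"
   using h l(1,2) by (simp add: g_dec_def le_less[symmetric])
 qed
 have second: "v = chg u c d m <-> (m < c & v = u m) \<or> ((c < m \<or> c = m) & (EX x a r x' a' r' p.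
   g_dec (NN Y) (%b e p. p = b ^ e) c m x a r & x' = chg u c d x & a' = u a & r' = chg u c d r & p = d ^ x' & v = p * a' + r'))"
  if "c : B" for c d m v
 proof (cases "m < c")
  case True
  then show ?thesis by (simp add: chg.simps[of u c d m])
 next
  case False
  then have "c <= m" by simp
  note dc = dec[OF ge2[OF that] this]
  show ?thesis using False ge2[OF that] unfolding dc by (auto simp: chg.simps[of u c d m])
 qed
 show ?thesis unfolding g_ur_def
 proof (intro conjI ballI impI, goal_cases)
  case (1 n v)
  show ?case using first[of v n] by simp
 next
  case (2 c d m v)
  then show ?case using second[of c v d m] by simp
 qed
qed

lemma good_nat: "g_good (NN Y) (%t. t : B) (%t. t : C) (%n v. v = u n)"
proof -
 have "\<not> (EX z. y dvd z & x < z & (ALL t. nxt C x t --> z < t))"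
  if h: "Suc n : B" "b0 B < Suc n" "x = u n" "y = (if x < b0 C then b0 C else bse C x)" for n x y
 proof
  have n: "b0 B <= n" using h(2) by simp
  have y: "y = dn n" using h uC[OF n] by simp
  assume "EX z. y dvd z & x < z & (ALL t. nxt C x t --> z < t)"
  then obtain z where z: "dn n dvd z" "u n < z" "!!t. nxt C (u n) t ==> z < t" using y h(3) by blast
  note nm = no_multiple[OF h(1,2), simplified, OF z(1,2)]
  let ?t = "LEAST t. t : C & u n < t"
  have t: "?t : C & u n < ?t" by (rule LeastI[of _ "dn (Suc n)"]) (use nm in simp)
  have "nxt C (u n) ?t" unfolding nxt_def using t by (auto intro: Least_le)
  moreover have "?t <= dn (Suc n)" by (rule Least_le) (use nm in simp)
  ultimately show False using z(3)[of ?t] nm(1) by simp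
 qed
 then show ?thesis by (simp add: g_good_def s_dvd_def dvd_def[symmetric] b0_C le_less[symmetric])
qed

end

lemma Th_nat: assumes "2 <= c" "!!i. 1 <= es i" "0 < gg c es i"
 shows "Th (NN (YY c es)) (YY c es) i"
proof -
 interpret nhe "BB c es i" "es i" using nh_BB[of c es i] assms(1,2) by (simp add: nhe_def nhe_axioms_def)
 interpret B0: nh "range (bj c)" by (rule nh_bj[OF assms(1)])
 let ?Y = "YY c es"
 have B: "sl (NN ?Y) ?Y j = (%t. t : BB c es j)" for j by (intro ext) (simp add: sl_def)
 have U: "(%n v. Q (NN ?Y) ?Y (Suc 0) i (prn n v)) = (%n v. v = u n)" by (intro ext) (simp add: Q_def)
 have V: "(%b d m v. Q (NN ?Y) ?Y 2 i (prn (prn b d) (prn m v))) = Vn" by (intro ext) (simp add: Q_def)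
 have P: "(%b e p. Q (NN ?Y) ?Y 3 b (prn e p)) = (%b e p. p = b ^ e)" by (intro ext) (simp add: Q_def)
 have P': "(%e p. Q (NN ?Y) ?Y 3 b (prn e p)) = (%e p. p = b ^ e)" for b by (intro ext) (simp add: Q_def)
 have G: "Q (NN ?Y) ?Y 4 j = (%v. v = gg c es j)" for j by (intro ext) (simp add: Q_def)
 have lt: "x < b ^ x" if "2 <= b" for b x :: nat
  using less_le_trans[OF less_exp[of x] power_mono[OF that, of x]] by simp
 have "g_pow (NN ?Y) (%e p. p = i ^ e) i" by (auto simp: g_pow_def intro!: lt)
 moreover have "g_seq (NN ?Y) (%v. v = gg c es i) (%v. v = gg c es (Suc i)) (%n v. v = u n)"
  using assms(3) u_pos[OF assms(3)] by (simp add: g_seq_def)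
 moreover have "g_slow (NN ?Y) (%t. t : BB c es 0)"
 proof -
  have "EX s. nxt (range (bj c)) b s & s <= b * b & s <= b * c" if h: "b : range (bj c)" for b
  proof -
   obtain j where "b = bj c j" using h by auto
   then show ?thesis using bj_nxt[OF assms(1), of j] by (intro exI[of _ "bj c (Suc j)"]) simp
  qed
  then show ?thesis
   unfolding g_slow_def by (intro bexI[of _ c]) (use assms(1) in \<open>auto simp: le_less[symmetric]\<close>)
 qed
 ultimately show ?thesis
  using s_bh_nat[of ?Y] ur_nat[of ?Y] good_nat[of ?Y]
  unfolding Th_def by (simp only: pr_NN std_simps One_nat_def B U V P P' G BB.simps(2) add_Suc_right add_0_right simp_thms)
qed

theorem Theta_consistent: "\<not> inds \<union> true_arith \<union> AllN 0 ` Theta \<turnstile> Falsum"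
proof (rule consistency[where big = big and Y = "%(c, es, l). YY c es" and L = "%(c, es, l). l" and idx = idx])
 fix x y :: hm and h :: state and n assume a: "big x h" "y < x"
 obtain c es l where h: "h = (c, es, l)" by (cases h)
 obtain es' l' where s: "big y (c, es', l')" "n <= l'" "l <= l'" "ALL i<l. es' i = es i" using big_step[of x c es l y n] a h by blast
 then show "EX h'. big y h' & n <= (case h' of (c, es, l) => l) & (case h of (c, es, l) => l) <= (case h' of (c, es, l) => l) &
   (ALL x. idx x < (case h of (c, es, l) => l) -->
    (x : (case h' of (c, es, l) => YY c es)) = (x : (case h of (c, es, l) => YY c es)))"
  using YY_cong[of l es' es _ c] by (intro exI[of _ "(c, es', l')"]) (simp add: h)
next
 show "EX h. big x h" for x using big_start by blast
next
 fix e \<theta> i x and h :: state assume a: "\<theta> : Theta" "big x h" "i + 2 <= (case h of (c, es, l) => l)"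
 obtain c es l where h: "h = (c, es, l)" by (cases h)
 show "sat (NN (case h of (c, es, l) => YY c es)) (e(0 := i)) (%_. case h of (c, es, l) => YY c es) \<theta>"
 proof -
  have "Th (NN (YY c es)) (YY c es) ((e(0 := i)) 0)"
   using Th_nat[of c es i] a(2,3) unfolding h big_def ok_def by simp
  from this[folded sat_Theta] show ?thesis using a(1) by (simp add: h)
 qed
qed (rule Theta_lits)

section \<open>A model with a Goodstein sequence that does not terminate\<close>

lemma finite_fvN: "finite (fvN \<phi>)" by (induction \<phi>) auto

lemma tval_Ss: "tval (M\<lparr>Ss := S\<rparr>) e t = tval M e t" by (induction t) auto
lemma sat_Ss: "arithmetical \<phi> ==> sat (M\<lparr>Ss := S\<rparr>) e E \<phi> = sat M e E \<phi>"
 by (induction \<phi> arbitrary: e) (auto simp: tval_Ss)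
lemma asat_Ss: "asat (M\<lparr>Ss := S\<rparr>) E e \<phi> = asat M E e \<phi>"
 by (induction \<phi> arbitrary: e) (auto simp: tval_Ss)

lemma arithmetical_Theta: "\<theta> : Theta ==> arithmetical \<theta>"
 unfolding Theta_def
 by (elim imageE insertE emptyE; simp only:)
  (simp_all add: all_num_def ex_num_def f_not_def f_and_def f_or_def f_imp_def f_iff_def f_eq_def f_less_def
   f_le_def f_mem_def th_pow_def th_up_def th_good_def th_seq_def th_slow_def th_dec_def th_adm_def p_in_def
   hcl_def slice_def is_min_def is_base_def is_succ_def less_succ_def base_hierarchy_def divides_def)

lemma g_ur_cong:
 assumes "!!b e p. b : Dom M ==> e : Dom M ==> p : Dom M ==> P b e p = P' b e p"
  "!!n v. n : Dom M ==> v : Dom M ==> U n v = U' n v"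
  "!!b d m v. b : Dom M ==> d : Dom M ==> m : Dom M ==> v : Dom M ==> V b d m v = V' b d m v"
  "!!a. a : Dom M ==> Ad M a (On M) : Dom M"
 shows "g_ur M P B C U V = g_ur M P' B C U' V'"
 unfolding g_ur_def g_dec_def g_adm_def by (simp add: assms cong: ball_cong bex_cong)

text \<open>Validity of an open axiom covers all values of its set variables. Interpreting every set
  variable by \<open>A\<close> lets an arbitrary member of \<open>Ss M\<close> play the part of
  \<open>Y\<close>.\<close>

locale cut = 
 fixes M :: "'a mdl" and A :: "'a set"
 assumes str: "is_str M" and A: "A : Ss M"
  and T: "!!\<psi>. \<psi> : inds \<union> true_arith \<union> AllN 0 ` Theta ==> valid M \<psi>"
begin

lemma sat_T: "\<psi> : inds \<union> true_arith \<union> AllN 0 ` Theta ==> (!!x. e x : Dom M) ==> sat M e (%_. A) \<psi>"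
 using T[of \<psi>] A by (auto simp: valid_def)

sublocale d1: defn M "{A}" using str by unfold_locales auto

text \<open>Sets whose trace on the domain is arithmetical in \<open>A\<close> with number
  parameters.\<close>

definition \<S> :: "'a set set" where "\<S> = {S. ar M {A} (%e. e 0 : S)}"
definition N :: "'a mdl" where "N = M\<lparr>Ss := \<S>\<rparr>"

lemma N [simp]: "Dom N = Dom M" "Ze N = Ze M" "On N = On M" "Ad N = Ad M" "Mu N = Mu M" "Ls N = Ls M" "Ss N = \<S>"
 by (simp_all add: N_def)

lemma A_in: "A : \<S>" using d1.ar_mem[OF d1.tm_var[of 0], of A] by (simp add: \<S>_def)
lemma N_str: "is_str N" using str A_in by (auto simp: is_str_def)
sublocale d2: defn N \<S> using N_str A_in by unfold_locales auto

lemma sat_N: "arithmetical \<phi> ==> sat N e E \<phi> = sat M e E \<phi>" by (simp add: N_def sat_Ss)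

lemma tm_tval: "(!!y. d1.tm (\<sigma> y)) ==> d1.tm (%e. tval M (%y. \<sigma> y e) t)"
 by (induction t) (auto intro: d1.tm_const d1.tm_add d1.tm_mul)

text \<open>Formulas about sets definable from \<open>A\<close> are again definable from
  \<open>A\<close>, which yields arithmetical comprehension with set parameters. Number variables
  are carried through quantifiers as definable functions \<sigma>.\<close>

lemma sat_ar: "arithmetical \<phi> ==> (!!X. E X : \<S>) ==> (!!y. d1.tm (\<sigma> y)) ==> ar M {A} (%e. sat M (%y. \<sigma> y e) E \<phi>)"
proof (induction \<phi> arbitrary: \<sigma>)
 case (Mem t X)
 have "ar M {A} (%e. e 0 : E X)" using Mem.prems(2)[of X] by (simp add: \<S>_def)
 then show ?case by (simp) (rule d1.ar_sub[OF tm_tval[OF Mem.prems(3)], of "%a e. a : E X"])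
next
 case (AllN x \<phi>)
 have "ar M {A} (%e. sat M (%y. (if y = x then (%e. e 0) else (%e. \<sigma> y (%n. e (Suc n)))) e) E \<phi>)"
  by (rule AllN.IH) (use AllN.prems in \<open>auto intro: d1.tm_var d1.tm_shift\<close>)
 then have "ar M {A} (%e. sat M ((%y. \<sigma> y (%n. e (Suc n)))(x := e 0)) E \<phi>)"
  by (rule ar_cong[rotated]) (auto intro!: arg_cong[of _ _ "%f. sat M f E \<phi>"])
 then show ?case by simp (rule ar_all[of M "{A}" "%a e. sat M ((%y. \<sigma> y e)(x := a)) E \<phi>"])
qed (auto intro!: d1.ar_fal d1.ar_eq d1.ar_ls tm_tval ar_imp)

lemma comprehension: assumes "arithmetical \<phi>" "!!X. E X : \<S>" "!!y. e y : Dom M" shows "{a. sat M (e(x := a)) E \<phi>} : \<S>"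
proof -
 have "ar M {A} (%e'. sat M (%y. (if y = x then (%e'. e' 0) else (%e'. e y)) e') E \<phi>)"
  by (rule sat_ar[OF assms(1,2)]) (auto intro: d1.tm_var d1.tm_const assms(3))
 then show ?thesis unfolding \<S>_def mem_Collect_eq
  by (rule ar_cong[rotated]) (auto intro!: arg_cong[of _ _ "%f. sat M f E \<phi>"])
qed

lemma af_sat: assumes "!!i. p i : Dom M"
 obtains \<psi> q where "arithmetical \<psi>" "!!i. q i : Dom M"
  "!!a. asat M E (mix (case_nat a (%_. Ze M)) p) \<phi> = sat M (q(0 := a)) E \<psi>"
proof -
 obtain k where k: "ALL n:afv \<phi>. n < k" using finite_nat_set_iff_bounded by (metis finite_afv)
 define q where "q = mix (%_. Ze M) p"
 have "mix (case_nat a (%_. Ze M)) p = q(0 := a)" for a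
  by (rule ext) (auto simp: q_def mix_def split: nat.split)
 then have "asat M E (mix (case_nat a (%_. Ze M)) p) \<phi> = sat M (q(0 := a)) E (tr id k \<phi>)" for a
 proof -
  have "sat M (q(0 := a)) E (tr id k \<phi>) = asat M E (%n. (q(0 := a)) (id n)) \<phi>" by (rule sat_tr) (use k in simp)
  then show ?thesis by (simp only: \<open>mix (case_nat a (%_. Ze M)) p = q(0 := a)\<close> id_apply)
 qed
 then show thesis using that[of "tr id k \<phi>" q] arithmetical_tr assms by (auto simp: q_def mix_def)
qed

lemma def_set: assumes "ar N \<S> (%e. P (e 0))" shows "EX S:\<S>. ALL a:Dom M. a : S <-> P a"
proof -
 obtain \<phi> E p where 1: "!!i. E i : \<S>" "!!i. p i : Dom M"
  "!!e. (!!i. e i : Dom M) ==> P (e 0) = asat N E (mix e p) \<phi>" using assms unfolding ar_def by auto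
 obtain \<psi> q where 2: "arithmetical \<psi>" "!!i. q i : Dom M"
  "!!a. asat M E (mix (case_nat a (%_. Ze M)) p) \<phi> = sat M (q(0 := a)) E \<psi>" by (rule af_sat[of p, OF 1(2)]) blast
 have "P a = sat M (q(0 := a)) E \<psi>" if "a : Dom M" for a
 proof -
  have "P (case_nat a (%_. Ze M) 0) = asat N E (mix (case_nat a (%_. Ze M)) p) \<phi>"
   by (rule 1(3)) (use that in \<open>simp split: nat.split\<close>)
  then show ?thesis by (simp add: 2(3)[symmetric] N_def asat_Ss)
 qed
 then show ?thesis using comprehension[OF 2(1) 1(1) 2(2), where x = 0] by (intro bexI[of _ "{a. sat M (q(0 := a)) E \<psi>}"]) auto
qed

text \<open>Membership in \<open>S\<close> is expressed by a named formula about \<open>A\<close>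
  alone, and the scheme \<open>inds\<close> applies to that formula with a variable \<open>z\<close>
  that is not free in it.\<close>

lemma induction: assumes "S : \<S>" "Ze M : S" "!!a. a : Dom M ==> a : S ==> Ad M a (On M) : S" "a : Dom M" shows "a : S"
proof -
 obtain \<phi> E p where 1: "!!i. E i : {A}" "!!i. p i : Dom M"
  "!!e. (!!i. e i : Dom M) ==> (e 0 : S) = asat M E (mix e p) \<phi>" using assms(1) unfolding ar_def \<S>_def by auto
 have E: "E = (%_. A)" using 1(1) by auto
 obtain \<psi> q where 2: "arithmetical \<psi>" "!!i. q i : Dom M"
  "!!a. asat M E (mix (case_nat a (%_. Ze M)) p) \<phi> = sat M (q(0 := a)) E \<psi>" by (rule af_sat[of p, OF 1(2)]) blast
 have S: "a : S <-> sat M (q(0 := a)) (%_. A) \<psi>" if "a : Dom M" for a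
 proof -
  have *: "!!i. case_nat a (%_. Ze M) i : Dom M" using that by (simp split: nat.split)
  have "a : S <-> sat M (q(0 := a)) E \<psi>" using 1(3)[of "case_nat a (%_. Ze M)", OF *] 2(3)[of a] by simp
  then show ?thesis by (simp only: E)
 qed
 obtain z where z: "z ~: insert 0 (fvN \<psi>)" using ex_new_if_finite[OF infinite_UNIV_nat, of "insert 0 (fvN \<psi>)"] finite_fvN by auto
 then have z0: "z ~= 0" "z ~: fvN \<psi>" by auto
 have "indf z \<psi> : inds" using z0 by (auto simp: inds_def)
 then have "sat M q (%_. A) (indf z \<psi>)" using sat_T[of "indf z \<psi>" q] 2(2) by blast
 moreover define R where "R a = sat M (q(0 := a)) (%_. A) \<psi>" for a
 have "sat M (q(z := y, 0 := a)) (%_. A) \<psi> = R a" for y a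
  unfolding R_def by (rule sat_cong) (use z0 in auto)
 ultimately have h: "(ALL a:Dom M. a = Ze M --> R a) --> (ALL y:Dom M. (ALL a:Dom M. a = y --> R a) -->
   (ALL a:Dom M. a = Ad M y (On M) --> R a)) --> (ALL a:Dom M. R a)"
  by (simp only: indf_def sat.simps tval.simps fun_upd_same fun_upd_other[OF z0(1)] R_def[symmetric])
 have R: "a : S <-> R a" if "a : Dom M" for a using S[OF that] by (simp only: R_def)
 have "ALL y:Dom M. (ALL a:Dom M. a = y --> R a) --> (ALL a:Dom M. a = Ad M y (On M) --> R a)"
 proof (intro ballI impI)
  fix y a assume k: "y : Dom M" "ALL a:Dom M. a = y --> R a" "a : Dom M" "a = Ad M y (On M)"
  have "y : S" using bspec[OF k(2,1)] R[OF k(1)] by simp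
  then have "a : S" unfolding k(4) by (rule assms(3)[OF k(1)])
  then show "R a" using R[OF k(3)] by simp
 qed
 moreover have "ALL a:Dom M. a = Ze M --> R a" using assms(2) R[OF d1.ops(1)] by simp
 ultimately show ?thesis using h R[OF assms(4)] assms(4) by blast
qed

lemma ind: assumes "ar N \<S> (%e. P (e 0))" "P (Ze M)" "!!a. a : Dom M ==> P a ==> P (Ad M a (On M))" "a : Dom M" shows "P a"
proof -
 obtain S where S: "S : \<S>" "ALL a:Dom M. a : S <-> P a" using def_set[OF assms(1)] by blast
 have "a : S"
 proof (rule induction[OF S(1) _ _ assms(4)])
  show "Ze M : S" using bspec[OF S(2) d1.ops(1)] assms(2) by simp
  fix a assume a: "a : Dom M" "a : S"
  then have "P (Ad M a (On M))" using assms(3)[OF a(1)] bspec[OF S(2) a(1)] by simp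
  then show "Ad M a (On M) : S" using bspec[OF S(2) d1.ops(3)[OF a(1) d1.ops(2)]] by simp
 qed
 then show ?thesis using S(2) assms(4) by blast
qed

lemma arith: "arithmetical \<phi> ==> fvS \<phi> = {} ==> (!!e. sat (NN {}) e (%_. {}) \<phi>) ==> (!!x. e x : Dom M) ==> sat M e (%_. A) \<phi>"
 by (rule sat_T) (auto simp: true_arith_def)

lemma basic_true: "basic_axioms <= true_arith"
 by (auto simp: basic_axioms_def true_arith_def Let_def)

lemma aca: assumes "\<psi> : ACA0" shows "valid N \<psi>"
 using assms
proof (cases rule: ACA0_cases)
 case 1
 then have t: "\<psi> : true_arith" using basic_true by auto
 show ?thesis unfolding valid_def
 proof (intro allI impI)
  fix e :: "nat => 'a" and E :: "nat => 'a set" assume e: "ALL x. e x : Dom N" "ALL X. E X : Ss N"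
  have "sat M e (%_. A) \<psi>" using sat_T[of \<psi> e] t e(1) by simp
  moreover have "sat M e E \<psi> = sat M e (%_. A) \<psi>" by (rule sat_cong) (use t in \<open>auto simp: true_arith_def\<close>)
  ultimately show "sat N e E \<psi>" using t sat_N[of \<psi>] by (simp add: true_arith_def)
 qed
next
 case 2
 show ?thesis unfolding valid_def 2
 proof (intro allI impI)
  fix e :: "nat => 'a" and E :: "nat => 'a set" assume e: "ALL x. e x : Dom N" "ALL X. E X : Ss N"
  have "Ze M : E 0 ==> (!!a. a : Dom M ==> a : E 0 ==> Ad M a (On M) : E 0) ==> (ALL a:Dom M. a : E 0)"
   using induction[of "E 0"] e(2) by simp
  then show "sat N e E induction_axiom" unfolding induction_axiom_def by simp
 qed
next
 case 3
 show ?thesis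
 proof (rule valid_comprehension[OF _ 3])
  fix \<phi> x and e :: "nat => 'a" and E :: "nat => 'a set" assume h: "arithmetical \<phi>" "!!y. e y : Dom N" "!!X. E X : Ss N"
  show "EX S:Ss N. ALL a:Dom N. a : S <-> sat N (e(x := a)) E \<phi>"
   using comprehension[OF h(1), of E e x] h by (intro bexI[of _ "{a. sat M (e(x := a)) E \<phi>}"]) (auto simp: sat_N)
 qed
qed

lemma order: assumes "a : Dom M" "b : Dom M" "c : Dom M"
 shows "Ls M a b ==> Ls M b c ==> Ls M a c" "\<not> Ls M a a" "Ls M a (Ad M b (On M)) <-> Ls M a b \<or> a = b" "\<not> Ls M a (Ze M)"
  "Ad M a (On M) = Ad M b (On M) ==> a = b"
proof -
 let ?e = "%x :: nat. if x = 0 then a else if x = 1 then b else c"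
 have e: "?e x : Dom M" for x using assms by simp
 note th = arith[where e = ?e, OF _ _ _ e]
 show "Ls M a b ==> Ls M b c ==> Ls M a c"
  using th[of "Imp (Less (Var 0) (Var 1)) (Imp (Less (Var 1) (Var 2)) (Less (Var 0) (Var 2)))"] by simp
 show "\<not> Ls M a a" using th[of "Neg (Less (Var 0) (Var 0))"] by simp
 show "Ls M a (Ad M b (On M)) <-> Ls M a b \<or> a = b"
  using th[of "Iff (Less (Var 0) (Add (Var 1) One)) (Dis (Less (Var 0) (Var 1)) (Eq (Var 0) (Var 1)))"] by (auto simp: less_Suc_eq)
 show "\<not> Ls M a (Ze M)" using th[of "Neg (Less (Var 0) Zero)"] by simp
 show "Ad M a (On M) = Ad M b (On M) ==> a = b"
  using th[of "Imp (Eq (Add (Var 0) One) (Add (Var 1) One)) (Eq (Var 0) (Var 1))"] by simp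
qed

lemma Th: assumes "i : Dom M" shows "Th N A i"
proof -
 have "\<forall>\<theta>\<in>Theta. sat N (%_. i) (%_. A) \<theta>"
 proof
  fix \<theta> assume t: "\<theta> : Theta"
  then have "sat M (%_. i) (%_. A) (AllN 0 \<theta>)" using sat_T[of "AllN 0 \<theta>" "%_. i"] assms by blast
  moreover have "(%_. i)(0 := i) = (%_ :: nat. i)" by auto
  ultimately have "sat M (%_. i) (%_. A) \<theta>" using assms by simp (metis (no_types, lifting) fun_upd_idem_iff)
  then show "sat N (%_. i) (%_. A) \<theta>" using sat_N[OF arithmetical_Theta[OF t]] by simp
 qed
 then show ?thesis unfolding sat_Theta .
qed

lemma less_ind: assumes "ar N \<S> (%e. P (e 0))" "!!m. m : Dom M ==> (!!k. k : Dom M ==> Ls M k m ==> P k) ==> P m" "a : Dom M" shows "P a"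
proof -
 have "ar N \<S> (%e. ALL k:Dom N. Ls N k (e 0) --> P k)"
  by (rule ar_all[of N \<S> "%k e. Ls N k (e 0) --> P k"]) (intro ar_imp d2.ar_ls d2.tm_var assms(1))
 note ar = this
 have "ALL k:Dom N. Ls N k a --> P k"
 proof (rule ind[of "%a. ALL k:Dom N. Ls N k a --> P k", OF ar _ _ assms(3)])
  show "ALL k:Dom N. Ls N k (Ze M) --> P k" using order(4) by simp
  fix a assume a: "a : Dom M" "ALL k:Dom N. Ls N k a --> P k"
  have "P a" by (rule assms(2)[OF a(1)]) (use a(2) in simp)
  then show "ALL k:Dom N. Ls N k (Ad M a (On M)) --> P k" using a order(3)[OF _ a(1) a(1)] by auto
 qed
 note h = this
 show ?thesis by (rule assms(2)[OF assms(3)]) (use h in simp)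
qed

lemma ar_all3: assumes "ar N \<S> (%e. R (e (Suc (Suc 0))) (e (Suc 0)) (e 0) (e (Suc (Suc (Suc 0)))))"
 shows "ar N \<S> (%e. ALL b:Dom N. ALL d:Dom N. ALL v:Dom N. R b d v (e 0))"
proof -
 have "ar N \<S> (%e. ALL v:Dom N. R (e (Suc 0)) (e 0) v (e (Suc (Suc 0))))"
  by (rule ar_all[of N \<S> "%v e. R (e (Suc 0)) (e 0) v (e (Suc (Suc 0)))", OF assms])
 from ar_all[of N \<S> "%d e. ALL v:Dom N. R (e 0) d v (e (Suc 0))", OF this]
 show ?thesis by (rule ar_all[of N \<S> "%b e. ALL d:Dom N. ALL v:Dom N. R b d v (e 0)"])
qed

lemma Q_tm: "k : Dom M ==> d2.tm f ==> ar N \<S> (%e. Q N A j k (f e))"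
proof -
 assume h: "k : Dom M" "d2.tm f"
 have "nm N j : Dom N" unfolding nm_def by (rule tval_Dom[OF N_str]) simp
 then show ?thesis unfolding Q_def om_def pr_def
  by (intro d2.ar_mem d2.tm_add d2.tm_mul d2.tm_const h A_in) (use h in simp_all)
qed

lemma pr_D [simp]: "a : Dom M ==> b : Dom M ==> pr N a b : Dom M" by (simp add: pr_def)
lemma pr_tm: "d2.tm f ==> d2.tm g ==> d2.tm (%e. pr N (f e) (g e))" unfolding pr_def by (intro d2.tm_add d2.tm_mul)

lemma Q_set: assumes "k : Dom M" obtains S where "S : \<S>" "!!a. a : Dom M ==> a : S <-> Q N A j k a"
 using def_set[OF Q_tm[OF assms d2.tm_var[of 0], of j]] by blast

section \<open>The coded data are the official notions of the new model\<close>

lemma s_pow_iff: assumes "b : Dom M" "x : Dom M" "p : Dom M" shows "s_pow N b x p <-> QP N A b x p"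
proof -
 have g: "!!x. x : Dom M ==> EX y:Dom M. QP N A b x y & (ALL z:Dom M. QP N A b x z --> z = y)" "QP N A b (Ze M) (On M)"
  "!!x y. x : Dom M ==> y : Dom M ==> QP N A b x y ==> QP N A b (Ad M x (On M)) (Mu M y b)"
  using Th[OF assms(1)] unfolding Th_def g_pow_def by auto
 show ?thesis
 proof
  assume "QP N A b x p"
  moreover obtain S where "S : \<S>" "!!a. a : Dom M ==> a : S <-> Q N A 3 b a" by (rule Q_set[OF assms(1)]) blast
  ultimately show "s_pow N b x p" unfolding s_pow_def s_fun_def using g assms by (intro bexI[of _ S]) (simp_all cong: ball_cong bex_cong conj_cong)
 next
  assume "s_pow N b x p"
  then obtain E where E: "E : \<S>" "s_fun N E" "pr N (Ze M) (On M) : E" "pr N x p : E"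
   "!!x y. x : Dom M ==> y : Dom M ==> pr N x y : E ==> pr N (Ad M x (On M)) (Mu M y b) : E"
   by (auto simp: s_pow_def)
  have fn: "y = z" if "a : Dom M" "y : Dom M" "z : Dom M" "pr N a y : E" "pr N a z : E" for a y z
   using E(2) that unfolding s_fun_def N by metis
  have "ALL y:Dom N. pr N x y : E --> QP N A b x y"
  proof (rule ind[of "%x. ALL y:Dom N. pr N x y : E --> QP N A b x y", OF _ _ _ assms(2)])
   show "ar N \<S> (%e. ALL y:Dom N. pr N (e 0) y : E --> QP N A b (e 0) y)"
    by (rule ar_all[of N \<S> "%y e. pr N (e 0) y : E --> QP N A b (e 0) y"])
     (intro ar_imp d2.ar_mem Q_tm pr_tm d2.tm_var E(1) assms(1))
   show "ALL y:Dom N. pr N (Ze M) y : E --> QP N A b (Ze M) y" using fn[OF _ _ _ _ E(3)] g(2) by auto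
  next
   fix a assume a: "a : Dom M" and IH: "ALL y:Dom N. pr N a y : E --> QP N A b a y"
   obtain y0 where y0: "y0 : Dom M" "pr N a y0 : E" using E(2) a unfolding s_fun_def N by blast
   have q: "QP N A b (Ad M a (On M)) (Mu M y0 b)" using g(3)[OF a y0(1)] IH y0 by simp
   show "ALL y:Dom N. pr N (Ad M a (On M)) y : E --> QP N A b (Ad M a (On M)) y"
   proof (intro ballI impI)
    fix y assume y: "y : Dom N" "pr N (Ad M a (On M)) y : E"
    have "y = Mu M y0 b" by (rule fn[OF _ _ _ y(2) E(5)[OF a y0]]) (use a y y0 assms in auto)
    then show "QP N A b (Ad M a (On M)) y" using q by simp
   qed
  qed
  then show "QP N A b x p" using E(4) assms(3) by simp
 qed
qed

lemma s_ur_g: "s_ur N B C U V = g_ur N (s_pow N) B C (%n v. pr N n v : U) (s_inV N V)"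
 unfolding s_ur_def g_ur_def s_dec_def g_dec_def s_adm_def g_adm_def ..

lemma s_ur_QP: "s_ur N B C U V = g_ur N (QP N A) B C (%n v. pr N n v : U) (s_inV N V)"
 unfolding s_ur_g by (rule g_ur_cong) (simp_all add: s_pow_iff)

text \<open>The clauses determine their solution by recursion on the argument. Digits and remainders
  are smaller anyway, and exponents are smaller by hypothesis \<open>P\<close>; hypothesis
  \<open>ar\<close> admits the agreement statement to the induction of the model.\<close>

lemma unique:
 assumes g: "g_ur N P B C U V" "g_ur N P B C U' V'"
  and ar: "ar N \<S> (%e. (ALL v:Dom N. U' (e 0) v <-> U (e 0) v) &
   (ALL b:Dom N. ALL d:Dom N. ALL v:Dom N. B b & C d --> (V' b d (e 0) v <-> V b d (e 0) v)))"
  and P: "!!b e p. b : Dom M ==> e : Dom M ==> p : Dom M ==> B b ==> P b e p ==> Ls M e p"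
  and n: "n : Dom M" "v : Dom M"
 shows "U' n v <-> U n v"
proof -
 have "(ALL v:Dom N. U' n v <-> U n v) &
   (ALL b:Dom N. ALL d:Dom N. ALL v:Dom N. B b & C d --> (V' b d n v <-> V b d n v))"
 proof (rule less_ind[of "%n. (ALL v:Dom N. U' n v <-> U n v) &
   (ALL b:Dom N. ALL d:Dom N. ALL v:Dom N. B b & C d --> (V' b d n v <-> V b d n v))", OF ar _ n(1)])
  fix m assume m: "m : Dom M" and IH: "!!k. k : Dom M ==> Ls M k m ==> (ALL v:Dom N. U' k v <-> U k v) &
   (ALL b:Dom N. ALL d:Dom N. ALL v:Dom N. B b & C d --> (V' b d k v <-> V b d k v))"
  have lt: "Ls M e m" "Ls M a m" "Ls M r m" if h: "g_dec N P b m e a r" "B b" "le M b m" "b : Dom M" "e : Dom M" "a : Dom M" "r : Dom M" for b e a r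
  proof -
   obtain p where p: "p : Dom M" "P b e p" "le M p m" "Ls M a b" "Ls M r p" using h(1) by (auto simp: g_dec_def)
   show "Ls M e m" using P[OF h(4,5) p(1) h(2) p(2)] p(3) order(1)[OF h(5) p(1) m] by auto
   show "Ls M a m" using p(4) h(3) order(1)[OF h(6,4) m] by auto
   show "Ls M r m" using p(5,3) order(1)[OF h(7) p(1) m] by auto
  qed
  have g2: "V b d m v <-> (Ls N m b & U m v) \<or> (le N b m & (EX e:Dom N. EX a:Dom N. EX r:Dom N. EX e':Dom N. EX a':Dom N.
    EX r':Dom N. EX p:Dom N. g_dec N P b m e a r & V b d e e' & U a a' & V b d r r' & P d e' p & v = Ad N (Mu N p a') r'))"
   if h: "g_ur N P B C U V" "b : Dom M" "d : Dom M" "v : Dom M" "B b" "C d" for U V b d v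
   unfolding N by (rule HOL.mp[OF bspec[OF bspec[OF bspec[OF bspec[OF conjunct2[OF h(1)[unfolded g_ur_def N]] h(2)] h(3)] m] h(4)] conjI[OF h(5,6)]])
  have rec: "(EX e:Dom N. EX a:Dom N. EX r:Dom N. EX e':Dom N. EX a':Dom N.
    EX r':Dom N. EX p:Dom N. g_dec N P b m e a r & V' b d e e' & U' a a' & V' b d r r' & P d e' p & v = Ad N (Mu N p a') r')
   <-> (EX e:Dom N. EX a:Dom N. EX r:Dom N. EX e':Dom N. EX a':Dom N.
    EX r':Dom N. EX p:Dom N. g_dec N P b m e a r & V b d e e' & U a a' & V b d r r' & P d e' p & v = Ad N (Mu N p a') r')"
   if h: "b : Dom M" "d : Dom M" "B b" "C d" "le M b m" for b d v
  proof -
   have "(g_dec N P b m e a r & V' b d e e' & U' a a' & V' b d r r' & P d e' p & v = Ad N (Mu N p a') r') <->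
     (g_dec N P b m e a r & V b d e e' & U a a' & V b d r r' & P d e' p & v = Ad N (Mu N p a') r')"
    if k: "e : Dom N" "a : Dom N" "r : Dom N" "e' : Dom N" "a' : Dom N" "r' : Dom N" for e a r e' a' r' p
   proof (cases "g_dec N P b m e a r")
    case True
    note l = lt[OF True h(3,5,1)]
    have "V' b d e e' <-> V b d e e'" using IH[of e] l(1) k h by simp
    moreover have "U' a a' <-> U a a'" using IH[of a] l(2) k by simp
    moreover have "V' b d r r' <-> V b d r r'" using IH[of r] l(3) k h by simp
    ultimately show ?thesis by simp
   qed simp
   then show ?thesis by (simp cong: bex_cong)
  qed
  have V1: "V' b d m v <-> V b d m v" if h: "b : Dom M" "d : Dom M" "v : Dom M" "B b" "C d" "le M b m" for b d v
  proof -
   have "\<not> Ls M m b" using h(6) order(1)[OF h(1) m h(1)] order(2)[OF h(1) h(1) h(1)] by auto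
   then show ?thesis unfolding g2[OF g(1) h(1-5)] g2[OF g(2) h(1-5)] rec[OF h(1,2,4-6)] by simp
  qed
  have g1: "U m v <-> (EX k:Dom N. s_min N B k & ((Ls N m k & v = m) \<or> (le N k m & (EX b:Dom N. EX d:Dom N. s_base N B m b &
    g_adm N C U V b m d & (ALL d':Dom N. g_adm N C U V b m d' --> le N d d') & V b d m v))))"
   if h: "g_ur N P B C U V" "v : Dom M" for U V v
   unfolding N by (rule bspec[OF bspec[OF conjunct1[OF h(1)[unfolded g_ur_def N]] m] h(2)])
  have adm: "g_adm N C U' V' b m d <-> g_adm N C U V b m d" if h: "b : Dom M" "d : Dom M" "B b" "le M b m" for b d
  proof (cases "C d")
   case True
   have "(m = Ad N n' (On N) & U' n' x & V' b d m v & Ls N x v & s_lsucc N C d v) <->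
     (m = Ad N n' (On N) & U n' x & V b d m v & Ls N x v & s_lsucc N C d v)"
    if k: "n' : Dom N" "x : Dom N" "v : Dom N" for n' x v
   proof (cases "m = Ad N n' (On N)")
    case True
    have "Ls M n' m" using order(3)[of n' n' n'] k True by simp
    then show ?thesis using IH[of n'] k V1[OF h(1,2) _ h(3) \<open>C d\<close> h(4), of v] by simp
   qed simp
   then show ?thesis unfolding g_adm_def by (simp cong: bex_cong)
  qed (simp add: g_adm_def)
  have U1: "U' m v <-> U m v" if v: "v : Dom M" for v
  proof -
   have "(EX b:Dom N. EX d:Dom N. s_base N B m b & g_adm N C U' V' b m d & (ALL d':Dom N. g_adm N C U' V' b m d' --> le N d d') & V' b d m v)
    <-> (EX b:Dom N. EX d:Dom N. s_base N B m b & g_adm N C U V b m d & (ALL d':Dom N. g_adm N C U V b m d' --> le N d d') & V b d m v)"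
    if k: "k : Dom M" "s_min N B k" "le M k m" for k
   proof -
    have b: "B b" "le M b m" if h2: "s_base N B m b" "b : Dom M" for b
    proof -
     obtain k' where k': "k' : Dom M" "s_min N B k'" "(le M k' m & B b & le M b m) \<or> (Ls M m k' & b = k')"
      using h2(1) unfolding s_base_def N by blast
     have "le M k' k" using k'(2) k(1,2) by (auto simp: s_min_def)
     then have "\<not> Ls M m k'" using k(3) order(1)[OF m k'(1) k(1)] order(1)[OF m k(1) m] order(2)[OF m m m]
      order(1)[OF k'(1) k(1) m] order(1)[OF m k'(1) m] by blast
     then show "B b" "le M b m" using k'(3) by auto
    qed
    have "(s_base N B m b & g_adm N C U' V' b m d & (ALL d':Dom N. g_adm N C U' V' b m d' --> le N d d') & V' b d m v) <->
     (s_base N B m b & g_adm N C U V b m d & (ALL d':Dom N. g_adm N C U V b m d' --> le N d d') & V b d m v)"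
     if z: "b : Dom N" "d : Dom N" for b d
    proof (cases "s_base N B m b & C d")
     case True
     have bb: "B b" "le M b m" using b[of b] True z by auto
     have "!!d'. d' : Dom N ==> g_adm N C U' V' b m d' <-> g_adm N C U V b m d'" using adm[OF _ _ bb] z by simp
     moreover have "V' b d m v <-> V b d m v" using V1[OF _ _ v bb(1) _ bb(2)] z True by simp
     ultimately show ?thesis using z by simp
    qed (auto simp: g_adm_def)
    then show ?thesis by (simp cong: bex_cong)
   qed
   note inn = this
   show ?thesis unfolding g1[OF g(1) v] g1[OF g(2) v]
   proof (rule bex_cong[OF refl], goal_cases)
    case (1 k)
    then show ?case using inn[of k] by (cases "s_min N B k & le M k m") auto
   qed
  qed
  have "V' b d m v <-> V b d m v" if h: "b : Dom M" "d : Dom M" "v : Dom M" "B b" "C d" for b d v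
  proof (cases "le M b m")
   case True
   then show ?thesis using V1 h by blast
  next
   case False
   then show ?thesis using U1[OF h(3)] unfolding g2[OF g(1) h] g2[OF g(2) h] by simp
  qed
  then show "(ALL v:Dom N. U' m v <-> U m v) &
   (ALL b:Dom N. ALL d:Dom N. ALL v:Dom N. B b & C d --> (V' b d m v <-> V b d m v))" using U1 by simp
 qed
 then show ?thesis using n(2) by simp
qed

lemma sl_tm: "d2.tm f ==> i : Dom M ==> ar N \<S> (%e. sl N A i (f e))"
 unfolding sl_def by (rule d2.ar_mem[OF _ A_in], rule pr_tm[OF d2.tm_const]) simp_all

text \<open>The coded graph is itself a set of the model and thus a witness for \<open>s_up\<close>.
  By \<open>unique\<close> any other witness has the same values.\<close>

lemma up_iff: assumes i: "i : Dom M" and n: "n : Dom M" "v : Dom M"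
 shows "s_up N (sl N A i) (sl N A (Ad M i (On M))) n v <-> QU N A i n v"
proof -
 let ?B = "sl N A i" and ?C = "sl N A (Ad M i (On M))"
 have g: "g_ur N (QP N A) ?B ?C (QU N A i) (QV N A i)" "s_bh N ?B" using Th[OF i] by (auto simp: Th_def)
 obtain U where U: "U : \<S>" "!!a. a : Dom M ==> a : U <-> Q N A 1 i a" by (rule Q_set[OF i, of 1]) blast
 obtain V where V: "V : \<S>" "!!a. a : Dom M ==> a : V <-> Q N A 2 i a" by (rule Q_set[OF i, of 2]) blast
 have "s_ur N ?B ?C U V" unfolding s_ur_QP
  by (rule g_ur_cong[THEN iffD2, OF _ _ _ _ g(1)]) (simp_all add: U V s_inV_def)
 then have "QU N A i n v ==> s_up N ?B ?C n v" using U V n unfolding s_up_def by auto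
 moreover have "QU N A i n v" if "s_up N ?B ?C n v"
 proof -
  obtain U' V' where U': "U' : \<S>" "V' : \<S>" "s_ur N ?B ?C U' V'" "pr N n v : U'" using \<open>s_up N ?B ?C n v\<close> by (auto simp: s_up_def)
  have "pr N n v : U' <-> QU N A i n v"
  proof (rule unique[OF g(1) U'(3)[unfolded s_ur_QP] _ _ n])
   show "ar N \<S> (%e. (ALL v:Dom N. pr N (e 0) v : U' <-> QU N A i (e 0) v) &
    (ALL b:Dom N. ALL d:Dom N. ALL v:Dom N. ?B b & ?C d --> (s_inV N V' b d (e 0) v <-> QV N A i b d (e 0) v)))"
    unfolding s_inV_def
    by (intro d2.ar_and ar_all[of N \<S> "%v e. pr N (e 0) v : U' <-> QU N A i (e 0) v"]
     ar_all3[of "%b d v m. ?B b & ?C d --> (pr N (pr N b d) (pr N m v) : V' <-> QV N A i b d m v)"]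
     d2.ar_iff ar_imp d2.ar_mem Q_tm sl_tm pr_tm d2.tm_var U'(1,2) i) (use i in simp_all)
   fix b e p assume h: "b : Dom M" "e : Dom M" "p : Dom M" "?B b" "QP N A b e p"
   have "b ~= Ze M" "b ~= On M" using g(2) h(4) by (auto simp: s_bh_def)
   then show "Ls M e p" using Th[OF h(1)] h unfolding Th_def g_pow_def N by blast
  qed
  then show ?thesis using U'(4) by simp
 qed
 ultimately show ?thesis by blast
qed

lemma dyn: "s_dyn N A"
proof -
 have "s_good N (sl N A i) (sl N A (Ad M i (On M)))" if i: "i : Dom M" for i
  using Th[OF i] unfolding Th_def s_good_def g_good_def N
  by (simp add: up_iff[OF i] cong: ball_cong bex_cong)
 then show ?thesis using Th unfolding s_dyn_def Th_def N by simp
qed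

text \<open>A Goodstein sequence in the sense of the model agrees with the coded one by induction,
  and the coded one is positive at every stage.\<close>

lemma not_term: "EX c:Dom N. le N (nm N 2) c & \<not> s_term N c"
proof -
 obtain c where c: "c : Dom M" "le M (nm N 2) c" "s_slow N A c"
  using Th[of "Ze M"] unfolding Th_def g_slow_def s_slow_def N by auto
 have seq: "EX x:Dom M. EX y:Dom M. Q N A 4 i x & (ALL z:Dom M. Q N A 4 i z --> z = x) & Ls M (Ze M) x &
   Q N A 4 (Ad M i (On M)) y & QU N A i x (Ad M y (On M))" if "i : Dom M" for i
  using Th[OF that] unfolding Th_def g_seq_def N by blast
 obtain n where n: "n : Dom M" "Q N A 4 (Ze M) n" using seq[of "Ze M"] by auto
 have "\<not> s_gval N A n i (Ze M)" if i: "i : Dom M" for i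
 proof
  assume "s_gval N A n i (Ze M)"
  then obtain G where G: "G : \<S>" "s_fun N G" "pr N (Ze M) n : G" "pr N i (Ze M) : G"
   "!!i x y. i : Dom M ==> x : Dom M ==> y : Dom M ==> pr N i x : G ==> pr N (Ad M i (On M)) y : G ==>
    (Ls M (Ze M) x & s_up N (sl N A i) (sl N A (Ad M i (On M))) x (Ad M y (On M))) \<or> (x = Ze M & y = Ze M)"
   unfolding s_gval_def s_gseq_def N by blast
  have fn: "y = z" if "a : Dom M" "y : Dom M" "z : Dom M" "pr N a y : G" "pr N a z : G" for a y z
   using G(2) that unfolding s_fun_def N by metis
  have "ALL y:Dom N. pr N i y : G --> om N (pr N (pr N (nm N 4) i) y) : A"
  proof (rule ind[of "%i. ALL y:Dom N. pr N i y : G --> om N (pr N (pr N (nm N 4) i) y) : A", OF _ _ _ i])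
   have "nm N 4 : Dom N" unfolding nm_def by (rule tval_Dom[OF N_str]) simp
   then show "ar N \<S> (%e. ALL y:Dom N. pr N (e 0) y : G --> om N (pr N (pr N (nm N 4) (e 0)) y) : A)"
    unfolding om_def
    by (intro ar_all[of N \<S> "%y e. pr N (e 0) y : G --> _ y (e 0)"] ar_imp d2.ar_mem d2.tm_add d2.tm_mul pr_tm d2.tm_var d2.tm_const G(1) A_in) simp_all
   show "ALL y:Dom N. pr N (Ze M) y : G --> om N (pr N (pr N (nm N 4) (Ze M)) y) : A"
    using fn[OF _ _ _ _ G(3)] n unfolding Q_def by auto
  next
   fix a assume a: "a : Dom M" and IH: "ALL y:Dom N. pr N a y : G --> om N (pr N (pr N (nm N 4) a) y) : A"
   obtain x y where xy: "x : Dom M" "y : Dom M" "ALL z:Dom M. Q N A 4 a z --> z = x" "Ls M (Ze M) x"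
    "Q N A 4 (Ad M a (On M)) y" "QU N A a x (Ad M y (On M))" using seq[OF a] by blast
   obtain x' where x': "x' : Dom M" "pr N a x' : G" using G(2) a unfolding s_fun_def N by blast
   then have "x' = x" using IH xy(3) by (simp add: Q_def)
   show "ALL y:Dom N. pr N (Ad M a (On M)) y : G --> om N (pr N (pr N (nm N 4) (Ad M a (On M))) y) : A"
   proof (intro ballI impI)
    fix z assume z: "z : Dom N" "pr N (Ad M a (On M)) z : G"
    have "x ~= Ze M" using xy(4) order(2)[of "Ze M" x x] xy(1) by auto
    then have "s_up N (sl N A a) (sl N A (Ad M a (On M))) x (Ad M z (On M))"
     using G(5)[OF a xy(1) _ _ z(2)] x' \<open>x' = x\<close> z(1) by auto
    then have "QU N A a x (Ad M z (On M))" using up_iff[OF a xy(1)] z(1) by simp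
    \<comment> \<open>The axioms state that the coded upgrade is total, not that it is single
      valued. The latter comes from the theorem of ACA0, which applies because the coded hierarchy
      is a dynamical hierarchy with slow start in this model.\<close>
    moreover have "valid N upgrade_unique" by (rule soundness[OF ACA0_targets N_str aca]) (simp_all add: targets_def)
    then have u: "ALL X:Ss N. ALL c:Dom N. ALL i:Dom N. ALL n:Dom N. ALL v:Dom N. ALL w:Dom N. s_dyn N X & s_slow N X c &
      s_up N (sl N X i) (sl N X (Ad N i (On N))) n v & s_up N (sl N X i) (sl N X (Ad N i (On N))) n w --> v = w"
     unfolding valid_unique[OF N_str] .
    have D: "Ad M z (On M) : Dom M" "Ad M y (On M) : Dom M" using z(1) xy(2) by simp_all
    note bspec[OF bspec[OF bspec[OF bspec[OF bspec[OF bspec[OF u[unfolded N] A_in] c(1)] a] xy(1)] D(1)] D(2)]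
    ultimately have "Ad M z (On M) = Ad M y (On M)"
     using dyn c(3) xy(6) up_iff[OF a xy(1) D(1)] up_iff[OF a xy(1) D(2)] by simp
    then have "z = y" using order(5)[of z y y] z(1) xy(2) by simp
    then show "om N (pr N (pr N (nm N 4) (Ad M a (On M))) z) : A" using xy(5) by (simp add: Q_def)
   qed
  qed
  then have "Q N A 4 i (Ze M)" using G(4) by (simp add: Q_def)
  moreover obtain x where "ALL z:Dom M. Q N A 4 i z --> z = x" "Ls M (Ze M) x" using seq[OF i] by blast
  ultimately have "Ls M (Ze M) (Ze M)" using bspec[of "Dom M" _ "Ze M"] d1.ops(1) by metis
  then show False using order(2)[OF d1.ops(1) d1.ops(1) d1.ops(1)] by contradiction
 qed
 note no = this
 have "\<not> s_term N c"
 proof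
  assume "s_term N c"
  note h = HOL.mp[OF bspec[OF this[unfolded s_term_def N] A_in] conjI[OF dyn c(3)]]
  obtain i where "i : Dom M" "s_gval N A n i (Ze M)" using bspec[OF h n(1)] by blast
  then show False using no by blast
 qed
 then show ?thesis using c by auto
qed

end

theorem theorem8p12:
 shows "(\<forall>c::nat. c \<ge> 2 --> ACA0 \<turnstile> sentence (goodstein_terminates (num c))) &
  \<not> ACA0 \<turnstile> sentence (\<^bold>\<forall>c. num 2 \<^bold>\<le> c \<^bold>\<longrightarrow> goodstein_terminates c)"
proof (intro conjI allI impI notI)
 show "ACA0 \<turnstile> sentence (goodstein_terminates (num c))" if "2 <= c" for c
  by (rule ACA0_targets) (use that in \<open>auto simp: targets_def\<close>)
next
 assume a: "ACA0 \<turnstile> sentence (\<^bold>\<forall>c. num 2 \<^bold>\<le> c \<^bold>\<longrightarrow> goodstein_terminates c)"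
 obtain M :: "trm mdl" where M: "is_str M" "!!\<psi>. inds \<union> true_arith \<union> AllN 0 ` Theta \<turnstile> \<psi> ==> valid M \<psi>"
  by (rule completeness[OF Theta_consistent]) blast
 obtain A where "A : Ss M" using M(1) by (auto simp: is_str_def)
 then interpret cut M A using M by unfold_locales (auto intro: Ax)
 have "valid N (sentence (\<^bold>\<forall>c. num 2 \<^bold>\<le> c \<^bold>\<longrightarrow> goodstein_terminates c))" by (rule soundness[OF a N_str aca])
 then show False using not_term unfolding valid_all_terminate[OF N_str] by (auto simp: nm_def numeral_2_eq_2)
qed

end
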